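(* Let $e>1$, $n\ge1$, $q=\exp(2\pi\sqrt{-1}/e)$, and fix a charge $\mathbf{s}=(s_1,\dots,s_\ell)\in\mathbb{Z}^\ell$ with $s_1\le s_2\le\dots\le s_\ell<s_1+e$. Let $\boldsymbol{\lambda}$ be an $\ell$-multipartition of $n$ labelling a simple module $D_{\mathbf{s}}(\boldsymbol{\lambda})$ of the cyclotomic Hecke algebra $\mathcal{H}_{q,q^{s_1},\dots,q^{s_\ell}}(n)$, regarded as a simple module of the affine Hecke algebra $\mathcal{H}^{\mathsf{aff}}_q(n)$. Then the following three conditions are equivalent, and $D_{\mathbf{s}}(\boldsymbol{\lambda})$ is unitary if and only if they hold: (i) $\boldsymbol{\lambda}$ is cylindric, its right border multiset $\mathsf{B}^{\mathbf{s}}(\boldsymbol{\lambda})$ has period at most $e$, and the reading word of $\mathsf{B}^{\mathbf{s}}(\boldsymbol{\lambda})$ is increasing; (ii) $\underline{h}:=h(\boldsymbol{\lambda})$ is $\mathbf{s}$-admissible and $\boldsymbol{\lambda}\in\mathcal{F}_{\underline{h}}$, the fundamental alcove for the $\mathbf{s}$-shifted action of the affine symmetric group $\widehat{\mathfrak{S}}_{h_1+\dots+h_\ell}$; (iii) $D_{\mathbf{s}}(\boldsymbol{\lambda})$ is calibrated.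
   Context: Algebras. The extended affine braid group $B^{ea}_n$ is generated by $T_1,\dots,T_{n-1},x_1,\dots,x_n$ subject to the braid relations among the $T_i$; $x_ix_j=x_jx_i$; $T_ix_iT_i=x_{i+1}$; $T_ix_j=x_jT_i$ if $j\ne i,i+1$. $\mathcal{H}^{\mathsf{aff}}_q(n)$ is the quotient of $\mathbb{C}B^{ea}_n$ by $(T_i+1)(T_i-q)=0$; put $X_i=q^{1-i}x_i$. The cyclotomic quotient is $\mathcal{H}_{q,Q_1,\dots,Q_\ell}(n)=\mathcal{H}^{\mathsf{aff}}_q(n)/(\prod_{i}(X_1-Q_i))$. A finite-dimensional module is unitary if it has a positive-definite $B^{ea}_n$-invariant Hermitian form, and calibrated if $X_1,\dots,X_n$ act simultaneously diagonalisably. Multipartitions. An $\ell$-multipartition $\boldsymbol{\lambda}=(\lambda^1,\dots,\lambda^\ell)$ is identified with its set of boxes $(r,c,m)$ (row $r$, column $c$ of component $m$), $1\le c\le\lambda^m_r$. The charged content of $b=(r,c,m)$ is $\mathsf{co}^{\mathbf{s}}(b)=s_m+c-r$; its residue is $\mathsf{co}^{\mathbf{s}}(b)$ mod $e$. An $i$-box is a box of residue $i$. For boxes of equal residue, $(r,c,m)\rhd(r',c',m')$ if $\mathsf{co}^{\mathbf{s}}(r,c,m)>\mathsf{co}^{\mathbf{s}}(r',c',m')$, or these are equal and $m<m'$. Crystal and labelling of simples. For $i\in\mathbb{Z}/e\mathbb{Z}$ list all addable and removable $i$-boxes of $\boldsymbol{\lambda}$ in increasing order (for $\rhd$) from left to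 right, writing $+$ for addable and $-$ for removable; recursively delete adjacent pairs $(-+)$ to reach $(+)^a(-)^b$. Then $\tilde f_i\boldsymbol{\lambda}$ is obtained by adding the addable box of the rightmost remaining $+$ ($0$ if none), and $\tilde e_i\boldsymbol\lambda$ by removing the removable box of the leftmost remaining $-$ ($0$ if none). The simple modules of $\mathcal{H}_{q,q^{s_1},\dots,q^{s_\ell}}(n)$ are labelled by the $\boldsymbol{\lambda}=\tilde f_{i_n}\cdots\tilde f_{i_1}\varnothing$, as follows: $D_{\mathbf{s}}(\varnothing)=\mathbb{C}$ for $n=0$, and if $\tilde e_i\boldsymbol{\lambda}=\boldsymbol{\mu}\ne0$ then $D_{\mathbf{s}}(\boldsymbol{\mu})$ is the (simple) socle of the generalised $q^i$-eigenspace of $X_n$ on $D_{\mathbf{s}}(\boldsymbol{\lambda})$, regarded as a module for $\mathcal{H}_{q,q^{s_1},\dots,q^{s_\ell}}(n-1)$. Equivalently (Foda–Leclerc–Okado–Thibon–Welsh), these labels are the $\boldsymbol{\lambda}$ which are cylindric (defined below) and such that for every $\alpha>0$ the residues of the rightmost boxes of the rows of length $\alpha$ do not exhaust $\mathbb{Z}/e\mathbb{Z}$. Cylindric: $\lambda^j_k\ge\lambda^{j+1}_{k+s_{j+1}-s_j}$ for $1\le j\le\ell-1$, $k\ge1$, and $\lambda^\ell_k\ge\lambda^1_{k+e+s_1-s_\ell}$ for $k\ge1$. Right border: $\mathsf{B}^{\mathbf{s}}(\boldsymbol{\lambda})$ is the multiset of charged contents of the last boxes of the nonzero rows of $\boldsymbol{\lambda}$.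 It has period at most $e$ if it is contained in $[z,z+e-1]$ for some $z\in\mathbb{Z}$. Its reading word lists the border contents of $\lambda^1$ in increasing order, then those of $\lambda^2$ in increasing order, and so on; it is increasing if this whole sequence is strictly increasing. Alcoves. $h(\boldsymbol{\lambda})=(h_1,\dots,h_\ell)$ where $h_m$ is the number of nonzero rows of $\lambda^m$. $\underline{h}=(h_1,\dots,h_\ell)$ is $\mathbf{s}$-admissible if $h_m\le s_m-s_{m-1}$ for $1<m\le\ell$ and $h_1\le e+s_1-s_\ell$, with at least one of these inequalities strict. Put $h=h_1+\dots+h_\ell$, and let $\mathbb{E}_{\underline{h}}$ be the real Euclidean space with orthonormal basis $\varepsilon_1,\dots,\varepsilon_h$, with $\varepsilon_{i,m}:=\varepsilon_{(h_\ell+\dots+h_{m+1})+i}$ for $1\le i\le h_m$; identify $\boldsymbol{\lambda}$ with $\sum_{m,i}\lambda^m_i\varepsilon_{i,m}$. Let $\rho=(\rho_\ell,\dots,\rho_1)$ with $\rho_m=(s_m,s_m-1,\dots,s_m-h_m+1)$. $\widehat{\mathfrak{S}}_h$ is generated by the reflections $s_{\alpha,re}(x)=x-(\langle x,\alpha\rangle-re)\alpha$, for $\alpha=\varepsilon_i-\varepsilon_j$ ($i\ne j$), $r\in\mathbb{Z}$, acting by the shifted action $w\cdot x=w(x+\rho)-\rho$. The corresponding hyperplanes are $\{x:\langle x+\rho,\alpha\rangle=re\}$; alcoves are the connected components of the complement of all of them, and $\mathcal{F}_{\underline{h}}$ is the alcove containing the origin. *)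

theory Defs
  imports "HOL-Analysis.Analysis" "HOL-Library.Multiset"
begin

section \<open>Representations of the extended affine braid group and Hecke algebras\<close>

text \<open>A representation is carried by a subspace \<open>vspace M\<close> of an ambient complex vector space, with
  scalar multiplication \<open>smul M\<close>; \<open>Tact M i\<close> and \<open>xact M j\<close> are the actions of \<open>T_i\<close> and \<open>x_j\<close> and
  only their values on \<open>vspace M\<close> matter. Modules over an algebra given by generators and relations
  are families of operators satisfying these relations. The rank \<open>n\<close> is a separate parameter, so that
  restriction to a smaller rank and passage to a subspace change neither the operators nor the type.\<close>

record 'v brep =
  smul :: "complex \<Rightarrow> 'v \<Rightarrow> 'v"
  vspace :: "'v set"
  Tact :: "nat \<Rightarrow> 'v \<Rightarrow> 'v"
  xact :: "nat \<Rightarrow> 'v \<Rightarrow> 'v"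

definition linear_automorphism :: "('v::ab_group_add) brep \<Rightarrow> ('v \<Rightarrow> 'v) \<Rightarrow> bool" where
  "linear_automorphism M f \<longleftrightarrow>
     bij_betw f (vspace M) (vspace M) \<and>
     (\<forall>u\<in>vspace M. \<forall>v\<in>vspace M. f (u + v) = f u + f v) \<and>
     (\<forall>c. \<forall>v\<in>vspace M. f (smul M c v) = smul M c (f v))"

definition braid_rep :: "nat \<Rightarrow> ('v::ab_group_add) brep \<Rightarrow> bool" where
  "braid_rep n M \<longleftrightarrow>
     vector_space (smul M) \<and> module.subspace (smul M) (vspace M) \<and>
     (\<forall>i\<in>{1..<n}. linear_automorphism M (Tact M i)) \<and>
     (\<forall>j\<in>{1..n}. linear_automorphism M (xact M j)) \<and>
     (\<forall>v\<in>vspace M.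
        (\<forall>i\<in>{1..<n}. \<forall>j\<in>{1..<n}. Suc i < j \<longrightarrow> Tact M i (Tact M j v) = Tact M j (Tact M i v)) \<and>
        (\<forall>i. 1 \<le> i \<and> Suc i < n \<longrightarrow>
           Tact M i (Tact M (Suc i) (Tact M i v)) = Tact M (Suc i) (Tact M i (Tact M (Suc i) v))) \<and>
        (\<forall>i\<in>{1..n}. \<forall>j\<in>{1..n}. xact M i (xact M j v) = xact M j (xact M i v)) \<and>
        (\<forall>i\<in>{1..<n}. Tact M i (xact M i (Tact M i v)) = xact M (Suc i) v) \<and>
        (\<forall>i\<in>{1..<n}. \<forall>j\<in>{1..n}. j \<noteq> i \<and> j \<noteq> Suc i \<longrightarrow>
           Tact M i (xact M j v) = xact M j (Tact M i v)))"

definition aff_hecke_module :: "complex \<Rightarrow> nat \<Rightarrow> ('v::ab_group_add) brep \<Rightarrow> bool" where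
  "aff_hecke_module q n M \<longleftrightarrow>
     braid_rep n M \<and>
     (\<forall>i\<in>{1..<n}. \<forall>v\<in>vspace M.
        (let w = Tact M i v - smul M q v in Tact M i w + w = 0))"

text \<open>The normalised generators \<open>X_j = q^(1-j) x_j\<close>, and the operator \<open>X_j - a\<close>.\<close>

definition Xact :: "complex \<Rightarrow> ('v::ab_group_add) brep \<Rightarrow> nat \<Rightarrow> 'v \<Rightarrow> 'v" where
  "Xact q M j v = smul M (q powi (1 - int j)) (xact M j v)"

definition X_minus :: "complex \<Rightarrow> ('v::ab_group_add) brep \<Rightarrow> nat \<Rightarrow> complex \<Rightarrow> 'v \<Rightarrow> 'v" where
  "X_minus q M j a v = Xact q M j v - smul M a v"

text \<open>For \<open>n = 0\<close> there is no \<open>X_1\<close>, hence no cyclotomic relation.\<close>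

definition cyclotomic_module ::
    "complex \<Rightarrow> nat \<Rightarrow> (nat \<Rightarrow> complex) \<Rightarrow> nat \<Rightarrow> ('v::ab_group_add) brep \<Rightarrow> bool" where
  "cyclotomic_module q l Q n M \<longleftrightarrow>
     aff_hecke_module q n M \<and>
     (1 \<le> n \<longrightarrow> (\<forall>v\<in>vspace M. fold (\<lambda>m. X_minus q M 1 (Q m)) [1..<Suc l] v = 0))"

definition restrict_rep :: "'v brep \<Rightarrow> 'v set \<Rightarrow> 'v brep" where
  "restrict_rep M W = M\<lparr>vspace := W\<rparr>"

definition simple_module :: "complex \<Rightarrow> nat \<Rightarrow> ('v::ab_group_add) brep \<Rightarrow> bool" where
  "simple_module q n M \<longleftrightarrow>
     aff_hecke_module q n M \<and> vspace M \<noteq> {0} \<and>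
     (\<forall>W. W \<subseteq> vspace M \<and> aff_hecke_module q n (restrict_rep M W) \<longrightarrow> W = {0} \<or> W = vspace M)"

definition socle :: "complex \<Rightarrow> nat \<Rightarrow> ('v::ab_group_add) brep \<Rightarrow> 'v brep" where
  "socle q n M = restrict_rep M
     (module.span (smul M) (\<Union>{W. W \<subseteq> vspace M \<and> simple_module q n (restrict_rep M W)}))"

definition gen_eigenspace ::
    "complex \<Rightarrow> nat \<Rightarrow> complex \<Rightarrow> ('v::ab_group_add) brep \<Rightarrow> 'v brep" where
  "gen_eigenspace q j a M = restrict_rep M {v \<in> vspace M. \<exists>k. (X_minus q M j a ^^ k) v = 0}"

definition finite_dim :: "('v::ab_group_add) brep \<Rightarrow> bool" where
  "finite_dim M \<longleftrightarrow> (\<exists>B. finite B \<and> module.span (smul M) B = vspace M)"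

definition calibrated :: "complex \<Rightarrow> nat \<Rightarrow> ('v::ab_group_add) brep \<Rightarrow> bool" where
  "calibrated q n M \<longleftrightarrow> finite_dim M \<and>
     (\<exists>B. \<not> module.dependent (smul M) B \<and> module.span (smul M) B = vspace M \<and>
        (\<forall>b\<in>B. \<forall>j\<in>{1..n}. \<exists>c. Xact q M j b = smul M c b))"

text \<open>The operators by which the elements of the group act.\<close>

inductive_set braid_action :: "nat \<Rightarrow> 'v brep \<Rightarrow> ('v \<Rightarrow> 'v) set"
  for n :: nat and M :: "'v brep" where
  "id \<in> braid_action n M"
| "\<lbrakk>1 \<le> i; i < n; g \<in> braid_action n M\<rbrakk> \<Longrightarrow> Tact M i \<circ> g \<in> braid_action n M"
| "\<lbrakk>1 \<le> i; i < n; g \<in> braid_action n M\<rbrakk> \<Longrightarrow> inv_into (vspace M) (Tact M i) \<circ> g \<in> braid_action n M"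
| "\<lbrakk>1 \<le> j; j \<le> n; g \<in> braid_action n M\<rbrakk> \<Longrightarrow> xact M j \<circ> g \<in> braid_action n M"
| "\<lbrakk>1 \<le> j; j \<le> n; g \<in> braid_action n M\<rbrakk> \<Longrightarrow> inv_into (vspace M) (xact M j) \<circ> g \<in> braid_action n M"

definition pos_def_hermitian :: "('v::ab_group_add) brep \<Rightarrow> ('v \<Rightarrow> 'v \<Rightarrow> complex) \<Rightarrow> bool" where
  "pos_def_hermitian M \<Phi> \<longleftrightarrow>
     (\<forall>u\<in>vspace M. \<forall>v\<in>vspace M. \<forall>w\<in>vspace M. \<Phi> (u + v) w = \<Phi> u w + \<Phi> v w) \<and>
     (\<forall>c. \<forall>u\<in>vspace M. \<forall>v\<in>vspace M. \<Phi> (smul M c u) v = c * \<Phi> u v) \<and>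
     (\<forall>u\<in>vspace M. \<forall>v\<in>vspace M. \<Phi> v u = cnj (\<Phi> u v)) \<and>
     (\<forall>v\<in>vspace M. v \<noteq> 0 \<longrightarrow> 0 < Re (\<Phi> v v))"

definition unitary :: "nat \<Rightarrow> ('v::ab_group_add) brep \<Rightarrow> bool" where
  "unitary n M \<longleftrightarrow> finite_dim M \<and>
     (\<exists>\<Phi>. pos_def_hermitian M \<Phi> \<and>
        (\<forall>g\<in>braid_action n M. \<forall>u\<in>vspace M. \<forall>v\<in>vspace M. \<Phi> (g u) (g v) = \<Phi> u v))"


section \<open>Multipartitions\<close>

text \<open>\<open>\<Lambda> m k\<close> is the length of row \<open>k\<close> of component \<open>m\<close>, both indices starting at 1; all other
  values are 0, so that equality of multipartitions is equality of functions.\<close>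

type_synonym mpart = "nat \<Rightarrow> nat \<Rightarrow> nat"
type_synonym box = "nat \<times> nat \<times> nat"

definition boxes :: "mpart \<Rightarrow> box set" where
  "boxes \<Lambda> = {(r, c, m). 1 \<le> r \<and> 1 \<le> c \<and> c \<le> \<Lambda> m r}"

definition multipartition :: "nat \<Rightarrow> nat \<Rightarrow> mpart \<Rightarrow> bool" where
  "multipartition l n \<Lambda> \<longleftrightarrow>
     (\<forall>m k. m \<notin> {1..l} \<or> k = 0 \<longrightarrow> \<Lambda> m k = 0) \<and>
     (\<forall>m k. 1 \<le> k \<longrightarrow> \<Lambda> m (Suc k) \<le> \<Lambda> m k) \<and>
     finite (boxes \<Lambda>) \<and> card (boxes \<Lambda>) = n"

definition empty_mpart :: mpart where
  "empty_mpart = (\<lambda>m k. 0)"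

definition charged_content :: "(nat \<Rightarrow> int) \<Rightarrow> box \<Rightarrow> int" where
  "charged_content s = (\<lambda>(r, c, m). s m + int c - int r)"

text \<open>\<open>box_less s b' b\<close> is the relation \<open>b \<rhd> b'\<close>: for equal contents the smaller component is larger.\<close>

definition box_less :: "(nat \<Rightarrow> int) \<Rightarrow> box \<Rightarrow> box \<Rightarrow> bool" where
  "box_less s b' b \<longleftrightarrow>
     charged_content s b > charged_content s b' \<or>
     (charged_content s b = charged_content s b' \<and> snd (snd b) < snd (snd b'))"

definition addable :: "nat \<Rightarrow> mpart \<Rightarrow> box \<Rightarrow> bool" where
  "addable l \<Lambda> = (\<lambda>(r, c, m). m \<in> {1..l} \<and> 1 \<le> r \<and> c = Suc (\<Lambda> m r) \<and> (r = 1 \<or> \<Lambda> m r < \<Lambda> m (r - 1)))"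

definition removable :: "nat \<Rightarrow> mpart \<Rightarrow> box \<Rightarrow> bool" where
  "removable l \<Lambda> = (\<lambda>(r, c, m). m \<in> {1..l} \<and> 1 \<le> r \<and> 1 \<le> c \<and> c = \<Lambda> m r \<and> \<Lambda> m (Suc r) < \<Lambda> m r)"

definition add_box :: "box \<Rightarrow> mpart \<Rightarrow> mpart" where
  "add_box = (\<lambda>(r, c, m) \<Lambda>. \<Lambda>(m := (\<Lambda> m)(r := c)))"

definition remove_box :: "box \<Rightarrow> mpart \<Rightarrow> mpart" where
  "remove_box = (\<lambda>(r, c, m) \<Lambda>. \<Lambda>(m := (\<Lambda> m)(r := c - 1)))"


section \<open>The crystal\<close>

text \<open>The residue \<open>i\<close> is represented by any integer in its class modulo \<open>e\<close>. Distinct addable or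
  removable \<open>i\<close>-boxes are comparable, since in one component their contents differ; hence the
  increasing list below is unique. The sign of a box is \<open>+\<close> iff it is addable.\<close>

definition signature :: "nat \<Rightarrow> nat \<Rightarrow> (nat \<Rightarrow> int) \<Rightarrow> int \<Rightarrow> mpart \<Rightarrow> box list" where
  "signature e l s i \<Lambda> = (THE bs.
     set bs = {b. (addable l \<Lambda> b \<or> removable l \<Lambda> b) \<and> charged_content s b mod int e = i mod int e} \<and>
     sorted_wrt (box_less s) bs)"

text \<open>Deletion of all pairs \<open>(-+)\<close>, working from the right; \<open>P\<close> holds for the entries of sign \<open>+\<close>.\<close>

fun reduce :: "('a \<Rightarrow> bool) \<Rightarrow> 'a list \<Rightarrow> 'a list" where
  "reduce P [] = []"
| "reduce P (b # bs) =
     (case reduce P bs of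
        [] \<Rightarrow> [b]
      | b' # bs' \<Rightarrow> if \<not> P b \<and> P b' then bs' else b # b' # bs')"

definition f_tilde :: "nat \<Rightarrow> nat \<Rightarrow> (nat \<Rightarrow> int) \<Rightarrow> int \<Rightarrow> mpart \<Rightarrow> mpart option" where
  "f_tilde e l s i \<Lambda> =
     (let bs = filter (addable l \<Lambda>) (reduce (addable l \<Lambda>) (signature e l s i \<Lambda>))
      in if bs = [] then None else Some (add_box (last bs) \<Lambda>))"

definition e_tilde :: "nat \<Rightarrow> nat \<Rightarrow> (nat \<Rightarrow> int) \<Rightarrow> int \<Rightarrow> mpart \<Rightarrow> mpart option" where
  "e_tilde e l s i \<Lambda> =
     (let bs = filter (removable l \<Lambda>) (reduce (addable l \<Lambda>) (signature e l s i \<Lambda>))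
      in if bs = [] then None else Some (remove_box (hd bs) \<Lambda>))"

inductive crystal_label :: "nat \<Rightarrow> nat \<Rightarrow> (nat \<Rightarrow> int) \<Rightarrow> nat \<Rightarrow> mpart \<Rightarrow> bool"
  for e l :: nat and s :: "nat \<Rightarrow> int" where
  "crystal_label e l s 0 empty_mpart"
| "\<lbrakk>crystal_label e l s n \<mu>; f_tilde e l s i \<mu> = Some \<Lambda>\<rbrakk> \<Longrightarrow> crystal_label e l s (Suc n) \<Lambda>"

text \<open>\<open>is_D q e l s n \<Lambda> M\<close>: \<open>\<Lambda>\<close> is a label of size \<open>n\<close> and \<open>M\<close> is (isomorphic to) the simple module
  \<open>D_s(\<Lambda>)\<close> of the cyclotomic Hecke algebra of rank \<open>n\<close> with parameters \<open>q^(s_1), ..., q^(s_l)\<close>.\<close>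

primrec is_D :: "complex \<Rightarrow> nat \<Rightarrow> nat \<Rightarrow> (nat \<Rightarrow> int) \<Rightarrow> nat \<Rightarrow> mpart \<Rightarrow> ('v::ab_group_add) brep \<Rightarrow> bool"
where
  "is_D q e l s 0 \<Lambda> M \<longleftrightarrow>
     \<Lambda> = empty_mpart \<and> cyclotomic_module q l (\<lambda>m. q powi s m) 0 M \<and>
     vector_space.dim (smul M) (vspace M) = 1"
| "is_D q e l s (Suc n) \<Lambda> M \<longleftrightarrow>
     crystal_label e l s (Suc n) \<Lambda> \<and>
     cyclotomic_module q l (\<lambda>m. q powi s m) (Suc n) M \<and> simple_module q (Suc n) M \<and>
     (\<forall>i \<mu>. e_tilde e l s i \<Lambda> = Some \<mu> \<longrightarrow>
        is_D q e l s n \<mu> (socle q n (gen_eigenspace q (Suc n) (q powi i) M)))"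


section \<open>Cylindric multipartitions and right borders\<close>

text \<open>For a charge with \<open>s_1 \<le> ... \<le> s_l < s_1 + e\<close> the shifted row indices are positive.\<close>

definition cylindric :: "nat \<Rightarrow> nat \<Rightarrow> (nat \<Rightarrow> int) \<Rightarrow> mpart \<Rightarrow> bool" where
  "cylindric e l s \<Lambda> \<longleftrightarrow>
     (\<forall>j k. 1 \<le> j \<and> j < l \<and> 1 \<le> k \<longrightarrow> \<Lambda> j k \<ge> \<Lambda> (Suc j) (nat (int k + s (Suc j) - s j))) \<and>
     (\<forall>k\<ge>1. \<Lambda> l k \<ge> \<Lambda> 1 (nat (int k + int e + s 1 - s l)))"

definition nonzero_rows :: "mpart \<Rightarrow> nat \<Rightarrow> nat set" where
  "nonzero_rows \<Lambda> m = {r. 1 \<le> r \<and> 0 < \<Lambda> m r}"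

definition component_border :: "(nat \<Rightarrow> int) \<Rightarrow> mpart \<Rightarrow> nat \<Rightarrow> int multiset" where
  "component_border s \<Lambda> m =
     {# charged_content s (r, \<Lambda> m r, m). r \<in># mset_set (nonzero_rows \<Lambda> m) #}"

definition right_border :: "nat \<Rightarrow> (nat \<Rightarrow> int) \<Rightarrow> mpart \<Rightarrow> int multiset" where
  "right_border l s \<Lambda> = (\<Sum>m\<in>{1..l}. component_border s \<Lambda> m)"

definition period_at_most :: "nat \<Rightarrow> int multiset \<Rightarrow> bool" where
  "period_at_most e B \<longleftrightarrow> (\<exists>z. set_mset B \<subseteq> {z..z + int e - 1})"

definition reading_word :: "nat \<Rightarrow> (nat \<Rightarrow> int) \<Rightarrow> mpart \<Rightarrow> int list" where
  "reading_word l s \<Lambda> =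
     concat (map (\<lambda>m. sorted_list_of_multiset (component_border s \<Lambda> m)) [1..<Suc l])"


section \<open>Alcoves\<close>

definition heights :: "mpart \<Rightarrow> nat \<Rightarrow> nat" where
  "heights \<Lambda> m = card (nonzero_rows \<Lambda> m)"

definition admissible :: "nat \<Rightarrow> nat \<Rightarrow> (nat \<Rightarrow> int) \<Rightarrow> (nat \<Rightarrow> nat) \<Rightarrow> bool" where
  "admissible e l s h \<longleftrightarrow>
     (\<forall>m\<in>{2..l}. int (h m) \<le> s m - s (m - 1)) \<and> int (h 1) \<le> int e + s 1 - s l \<and>
     ((\<exists>m\<in>{2..l}. int (h m) < s m - s (m - 1)) \<or> int (h 1) < int e + s 1 - s l)"

definition height_sum :: "nat \<Rightarrow> (nat \<Rightarrow> nat) \<Rightarrow> nat" where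
  "height_sum l h = (\<Sum>m\<in>{1..l}. h m)"

text \<open>\<open>Euclidean_space N\<close> consists of the functions supported on \<open>{0..<N}\<close>, so the basis vector with
  index \<open>k\<close> in \<open>1, ..., N\<close> is \<open>basis_vec (k - 1)\<close>.\<close>

definition basis_vec :: "nat \<Rightarrow> nat \<Rightarrow> real" where
  "basis_vec k = (\<lambda>t. if t = k then 1 else 0)"

definition eps :: "nat \<Rightarrow> (nat \<Rightarrow> nat) \<Rightarrow> nat \<Rightarrow> nat \<Rightarrow> nat \<Rightarrow> real" where
  "eps l h m i = basis_vec ((\<Sum>k\<in>{Suc m..l}. h k) + i - 1)"

definition mpart_point :: "nat \<Rightarrow> (nat \<Rightarrow> nat) \<Rightarrow> mpart \<Rightarrow> nat \<Rightarrow> real" where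
  "mpart_point l h \<Lambda> = (\<lambda>t. \<Sum>m\<in>{1..l}. \<Sum>i\<in>{1..h m}. real (\<Lambda> m i) * eps l h m i t)"

definition rho :: "nat \<Rightarrow> (nat \<Rightarrow> int) \<Rightarrow> (nat \<Rightarrow> nat) \<Rightarrow> nat \<Rightarrow> real" where
  "rho l s h = (\<lambda>t. \<Sum>m\<in>{1..l}. \<Sum>i\<in>{1..h m}. of_int (s m - int i + 1) * eps l h m i t)"

definition dot :: "nat \<Rightarrow> (nat \<Rightarrow> real) \<Rightarrow> (nat \<Rightarrow> real) \<Rightarrow> real" where
  "dot N x y = (\<Sum>t<N. x t * y t)"

definition root_vec :: "nat \<Rightarrow> nat \<Rightarrow> nat \<Rightarrow> real" where
  "root_vec i j = (\<lambda>t. basis_vec i t - basis_vec j t)"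

text \<open>The fixed points of the affine reflections
  \<open>x \<mapsto> s_(\<alpha>,re)(x + \<rho>) - \<rho>\<close> with \<open>s_(\<alpha>,re)(y) = y - (\<langle>y,\<alpha>\<rangle> - re) \<alpha>\<close>.\<close>

definition hyperplane :: "nat \<Rightarrow> nat \<Rightarrow> (nat \<Rightarrow> real) \<Rightarrow> (nat \<Rightarrow> real) \<Rightarrow> int \<Rightarrow> (nat \<Rightarrow> real) set" where
  "hyperplane e N \<rho> \<alpha> r =
     {x \<in> topspace (Euclidean_space N). dot N (\<lambda>t. x t + \<rho> t) \<alpha> = of_int (r * int e)}"

definition regular_points :: "nat \<Rightarrow> nat \<Rightarrow> (nat \<Rightarrow> real) \<Rightarrow> (nat \<Rightarrow> real) set" where
  "regular_points e N \<rho> =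
     topspace (Euclidean_space N) -
       \<Union>{hyperplane e N \<rho> (root_vec i j) r | i j r. i < N \<and> j < N \<and> i \<noteq> j}"

definition fundamental_alcove :: "nat \<Rightarrow> nat \<Rightarrow> (nat \<Rightarrow> int) \<Rightarrow> (nat \<Rightarrow> nat) \<Rightarrow> (nat \<Rightarrow> real) set" where
  "fundamental_alcove e l s h =
     (let N = height_sum l h in
      connected_component_of_set
        (subtopology (Euclidean_space N) (regular_points e N (rho l s h))) (\<lambda>t. 0))"


section \<open>The three conditions\<close>

definition border_condition :: "nat \<Rightarrow> nat \<Rightarrow> (nat \<Rightarrow> int) \<Rightarrow> mpart \<Rightarrow> bool" where
  "border_condition e l s \<Lambda> \<longleftrightarrow>
     cylindric e l s \<Lambda> \<and> period_at_most e (right_border l s \<Lambda>) \<and>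
     sorted_wrt (<) (reading_word l s \<Lambda>)"

definition alcove_condition :: "nat \<Rightarrow> nat \<Rightarrow> (nat \<Rightarrow> int) \<Rightarrow> mpart \<Rightarrow> bool" where
  "alcove_condition e l s \<Lambda> \<longleftrightarrow>
     (let h = heights \<Lambda> in
      admissible e l s h \<and> mpart_point l h \<Lambda> \<in> fundamental_alcove e l s h)"

end

theory Submission
  imports Defs "HOL-Library.Function_Algebras"
begin

text \<open>The combinatorics is that of particles on a circle of \<open>e\<close> points. A nonzero row of length
  \<open>a\<close> whose first box has content \<open>p\<close> is a particle that started at \<open>p\<close> and sits at \<open>p + a\<close> modulo
  \<open>e\<close>; adding a box of residue \<open>i\<close> moves a particle from \<open>i\<close> to \<open>i + 1\<close>. Both the border condition
  and the alcove condition say that the particles are distinct and keep their cyclic order,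
  without one of them getting a full turn ahead of another; this is the predicate \<open>alcove_like\<close>
  (\<open>border_condition_iff_alcove_like\<close>, \<open>alcove_condition_iff_alcove_like\<close>). The alcove condition
  also asks for fewer than \<open>e\<close> particles. For labels of simple modules this is automatic: such a
  label has a removable box whose particle can move back, so that some point of the circle is
  empty (\<open>e_tilde_alcove_like\<close>).

  If \<open>\<Lambda>\<close> satisfies these conditions, the words of residues along which \<open>\<Lambda>\<close> can be built up
  inside the alcove are closed under exchanging neighbouring letters \<open>i, j\<close> with \<open>j \<noteq> i \<plusminus> 1\<close>, and
  all of them are connected by such exchanges (\<open>walk_swap\<close>, \<open>walk_linked\<close>). Functions on these
  words therefore form a seminormal module: \<open>X_j\<close> multiplies by \<open>q\<close> to the power of the letter
  number \<open>j\<close>, and \<open>T_k\<close> acts by blocks of size at most two. As \<open>q = exp (2 \<pi> \<i> / e)\<close>, the number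
  \<open>\<bar>q - 1\<bar>\<close> is the least distance of two different \<open>e\<close>-th roots of unity, and this makes the
  blocks unitary (\<open>norm_diff_ge\<close>, \<open>coeff_norm\<close>). The module is simple because the words are
  connected (\<open>simple_word_rep\<close>). It is isomorphic to \<open>D_s(\<Lambda>)\<close> by induction (\<open>is_D_seminormal\<close>): if
  \<open>\<mu>\<close> arises from \<open>\<Lambda>\<close> by removing a box of residue \<open>i\<close> with the crystal operator, the seminormal
  module of \<open>\<mu>\<close> maps to both modules, with \<open>X_n\<close> acting by \<open>q\<close> to the power \<open>i\<close> on its image. No
  word of \<open>\<mu>\<close> ends with \<open>i\<close>, and in this situation a simple module of rank \<open>n\<close> is determined by
  that of rank \<open>n - 1\<close> (\<open>simple_modules_isomorphic\<close>). Hence \<open>D_s(\<Lambda>)\<close> is calibrated and unitary.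

  Conversely, if \<open>D_s(\<Lambda>)\<close> is calibrated or unitary, all \<open>X_j\<close> act semisimply
  (\<open>calibrated_semisimple_X\<close>, \<open>unitary_semisimple_X\<close>), and this passes to the socle that belongs
  to \<open>\<mu>\<close>, so that \<open>\<mu>\<close> is in its alcove by induction. Thus every word of \<open>\<mu>\<close>, followed by \<open>i\<close>, is a
  weight of \<open>D_s(\<Lambda>)\<close>. With semisimple \<open>X_j\<close>, two letters \<open>i\<close> of a weight are separated by an
  \<open>i + 1\<close> and by an \<open>i - 1\<close> (\<open>weight_between\<close>). But if the new box leads out of the alcove, some
  word of \<open>\<mu>\<close> has a letter \<open>i\<close> that is not followed by both of them (\<open>f_tilde_alcove_like\<close>); this
  contradiction shows that \<open>\<Lambda>\<close> is in its alcove (\<open>semisimple_alcove_like\<close>).\<close>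

section \<open>Modules, submodules and homomorphisms\<close>

definition lin_map :: "('v::ab_group_add) brep \<Rightarrow> ('w::ab_group_add) brep \<Rightarrow> ('v \<Rightarrow> 'w) \<Rightarrow> bool" where
  "lin_map A B f \<longleftrightarrow>
     (\<forall>v\<in>vspace A. f v \<in> vspace B) \<and>
     (\<forall>u\<in>vspace A. \<forall>v\<in>vspace A. f (u + v) = f u + f v) \<and>
     (\<forall>c. \<forall>v\<in>vspace A. f (smul A c v) = smul B c (f v))"

lemma lin_mapD:
  assumes "lin_map A B f"
  shows "v \<in> vspace A \<Longrightarrow> f v \<in> vspace B"
    and "u \<in> vspace A \<Longrightarrow> v \<in> vspace A \<Longrightarrow> f (u + v) = f u + f v"
    and "v \<in> vspace A \<Longrightarrow> f (smul A c v) = smul B c (f v)"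
  using assms unfolding lin_map_def by auto

lemma linear_automorphism_iff:
  "linear_automorphism M f \<longleftrightarrow> lin_map M M f \<and> bij_betw f (vspace M) (vspace M)"
  unfolding linear_automorphism_def lin_map_def by (auto simp: bij_betw_def)

locale vspace_rep =
  fixes M :: "('v::ab_group_add) brep"
  assumes vector_space_smul: "vector_space (smul M)"
    and subspace_vspace: "module.subspace (smul M) (vspace M)"
begin

sublocale vs: vector_space "smul M"
  by (rule vector_space_smul)

lemma in_vspace:
  shows "0 \<in> vspace M"
    and "u \<in> vspace M \<Longrightarrow> v \<in> vspace M \<Longrightarrow> u + v \<in> vspace M"
    and "u \<in> vspace M \<Longrightarrow> v \<in> vspace M \<Longrightarrow> u - v \<in> vspace M"
    and "v \<in> vspace M \<Longrightarrow> smul M c v \<in> vspace M"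
    and "v \<in> vspace M \<Longrightarrow> - v \<in> vspace M"
  by (simp_all add: vs.subspace_0[OF subspace_vspace] vs.subspace_add[OF subspace_vspace]
      vs.subspace_diff[OF subspace_vspace] vs.subspace_scale[OF subspace_vspace]
      vs.subspace_neg[OF subspace_vspace])

end

lemma lin_map_minus:
  assumes "vspace_rep A" "vspace_rep B" "lin_map A B f" "u \<in> vspace A" "v \<in> vspace A"
  shows "f (u - v) = f u - f v" and "f 0 = 0"
proof -
  interpret A: vspace_rep A by fact
  interpret B: vspace_rep B by fact
  have "f (u - v + v) = f (u - v) + f v"
    using assms by (intro lin_mapD(2)[OF assms(3)] A.in_vspace)
  then show "f (u - v) = f u - f v" by simp
  have "f (smul A 0 u) = smul B 0 (f u)"
    using assms by (intro lin_mapD(3)[OF assms(3)])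
  then show "f 0 = 0" by simp
qed

lemma lin_map_comp:
  "lin_map A B f \<Longrightarrow> lin_map B C g \<Longrightarrow> lin_map A C (\<lambda>v. g (f v))"
  unfolding lin_map_def by auto

lemma lin_map_span_subset:
  assumes "vspace_rep A" "vspace_rep B" "lin_map A B f" "S \<subseteq> vspace A"
    and "module.subspace (smul B) U" "\<And>v. v \<in> S \<Longrightarrow> f v \<in> U" "x \<in> module.span (smul A) S"
  shows "f x \<in> U"
proof -
  interpret A: vspace_rep A by fact
  interpret B: vspace_rep B by fact
  have "f 0 = 0"
    using lin_map_minus(2)[OF assms(1-3)] A.in_vspace(1) by blast
  then have "A.vs.subspace {v \<in> vspace A. f v \<in> U}"
    by (intro A.vs.subspaceI)
      (use assms in
        \<open>auto simp: lin_mapD[OF assms(3)] A.in_vspace B.vs.subspace_0 B.vs.subspace_add B.vs.subspace_scale\<close>)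
  moreover have "S \<subseteq> {v \<in> vspace A. f v \<in> U}"
    using assms by auto
  ultimately show ?thesis
    using A.vs.span_minimal assms(7) by blast
qed

text \<open>The constant term of the quadratic relation is not \<open>0\<close>, so the inverse of \<open>f\<close> is a
  polynomial in \<open>f\<close>.\<close>

lemma bij_betw_of_quadratic:
  assumes "vspace_rep M" "lin_map M M f" "q \<noteq> 0"
    and quad: "\<And>v. v \<in> vspace M \<Longrightarrow> f (f v) = smul M (q - 1) (f v) + smul M q v"
  shows "bij_betw f (vspace M) (vspace M)"
proof -
  interpret vspace_rep M by fact
  note lin = lin_mapD[OF assms(2)] and minus = lin_map_minus[OF assms(1,1,2)]
  let ?g = "\<lambda>v. smul M (inverse q) (f v - smul M (q - 1) v)"
  have fg: "f (?g v) = v" and gf: "?g (f v) = v" and g: "?g v \<in> vspace M" if v: "v \<in> vspace M" for v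
  proof -
    show "?g v \<in> vspace M" using v lin(1) by (intro in_vspace) auto
    show "?g (f v) = v" using assms(3) by (simp add: quad[OF v])
    have "f (?g v) = smul M (inverse q) (f (f v) - smul M (q - 1) (f v))"
      using v lin(1) by (simp add: lin(3) minus in_vspace)
    then show "f (?g v) = v" using assms(3) by (simp add: quad[OF v])
  qed
  show ?thesis
    by (rule bij_betw_byWitness[where f' = ?g]) (use lin(1) fg gf g in auto)
qed

lemma aff_hecke_moduleI:
  assumes "vspace_rep M" "q \<noteq> 0"
    and T_lin: "\<And>i. 1 \<le> i \<Longrightarrow> i < n \<Longrightarrow> lin_map M M (Tact M i)"
    and x_lin: "\<And>j. 1 \<le> j \<Longrightarrow> j \<le> n \<Longrightarrow> lin_map M M (xact M j)"
    and x_bij: "\<And>j. 1 \<le> j \<Longrightarrow> j \<le> n \<Longrightarrow> bij_betw (xact M j) (vspace M) (vspace M)"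
    and quad: "\<And>i v. 1 \<le> i \<Longrightarrow> i < n \<Longrightarrow> v \<in> vspace M \<Longrightarrow>
      Tact M i (Tact M i v) = smul M (q - 1) (Tact M i v) + smul M q v"
    and far: "\<And>i j v. 1 \<le> i \<Longrightarrow> Suc i < j \<Longrightarrow> j < n \<Longrightarrow> v \<in> vspace M \<Longrightarrow>
      Tact M i (Tact M j v) = Tact M j (Tact M i v)"
    and braid: "\<And>i v. 1 \<le> i \<Longrightarrow> Suc i < n \<Longrightarrow> v \<in> vspace M \<Longrightarrow>
      Tact M i (Tact M (Suc i) (Tact M i v)) = Tact M (Suc i) (Tact M i (Tact M (Suc i) v))"
    and xx: "\<And>i j v. 1 \<le> i \<Longrightarrow> i \<le> n \<Longrightarrow> 1 \<le> j \<Longrightarrow> j \<le> n \<Longrightarrow> v \<in> vspace M \<Longrightarrow>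
      xact M i (xact M j v) = xact M j (xact M i v)"
    and TxT: "\<And>i v. 1 \<le> i \<Longrightarrow> i < n \<Longrightarrow> v \<in> vspace M \<Longrightarrow>
      Tact M i (xact M i (Tact M i v)) = xact M (Suc i) v"
    and Tx: "\<And>i j v. 1 \<le> i \<Longrightarrow> i < n \<Longrightarrow> 1 \<le> j \<Longrightarrow> j \<le> n \<Longrightarrow> j \<noteq> i \<Longrightarrow> j \<noteq> Suc i \<Longrightarrow> v \<in> vspace M \<Longrightarrow>
      Tact M i (xact M j v) = xact M j (Tact M i v)"
  shows "aff_hecke_module q n M"
proof -
  interpret vspace_rep M by fact
  have "linear_automorphism M (Tact M i)" if "i \<in> {1..<n}" for i
    unfolding linear_automorphism_iff
    using that T_lin bij_betw_of_quadratic[OF assms(1) T_lin assms(2) quad] by auto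
  moreover have "linear_automorphism M (xact M j)" if "j \<in> {1..n}" for j
    unfolding linear_automorphism_iff using that x_lin x_bij by auto
  moreover have "let w = Tact M i v - smul M q v in Tact M i w + w = 0"
    if "i \<in> {1..<n}" "v \<in> vspace M" for i v
  proof -
    have i: "1 \<le> i" "i < n" using that by auto
    have "Tact M i (Tact M i v - smul M q v) = Tact M i (Tact M i v) - smul M q (Tact M i v)"
      using that(2) lin_mapD[OF T_lin[OF i]] lin_map_minus(1)[OF assms(1,1) T_lin[OF i]]
      by (simp add: in_vspace)
    then show ?thesis
      by (simp add: quad[OF i that(2)] Let_def vs.scale_left_diff_distrib)
  qed
  moreover have "Tact M i (Tact M j v) = Tact M j (Tact M i v)"
    if "v \<in> vspace M" "i \<in> {1..<n}" "j \<in> {1..<n}" "Suc i < j" for v i j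
    by (rule far) (use that in auto)
  moreover have "xact M i (xact M j v) = xact M j (xact M i v)"
    if "v \<in> vspace M" "i \<in> {1..n}" "j \<in> {1..n}" for v i j
    by (rule xx) (use that in auto)
  moreover have "Tact M i (xact M i (Tact M i v)) = xact M (Suc i) v"
    if "v \<in> vspace M" "i \<in> {1..<n}" for v i
    by (rule TxT) (use that in auto)
  moreover have "Tact M i (xact M j v) = xact M j (Tact M i v)"
    if "v \<in> vspace M" "i \<in> {1..<n}" "j \<in> {1..n}" "j \<noteq> i \<and> j \<noteq> Suc i" for v i j
    by (rule Tx) (use that in auto)
  ultimately show ?thesis
    unfolding aff_hecke_module_def braid_rep_def
    by (intro conjI ballI allI impI vector_space_smul subspace_vspace braid) blast+
qed

locale hecke_rep = vspace_rep M for M :: "('v::ab_group_add) brep" +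
  fixes q :: complex and n :: nat
  assumes hecke: "aff_hecke_module q n M" and q_nonzero: "q \<noteq> 0"

lemma hecke_repI:
  assumes "aff_hecke_module q n M" "q \<noteq> 0"
  shows "hecke_rep M q n"
  by (intro hecke_rep.intro vspace_rep.intro hecke_rep_axioms.intro assms)
    (use assms(1) in \<open>simp_all only: aff_hecke_module_def braid_rep_def\<close>)

context hecke_rep
begin

lemma Tact_lin: "1 \<le> i \<Longrightarrow> i < n \<Longrightarrow> lin_map M M (Tact M i)"
  and Tact_bij: "1 \<le> i \<Longrightarrow> i < n \<Longrightarrow> bij_betw (Tact M i) (vspace M) (vspace M)"
  and xact_lin: "1 \<le> j \<Longrightarrow> j \<le> n \<Longrightarrow> lin_map M M (xact M j)"
  and xact_bij: "1 \<le> j \<Longrightarrow> j \<le> n \<Longrightarrow> bij_betw (xact M j) (vspace M) (vspace M)"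
  using hecke unfolding aff_hecke_module_def braid_rep_def linear_automorphism_iff by auto

lemma
  assumes "v \<in> vspace M"
  shows Tact_Tact_far: "1 \<le> i \<Longrightarrow> Suc i < j \<Longrightarrow> j < n \<Longrightarrow> Tact M i (Tact M j v) = Tact M j (Tact M i v)"
    and Tact_braid: "1 \<le> i \<Longrightarrow> Suc i < n \<Longrightarrow>
      Tact M i (Tact M (Suc i) (Tact M i v)) = Tact M (Suc i) (Tact M i (Tact M (Suc i) v))"
    and xact_commute: "1 \<le> i \<Longrightarrow> i \<le> n \<Longrightarrow> 1 \<le> j \<Longrightarrow> j \<le> n \<Longrightarrow> xact M i (xact M j v) = xact M j (xact M i v)"
    and Tact_xact_Tact: "1 \<le> i \<Longrightarrow> i < n \<Longrightarrow> Tact M i (xact M i (Tact M i v)) = xact M (Suc i) v"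
    and Tact_xact_far: "1 \<le> i \<Longrightarrow> i < n \<Longrightarrow> 1 \<le> j \<Longrightarrow> j \<le> n \<Longrightarrow> j \<noteq> i \<Longrightarrow> j \<noteq> Suc i \<Longrightarrow>
      Tact M i (xact M j v) = xact M j (Tact M i v)"
proof -
  have rel: "\<forall>v\<in>vspace M.
        (\<forall>i\<in>{1..<n}. \<forall>j\<in>{1..<n}. Suc i < j \<longrightarrow> Tact M i (Tact M j v) = Tact M j (Tact M i v)) \<and>
        (\<forall>i. 1 \<le> i \<and> Suc i < n \<longrightarrow>
           Tact M i (Tact M (Suc i) (Tact M i v)) = Tact M (Suc i) (Tact M i (Tact M (Suc i) v))) \<and>
        (\<forall>i\<in>{1..n}. \<forall>j\<in>{1..n}. xact M i (xact M j v) = xact M j (xact M i v)) \<and>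
        (\<forall>i\<in>{1..<n}. Tact M i (xact M i (Tact M i v)) = xact M (Suc i) v) \<and>
        (\<forall>i\<in>{1..<n}. \<forall>j\<in>{1..n}. j \<noteq> i \<and> j \<noteq> Suc i \<longrightarrow>
           Tact M i (xact M j v) = xact M j (Tact M i v))"
    using hecke unfolding aff_hecke_module_def braid_rep_def by (elim conjE)
  note rel = bspec[OF rel assms]
  show "1 \<le> i \<Longrightarrow> Suc i < j \<Longrightarrow> j < n \<Longrightarrow> Tact M i (Tact M j v) = Tact M j (Tact M i v)"
    using rel[THEN conjunct1, rule_format, of i j] by simp
  show "1 \<le> i \<Longrightarrow> Suc i < n \<Longrightarrow>
      Tact M i (Tact M (Suc i) (Tact M i v)) = Tact M (Suc i) (Tact M i (Tact M (Suc i) v))"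
    using rel[THEN conjunct2, THEN conjunct1] by blast
  show "1 \<le> i \<Longrightarrow> i \<le> n \<Longrightarrow> 1 \<le> j \<Longrightarrow> j \<le> n \<Longrightarrow> xact M i (xact M j v) = xact M j (xact M i v)"
    using rel[THEN conjunct2, THEN conjunct2, THEN conjunct1, rule_format, of i j] by simp
  show "1 \<le> i \<Longrightarrow> i < n \<Longrightarrow> Tact M i (xact M i (Tact M i v)) = xact M (Suc i) v"
    using rel[THEN conjunct2, THEN conjunct2, THEN conjunct2, THEN conjunct1] by simp
  show "1 \<le> i \<Longrightarrow> i < n \<Longrightarrow> 1 \<le> j \<Longrightarrow> j \<le> n \<Longrightarrow> j \<noteq> i \<Longrightarrow> j \<noteq> Suc i \<Longrightarrow>
      Tact M i (xact M j v) = xact M j (Tact M i v)"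
    using rel[THEN conjunct2, THEN conjunct2, THEN conjunct2, THEN conjunct2, rule_format, of i j] by simp
qed

lemma Tact_quadratic:
  assumes "1 \<le> i" "i < n" "v \<in> vspace M"
  shows "Tact M i (Tact M i v) = smul M (q - 1) (Tact M i v) + smul M q v"
proof -
  have "Tact M i (Tact M i v - smul M q v) + (Tact M i v - smul M q v) = 0"
    using hecke assms unfolding aff_hecke_module_def by (auto simp: Let_def)
  moreover have "Tact M i (Tact M i v - smul M q v) = Tact M i (Tact M i v) - smul M q (Tact M i v)"
    using assms lin_mapD[OF Tact_lin[OF assms(1,2)]]
    by (subst lin_map_minus(1)[OF vspace_rep_axioms vspace_rep_axioms Tact_lin[OF assms(1,2)]])
      (auto simp: in_vspace)
  ultimately have "Tact M i (Tact M i v) - smul M q (Tact M i v) + (Tact M i v - smul M q v) = 0"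
    by simp
  then have "Tact M i (Tact M i v) = smul M q (Tact M i v) - Tact M i v + smul M q v"
    by (simp add: algebra_simps)
  then show ?thesis by (simp add: vs.scale_left_diff_distrib)
qed

lemma Tact_in: "1 \<le> i \<Longrightarrow> i < n \<Longrightarrow> v \<in> vspace M \<Longrightarrow> Tact M i v \<in> vspace M"
  and xact_in: "1 \<le> j \<Longrightarrow> j \<le> n \<Longrightarrow> v \<in> vspace M \<Longrightarrow> xact M j v \<in> vspace M"
  using lin_mapD(1) Tact_lin xact_lin by blast+

lemma Tact_inj: "1 \<le> i \<Longrightarrow> i < n \<Longrightarrow> u \<in> vspace M \<Longrightarrow> v \<in> vspace M \<Longrightarrow> Tact M i u = Tact M i v \<Longrightarrow> u = v"
  and xact_inj: "1 \<le> j \<Longrightarrow> j \<le> n \<Longrightarrow> u \<in> vspace M \<Longrightarrow> v \<in> vspace M \<Longrightarrow> xact M j u = xact M j v \<Longrightarrow> u = v"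
  using Tact_bij xact_bij unfolding bij_betw_def inj_on_def by metis+

lemmas Tact_minus = lin_map_minus[OF vspace_rep_axioms vspace_rep_axioms Tact_lin]
lemmas xact_minus = lin_map_minus[OF vspace_rep_axioms vspace_rep_axioms xact_lin]
lemmas Tact_linear = lin_mapD(2,3)[OF Tact_lin]
lemmas xact_linear = lin_mapD(2,3)[OF xact_lin]

text \<open>The inverse of \<open>T_i\<close> is a polynomial in \<open>T_i\<close>, so it preserves every subspace that \<open>T_i\<close>
  preserves.\<close>

lemma Tact_preimage:
  assumes "1 \<le> i" "i < n" "vs.subspace U" "U \<subseteq> vspace M" "\<And>v. v \<in> U \<Longrightarrow> Tact M i v \<in> U" "v \<in> U"
  shows "\<exists>u\<in>U. Tact M i u = v"
proof
  let ?w = "Tact M i v - smul M (q - 1) v"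
  show "smul M (inverse q) ?w \<in> U"
    using assms by (intro vs.subspace_scale vs.subspace_diff) auto
  have v: "v \<in> vspace M" and Tv: "Tact M i v \<in> vspace M" using assms by auto
  have "Tact M i (smul M (inverse q) ?w) = smul M (inverse q) (Tact M i ?w)"
    using v Tv by (subst Tact_linear(2)[OF assms(1,2)]) (auto simp: in_vspace)
  also have "Tact M i ?w = Tact M i (Tact M i v) - smul M (q - 1) (Tact M i v)"
    using v Tv by (subst Tact_minus(1)[OF assms(1,2)]) (auto simp: in_vspace Tact_linear(2)[OF assms(1,2)])
  also have "\<dots> = smul M q v"
    by (simp add: Tact_quadratic[OF assms(1,2) v])
  finally show "Tact M i (smul M (inverse q) ?w) = v"
    using q_nonzero by simp
qed

text \<open>In infinite dimension a subspace stable under \<open>x_j\<close> may fail to be stable under the inverse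
  of \<open>x_j\<close>, whence the last condition; for \<open>T_i\<close> the quadratic relation provides it.\<close>

lemma submoduleI:
  assumes sub: "vs.subspace U" "U \<subseteq> vspace M"
    and T: "\<And>i v. 1 \<le> i \<Longrightarrow> i < n \<Longrightarrow> v \<in> U \<Longrightarrow> Tact M i v \<in> U"
    and x: "\<And>j v. 1 \<le> j \<Longrightarrow> j \<le> n \<Longrightarrow> v \<in> U \<Longrightarrow> xact M j v \<in> U"
    and x_onto: "\<And>j v. 1 \<le> j \<Longrightarrow> j \<le> n \<Longrightarrow> v \<in> U \<Longrightarrow> \<exists>u\<in>U. xact M j u = v"
  shows "aff_hecke_module q n (restrict_rep M U)"
proof -
  let ?R = "restrict_rep M U"
  have R: "smul ?R = smul M" "vspace ?R = U" "Tact ?R = Tact M" "xact ?R = xact M"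
    by (simp_all add: restrict_rep_def)
  have inV: "v \<in> vspace M" if "v \<in> U" for v using that sub(2) by blast
  have lin: "lin_map M M f \<Longrightarrow> (\<And>v. v \<in> U \<Longrightarrow> f v \<in> U) \<Longrightarrow> lin_map ?R ?R f" for f
    using inV unfolding lin_map_def R by auto
  show ?thesis
  proof (rule aff_hecke_moduleI, unfold R)
    show "vspace_rep ?R"
      using sub(1) vector_space_smul by (intro vspace_rep.intro) (simp_all only: R)
    show "lin_map ?R ?R (Tact M i)" if "1 \<le> i" "i < n" for i
      using lin[OF Tact_lin T] that by blast
    show "lin_map ?R ?R (xact M j)" if "1 \<le> j" "j \<le> n" for j
      using lin[OF xact_lin x] that by blast
    show "bij_betw (xact M j) U U" if j: "1 \<le> j" "j \<le> n" for j
      unfolding bij_betw_def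
    proof
      show "inj_on (xact M j) U"
        using xact_bij[OF j] sub(2) unfolding bij_betw_def by (meson inj_on_subset)
      show "xact M j ` U = U"
        using x[OF j] x_onto[OF j] by blast
    qed
  qed (assumption | rule q_nonzero Tact_quadratic Tact_Tact_far Tact_braid xact_commute
      Tact_xact_Tact Tact_xact_far inV)+
qed

lemma submoduleD:
  assumes "aff_hecke_module q n (restrict_rep M U)"
  shows "vs.subspace U"
    and "1 \<le> i \<Longrightarrow> i < n \<Longrightarrow> v \<in> U \<Longrightarrow> Tact M i v \<in> U"
    and "1 \<le> j \<Longrightarrow> j \<le> n \<Longrightarrow> v \<in> U \<Longrightarrow> xact M j v \<in> U"
    and "1 \<le> j \<Longrightarrow> j \<le> n \<Longrightarrow> v \<in> U \<Longrightarrow> \<exists>u\<in>U. xact M j u = v"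
proof -
  interpret R: hecke_rep "restrict_rep M U" q n
    by (rule hecke_repI[OF assms q_nonzero])
  show "vs.subspace U"
    using R.subspace_vspace by (simp add: restrict_rep_def)
  show "1 \<le> i \<Longrightarrow> i < n \<Longrightarrow> v \<in> U \<Longrightarrow> Tact M i v \<in> U"
    using R.Tact_in by (simp add: restrict_rep_def)
  show "1 \<le> j \<Longrightarrow> j \<le> n \<Longrightarrow> v \<in> U \<Longrightarrow> xact M j v \<in> U"
    using R.xact_in by (simp add: restrict_rep_def)
  show "1 \<le> j \<Longrightarrow> j \<le> n \<Longrightarrow> v \<in> U \<Longrightarrow> \<exists>u\<in>U. xact M j u = v"
  proof -
    assume "1 \<le> j" "j \<le> n" "v \<in> U"
    then have "xact M j ` U = U" "v \<in> U"
      using R.xact_bij[of j] by (auto simp: restrict_rep_def bij_betw_def)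
    then show ?thesis by (metis imageE)
  qed
qed

text \<open>Since \<open>x_j = T_j\<inverse> x_(j+1) T_j\<inverse>\<close>, only the last of the \<open>x_j\<close> has to be checked.\<close>

lemma submoduleI_last:
  assumes sub: "vs.subspace U" "U \<subseteq> vspace M"
    and T: "\<And>i v. 1 \<le> i \<Longrightarrow> i < n \<Longrightarrow> v \<in> U \<Longrightarrow> Tact M i v \<in> U"
    and x: "\<And>v. 1 \<le> n \<Longrightarrow> v \<in> U \<Longrightarrow> xact M n v \<in> U"
    and x_onto: "\<And>v. 1 \<le> n \<Longrightarrow> v \<in> U \<Longrightarrow> \<exists>u\<in>U. xact M n u = v"
  shows "aff_hecke_module q n (restrict_rep M U)"
proof -
  have "(\<forall>v\<in>U. xact M j v \<in> U) \<and> (\<forall>v\<in>U. \<exists>u\<in>U. xact M j u = v)" if "1 \<le> j" "j \<le> n" for j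
    using that(2,1)
  proof (induction j rule: inc_induct)
    case base
    then show ?case using x x_onto by auto
  next
    case (step j)
    then have j: "1 \<le> j" "j < n" "1 \<le> Suc j" and IH: "\<forall>v\<in>U. xact M (Suc j) v \<in> U"
      "\<forall>v\<in>U. \<exists>u\<in>U. xact M (Suc j) u = v" by auto
    note pre = Tact_preimage[OF j(1,2) sub T[OF j(1,2)]]
    show ?case
    proof (intro conjI ballI)
      fix v assume "v \<in> U"
      then obtain u where u: "u \<in> U" "Tact M j u = v" using pre by blast
      obtain w where w: "w \<in> U" "Tact M j w = xact M (Suc j) u" using pre IH u by blast
      have "Tact M j (xact M j v) = Tact M j w"
        using u w Tact_xact_Tact[of u j] j sub(2) by auto
      then have "xact M j v = w"
        using Tact_inj[OF j(1,2)] xact_in[of j v] j \<open>v \<in> U\<close> w(1) sub(2) by (simp add: subset_iff)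
      then show "xact M j v \<in> U" using w by simp
    next
      fix v assume "v \<in> U"
      then obtain u where u: "u \<in> U" "xact M (Suc j) u = Tact M j v" using IH T[OF j(1,2)] by blast
      have Tu: "Tact M j u \<in> U" using T[OF j(1,2)] u by blast
      have "Tact M j (xact M j (Tact M j u)) = Tact M j v"
        using u Tact_xact_Tact[of u j] j sub(2) by auto
      then have "xact M j (Tact M j u) = v"
        using Tact_inj[OF j(1,2)] xact_in[of j "Tact M j u"] j \<open>v \<in> U\<close> Tu sub(2)
        by (simp add: subset_iff)
      then show "\<exists>u\<in>U. xact M j u = v" using Tu by blast
    qed
  qed
  then show ?thesis
    using submoduleI[OF sub T] by blast
qed

end

lemma hecke_rep_restrict:
  "hecke_rep M q n \<Longrightarrow> aff_hecke_module q n (restrict_rep M U) \<Longrightarrow> hecke_rep (restrict_rep M U) q n"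
  using hecke_repI unfolding hecke_rep_def hecke_rep_axioms_def by blast

lemma hecke_rep_rank_le:
  assumes "hecke_rep M q n" "k \<le> n"
  shows "hecke_rep M q k"
proof -
  interpret hecke_rep M q n by fact
  have "aff_hecke_module q k M"
  proof (rule aff_hecke_moduleI)
    fix i j v assume v: "v \<in> vspace M"
    show "Tact M i (Tact M j v) = Tact M j (Tact M i v)" if "1 \<le> i" "Suc i < j" "j < k"
      by (rule Tact_Tact_far) (use that assms(2) v in auto)
    show "xact M i (xact M j v) = xact M j (xact M i v)" if "1 \<le> i" "i \<le> k" "1 \<le> j" "j \<le> k"
      by (rule xact_commute) (use that assms(2) v in auto)
  qed (use assms(2) in \<open>simp_all add: vspace_rep_axioms q_nonzero Tact_lin xact_lin xact_bij
        Tact_quadratic Tact_braid Tact_xact_Tact Tact_xact_far\<close>)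
  then show ?thesis using hecke_repI q_nonzero by blast
qed

definition hecke_hom ::
    "nat \<Rightarrow> ('v::ab_group_add) brep \<Rightarrow> ('w::ab_group_add) brep \<Rightarrow> ('v \<Rightarrow> 'w) \<Rightarrow> bool" where
  "hecke_hom n A B f \<longleftrightarrow> lin_map A B f \<and>
     (\<forall>i\<in>{1..<n}. \<forall>v\<in>vspace A. f (Tact A i v) = Tact B i (f v)) \<and>
     (\<forall>j\<in>{1..n}. \<forall>v\<in>vspace A. f (xact A j v) = xact B j (f v))"

definition hecke_iso ::
    "nat \<Rightarrow> ('v::ab_group_add) brep \<Rightarrow> ('w::ab_group_add) brep \<Rightarrow> ('v \<Rightarrow> 'w) \<Rightarrow> bool" where
  "hecke_iso n A B f \<longleftrightarrow> hecke_hom n A B f \<and> bij_betw f (vspace A) (vspace B)"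

lemma hecke_homD:
  assumes "hecke_hom n A B f"
  shows "lin_map A B f"
    and "1 \<le> i \<Longrightarrow> i < n \<Longrightarrow> v \<in> vspace A \<Longrightarrow> f (Tact A i v) = Tact B i (f v)"
    and "1 \<le> j \<Longrightarrow> j \<le> n \<Longrightarrow> v \<in> vspace A \<Longrightarrow> f (xact A j v) = xact B j (f v)"
  using assms unfolding hecke_hom_def by auto

lemma hecke_hom_comp:
  assumes "hecke_hom n A B f" "hecke_hom n B C g"
  shows "hecke_hom n A C (\<lambda>v. g (f v))"
  using assms lin_mapD(1)[OF hecke_homD(1)[OF assms(1)]]
  unfolding hecke_hom_def by (auto intro: lin_map_comp)

lemma hecke_iso_comp:
  assumes "hecke_iso n A B f" "hecke_iso n B C g"
  shows "hecke_iso n A C (\<lambda>v. g (f v))"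
  using assms hecke_hom_comp[of n A B f C g] bij_betw_trans[of f "vspace A" "vspace B" g "vspace C"]
  unfolding hecke_iso_def comp_def by auto

lemma hecke_iso_inv:
  assumes "hecke_rep A q n" "hecke_iso n A B f"
  shows "hecke_iso n B A (inv_into (vspace A) f)"
proof -
  interpret A: hecke_rep A q n by fact
  let ?g = "inv_into (vspace A) f"
  have bij: "bij_betw f (vspace A) (vspace B)" and hom: "hecke_hom n A B f"
    using assms(2) unfolding hecke_iso_def by auto
  have g: "?g v \<in> vspace A" "f (?g v) = v" if "v \<in> vspace B" for v
    using that bij by (auto simp: bij_betw_def inv_into_into f_inv_into_f)
  have eqI: "?g v = w" if "w \<in> vspace A" "f w = v" for v w
    using that bij by (auto simp: bij_betw_def)
  note lin = lin_mapD[OF hecke_homD(1)[OF hom]]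
  have "hecke_hom n B A ?g"
    unfolding hecke_hom_def lin_map_def
    by (intro conjI ballI allI g eqI)
      (auto simp: g lin A.in_vspace A.Tact_in A.xact_in hecke_homD[OF hom])
  then show ?thesis
    using bij bij_betw_inv_into unfolding hecke_iso_def by blast
qed

lemma hecke_hom_image:
  assumes "hecke_rep A q n" "hecke_rep B q n" "hecke_hom n A B f"
  shows "aff_hecke_module q n (restrict_rep B (f ` vspace A))"
proof -
  interpret A: hecke_rep A q n by fact
  interpret B: hecke_rep B q n by fact
  note lin = lin_mapD[OF hecke_homD(1)[OF assms(3)]]
  have f0: "f 0 = 0"
    using lin_map_minus(2)[OF A.vspace_rep_axioms B.vspace_rep_axioms hecke_homD(1)[OF assms(3)]]
      A.in_vspace(1) by blast
  show ?thesis
  proof (rule B.submoduleI)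
    show "B.vs.subspace (f ` vspace A)"
    proof (rule B.vs.subspaceI)
      show "0 \<in> f ` vspace A" using f0 A.in_vspace(1) by (metis imageI)
      show "x + y \<in> f ` vspace A" if "x \<in> f ` vspace A" "y \<in> f ` vspace A" for x y
      proof -
        obtain u v where "u \<in> vspace A" "v \<in> vspace A" "x = f u" "y = f v" using \<open>x \<in> _\<close> \<open>y \<in> _\<close> by blast
        then have "x + y = f (u + v)" "u + v \<in> vspace A" using lin(2) A.in_vspace(2) by auto
        then show ?thesis by blast
      qed
      show "smul B c x \<in> f ` vspace A" if "x \<in> f ` vspace A" for c x
        using that lin(3)[symmetric] A.in_vspace(4) by fastforce
    qed
    show "f ` vspace A \<subseteq> vspace B" using lin(1) by auto
    show "Tact B i v \<in> f ` vspace A" if "1 \<le> i" "i < n" "v \<in> f ` vspace A" for i v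
      using that A.Tact_in hecke_homD(2)[OF assms(3), symmetric] by fastforce
    show "xact B i v \<in> f ` vspace A" if "1 \<le> i" "i \<le> n" "v \<in> f ` vspace A" for i v
      using that A.xact_in hecke_homD(3)[OF assms(3), symmetric] by fastforce
    show "\<exists>u\<in>f ` vspace A. xact B i u = v" if i: "1 \<le> i" "i \<le> n" and v: "v \<in> f ` vspace A" for i v
    proof -
      obtain w where w: "w \<in> vspace A" "v = f w" using v by blast
      then obtain w' where "w' \<in> vspace A" "w = xact A i w'"
        using A.xact_bij[OF i] unfolding bij_betw_def by (metis imageE)
      then show ?thesis using w hecke_homD(3)[OF assms(3) i] by auto
    qed
  qed
qed

lemma hecke_hom_kernel:
  assumes "hecke_rep A q n" "hecke_rep B q n" "hecke_hom n A B f"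
  shows "aff_hecke_module q n (restrict_rep A {v \<in> vspace A. f v = 0})"
proof -
  interpret A: hecke_rep A q n by fact
  interpret B: hecke_rep B q n by fact
  note lin = lin_mapD[OF hecke_homD(1)[OF assms(3)]]
  have f0: "f 0 = 0"
    using lin_map_minus(2)[OF A.vspace_rep_axioms B.vspace_rep_axioms hecke_homD(1)[OF assms(3)]]
      A.in_vspace(1) by blast
  have T0: "Tact B i 0 = 0" if "1 \<le> i" "i < n" for i
    using B.Tact_minus(2)[OF that B.in_vspace(1) B.in_vspace(1)] .
  have x0: "xact B i 0 = 0" if "1 \<le> i" "i \<le> n" for i
    using B.xact_minus(2)[OF that B.in_vspace(1) B.in_vspace(1)] .
  show ?thesis
  proof (rule A.submoduleI)
    show "A.vs.subspace {v \<in> vspace A. f v = 0}"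
      by (rule A.vs.subspaceI) (auto simp: f0 lin A.in_vspace)
    show "Tact A i v \<in> {v \<in> vspace A. f v = 0}" if "1 \<le> i" "i < n" "v \<in> {v \<in> vspace A. f v = 0}" for i v
      using that A.Tact_in hecke_homD(2)[OF assms(3)] T0 by auto
    show "xact A i v \<in> {v \<in> vspace A. f v = 0}" if "1 \<le> i" "i \<le> n" "v \<in> {v \<in> vspace A. f v = 0}" for i v
      using that A.xact_in hecke_homD(3)[OF assms(3)] x0 by auto
    show "\<exists>u\<in>{v \<in> vspace A. f v = 0}. xact A i u = v"
      if i: "1 \<le> i" "i \<le> n" and v: "v \<in> {v \<in> vspace A. f v = 0}" for i v
    proof -
      obtain u where u: "u \<in> vspace A" "v = xact A i u"
        using A.xact_bij[OF i] v unfolding bij_betw_def by blast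
      have "xact B i (f u) = xact B i 0"
        using u v hecke_homD(3)[OF assms(3) i u(1)] x0[OF i] by auto
      then have "f u = 0"
        using B.xact_inj[OF i] lin(1) u(1) B.in_vspace(1) by blast
      then show ?thesis using u by blast
    qed
  qed auto
qed

context hecke_rep
begin

lemma Xact_lin: "1 \<le> j \<Longrightarrow> j \<le> n \<Longrightarrow> lin_map M M (Xact q M j)"
  using lin_mapD[OF xact_lin[of j]]
  by (simp add: lin_map_def Xact_def in_vspace vs.scale_right_distrib mult.commute)

lemma Xact_in: "1 \<le> j \<Longrightarrow> j \<le> n \<Longrightarrow> v \<in> vspace M \<Longrightarrow> Xact q M j v \<in> vspace M"
  using lin_mapD(1) Xact_lin by blast

lemmas Xact_linear = lin_mapD(2,3)[OF Xact_lin]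
lemmas Xact_minus = lin_map_minus[OF vspace_rep_axioms vspace_rep_axioms Xact_lin]

lemma xact_Xact: "xact M j v = smul M (q powi (int j - 1)) (Xact q M j v)"
  using q_nonzero by (simp add: Xact_def flip: power_int_add)

lemma Tact_Xact_far:
  assumes "1 \<le> i" "i < n" "1 \<le> j" "j \<le> n" "j \<noteq> i" "j \<noteq> Suc i" "v \<in> vspace M"
  shows "Tact M i (Xact q M j v) = Xact q M j (Tact M i v)"
  unfolding Xact_def using Tact_xact_far[OF assms(7,1-6)] assms
  by (simp add: Tact_linear(2) xact_in)

text \<open>This Bernstein relation comes from \<open>T_i x_i T_i = x_(i+1)\<close> by multiplying with \<open>T_i\<close> on the
  right and reducing the square of \<open>T_i\<close>.\<close>

lemma Xact_Tact:
  assumes "1 \<le> i" "i < n" "v \<in> vspace M"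
  shows "Xact q M (Suc i) (Tact M i v) = Tact M i (Xact q M i v) + smul M (q - 1) (Xact q M (Suc i) v)"
proof -
  note T = Tact_linear[OF assms(1,2)] and inT = Tact_in[OF assms(1,2)]
  have xi: "xact M i v \<in> vspace M" "xact M i (Tact M i v) \<in> vspace M"
    and ij: "1 \<le> i" "i \<le> n" using assms inT xact_in by auto
  have "xact M (Suc i) (Tact M i v) = Tact M i (xact M i (Tact M i (Tact M i v)))"
    using Tact_xact_Tact[OF inT[OF assms(3)] assms(1,2)] by simp
  also have "\<dots> = smul M (q - 1) (Tact M i (xact M i (Tact M i v))) + smul M q (Tact M i (xact M i v))"
    using assms xi inT ij by (simp add: Tact_quadratic xact_linear T in_vspace)
  finally have *: "xact M (Suc i) (Tact M i v) = smul M (q - 1) (xact M (Suc i) v) + smul M q (Tact M i (xact M i v))"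
    using Tact_xact_Tact[OF assms(3,1,2)] by simp
  have "q powi (1 - int (Suc i)) * q = q powi (1 - int i)"
    using q_nonzero by (simp flip: power_int_add_1)
  then show ?thesis
    using xi(1) unfolding Xact_def * by (simp add: vs.scale_right_distrib T mult.commute)
qed

lemma X_minus_lin: "1 \<le> j \<Longrightarrow> j \<le> n \<Longrightarrow> lin_map M M (X_minus q M j a)"
  using Xact_linear[of j] Xact_in[of j]
  by (simp add: lin_map_def X_minus_def in_vspace algebra_simps vs.scale_right_distrib vs.scale_right_diff_distrib mult.commute)

lemma X_minus_in: "1 \<le> j \<Longrightarrow> j \<le> n \<Longrightarrow> v \<in> vspace M \<Longrightarrow> X_minus q M j a v \<in> vspace M"
  using lin_mapD(1) X_minus_lin by blast

end

lemma hecke_hom_Xact: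
  assumes "hecke_rep A q n" "hecke_hom n A B f" "1 \<le> j" "j \<le> n" "v \<in> vspace A"
  shows "f (Xact q A j v) = Xact q B j (f v)"
  using assms hecke_homD[OF assms(2)] hecke_rep.xact_in[OF assms(1)] lin_mapD(3)[OF hecke_homD(1)[OF assms(2)]]
  by (simp add: Xact_def)

lemma hecke_hom_X_minus:
  assumes "hecke_rep A q n" "hecke_rep B q n" "hecke_hom n A B f" "1 \<le> j" "j \<le> n" "v \<in> vspace A"
  shows "f (X_minus q A j a v) = X_minus q B j a (f v)"
proof -
  interpret A: hecke_rep A q n by fact
  interpret B: hecke_rep B q n by fact
  show ?thesis
    using lin_map_minus(1)[OF A.vspace_rep_axioms B.vspace_rep_axioms hecke_homD(1)[OF assms(3)]]
      hecke_hom_Xact[OF assms(1,3-)] lin_mapD(3)[OF hecke_homD(1)[OF assms(3)]] assms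
      A.Xact_in[OF assms(4-6)] A.in_vspace(4)
    by (simp add: X_minus_def)
qed

lemma hecke_hom_restrict:
  assumes "hecke_hom n A B f" "U \<subseteq> vspace A"
  shows "hecke_hom n (restrict_rep A U) B f"
  using assms unfolding hecke_hom_def lin_map_def restrict_rep_def by (auto simp: subset_iff)

definition prod_rep :: "('v::ab_group_add) brep \<Rightarrow> ('w::ab_group_add) brep \<Rightarrow> ('v \<times> 'w) brep" where
  "prod_rep A B =
    \<lparr>smul = (\<lambda>c x. (smul A c (fst x), smul B c (snd x))),
     vspace = vspace A \<times> vspace B,
     Tact = (\<lambda>i x. (Tact A i (fst x), Tact B i (snd x))),
     xact = (\<lambda>i x. (xact A i (fst x), xact B i (snd x)))\<rparr>"

lemma prod_rep_simps [simp]: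
  "smul (prod_rep A B) c x = (smul A c (fst x), smul B c (snd x))"
  "vspace (prod_rep A B) = vspace A \<times> vspace B"
  "Tact (prod_rep A B) i x = (Tact A i (fst x), Tact B i (snd x))"
  "xact (prod_rep A B) i x = (xact A i (fst x), xact B i (snd x))"
  by (simp_all add: prod_rep_def)

lemma hecke_rep_prod:
  assumes "hecke_rep A q n" "hecke_rep B q n"
  shows "hecke_rep (prod_rep A B) q n"
proof -
  interpret A: hecke_rep A q n by fact
  interpret B: hecke_rep B q n by fact
  let ?P = "prod_rep A B"
  have vs: "vector_space (smul ?P)"
    by unfold_locales
      (simp_all add: A.vs.scale_right_distrib B.vs.scale_right_distrib A.vs.scale_left_distrib B.vs.scale_left_distrib)
  interpret P: vector_space "smul ?P" by (rule vs)
  have sub: "P.subspace (vspace ?P)"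
    by (rule P.subspaceI) (auto simp: A.in_vspace B.in_vspace zero_prod_def)
  have rep: "vspace_rep ?P"
    by (intro vspace_rep.intro vs sub)
  have "aff_hecke_module q n ?P"
  proof (rule aff_hecke_moduleI)
    show "lin_map ?P ?P (Tact ?P i)" if "1 \<le> i" "i < n" for i
      using that by (auto simp: lin_map_def A.Tact_in B.Tact_in A.Tact_linear B.Tact_linear)
    show "lin_map ?P ?P (xact ?P i)" if "1 \<le> i" "i \<le> n" for i
      using that by (auto simp: lin_map_def A.xact_in B.xact_in A.xact_linear B.xact_linear)
    show "bij_betw (xact ?P j) (vspace ?P) (vspace ?P)" if j: "1 \<le> j" "j \<le> n" for j
      unfolding bij_betw_def
    proof
      show "inj_on (xact ?P j) (vspace ?P)"
        using A.xact_inj[OF j] B.xact_inj[OF j] by (auto simp: inj_on_def)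
      have "xact A j ` vspace A = vspace A" "xact B j ` vspace B = vspace B"
        using A.xact_bij[OF j] B.xact_bij[OF j] unfolding bij_betw_def by auto
      moreover have "xact ?P j ` vspace ?P = xact A j ` vspace A \<times> xact B j ` vspace B"
        by force
      ultimately show "xact ?P j ` vspace ?P = vspace ?P" by simp
    qed
    fix i j v assume v: "v \<in> vspace ?P"
    then have v: "fst v \<in> vspace A" "snd v \<in> vspace B" by auto
    show "Tact ?P i (Tact ?P j v) = Tact ?P j (Tact ?P i v)" if "1 \<le> i" "Suc i < j" "j < n"
      using A.Tact_Tact_far[OF v(1) that] B.Tact_Tact_far[OF v(2) that] by simp
    show "xact ?P i (xact ?P j v) = xact ?P j (xact ?P i v)" if "1 \<le> i" "i \<le> n" "1 \<le> j" "j \<le> n"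
      using A.xact_commute[OF v(1) that] B.xact_commute[OF v(2) that] by simp
  qed (auto simp: rep A.q_nonzero A.Tact_quadratic B.Tact_quadratic A.Tact_braid B.Tact_braid
        A.Tact_xact_Tact B.Tact_xact_Tact A.Tact_xact_far B.Tact_xact_far)
  then show ?thesis using hecke_repI A.q_nonzero by blast
qed

lemma hecke_hom_proj:
  shows "hecke_hom n (prod_rep A B) A fst" "hecke_hom n (prod_rep A B) B snd"
  by (auto simp: hecke_hom_def lin_map_def)

lemma hecke_hom_pair:
  assumes "hecke_hom n C A f" "hecke_hom n C B g"
  shows "hecke_hom n C (prod_rep A B) (\<lambda>v. (f v, g v))"
  using assms by (auto simp: hecke_hom_def lin_map_def)

section \<open>Induction by one rank\<close>

text \<open>A submodule \<open>N\<close> of rank \<open>m\<close> on which \<open>X_(m+1)\<close> acts by a scalar generates a module of rank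
  \<open>m + 1\<close>: since the elements \<open>T_(m-k+1) \<dots> T_m\<close> represent the cosets of the symmetric group of
  rank \<open>m\<close> in that of rank \<open>m + 1\<close>, the spaces \<open>T_(m-k+1) \<dots> T_m N\<close> span it. The operator
  \<open>T_(m-k+1) \<dots> T_m\<close> is called \<open>chain k\<close>.\<close>

locale induced_submodule = hecke_rep M q "Suc m" for M :: "('v::ab_group_add) brep" and q m +
  fixes N :: "'v set" and a :: complex
  assumes N_module: "aff_hecke_module q m (restrict_rep M N)"
    and N_subset: "N \<subseteq> vspace M"
    and N_scalar: "\<And>x. x \<in> N \<Longrightarrow> Xact q M (Suc m) x = smul M a x"
    and a_nonzero: "a \<noteq> 0"
begin

primrec chain :: "nat \<Rightarrow> 'v \<Rightarrow> 'v" where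
  "chain 0 v = v"
| "chain (Suc k) v = Tact M (m - k) (chain k v)"

definition generated :: "'v set" where
  "generated = vs.span {chain k x |k x. k \<le> m \<and> x \<in> N}"

lemma chain_lin: "k \<le> m \<Longrightarrow> lin_map M M (chain k)"
proof (induction k)
  case 0
  then show ?case by (simp add: lin_map_def)
next
  case (Suc k)
  then show ?case
    using lin_map_comp[of M M "chain k" M "Tact M (m - k)"] Tact_lin[of "m - k"] by simp
qed

lemmas chain_linear = lin_mapD[OF chain_lin]

lemma N_sub: "vs.subspace N"
  and N_Tact: "1 \<le> i \<Longrightarrow> i < m \<Longrightarrow> v \<in> N \<Longrightarrow> Tact M i v \<in> N"
proof -
  have "hecke_rep M q m" using hecke_rep_rank_le[OF hecke_rep_axioms, of m] by simp
  then interpret R: hecke_rep M q m .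
  show "vs.subspace N" by (rule R.submoduleD(1)[OF N_module])
  show "1 \<le> i \<Longrightarrow> i < m \<Longrightarrow> v \<in> N \<Longrightarrow> Tact M i v \<in> N" by (rule R.submoduleD(2)[OF N_module])
qed

lemma N_Xact:
  assumes "1 \<le> m" "v \<in> N"
  shows "Xact q M m v \<in> N" and "\<exists>u\<in>N. Xact q M m u = v"
proof -
  have "hecke_rep M q m" using hecke_rep_rank_le[OF hecke_rep_axioms, of m] by simp
  then interpret R: hecke_rep M q m .
  show "Xact q M m v \<in> N"
    unfolding Xact_def by (intro vs.subspace_scale N_sub R.submoduleD(3)[OF N_module]) (use assms in auto)
  have "smul M (q powi (int m - 1)) v \<in> N" by (intro vs.subspace_scale N_sub assms)
  then obtain u where u: "u \<in> N" "xact M m u = smul M (q powi (int m - 1)) v"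
    using R.submoduleD(4)[OF N_module] assms by blast
  have "Xact q M m u = v" unfolding Xact_def u using q_nonzero by (simp flip: power_int_add)
  then show "\<exists>u\<in>N. Xact q M m u = v" using u by blast
qed

lemma Tact_chain_low:
  "k \<le> m \<Longrightarrow> 1 \<le> i \<Longrightarrow> i < m - k \<Longrightarrow> v \<in> vspace M \<Longrightarrow> Tact M i (chain k v) = chain k (Tact M i v)"
proof (induction k)
  case (Suc k)
  have "Tact M i (Tact M (m - k) (chain k v)) = Tact M (m - k) (Tact M i (chain k v))"
    by (rule Tact_Tact_far) (use Suc.prems chain_linear(1)[of k] in auto)
  then show ?case using Suc by simp
qed simp

text \<open>By the braid relation, a generator that occurs in the chain, other than its first factor,
  passes through it with its index lowered by one.\<close>

lemma Tact_chain_high: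
  "k \<le> m \<Longrightarrow> Suc m < i + k \<Longrightarrow> i \<le> m \<Longrightarrow> v \<in> vspace M \<Longrightarrow> Tact M i (chain k v) = chain k (Tact M (i - 1) v)"
proof (induction k)
  case (Suc k)
  show ?case
  proof (cases "i = Suc (m - k)")
    case True
    then obtain k' where k': "k = Suc k'" using Suc.prems by (cases k) auto
    have i: "m - k' = i" "m - k = i - 1" and i1: "1 \<le> i - 1" "Suc (i - 1) = i" using True k' Suc.prems by auto
    have w: "chain k' v \<in> vspace M" using chain_linear(1)[of k'] k' Suc.prems by auto
    have "Tact M i (chain (Suc k) v) = Tact M i (Tact M (i - 1) (Tact M i (chain k' v)))"
      using i k' by simp
    also have "\<dots> = Tact M (i - 1) (Tact M i (Tact M (i - 1) (chain k' v)))"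
      using Tact_braid[OF w i1(1)] i1 Suc.prems by simp
    also have "Tact M (i - 1) (chain k' v) = chain k' (Tact M (i - 1) v)"
      by (rule Tact_chain_low) (use Suc.prems k' i i1 in auto)
    finally show ?thesis using i k' by simp
  next
    case False
    have "Tact M (m - k) (Tact M i (chain k v)) = Tact M i (Tact M (m - k) (chain k v))"
      by (rule Tact_Tact_far) (use Suc.prems False chain_linear(1)[of k] in auto)
    then show ?thesis using Suc False by simp
  qed
qed simp

text \<open>Of the factors of the chain only \<open>T_m\<close> fails to commute with \<open>X_(m+1)\<close>. The correction in
  the Bernstein relation lies in \<open>N\<close>, and the other factors have indices less than \<open>m\<close> and
  preserve \<open>N\<close>.\<close>

lemma Xact_chain:
  assumes "1 \<le> k" "k \<le> m" "x \<in> N"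
  shows "\<exists>y\<in>N. Xact q M (Suc m) (chain k x) = chain k (Xact q M m x) + y"
  using assms(1,2)
proof (induction k rule: nat_induct_at_least)
  case base
  then have "Xact q M (Suc m) (chain 1 x) = chain 1 (Xact q M m x) + smul M (q - 1) (smul M a x)"
    using Xact_Tact[of m x] assms(3) N_subset N_scalar by auto
  moreover have "smul M (q - 1) (smul M a x) \<in> N"
    using assms(3) N_sub vs.subspace_scale by blast
  ultimately show ?case by blast
next
  case (Suc k)
  then obtain y where y: "y \<in> N" "Xact q M (Suc m) (chain k x) = chain k (Xact q M m x) + y" by auto
  have x: "x \<in> vspace M" "y \<in> vspace M" "Xact q M m x \<in> vspace M"
    using assms(3) y N_subset N_Xact(1)[of x] Suc by auto
  have mk: "1 \<le> m - k" "m - k < Suc m" "m - k < m" using Suc by auto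
  have "Xact q M (Suc m) (chain (Suc k) x) = Tact M (m - k) (Xact q M (Suc m) (chain k x))"
    using Tact_Xact_far[of "m - k" "Suc m" "chain k x"] mk chain_linear(1)[of k x] x Suc by auto
  also have "\<dots> = chain (Suc k) (Xact q M m x) + Tact M (m - k) y"
    using y x chain_linear(1)[of k] Suc Tact_linear(1)[OF mk(1,2)] by simp
  finally show ?case using N_Tact[OF mk(1,3) y(1)] by blast
qed

lemma generated_sub: "vs.subspace generated" and generated_subset: "generated \<subseteq> vspace M"
  and N_generated: "N \<subseteq> generated"
proof -
  show "vs.subspace generated" unfolding generated_def by (rule vs.subspace_span)
  show "generated \<subseteq> vspace M"
    unfolding generated_def using chain_linear(1) N_subset
    by (intro vs.span_minimal subspace_vspace) auto
  have "N \<subseteq> {chain k x |k x. k \<le> m \<and> x \<in> N}" using chain.simps(1) by force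
  then show "N \<subseteq> generated" unfolding generated_def using vs.span_superset by blast
qed

lemma chain_generated: "k \<le> m \<Longrightarrow> x \<in> N \<Longrightarrow> chain k x \<in> generated"
  unfolding generated_def by (rule vs.span_base) auto

lemma generated_map:
  assumes "lin_map M M f" "vs.subspace W" "\<And>k x. k \<le> m \<Longrightarrow> x \<in> N \<Longrightarrow> f (chain k x) \<in> W" "v \<in> generated"
  shows "f v \<in> W"
  by (rule lin_map_span_subset[OF vspace_rep_axioms vspace_rep_axioms assms(1) _ assms(2) _ assms(4)[unfolded generated_def]])
    (use assms(3) chain_linear(1) N_subset in auto)

lemma generated_module: "aff_hecke_module q (Suc m) (restrict_rep M generated)"
proof (rule submoduleI_last[OF generated_sub generated_subset])
  fix i v assume i: "1 \<le> i" "i < Suc m" and v: "v \<in> generated"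
  show "Tact M i v \<in> generated"
  proof (rule generated_map[OF Tact_lin[OF i] generated_sub _ v])
    fix k x assume k: "k \<le> m" and x: "x \<in> N"
    then have xV: "x \<in> vspace M" using N_subset by auto
    \<comment> \<open>In these cases \<open>T_i\<close> commutes with the chain, makes it longer, meets its own square, or
      passes through the chain with its index lowered.\<close>
    consider "i < m - k" | "i = m - k" | "i = Suc (m - k)" | "Suc m < i + k" by linarith
    then show "Tact M i (chain k x) \<in> generated"
    proof cases
      case 1
      then show ?thesis
        using Tact_chain_low[OF k i(1) 1 xV] chain_generated[OF k N_Tact[OF i(1) _ x]] by simp
    next
      case 2
      then have "Tact M i (chain k x) = chain (Suc k) x" by simp
      then show ?thesis using chain_generated[of "Suc k" x] x 2 i by simp
    next
      case 3
      then obtain k' where k': "k = Suc k'" using i by (cases k) auto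
      then have "chain k x = Tact M i (chain k' x)" using 3 k by (simp add: Suc_diff_Suc)
      then have "Tact M i (chain k x) = smul M (q - 1) (chain k x) + smul M q (chain k' x)"
        using Tact_quadratic[OF i, of "chain k' x"] chain_linear(1)[of k' x] k k' xV by simp
      moreover have "chain k x \<in> generated" "chain k' x \<in> generated"
        using chain_generated[OF k x] chain_generated[of k' x] k k' x by (simp_all del: chain.simps)
      ultimately show ?thesis
        using generated_sub by (simp add: vs.subspace_add vs.subspace_scale)
    next
      case 4
      then show ?thesis
        using Tact_chain_high[OF k 4 _ xV] chain_generated[OF k N_Tact[of "i - 1" x]] i x k by simp
    qed
  qed
next
  have X: "Xact q M (Suc m) v \<in> generated" if "v \<in> generated" for v
  proof (rule generated_map[OF Xact_lin generated_sub _ that])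
    fix k x assume k: "k \<le> m" and x: "x \<in> N"
    show "Xact q M (Suc m) (chain k x) \<in> generated"
    proof (cases "k = 0")
      case True
      then show ?thesis
        using x N_scalar N_generated generated_sub by (auto intro!: vs.subspace_scale)
    next
      case False
      then obtain y where "y \<in> N" "Xact q M (Suc m) (chain k x) = chain k (Xact q M m x) + y"
        using Xact_chain[of k x] k x by auto
      then show ?thesis
        using chain_generated[OF k N_Xact(1)] False k x N_generated generated_sub by (auto intro!: vs.subspace_add)
    qed
  qed auto
  \<comment> \<open>The image of \<open>X_(m+1)\<close> contains \<open>N\<close>, where \<open>X_(m+1)\<close> is the nonzero scalar \<open>a\<close>; modulo \<open>N\<close>,
    it then contains every \<open>chain k N\<close> because \<open>X_m\<close> maps \<open>N\<close> onto \<open>N\<close>.\<close>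
  let ?c = "q powi (int (Suc m) - 1)"
  fix v assume v: "v \<in> generated"
  show "xact M (Suc m) v \<in> generated"
    unfolding xact_Xact using X[OF v] generated_sub by (intro vs.subspace_scale)
  let ?I = "Xact q M (Suc m) ` generated"
  have lin: "lin_map M M (Xact q M (Suc m))" by (rule Xact_lin) auto
  note Xl = lin_mapD[OF lin]
  have gV: "u \<in> vspace M" if "u \<in> generated" for u using that generated_subset by blast
  have "vs.subspace ?I"
  proof (rule vs.subspaceI)
    show "0 \<in> ?I"
      using lin_map_minus(2)[OF vspace_rep_axioms vspace_rep_axioms lin in_vspace(1) in_vspace(1)]
        vs.subspace_0[OF generated_sub] by force
    show "x + y \<in> ?I" if xy: "x \<in> ?I" "y \<in> ?I" for x y
    proof -
      obtain u w where "u \<in> generated" "w \<in> generated" "x = Xact q M (Suc m) u" "y = Xact q M (Suc m) w"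
        using xy by blast
      then have "x + y = Xact q M (Suc m) (u + w)" "u + w \<in> generated"
        using Xl(2) gV vs.subspace_add[OF generated_sub] by auto
      then show ?thesis by blast
    qed
    show "smul M c x \<in> ?I" if x: "x \<in> ?I" for c x
    proof -
      obtain u where "u \<in> generated" "x = Xact q M (Suc m) u"
        using x by blast
      then have "smul M c x = Xact q M (Suc m) (smul M c u)" "smul M c u \<in> generated"
        using Xl(3) gV vs.subspace_scale[OF generated_sub] by auto
      then show ?thesis by blast
    qed
  qed
  moreover have "chain k x \<in> ?I" if k: "k \<le> m" and x: "x \<in> N" for k x
  proof -
    have N_I: "\<exists>u\<in>generated. Xact q M (Suc m) u = y" if "y \<in> N" for y
    proof
      show "smul M (inverse a) y \<in> generated"
        using that N_generated generated_sub by (auto intro!: vs.subspace_scale)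
      show "Xact q M (Suc m) (smul M (inverse a) y) = y"
        using that N_subset N_scalar a_nonzero by (subst Xl(3)) auto
    qed
    show ?thesis
    proof (cases "k = 0")
      case True
      then show ?thesis using N_I[OF x] by auto
    next
      case False
      then obtain x' where x': "x' \<in> N" "Xact q M m x' = x" using N_Xact(2)[of x] k x by auto
      obtain y where y: "y \<in> N" "Xact q M (Suc m) (chain k x') = chain k x + y"
        using Xact_chain[of k x'] k x' False by auto
      obtain u where u: "u \<in> generated" "Xact q M (Suc m) u = y" using N_I[OF y(1)] by blast
      have c: "chain k x' \<in> generated" by (rule chain_generated[OF k x'(1)])
      have "Xact q M (Suc m) (chain k x' - u) = chain k x"
        using lin_map_minus(1)[OF vspace_rep_axioms vspace_rep_axioms lin gV[OF c] gV[OF u(1)]] y u by simp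
      then show ?thesis
        using vs.subspace_diff[OF generated_sub c u(1)] by (metis imageI)
    qed
  qed
  ultimately have "generated \<subseteq> ?I"
    unfolding generated_def by (intro vs.span_minimal) (auto simp flip: generated_def)
  moreover have "smul M (inverse ?c) v \<in> generated" using v generated_sub by (intro vs.subspace_scale)
  ultimately have "smul M (inverse ?c) v \<in> ?I" by (rule subsetD)
  then obtain u where u: "smul M (inverse ?c) v = Xact q M (Suc m) u" "u \<in> generated" by (rule imageE)
  have "xact M (Suc m) u = v" unfolding xact_Xact u(1)[symmetric] using q_nonzero by simp
  then show "\<exists>u\<in>generated. xact M (Suc m) u = v" using u by blast
qed

text \<open>On \<open>T_(m-k+1) \<dots> T_m N\<close> with \<open>k > 0\<close> the operator \<open>X_(m+1)\<close> acts modulo \<open>N\<close> as \<open>X_m\<close> acts on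
  \<open>N\<close>. So if \<open>a\<close> is not an eigenvalue of \<open>X_m\<close> on \<open>N\<close>, nothing outside \<open>N\<close> is an eigenvector
  for \<open>a\<close>.\<close>

lemma eigenvector_in_N:
  assumes kill: "\<And>x. 1 \<le> m \<Longrightarrow> x \<in> N \<Longrightarrow> foldr (X_minus q M m) as x = 0"
    and "a \<notin> set as" "v \<in> generated" "Xact q M (Suc m) v = smul M a v"
  shows "v \<in> N"
proof (cases "m = 0")
  case True
  then have "k \<le> m \<longleftrightarrow> k = 0" for k by simp
  then have "{chain k x |k x. k \<le> m \<and> x \<in> N} = N" by simp
  then have "generated = N"
    unfolding generated_def using vs.span_eq_iff N_sub by simp
  then show ?thesis using assms(3) by simp
next
  case m: False
  let ?P = "foldr (X_minus q M (Suc m))" and ?Q = "foldr (X_minus q M m)"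
  have NX: "X_minus q M (Suc m) b x \<in> N" if "x \<in> N" for b x
    using that N_scalar[OF that] N_sub by (simp add: X_minus_def vs.subspace_diff vs.subspace_scale)
  have NX': "X_minus q M m b x \<in> N" if "x \<in> N" for b x
    using that N_Xact(1)[of x] m N_sub by (simp add: X_minus_def vs.subspace_diff vs.subspace_scale)
  have PN: "?P bs x \<in> N" and QN: "?Q bs x \<in> N" if "x \<in> N" for bs x
    using that NX NX' by (induction bs) auto
  have Plin: "lin_map M M (?P bs)" for bs
  proof (induction bs)
    case Nil
    then show ?case by (simp add: lin_map_def)
  next
    case (Cons b bs)
    then show ?case using lin_map_comp[OF Cons X_minus_lin[of "Suc m" b]] by (simp add: comp_def)
  qed
  have step: "\<exists>y\<in>N. ?P bs (chain k x) = chain k (?Q bs x) + y" if k: "1 \<le> k" "k \<le> m" "x \<in> N" for bs k x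
  proof (induction bs)
    case Nil
    then show ?case using vs.subspace_0[OF N_sub] by force
  next
    case (Cons b bs)
    then obtain y where y: "y \<in> N" "?P bs (chain k x) = chain k (?Q bs x) + y" by blast
    let ?z = "?Q bs x"
    have z: "?z \<in> N" by (rule QN[OF k(3)])
    obtain y' where y': "y' \<in> N" "Xact q M (Suc m) (chain k ?z) = chain k (Xact q M m ?z) + y'"
      using Xact_chain[OF k(1,2) z] by blast
    have V: "y \<in> vspace M" "?z \<in> vspace M" "Xact q M m ?z \<in> vspace M" "chain k ?z \<in> vspace M"
      using y z N_subset N_Xact(1)[OF _ z] m chain_linear(1)[OF k(2)] by auto
    have ch: "chain k (X_minus q M m b ?z) = chain k (Xact q M m ?z) - smul M b (chain k ?z)"
      using lin_map_minus(1)[OF vspace_rep_axioms vspace_rep_axioms chain_lin[OF k(2)] V(3) in_vspace(4)[OF V(2)]]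
        chain_linear(3)[OF k(2) V(2)] by (simp add: X_minus_def)
    have "X_minus q M (Suc m) b (chain k ?z + y) = X_minus q M (Suc m) b (chain k ?z) + X_minus q M (Suc m) b y"
      by (rule lin_mapD(2)[OF X_minus_lin]) (use V in auto)
    also have "X_minus q M (Suc m) b (chain k ?z) = chain k (X_minus q M m b ?z) + y'"
      unfolding ch by (simp add: X_minus_def y')
    finally have "?P (b # bs) (chain k x) = chain k (?Q (b # bs) x) + (y' + X_minus q M (Suc m) b y)"
      by (simp add: y algebra_simps)
    moreover have "y' + X_minus q M (Suc m) b y \<in> N"
      using y' NX[OF y(1)] N_sub vs.subspace_add by blast
    ultimately show ?case by blast
  qed
  have "?P as v \<in> N"
  proof (rule generated_map[OF Plin N_sub _ assms(3)])
    fix k x assume k: "k \<le> m" "x \<in> N"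
    show "?P as (chain k x) \<in> N"
    proof (cases "k = 0")
      case True
      then show ?thesis using PN[OF k(2)] by simp
    next
      case False
      have "chain k 0 = 0"
        using lin_map_minus(2)[OF vspace_rep_axioms vspace_rep_axioms chain_lin[OF k(1)] in_vspace(1) in_vspace(1)] .
      then show ?thesis
        using step[of k x as] kill[OF _ k(2)] k False m by auto
    qed
  qed
  moreover have "?P bs v = smul M (prod_list (map (\<lambda>b. a - b) bs)) v" for bs
  proof (induction bs)
    case (Cons b bs)
    have "v \<in> vspace M" using assms(3) generated_subset by blast
    then have "Xact q M (Suc m) (smul M c v) = smul M (c * a) v" for c
      using Xact_linear(2)[of "Suc m" v c] assms(4) by simp
    then show ?case using Cons
      by (simp add: X_minus_def flip: vs.scale_left_diff_distrib) (simp add: algebra_simps)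
  qed simp
  ultimately have Pv: "smul M (prod_list (map (\<lambda>b. a - b) as)) v \<in> N" (is "smul M ?p v \<in> N")
    by simp
  have "?p \<noteq> 0" using assms(2) by (auto simp: prod_list_zero_iff)
  then have "v = smul M (inverse ?p) (smul M ?p v)" by simp
  also have "\<dots> \<in> N" by (rule vs.subspace_scale[OF N_sub Pv])
  finally show ?thesis .
qed

end

text \<open>In the product of \<open>L\<close> and \<open>M\<close>, the diagonal copy of \<open>A\<close> generates the graph of an
  isomorphism. The graph projects onto both factors because these are simple. If the kernel of a
  projection were not zero, it would by simplicity be the whole of the other factor, and contain
  an eigenvector \<open>(f v0, 0)\<close> or \<open>(0, g v0)\<close> of \<open>X_(m+1)\<close> for \<open>a\<close>; but such eigenvectors lie in the
  diagonal copy of \<open>A\<close>, since \<open>a\<close> is not an eigenvalue of \<open>X_m\<close> there.\<close>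

lemma simple_modules_isomorphic:
  fixes A :: "('a::ab_group_add) brep" and M :: "('v::ab_group_add) brep" and L :: "('w::ab_group_add) brep"
  assumes "hecke_rep A q m" "simple_module q (Suc m) M" "simple_module q (Suc m) L"
    and f: "hecke_hom m A L f" "\<And>v. v \<in> vspace A \<Longrightarrow> Xact q L (Suc m) (f v) = smul L a (f v)"
    and g: "hecke_hom m A M g" "\<And>v. v \<in> vspace A \<Longrightarrow> Xact q M (Suc m) (g v) = smul M a (g v)"
    and inj: "\<And>v. v \<in> vspace A \<Longrightarrow> f v = 0 \<Longrightarrow> v = 0"
    and v0: "v0 \<in> vspace A" "g v0 \<noteq> 0"
    and "a \<noteq> 0" "q \<noteq> 0"
    and kill: "\<And>x. 1 \<le> m \<Longrightarrow> x \<in> vspace A \<Longrightarrow> foldr (X_minus q A m) as x = 0" and "a \<notin> set as"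
  shows "\<exists>\<phi>. hecke_iso (Suc m) L M \<phi>"
proof -
  let ?P = "prod_rep L M" and ?h = "\<lambda>v. (f v, g v)"
  let ?N = "?h ` vspace A"
  interpret A: hecke_rep A q m by fact
  interpret M: hecke_rep M q "Suc m" using assms(2) \<open>q \<noteq> 0\<close> hecke_repI unfolding simple_module_def by blast
  interpret L: hecke_rep L q "Suc m" using assms(3) \<open>q \<noteq> 0\<close> hecke_repI unfolding simple_module_def by blast
  have P: "hecke_rep ?P q (Suc m)" by (rule hecke_rep_prod[OF L.hecke_rep_axioms M.hecke_rep_axioms])
  have Pm: "hecke_rep ?P q m" using hecke_rep_rank_le[OF P, of m] by simp
  have h: "hecke_hom m A ?P ?h" by (rule hecke_hom_pair[OF f(1) g(1)])
  have Xh: "Xact q ?P (Suc m) (?h v) = smul ?P a (?h v)" if "v \<in> vspace A" for v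
    using f(2)[OF that] g(2)[OF that] by (simp add: Xact_def)
  interpret I: induced_submodule ?P q m ?N a
  proof (intro induced_submodule.intro induced_submodule_axioms.intro P)
    show "aff_hecke_module q m (restrict_rep ?P ?N)" by (rule hecke_hom_image[OF A.hecke_rep_axioms Pm h])
    show "?N \<subseteq> vspace ?P" using lin_mapD(1)[OF hecke_homD(1)[OF h]] by blast
  qed (use Xh \<open>a \<noteq> 0\<close> in auto)
  define U where "U = I.generated"
  let ?U = "restrict_rep ?P U"
  have h0: "?h 0 = 0"
    using lin_map_minus(2)[OF A.vspace_rep_axioms I.vspace_rep_axioms hecke_homD(1)[OF h]] v0(1) by blast
  have in_N: "x \<in> ?N" if "x \<in> U" "Xact q ?P (Suc m) x = smul ?P a x" for x
  proof (rule I.eigenvector_in_N[where as = as])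
    show "foldr (X_minus q ?P m) as x = 0" if "1 \<le> m" and x: "x \<in> ?N" for x
    proof -
      obtain v where v: "v \<in> vspace A" "x = ?h v" using x by blast
      have "foldr (X_minus q A m) bs v \<in> vspace A \<and>
        ?h (foldr (X_minus q A m) bs v) = foldr (X_minus q ?P m) bs (?h v)" for bs
      proof (induction bs)
        case (Cons b bs)
        then show ?case
          using A.X_minus_in[OF \<open>1 \<le> m\<close> order_refl] hecke_hom_X_minus[OF A.hecke_rep_axioms Pm h \<open>1 \<le> m\<close> order_refl]
          by (simp del: prod.inject)
      qed (use v in auto)
      then show ?thesis using kill[OF \<open>1 \<le> m\<close> v(1)] v(2) h0 by metis
    qed
  qed (use assms that U_def in auto)
  have Umod: "hecke_rep ?U q (Suc m)"
    unfolding U_def by (rule hecke_rep_restrict[OF P I.generated_module])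
  interpret U: hecke_rep ?U q "Suc m" by (rule Umod)
  have UP: "U \<subseteq> vspace ?P" unfolding U_def by (rule I.generated_subset)
  have NU: "?N \<subseteq> U" unfolding U_def by (rule I.N_generated)
  have vU: "vspace ?U = U" by (simp add: restrict_rep_def)
  have fst: "hecke_hom (Suc m) ?U L fst" and snd: "hecke_hom (Suc m) ?U M snd"
    by (intro hecke_hom_restrict hecke_hom_proj UP)+
  have simpleL: "W = {0} \<or> W = vspace L" if "W \<subseteq> vspace L" "aff_hecke_module q (Suc m) (restrict_rep L W)" for W
    using assms(3) that unfolding simple_module_def by blast
  have simpleM: "W = {0} \<or> W = vspace M" if "W \<subseteq> vspace M" "aff_hecke_module q (Suc m) (restrict_rep M W)" for W
    using assms(2) that unfolding simple_module_def by blast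
  have fv0: "f v0 \<in> vspace L" "g v0 \<in> vspace M" "?h v0 \<in> U"
    using lin_mapD(1)[OF hecke_homD(1)[OF f(1)] v0(1)] lin_mapD(1)[OF hecke_homD(1)[OF g(1)] v0(1)] v0(1) NU by auto
  have Lz: "f 0 = 0" "g 0 = 0" using h0 by (auto simp: zero_prod_def)
  have fnz: "f v0 \<noteq> 0" using inj[OF v0(1)] v0 Lz by auto

  have "fst ` U = vspace L"
  proof -
    have "fst ` U \<subseteq> vspace L" using UP by auto
    moreover have "aff_hecke_module q (Suc m) (restrict_rep L (fst ` U))"
      using hecke_hom_image[OF Umod L.hecke_rep_axioms fst] vU by simp
    ultimately show ?thesis using simpleL[of "fst ` U"] fv0(3) fnz by force
  qed
  moreover have "snd ` U = vspace M"
  proof -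
    have "snd ` U \<subseteq> vspace M" using UP by auto
    moreover have "aff_hecke_module q (Suc m) (restrict_rep M (snd ` U))"
      using hecke_hom_image[OF Umod M.hecke_rep_axioms snd] vU by simp
    ultimately show ?thesis using simpleM[of "snd ` U"] fv0(3) v0(2) by force
  qed
  moreover have ker_snd: "x = 0" if "x \<in> U" "snd x = 0" for x
  proof (rule ccontr)
    assume "x \<noteq> 0"
    let ?K = "{x \<in> U. snd x = 0}"
    have K: "hecke_rep (restrict_rep ?P ?K) q (Suc m)"
      using hecke_hom_kernel[OF Umod M.hecke_rep_axioms snd] hecke_repI \<open>q \<noteq> 0\<close> by (simp add: restrict_rep_def)
    have "?K \<subseteq> vspace ?P" using UP by auto
    then have "aff_hecke_module q (Suc m) (restrict_rep L (fst ` ?K))"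
      using hecke_hom_image[OF K L.hecke_rep_axioms hecke_hom_restrict[OF hecke_hom_proj(1)]]
      by (simp add: restrict_rep_def)
    moreover have "fst ` ?K \<subseteq> vspace L" using UP by auto
    moreover have "fst ` ?K \<noteq> {0}" using that \<open>x \<noteq> 0\<close> by (auto simp: prod_eq_iff)
    ultimately have "fst ` ?K = vspace L" using simpleL by blast
    then have "f v0 \<in> fst ` ?K" using fv0(1) by simp
    then obtain y where "f v0 = fst y" "y \<in> ?K" by (rule imageE)
    then have y: "(f v0, 0) \<in> U" by (cases y) simp
    have "Xact q ?P (Suc m) (f v0, 0) = smul ?P a (f v0, 0)"
      using f(2)[OF v0(1)] M.Xact_minus(2)[of "Suc m" 0 0] M.in_vspace(1) by (simp add: Xact_def)
    then obtain w where w: "w \<in> vspace A" "(f v0, 0) = ?h w" using in_N[OF y] by blast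
    have "f (w - v0) = 0"
      using lin_map_minus(1)[OF A.vspace_rep_axioms L.vspace_rep_axioms hecke_homD(1)[OF f(1)] w(1) v0(1)] w by simp
    then have "w = v0" using inj[of "w - v0"] A.in_vspace(3)[OF w(1) v0(1)] by simp
    then show False using w v0 by simp
  qed
  moreover have ker_fst: "x = 0" if "x \<in> U" "fst x = 0" for x
  proof (rule ccontr)
    assume "x \<noteq> 0"
    let ?K = "{x \<in> U. fst x = 0}"
    have K: "hecke_rep (restrict_rep ?P ?K) q (Suc m)"
      using hecke_hom_kernel[OF Umod L.hecke_rep_axioms fst] hecke_repI \<open>q \<noteq> 0\<close> by (simp add: restrict_rep_def)
    have "?K \<subseteq> vspace ?P" using UP by auto
    then have "aff_hecke_module q (Suc m) (restrict_rep M (snd ` ?K))"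
      using hecke_hom_image[OF K M.hecke_rep_axioms hecke_hom_restrict[OF hecke_hom_proj(2)]]
      by (simp add: restrict_rep_def)
    moreover have "snd ` ?K \<subseteq> vspace M" using UP by auto
    moreover have "snd ` ?K \<noteq> {0}" using that \<open>x \<noteq> 0\<close> by (auto simp: prod_eq_iff)
    ultimately have "snd ` ?K = vspace M" using simpleM by blast
    then have "g v0 \<in> snd ` ?K" using fv0(2) by simp
    then obtain y where "g v0 = snd y" "y \<in> ?K" by (rule imageE)
    then have y: "(0, g v0) \<in> U" by (cases y) simp
    have "Xact q ?P (Suc m) (0, g v0) = smul ?P a (0, g v0)"
      using g(2)[OF v0(1)] L.Xact_minus(2)[of "Suc m" 0 0] L.in_vspace(1) by (simp add: Xact_def)
    then obtain w where w: "w \<in> vspace A" "(0, g v0) = ?h w" using in_N[OF y] by blast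
    then have "w = 0" using inj by simp
    then show False using w v0 Lz by simp
  qed
  moreover have injU: "inj_on f' U" if "hecke_hom (Suc m) ?U (B :: ('b::ab_group_add) brep) f'" "vspace_rep B" "\<And>x. x \<in> U \<Longrightarrow> f' x = 0 \<Longrightarrow> x = 0" for f' B
  proof (rule inj_onI)
    fix x y assume xy: "x \<in> U" "y \<in> U" "f' x = f' y"
    have "f' (x - y) = 0"
      using lin_map_minus(1)[OF U.vspace_rep_axioms that(2) hecke_homD(1)[OF that(1)], of x y] xy vU by simp
    then show "x = y" using that(3)[of "x - y"] U.in_vspace(3)[of x y] xy vU by simp
  qed
  ultimately have "hecke_iso (Suc m) ?U L fst" "hecke_iso (Suc m) ?U M snd"
    unfolding hecke_iso_def bij_betw_def vU
    using fst snd injU[OF fst L.vspace_rep_axioms] injU[OF snd M.vspace_rep_axioms] by auto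
  then show ?thesis
    using hecke_iso_comp[OF hecke_iso_inv[OF Umod]] by blast
qed

section \<open>Distances between roots of unity\<close>

definition adjacent :: "nat \<Rightarrow> int \<Rightarrow> int \<Rightarrow> bool" where
  "adjacent e a b \<longleftrightarrow> a mod int e = (b + 1) mod int e \<or> b mod int e = (a + 1) mod int e"

lemma adjacent_sym: "adjacent e a b \<longleftrightarrow> adjacent e b a"
  unfolding adjacent_def by auto

locale root_of_unity =
  fixes e :: nat and q :: complex
  assumes e_gt1: "e > 1" and q_def: "q = exp (2 * of_real pi * \<i> / of_nat e)"
begin

lemma q_nz: "q \<noteq> 0"
  by (simp add: q_def)

lemma q_powi: "q powi a = exp (\<i> * of_real (2 * pi * of_int a / real e))"
proof -
  have "q powi a = exp (of_int a * (2 * of_real pi * \<i> / of_nat e))"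
    unfolding q_def by (simp add: exp_power_int)
  then show ?thesis by (simp add: algebra_simps)
qed

lemma norm_q_powi [simp]: "cmod (q powi a) = 1"
  by (simp add: q_powi)

lemma q_powi_e: "q powi (int e * a) = 1"
proof -
  have "q powi (int e * a) = exp (2 * of_int a * of_real pi * \<i>)"
    unfolding q_powi using e_gt1 by (simp add: algebra_simps)
  then show ?thesis using exp_integer_2pi[of "of_int a"] by simp
qed

lemma q_powi_mod: "q powi (a mod int e) = q powi a"
proof -
  have "q powi a = q powi (a mod int e) * q powi (int e * (a div int e))"
    using q_nz by (metis mod_mult_div_eq power_int_add)
  then show ?thesis by (simp add: q_powi_e)
qed

lemma q_powi_diff: "q powi a - q powi b = q powi b * (q powi (a - b) - 1)"
  using q_nz by (simp add: algebra_simps flip: power_int_add)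

lemma norm_q_powi_diff: "cmod (q powi a - q powi b) = 2 * \<bar>sin (pi * of_int ((a - b) mod int e) / real e)\<bar>"
proof -
  have "cmod (q powi a - q powi b) = cmod (q powi ((a - b) mod int e) - 1)"
    unfolding q_powi_diff by (simp add: norm_mult q_powi_mod)
  also have "\<dots> = 2 * \<bar>sin (pi * of_int ((a - b) mod int e) / real e)\<bar>"
    unfolding q_powi by (subst dist_exp_i_1) (simp add: algebra_simps)
  finally show ?thesis .
qed

lemma sin_pos: "0 < sin (pi / real e)"
  using e_gt1 by (intro sin_gt_zero) (auto simp: field_simps)

lemma norm_q_minus_1: "cmod (q - 1) = 2 * sin (pi / real e)"
  using norm_q_powi_diff[of 1 0] sin_pos e_gt1 by simp

text \<open>The sine increases up to \<open>\<pi> / 2\<close> and is symmetric about this point.\<close>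

lemma sin_ge:
  fixes t :: int
  assumes "1 \<le> t" "t \<le> int e - 1"
  shows "sin (pi / real e) \<le> sin (pi * of_int t / real e)"
    and "t \<noteq> 1 \<Longrightarrow> t \<noteq> int e - 1 \<Longrightarrow> sin (pi / real e) < sin (pi * of_int t / real e)"
proof -
  have e: "real e > 1" and pe: "pi / real e > 0" using e_gt1 by auto
  let ?x = "pi * of_int t / real e"
  have t: "1 \<le> real_of_int t" "real_of_int t \<le> real e - 1" using assms by linarith+
  have "pi * 1 \<le> pi * of_int t" "pi * of_int t \<le> pi * (real e - 1)"
    using t by (intro mult_left_mono; simp)+
  then have x: "pi / real e \<le> ?x" "?x \<le> pi - pi / real e"
    using e by (simp_all add: field_simps)
  have sym: "sin ?x = sin (pi - ?x)" by simp
  show "sin (pi / real e) \<le> sin ?x"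
  proof (cases "?x \<le> pi / 2")
    case True
    then show ?thesis using x pe by (intro sin_monotone_2pi_le) linarith+
  next
    case False
    then show ?thesis unfolding sym using x pe by (intro sin_monotone_2pi_le) linarith+
  qed
  show "sin (pi / real e) < sin ?x" if "t \<noteq> 1" "t \<noteq> int e - 1"
  proof -
    have "1 < real_of_int t" "real_of_int t < real e - 1" using assms that by linarith+
    then have "pi * 1 < pi * of_int t" "pi * of_int t < pi * (real e - 1)"
      by (intro mult_strict_left_mono; simp)+
    then have x: "pi / real e < ?x" "?x < pi - pi / real e"
      using e by (simp_all add: field_simps)
    show ?thesis
    proof (cases "?x \<le> pi / 2")
      case True
      then show ?thesis using x pe by (intro sin_monotone_2pi) linarith+
    next
      case False
      then show ?thesis unfolding sym using x pe by (intro sin_monotone_2pi) linarith+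
    qed
  qed
qed

lemma mod_diff_range:
  assumes "a mod int e \<noteq> b mod int e"
  shows "1 \<le> (a - b) mod int e" "(a - b) mod int e \<le> int e - 1"
proof -
  have "(a - b) mod int e \<noteq> 0" using assms by (simp add: mod_eq_dvd_iff mod_eq_0_iff_dvd)
  moreover have "0 \<le> (a - b) mod int e" "(a - b) mod int e < int e" using e_gt1 by auto
  ultimately show "1 \<le> (a - b) mod int e" "(a - b) mod int e \<le> int e - 1" by linarith+
qed

lemma adjacent_iff: "adjacent e a b \<longleftrightarrow> (a - b) mod int e = 1 \<or> (a - b) mod int e = int e - 1"
proof -
  have "a mod int e = (b + 1) mod int e \<longleftrightarrow> (a - b) mod int e = 1"
  proof -
    have "a mod int e = (b + 1) mod int e \<longleftrightarrow> (a - b) mod int e = 1 mod int e"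
      by (simp add: mod_eq_dvd_iff algebra_simps)
    then show ?thesis using e_gt1 by simp
  qed
  moreover have "b mod int e = (a + 1) mod int e \<longleftrightarrow> (a - b) mod int e = int e - 1"
  proof -
    have "b mod int e = (a + 1) mod int e \<longleftrightarrow> (a - b) mod int e = -1 mod int e"
      by (subst (3) eq_commute) (simp add: mod_eq_dvd_iff algebra_simps)
    then show ?thesis using e_gt1 by (simp add: zmod_minus1)
  qed
  ultimately show ?thesis unfolding adjacent_def by blast
qed

lemma q_powi_eq_iff: "q powi a = q powi b \<longleftrightarrow> a mod int e = b mod int e"
proof
  assume *: "q powi a = q powi b"
  show "a mod int e = b mod int e"
  proof (rule ccontr)
    assume "a mod int e \<noteq> b mod int e"
    then have "0 < sin (pi * of_int ((a - b) mod int e) / real e)"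
      using sin_ge(1)[OF mod_diff_range] sin_pos by fastforce
    then show False using * norm_q_powi_diff[of a b] by simp
  qed
qed (metis q_powi_mod)

text \<open>Neighbours are the closest among the \<open>e\<close>-th roots of unity, and \<open>q\<close> is a neighbour of \<open>1\<close>.
  Here the choice of the primitive root \<open>q\<close> matters; it is the source of unitarity.\<close>

lemma norm_diff_ge:
  assumes "a mod int e \<noteq> b mod int e"
  shows "cmod (q - 1) \<le> cmod (q powi b - q powi a)"
    and "cmod (q - 1) = cmod (q powi b - q powi a) \<longleftrightarrow> adjacent e a b"
proof -
  let ?t = "(a - b) mod int e"
  have ge: "sin (pi / real e) \<le> sin (pi * of_int ?t / real e)"
    by (rule sin_ge(1)[OF mod_diff_range[OF assms]])
  have eq: "cmod (q powi b - q powi a) = 2 * sin (pi * of_int ?t / real e)"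
    using norm_q_powi_diff[of a b] ge sin_pos by (simp add: norm_minus_commute)
  show "cmod (q - 1) \<le> cmod (q powi b - q powi a)"
    using ge unfolding eq norm_q_minus_1 by simp
  show "cmod (q - 1) = cmod (q powi b - q powi a) \<longleftrightarrow> adjacent e a b"
  proof
    assume "adjacent e a b"
    then have "?t = 1 \<or> ?t = int e - 1" by (simp add: adjacent_iff)
    moreover have "sin (pi * (real e - 1) / real e) = sin (pi / real e)"
      using sin_pi_minus[of "pi / real e"] e_gt1 by (simp add: field_simps)
    ultimately show "cmod (q - 1) = cmod (q powi b - q powi a)"
      unfolding eq norm_q_minus_1 using e_gt1 by (auto simp: of_nat_diff)
  next
    assume "cmod (q - 1) = cmod (q powi b - q powi a)"
    then have "\<not> sin (pi / real e) < sin (pi * of_int ?t / real e)"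
      unfolding eq norm_q_minus_1 by simp
    then show "adjacent e a b"
      using sin_ge(2)[OF mod_diff_range[OF assms]] by (auto simp: adjacent_iff)
  qed
qed

section \<open>The entries of the seminormal matrices\<close>

text \<open>The entries of the \<open>2 \<times> 2\<close> blocks of \<open>T_k\<close>. The diagonal entry is forced by the commutation
  with \<open>X_k\<close> and \<open>X_(k+1)\<close>; the square of the other one is forced by the quadratic relation, and the
  factor \<open>exp (i pi / e)\<close>, a square root of \<open>q\<close>, makes the block unitary.\<close>

definition diag_coeff :: "int \<Rightarrow> int \<Rightarrow> complex" where
  "diag_coeff a b = (q - 1) * q powi b / (q powi b - q powi a)"

definition off_coeff :: "int \<Rightarrow> int \<Rightarrow> complex" where
  "off_coeff a b =
     exp (\<i> * of_real (pi / real e)) * of_real (sqrt (1 - (cmod (q - 1) / cmod (q powi b - q powi a))\<^sup>2))"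

lemma off_coeff_sym: "off_coeff a b = off_coeff b a"
  unfolding off_coeff_def by (simp add: norm_minus_commute)

lemma cnj_q_powi: "cnj (q powi a) = inverse (q powi a)"
proof -
  have "q powi a * cnj (q powi a) = 1"
    using norm_q_powi[of a] complex_norm_square[of "q powi a"] by simp
  then show ?thesis by (simp add: inverse_unique)
qed

lemma off_coeff_eq_0_iff:
  assumes "a mod int e \<noteq> b mod int e"
  shows "off_coeff a b = 0 \<longleftrightarrow> adjacent e a b"
proof -
  have pos: "0 < cmod (q powi b - q powi a)"
    using assms q_powi_eq_iff[of b a] by auto
  have "off_coeff a b = 0 \<longleftrightarrow> (cmod (q - 1) / cmod (q powi b - q powi a))\<^sup>2 = 1\<^sup>2"
    unfolding off_coeff_def by auto
  also have "\<dots> \<longleftrightarrow> cmod (q - 1) / cmod (q powi b - q powi a) = 1"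
    by (subst power2_eq_iff_nonneg) auto
  also have "\<dots> \<longleftrightarrow> cmod (q - 1) = cmod (q powi b - q powi a)"
    using pos by (auto simp: field_simps)
  finally show ?thesis using norm_diff_ge(2)[OF assms] by simp
qed

context
  fixes a b :: int
  assumes ab: "a mod int e \<noteq> b mod int e"
begin

lemma qab: "q powi b - q powi a \<noteq> 0" "q powi a - q powi b \<noteq> 0" "q powi a \<noteq> 0" "q powi b \<noteq> 0"
  using ab q_powi_eq_iff[of a b] q_nz by auto

lemma diag_coeff_add: "diag_coeff a b + diag_coeff b a = q - 1"
proof -
  have "diag_coeff b a = - ((q - 1) * q powi a / (q powi b - q powi a))"
    unfolding diag_coeff_def using qab by (simp add: field_simps)
  then have "diag_coeff a b + diag_coeff b a = (q - 1) * (q powi b - q powi a) / (q powi b - q powi a)"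
    unfolding diag_coeff_def by (simp only: right_diff_distrib diff_divide_distrib) simp
  then show ?thesis using qab by simp
qed

lemma diag_coeff_weight: "q powi a * diag_coeff a b + q powi b * diag_coeff b a = 0"
proof -
  have "diag_coeff b a = - ((q - 1) * q powi a / (q powi b - q powi a))"
    unfolding diag_coeff_def using qab by (simp add: field_simps)
  then show ?thesis unfolding diag_coeff_def by simp
qed

lemma sqrt_q: "exp (\<i> * of_real (pi / real e)) * exp (\<i> * of_real (pi / real e)) = q"
  unfolding q_def by (simp add: algebra_simps flip: exp_add)

lemma off_coeff_square: "off_coeff a b * off_coeff a b = q + diag_coeff a b * diag_coeff b a"
proof -
  define A where "A = q powi a"
  define B where "B = q powi b"
  have nz: "B - A \<noteq> 0" "A - B \<noteq> 0" "A \<noteq> 0" "B \<noteq> 0" using qab unfolding A_def B_def by auto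
  have nB: "of_real ((cmod (B - A))\<^sup>2) = (B - A) * (1 / B - 1 / A)"
    unfolding complex_norm_square using cnj_q_powi[of a] cnj_q_powi[of b] by (simp add: A_def B_def divide_inverse)
  have nq: "of_real ((cmod (q - 1))\<^sup>2) = (q - 1) * (1 / q - 1)"
    unfolding complex_norm_square using cnj_q_powi[of 1] by (simp add: divide_inverse)
  have "(cmod (q - 1) / cmod (B - A))\<^sup>2 \<le> 1"
    using norm_diff_ge(1)[OF ab] nz by (intro power_le_one) (auto simp: A_def B_def)
  then have le: "0 \<le> 1 - (cmod (q - 1) / cmod (B - A))\<^sup>2" by (simp only: diff_ge_0_iff_ge)
  let ?s = "sqrt (1 - (cmod (q - 1) / cmod (B - A))\<^sup>2)"
  have "off_coeff a b * off_coeff a b =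
      (exp (\<i> * of_real (pi / real e)) * exp (\<i> * of_real (pi / real e))) * of_real (?s * ?s)"
    unfolding off_coeff_def A_def B_def by (simp only: of_real_mult mult_ac)
  also have "\<dots> = q * of_real (?s * ?s)" unfolding sqrt_q ..
  also have "\<dots> = q * of_real (1 - (cmod (q - 1))\<^sup>2 / (cmod (B - A))\<^sup>2)"
    by (simp only: real_sqrt_mult_self abs_of_nonneg[OF le]) (simp only: power_divide)
  also have "\<dots> = q * (1 - ((q - 1) * (1 / q - 1)) / ((B - A) * (1 / B - 1 / A)))"
    by (simp only: of_real_diff of_real_divide nq nB of_real_1)
  also have "\<dots> = q + ((q - 1) * B / (B - A)) * ((q - 1) * A / (A - B))"
  proof -
    have 1: "1 / B - 1 / A = (A - B) / (A * B)" "1 / q - 1 = (1 - q) / q"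
      using nz q_nz by (simp_all add: field_simps)
    show ?thesis unfolding 1 using nz q_nz by (simp add: divide_simps, (simp add: algebra_simps)?)
  qed
  finally show ?thesis by (simp add: diag_coeff_def A_def B_def)
qed

lemma coeff_norm: "(cmod (diag_coeff a b))\<^sup>2 + (cmod (off_coeff a b))\<^sup>2 = 1"
proof -
  let ?r = "cmod (q - 1) / cmod (q powi b - q powi a)"
  have "?r\<^sup>2 \<le> 1"
    using norm_diff_ge(1)[OF ab] qab by (intro power_le_one) auto
  then have le: "0 \<le> 1 - ?r\<^sup>2" by (simp only: diff_ge_0_iff_ge)
  have "cmod (diag_coeff a b) = ?r"
    unfolding diag_coeff_def by (simp add: norm_mult norm_divide)
  moreover have "(cmod (off_coeff a b))\<^sup>2 = 1 - ?r\<^sup>2"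
    unfolding off_coeff_def norm_mult norm_of_real power_mult_distrib power2_abs real_sqrt_pow2[OF le] by simp
  ultimately show ?thesis by simp
qed

lemma coeff_orthogonal: "diag_coeff a b * cnj (off_coeff a b) + off_coeff a b * cnj (diag_coeff b a) = 0"
proof -
  define r where "r = exp (\<i> * of_real (pi / real e))"
  define s where "s = sqrt (1 - (cmod (q - 1) / cmod (q powi b - q powi a))\<^sup>2)"
  define A where "A = q powi a"
  define B where "B = q powi b"
  have nz: "B - A \<noteq> 0" "A - B \<noteq> 0" "A \<noteq> 0" "B \<noteq> 0" using qab unfolding A_def B_def by auto
  have rr: "r * r = q" using sqrt_q unfolding r_def .
  have "cmod r = 1" unfolding r_def by (subst norm_exp_i_times) simp
  then have "r * cnj r = 1" using complex_norm_square[of r] by simp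
  then have r: "cnj r = 1 / r" "r \<noteq> 0" by (auto simp: inverse_unique divide_inverse)
  have off: "off_coeff a b = r * of_real s" unfolding off_coeff_def r_def s_def by simp
  have "cnj (diag_coeff b a) = (1 / q - 1) * (1 / A) / (1 / A - 1 / B)"
    unfolding diag_coeff_def using cnj_q_powi[of a] cnj_q_powi[of b] cnj_q_powi[of 1]
    by (simp add: A_def B_def divide_inverse)
  also have "\<dots> = - (q - 1) * B / (q * (B - A))"
  proof -
    have 1: "1 / A - 1 / B = (B - A) / (A * B)" "1 / q - 1 = (1 - q) / q"
      using nz q_nz by (simp_all add: field_simps)
    show ?thesis unfolding 1 using nz q_nz by (simp add: divide_simps, (simp add: algebra_simps)?)
  qed
  finally have c: "cnj (diag_coeff b a) = - (q - 1) * B / (q * (B - A))" .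
  have "diag_coeff a b * (1 / r) + r * cnj (diag_coeff b a) = (q - 1) * B / (B - A) * (1 / r - r / q)"
    unfolding c using nz q_nz r(2) by (simp add: diag_coeff_def A_def B_def divide_simps, (simp add: algebra_simps)?)
  also have "1 / r - r / q = 0" using r(2) unfolding rr[symmetric] by simp
  finally have "of_real s * (diag_coeff a b * (1 / r) + r * cnj (diag_coeff b a)) = 0" by simp
  then show ?thesis unfolding off by (simp add: r algebra_simps)
qed

end

lemma adjacent_two: "e = 2 \<Longrightarrow> a mod int e \<noteq> b mod int e \<Longrightarrow> adjacent e a b"
  unfolding adjacent_def by simp presburger

lemma diag_coeff_two:
  assumes "e = 2" "a mod int e \<noteq> b mod int e"
  shows "diag_coeff a b = -1"
proof -
  have "(a - b) mod 2 = 1" using assms by simp presburger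
  then have "q powi (a - b) = q powi 1" by (metis q_powi_mod assms(1) of_nat_numeral mod_mod_trivial)
  moreover have "q = -1" unfolding q_def assms(1) by simp
  ultimately have "q powi (a - b) = -1" by simp
  then have "q powi a = - (q powi b)" using q_nz power_int_add[of q "a - b" b] by simp
  then show ?thesis unfolding diag_coeff_def using \<open>q = -1\<close> q_nz by simp
qed

text \<open>Applied to a word with the letters \<open>a, b, c\<close>, both sides of the braid relation are
  combinations of the six words obtained by permuting these letters. The coefficients of the word
  itself and of its two images under a single exchange agree by these identities; the other three
  agree because complex multiplication is commutative.\<close>

lemma
  assumes ab: "a mod int e \<noteq> b mod int e" and bc: "b mod int e \<noteq> c mod int e" and ac: "a mod int e \<noteq> c mod int e"
  shows diag_coeff_braid1: "diag_coeff a b * diag_coeff b c + diag_coeff a c * diag_coeff b a = diag_coeff b c * diag_coeff a c"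
    and diag_coeff_braid2: "diag_coeff a b * diag_coeff a c = diag_coeff b c * diag_coeff a b + diag_coeff a c * diag_coeff c b"
    and diag_coeff_braid3: "diag_coeff a b * diag_coeff a b * diag_coeff b c + off_coeff a b * off_coeff a b * diag_coeff a c =
      diag_coeff b c * diag_coeff b c * diag_coeff a b + off_coeff b c * off_coeff b c * diag_coeff a c"
proof -
  let ?c = diag_coeff
  define A where "A = q powi a"
  define B where "B = q powi b"
  define C where "C = q powi c"
  have nz: "B - A \<noteq> 0" "C - B \<noteq> 0" "C - A \<noteq> 0"
    using qab[OF ab] qab[OF bc] qab[OF ac] unfolding A_def B_def C_def by auto
  have "?c a b * ?c b c + ?c a c * (q - 1 - ?c a b) = ?c b c * ?c a c"
  proof -
    define x where "x = B / (B - A)"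
    define y where "y = C / (C - B)"
    define z where "z = C / (C - A)"
    have xyz: "x * y + z * (1 - x) = y * z"
      unfolding x_def y_def z_def using nz by (simp add: divide_simps, (simp add: algebra_simps)?)
    have "?c a b = (q - 1) * x" "?c b c = (q - 1) * y" "?c a c = (q - 1) * z"
      by (simp_all add: diag_coeff_def x_def y_def z_def A_def B_def C_def)
    then show ?thesis using xyz by algebra
  qed
  moreover have ba: "?c b a = q - 1 - ?c a b" and cb: "?c c b = q - 1 - ?c b c"
    using diag_coeff_add[OF ab] diag_coeff_add[OF bc] by (simp_all add: algebra_simps)
  ultimately show 1: "?c a b * ?c b c + ?c a c * ?c b a = ?c b c * ?c a c"
    by simp
  show "?c a b * ?c a c = ?c b c * ?c a b + ?c a c * ?c c b"
    using 1 unfolding ba cb by (simp add: algebra_simps)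
  show "?c a b * ?c a b * ?c b c + off_coeff a b * off_coeff a b * ?c a c =
      ?c b c * ?c b c * ?c a b + off_coeff b c * off_coeff b c * ?c a c"
  proof -
    have *: "p * p * r + (q + p * (k - p)) * s - (r * r * p + (q + r * (k - r)) * s)
        = (p - r) * (p * r + s * (k - p) - r * s)" for p r s k :: complex
      by (simp add: algebra_simps)
    have "p * p * r + (q + p * (k - p)) * s = r * r * p + (q + r * (k - r)) * s"
      if "p * r + s * (k - p) = r * s" for p r s k :: complex
      using *[of p r k s] that by simp
    from this[OF 1[unfolded ba]] show ?thesis
      unfolding off_coeff_square[OF ab] off_coeff_square[OF bc] ba cb .
  qed
qed

end

section \<open>Seminormal modules on sets of residue words\<close>

definition swap_letters :: "nat \<Rightarrow> 'a list \<Rightarrow> 'a list" where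
  "swap_letters k w = w[k - 1 := w ! k, k := w ! (k - 1)]"

lemma length_swap_letters [simp]: "length (swap_letters k w) = length w"
  by (simp add: swap_letters_def)

lemma nth_swap_letters:
  assumes "1 \<le> k" "k < length w" "j < length w"
  shows "swap_letters k w ! j = (if j = k - 1 then w ! k else if j = k then w ! (k - 1) else w ! j)"
  using assms by (auto simp: swap_letters_def nth_list_update)

lemma swap_letters_twice [simp]:
  "1 \<le> k \<Longrightarrow> k < length w \<Longrightarrow> swap_letters k (swap_letters k w) = w"
  by (rule nth_equalityI) (auto simp: nth_swap_letters)

lemma swap_letters_far:
  "1 \<le> i \<Longrightarrow> Suc i < j \<Longrightarrow> j < length w \<Longrightarrow> swap_letters i (swap_letters j w) = swap_letters j (swap_letters i w)"
  by (rule nth_equalityI) (auto simp: nth_swap_letters)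

lemma swap_letters_braid:
  "1 \<le> i \<Longrightarrow> Suc i < length w \<Longrightarrow> swap_letters i (swap_letters (Suc i) (swap_letters i w)) =
     swap_letters (Suc i) (swap_letters i (swap_letters (Suc i) w))"
  by (rule nth_equalityI) (auto simp: nth_swap_letters)

text \<open>The words index a basis on which \<open>X_j\<close> acts by \<open>q\<close> to the power of the letter number \<open>j\<close>.
  Distinct neighbours are needed for the entries of \<open>T_k\<close> to be defined. The condition on second
  neighbours serves the braid relation, which for \<open>e = 2\<close> also holds at letters \<open>i, j, i\<close>, where
  both generators act by \<open>-1\<close>. Exchanging adjacent letters is excluded because the corresponding
  entry vanishes. The letters are taken from a fixed system of residues, so that a word is
  determined by the eigenvalues of the \<open>X_j\<close>; then connectedness makes the module simple.\<close>

locale word_set = root_of_unity +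
  fixes n :: nat and W :: "int list set"
  assumes finite_W: "finite W"
    and length_W: "w \<in> W \<Longrightarrow> length w = n"
    and letters_W: "w \<in> W \<Longrightarrow> set w \<subseteq> {0..<int e}"
    and neighbours_W: "w \<in> W \<Longrightarrow> 1 \<le> k \<Longrightarrow> k < n \<Longrightarrow> w ! (k - 1) \<noteq> w ! k"
    and second_neighbours_W: "w \<in> W \<Longrightarrow> e \<noteq> 2 \<Longrightarrow> 1 \<le> k \<Longrightarrow> Suc k < n \<Longrightarrow> w ! (k - 1) \<noteq> w ! Suc k"
    and swap_W: "w \<in> W \<Longrightarrow> 1 \<le> k \<Longrightarrow> k < n \<Longrightarrow> \<not> adjacent e (w ! (k - 1)) (w ! k) \<Longrightarrow> swap_letters k w \<in> W"
    and W_nonempty: "W \<noteq> {}"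
    and W_connected: "S \<subseteq> W \<Longrightarrow> S \<noteq> {} \<Longrightarrow>
      (\<And>w k. w \<in> S \<Longrightarrow> 1 \<le> k \<Longrightarrow> k < n \<Longrightarrow> \<not> adjacent e (w ! (k - 1)) (w ! k) \<Longrightarrow> swap_letters k w \<in> S) \<Longrightarrow> S = W"
begin

text \<open>The function \<open>f\<close> is the combination of basis vectors \<open>w\<close> with coefficients \<open>f w\<close>. The
  exchange of letters is an involution and \<open>off_coeff\<close> is symmetric, so that the coefficient of
  \<open>w\<close> in \<open>T_k f\<close> only involves \<open>w\<close> and the word after the exchange.\<close>

definition word_rep :: "(int list \<Rightarrow> complex) brep" where
  "word_rep =
    \<lparr>smul = (\<lambda>c f w. c * f w),
     vspace = {f. \<forall>w. w \<notin> W \<longrightarrow> f w = 0},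
     Tact = (\<lambda>k f w. if length w = n
       then diag_coeff (w ! (k - 1)) (w ! k) * f w + off_coeff (w ! (k - 1)) (w ! k) * f (swap_letters k w)
       else 0),
     xact = (\<lambda>j f w. q powi (int j - 1 + w ! (j - 1)) * f w)\<rparr>"

lemma word_rep_simps [simp]:
  "smul word_rep c f w = c * f w"
  "f \<in> vspace word_rep \<longleftrightarrow> (\<forall>w. w \<notin> W \<longrightarrow> f w = 0)"
  "xact word_rep j f w = q powi (int j - 1 + w ! (j - 1)) * f w"
  by (simp_all add: word_rep_def)

lemma Tact_word:
  "length w = n \<Longrightarrow> Tact word_rep k f w =
    diag_coeff (w ! (k - 1)) (w ! k) * f w + off_coeff (w ! (k - 1)) (w ! k) * f (swap_letters k w)"
  by (simp add: word_rep_def)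

lemma Tact_word_other: "length w \<noteq> n \<Longrightarrow> Tact word_rep k f w = 0"
  by (simp add: word_rep_def)

lemma neighbours_mod:
  assumes "w \<in> W" "1 \<le> k" "k < n"
  shows "w ! (k - 1) mod int e \<noteq> w ! k mod int e"
proof -
  have "w ! (k - 1) \<in> {0..<int e}" "w ! k \<in> {0..<int e}"
    using assms letters_W[OF assms(1)] length_W[OF assms(1)] nth_mem[of _ w] by (meson less_imp_diff_less subsetD)+
  then show ?thesis using neighbours_W[OF assms] by simp
qed

lemma second_neighbours_mod:
  assumes "w \<in> W" "1 \<le> k" "Suc k < n" "e \<noteq> 2"
  shows "w ! (k - 1) mod int e \<noteq> w ! Suc k mod int e"
proof -
  have "w ! (k - 1) \<in> {0..<int e}" "w ! Suc k \<in> {0..<int e}"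
    using assms letters_W[OF assms(1)] length_W[OF assms(1)] nth_mem[of _ w] by (meson less_imp_diff_less Suc_lessD subsetD)+
  then show ?thesis using second_neighbours_W[OF assms(1,4,2,3)] by simp
qed

text \<open>A nonzero entry belongs to letters that are not adjacent, and exchanging such letters does
  not lead out of \<open>W\<close>.\<close>

lemma off_coeff_swap_nonzero:
  assumes "1 \<le> k" "k < n" "swap_letters k w \<in> W" "off_coeff (w ! (k - 1)) (w ! k) \<noteq> 0"
  shows "w \<in> W"
proof -
  have len: "length w = n" using length_W[OF assms(3)] by simp
  let ?v = "swap_letters k w"
  have v: "?v ! (k - 1) = w ! k" "?v ! k = w ! (k - 1)"
    using assms len by (auto simp: nth_swap_letters)
  have "\<not> adjacent e (?v ! (k - 1)) (?v ! k)"
    using off_coeff_eq_0_iff[OF neighbours_mod[OF assms(3,1,2)]] assms(4) off_coeff_sym v by auto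
  then have "swap_letters k ?v \<in> W" by (rule swap_W[OF assms(3,1,2)])
  then show ?thesis using assms len by simp
qed

lemma vspace_rep_word: "vspace_rep word_rep"
proof -
  have vs: "vector_space (smul word_rep)"
    by unfold_locales (auto simp: fun_eq_iff algebra_simps)
  interpret vector_space "smul word_rep" by (rule vs)
  show ?thesis
    by (intro vspace_rep.intro vs subspaceI) auto
qed

lemma Tact_word_in:
  assumes "1 \<le> k" "k < n" "f \<in> vspace word_rep"
  shows "Tact word_rep k f \<in> vspace word_rep"
proof -
  have "Tact word_rep k f w = 0" if "w \<notin> W" for w
  proof (cases "length w = n")
    case True
    then show ?thesis
      using off_coeff_swap_nonzero[OF assms(1,2), of w] assms(3) that by (auto simp: Tact_word)
  qed (simp add: Tact_word_other)
  then show ?thesis by simp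
qed

lemma word_rep_eqI:
  assumes "f \<in> vspace word_rep" "g \<in> vspace word_rep" "\<And>w. w \<in> W \<Longrightarrow> f w = g w"
  shows "f = g"
proof
  fix w show "f w = g w" using assms by (cases "w \<in> W") auto
qed

lemma hecke_rep_word: "hecke_rep word_rep q n"
proof -
  interpret R: vspace_rep word_rep by (rule vspace_rep_word)
  have xin: "xact word_rep j f \<in> vspace word_rep" if "f \<in> vspace word_rep" for j f
    using that by simp
  have "aff_hecke_module q n word_rep"
  proof (rule aff_hecke_moduleI)
    show "vspace_rep word_rep" by (rule vspace_rep_word)
    show "q \<noteq> 0" by (rule q_nz)
    show "lin_map word_rep word_rep (Tact word_rep i)" if i: "1 \<le> i" "i < n" for i
      unfolding lin_map_def
      using Tact_word_in[OF i]
      by (auto simp: fun_eq_iff algebra_simps word_rep_def)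
    show "lin_map word_rep word_rep (xact word_rep j)" for j
      unfolding lin_map_def by (auto simp: fun_eq_iff algebra_simps)
    show "bij_betw (xact word_rep j) (vspace word_rep) (vspace word_rep)" for j
    proof (rule bij_betw_byWitness[where f' = "\<lambda>f w. inverse (q powi (int j - 1 + w ! (j - 1))) * f w"])
    qed (auto simp: fun_eq_iff q_nz)
    fix i j :: nat and f assume f: "f \<in> vspace word_rep"
    let ?T = "Tact word_rep"
    show "?T i (?T i f) = smul word_rep (q - 1) (?T i f) + smul word_rep q f" if i: "1 \<le> i" "i < n"
    proof (rule word_rep_eqI)
      fix w assume w: "w \<in> W"
      have len: "length w = n" by (rule length_W[OF w])
      have ne: "w ! (i - 1) mod int e \<noteq> w ! i mod int e" by (rule neighbours_mod[OF w i])
      have ii: "i - 1 < length w" "i < length w" "i - 1 \<noteq> i" using i len by auto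
      have block: "c * (c * x + d * y) + d * (c' * y + d * x) = (q - 1) * (c * x + d * y) + q * x"
        if "c + c' = q - 1" "d * d = q + c * c'" for c c' d x y
      proof -
        have "c * (c * x + d * y) + d * (c' * y + d * x) = (c + c') * (c * x + d * y) + (d * d - c * c') * x"
          by (simp add: algebra_simps)
        then show ?thesis unfolding that by simp
      qed
      show "?T i (?T i f) w = (smul word_rep (q - 1) (?T i f) + smul word_rep q f) w"
        using block[OF diag_coeff_add[OF ne] off_coeff_square[OF ne]] off_coeff_sym[of "w ! i" "w ! (i - 1)"] i len ii
        by (simp add: Tact_word nth_swap_letters)
    qed (rule f Tact_word_in[OF i] R.in_vspace)+
    show "?T i (?T j f) = ?T j (?T i f)" if ij: "1 \<le> i" "Suc i < j" "j < n"
    proof -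
      have j: "1 \<le> j" "i < n" using ij by auto
      show ?thesis
      proof (rule word_rep_eqI)
        fix w assume w: "w \<in> W"
        have len: "length w = n" by (rule length_W[OF w])
        have sw: "swap_letters i (swap_letters j w) = swap_letters j (swap_letters i w)"
          using ij len by (intro swap_letters_far) auto
        have ii: "i - 1 \<noteq> j" "i - 1 \<noteq> j - 1" "i \<noteq> j - 1" "i \<noteq> j" "j - 1 \<noteq> i" "j - 1 < n" "i - 1 < n" "i < n"
          using ij by auto
        show "?T i (?T j f) w = ?T j (?T i f) w"
          using ij len ii by (simp add: Tact_word nth_swap_letters sw) (simp add: algebra_simps)
      qed (rule f Tact_word_in[OF ij(1) j(2)] Tact_word_in[OF j(1) ij(3)])+
    qed
    show "?T i (?T (Suc i) (?T i f)) = ?T (Suc i) (?T i (?T (Suc i) f))" if i: "1 \<le> i" "Suc i < n"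
    proof -
      have i': "i < n" "1 \<le> Suc i" using i by auto
      show ?thesis
      proof (rule word_rep_eqI)
        fix w assume w: "w \<in> W"
        have len: "length w = n" by (rule length_W[OF w])
        let ?a = "w ! (i - 1)" and ?b = "w ! i" and ?c = "w ! Suc i"
        have ab: "?a mod int e \<noteq> ?b mod int e" by (rule neighbours_mod[OF w i(1) i'(1)])
        have bc: "?b mod int e \<noteq> ?c mod int e" using neighbours_mod[OF w i'(2) i(2)] by simp
        have ii: "i - 1 < n" "i - 1 \<noteq> i" "i - 1 \<noteq> Suc i" using i by auto
        have L: "?T i (?T (Suc i) (?T i f)) w =
          (diag_coeff ?a ?b * diag_coeff ?a ?b * diag_coeff ?b ?c + off_coeff ?a ?b * off_coeff ?b ?a * diag_coeff ?a ?c) * f w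
          + off_coeff ?a ?b * (diag_coeff ?a ?b * diag_coeff ?b ?c + diag_coeff ?a ?c * diag_coeff ?b ?a) * f (swap_letters i w)
          + diag_coeff ?a ?b * off_coeff ?b ?c * diag_coeff ?a ?c * f (swap_letters (Suc i) w)
          + diag_coeff ?a ?b * off_coeff ?b ?c * off_coeff ?a ?c * f (swap_letters i (swap_letters (Suc i) w))
          + off_coeff ?a ?b * off_coeff ?a ?c * diag_coeff ?b ?c * f (swap_letters (Suc i) (swap_letters i w))
          + off_coeff ?a ?b * off_coeff ?a ?c * off_coeff ?b ?c * f (swap_letters i (swap_letters (Suc i) (swap_letters i w)))"
          using i len ii by (simp add: Tact_word nth_swap_letters) (simp add: algebra_simps)
        have R: "?T (Suc i) (?T i (?T (Suc i) f)) w =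
          (diag_coeff ?b ?c * diag_coeff ?b ?c * diag_coeff ?a ?b + off_coeff ?b ?c * off_coeff ?c ?b * diag_coeff ?a ?c) * f w
          + off_coeff ?b ?c * (diag_coeff ?b ?c * diag_coeff ?a ?b + diag_coeff ?a ?c * diag_coeff ?c ?b) * f (swap_letters (Suc i) w)
          + diag_coeff ?b ?c * off_coeff ?a ?b * diag_coeff ?a ?c * f (swap_letters i w)
          + diag_coeff ?b ?c * off_coeff ?a ?b * off_coeff ?a ?c * f (swap_letters (Suc i) (swap_letters i w))
          + off_coeff ?b ?c * off_coeff ?a ?c * diag_coeff ?a ?b * f (swap_letters i (swap_letters (Suc i) w))
          + off_coeff ?b ?c * off_coeff ?a ?c * off_coeff ?a ?b * f (swap_letters (Suc i) (swap_letters i (swap_letters (Suc i) w)))"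
          using i len ii by (simp add: Tact_word nth_swap_letters) (simp add: algebra_simps)
        show "?T i (?T (Suc i) (?T i f)) w = ?T (Suc i) (?T i (?T (Suc i) f)) w"
        proof (cases "?a mod int e = ?c mod int e")
          case True
          \<comment> \<open>Then \<open>e = 2\<close>, and both generators act on \<open>w\<close> by \<open>-1\<close>.\<close>
          then have e2: "e = 2" using second_neighbours_mod[OF w i] by blast
          have "adjacent e ?a ?b" "adjacent e ?b ?c"
            using adjacent_two[OF e2] ab bc by auto
          then have "off_coeff ?a ?b = 0" "off_coeff ?b ?c = 0"
            using off_coeff_eq_0_iff[OF ab] off_coeff_eq_0_iff[OF bc] by auto
          then show ?thesis
            unfolding L R using diag_coeff_two[OF e2 ab] diag_coeff_two[OF e2 bc] by simp
        next
          case False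
          show ?thesis
            unfolding L R off_coeff_sym[of ?b ?a] off_coeff_sym[of ?c ?b]
              diag_coeff_braid3[OF ab bc False] diag_coeff_braid1[OF ab bc False] diag_coeff_braid2[OF ab bc False, symmetric]
              swap_letters_braid[OF i(1) i(2)[folded len]]
            by (simp add: algebra_simps)
        qed
      qed (rule f Tact_word_in[OF i(1) i'(1)] Tact_word_in[OF i'(2) i(2)])+
    qed
    show "xact word_rep i (xact word_rep j f) = xact word_rep j (xact word_rep i f)"
      by (simp add: fun_eq_iff)
    show "?T i (xact word_rep i (?T i f)) = xact word_rep (Suc i) f" if i: "1 \<le> i" "i < n"
    proof (rule word_rep_eqI)
      fix w assume w: "w \<in> W"
      have len: "length w = n" by (rule length_W[OF w])
      let ?a = "w ! (i - 1)" and ?b = "w ! i"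
      have ne: "?a mod int e \<noteq> ?b mod int e" by (rule neighbours_mod[OF w i])
      have ii: "i - 1 < n" "i - 1 \<noteq> i" using i by auto
      have p: "q powi (int i - 1 + x) = q powi (int i - 1) * q powi x" for x
        using q_nz by (simp add: power_int_add)
      have "?T i (xact word_rep i (?T i f)) w = q powi (int i - 1) *
         ((diag_coeff ?a ?b * (q powi ?a * diag_coeff ?a ?b + q powi ?b * diag_coeff ?b ?a)
            + q powi ?b * (off_coeff ?a ?b * off_coeff ?a ?b - diag_coeff ?a ?b * diag_coeff ?b ?a)) * f w
          + off_coeff ?a ?b * (q powi ?a * diag_coeff ?a ?b + q powi ?b * diag_coeff ?b ?a) * f (swap_letters i w))"
        using i len ii off_coeff_sym[of ?b ?a] by (simp add: Tact_word nth_swap_letters p) (simp add: algebra_simps)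
      also have "\<dots> = q powi (int i - 1) * q * q powi ?b * f w"
        unfolding diag_coeff_weight[OF ne] off_coeff_square[OF ne] by simp
      also have "\<dots> = xact word_rep (Suc i) f w"
        using q_nz by (simp add: power_int_add algebra_simps power_int_diff)
      finally show "?T i (xact word_rep i (?T i f)) w = xact word_rep (Suc i) f w" .
    qed (rule f Tact_word_in[OF i] xin)+
    show "?T i (xact word_rep j f) = xact word_rep j (?T i f)"
      if i: "1 \<le> i" "i < n" "1 \<le> j" "j \<le> n" "j \<noteq> i" "j \<noteq> Suc i"
    proof (rule word_rep_eqI)
      fix w assume w: "w \<in> W"
      have len: "length w = n" by (rule length_W[OF w])
      have "j - 1 \<noteq> i - 1" "j - 1 \<noteq> i" "j - 1 < n" using i by auto
      then show "?T i (xact word_rep j f) w = xact word_rep j (?T i f) w"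
        using i len by (simp add: Tact_word nth_swap_letters algebra_simps)
    qed (rule f Tact_word_in[OF i(1,2)] xin)+
  qed
  then show ?thesis using hecke_repI q_nz by blast
qed

lemma Xact_word: "Xact q word_rep j f w = q powi (w ! (j - 1)) * f w"
  using q_nz by (simp add: Xact_def flip: power_int_add mult.assoc)

lemma foldr_X_minus_word:
  "foldr (X_minus q word_rep j) as f w = prod_list (map (\<lambda>a. q powi (w ! (j - 1)) - a) as) * f w"
  by (induction as) (simp_all add: X_minus_def Xact_word fun_diff_def algebra_simps)

definition word_vec :: "int list \<Rightarrow> int list \<Rightarrow> complex" where
  "word_vec w = (\<lambda>v. if v = w then 1 else 0)"

lemma word_vec_in: "w \<in> W \<Longrightarrow> word_vec w \<in> vspace word_rep"
  by (auto simp: word_vec_def)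

lemma Xact_word_vec: "Xact q word_rep j (word_vec w) = smul word_rep (q powi (w ! (j - 1))) (word_vec w)"
  by (auto simp: fun_eq_iff Xact_word word_vec_def)

lemma Tact_word_vec:
  assumes "w \<in> W" "1 \<le> k" "k < n"
  shows "Tact word_rep k (word_vec w) = smul word_rep (diag_coeff (w ! (k - 1)) (w ! k)) (word_vec w)
     + smul word_rep (off_coeff (w ! (k - 1)) (w ! k)) (word_vec (swap_letters k w))"
proof
  fix v
  have len: "length w = n" by (rule length_W[OF assms(1)])
  show "Tact word_rep k (word_vec w) v = (smul word_rep (diag_coeff (w ! (k - 1)) (w ! k)) (word_vec w)
     + smul word_rep (off_coeff (w ! (k - 1)) (w ! k)) (word_vec (swap_letters k w))) v"
  proof (cases "length v = n")
    case True
    have "swap_letters k v = w \<longleftrightarrow> v = swap_letters k w"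
      using assms len True swap_letters_twice[of k v] swap_letters_twice[of k w] by metis
    moreover have "off_coeff (swap_letters k w ! (k - 1)) (swap_letters k w ! k) = off_coeff (w ! (k - 1)) (w ! k)"
      using assms len off_coeff_sym by (simp add: nth_swap_letters)
    ultimately show ?thesis using True by (auto simp: Tact_word word_vec_def)
  next
    case False
    then have "v \<noteq> w" "v \<noteq> swap_letters k w" using len by auto
    then show ?thesis using False by (simp add: Tact_word_other word_vec_def)
  qed
qed

lemma word_rep_span: "vspace word_rep = module.span (smul word_rep) (word_vec ` W)"
proof -
  interpret R: vspace_rep word_rep by (rule vspace_rep_word)
  have "f \<in> R.vs.span (word_vec ` W)" if f: "f \<in> vspace word_rep" for f
  proof -
    have "(\<Sum>w\<in>A. smul word_rep (f w) (word_vec w)) v = (if v \<in> A then f v else 0)" if "finite A" for A v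
      using that by (induction A) (auto simp: word_vec_def)
    then have "f = (\<Sum>w\<in>W. smul word_rep (f w) (word_vec w))"
      using finite_W f by (auto simp: fun_eq_iff)
    moreover have "(\<Sum>w\<in>W. smul word_rep (f w) (word_vec w)) \<in> R.vs.span (word_vec ` W)"
      by (intro R.vs.span_sum R.vs.span_scale R.vs.span_base) auto
    ultimately show ?thesis by simp
  qed
  moreover have "R.vs.span (word_vec ` W) \<subseteq> vspace word_rep"
    using word_vec_in by (intro R.vs.span_minimal R.subspace_vspace) auto
  ultimately show ?thesis by blast
qed

text \<open>A nonzero element of a submodule with the fewest nonzero coefficients has only one: two words
  in its support differ in some letter, and the corresponding \<open>X_j\<close> separates them. The swaps then
  produce all other basis vectors.\<close>

lemma simple_word_rep: "simple_module q n word_rep"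
proof -
  interpret R: hecke_rep word_rep q n by (rule hecke_rep_word)
  obtain w0 where w0: "w0 \<in> W" using W_nonempty by blast
  have "vspace word_rep \<noteq> {0}"
  proof
    assume "vspace word_rep = {0}"
    then have "word_vec w0 = 0" using word_vec_in[OF w0] by blast
    then have "word_vec w0 w0 = 0" by simp
    then show False by (simp add: word_vec_def)
  qed
  moreover have "U = vspace word_rep"
    if U: "U \<subseteq> vspace word_rep" "aff_hecke_module q n (restrict_rep word_rep U)" "U \<noteq> {0}" for U
  proof -
    note D = R.submoduleD[OF U(2)]
    let ?supp = "\<lambda>f :: int list \<Rightarrow> complex. {w. f w \<noteq> 0}"
    have supp: "?supp f \<subseteq> W" "finite (?supp f)" if "f \<in> U" for f
    proof -
      have "f \<in> vspace word_rep" using that U(1) by blast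
      then show "?supp f \<subseteq> W" by auto
      then show "finite (?supp f)" by (rule finite_subset[OF _ finite_W])
    qed
    obtain f0 where f0: "f0 \<in> U" "f0 \<noteq> 0"
      using U(3) R.vs.subspace_0[OF D(1)] by blast
    define f where "f = arg_min (\<lambda>f. card (?supp f)) (\<lambda>f. f \<in> U \<and> f \<noteq> 0)"
    have f: "f \<in> U" "f \<noteq> 0" and least: "\<And>g. g \<in> U \<Longrightarrow> g \<noteq> 0 \<Longrightarrow> card (?supp f) \<le> card (?supp g)"
      using arg_min_nat_lemma[of "\<lambda>f. f \<in> U \<and> f \<noteq> 0" f0 "\<lambda>f. card (?supp f)"] f0 unfolding f_def by auto
    obtain w where w: "f w \<noteq> 0" using f(2) by (auto simp: fun_eq_iff)
    have wW: "w \<in> W" using supp[OF f(1)] w by auto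
    have single: "f v = 0" if "v \<noteq> w" for v
    proof (rule ccontr)
      assume v: "f v \<noteq> 0"
      then have vW: "v \<in> W" using supp[OF f(1)] by auto
      have "\<exists>j<n. v ! j \<noteq> w ! j"
        using that length_W[OF vW] length_W[OF wW] by (auto simp: list_eq_iff_nth_eq)
      then obtain j where j: "j < n" "v ! j \<noteq> w ! j" by blast
      have "v ! j \<in> {0..<int e}" "w ! j \<in> {0..<int e}"
        using subsetD[OF letters_W[OF vW] nth_mem[of j v]] subsetD[OF letters_W[OF wW] nth_mem[of j w]]
          length_W[OF vW] length_W[OF wW] j(1) by simp_all
      then have ne: "q powi (v ! j) \<noteq> q powi (w ! j)" using q_powi_eq_iff j(2) by simp
      let ?g = "X_minus q word_rep (Suc j) (q powi (w ! j)) f"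
      have g: "?g u = (q powi (u ! j) - q powi (w ! j)) * f u" for u
        by (simp add: X_minus_def Xact_word fun_diff_def algebra_simps)
      have "?g \<in> U"
        unfolding X_minus_def Xact_def using f(1) j(1) D(1)
        by (intro R.vs.subspace_diff R.vs.subspace_scale D(3)) auto
      moreover have "?g v \<noteq> 0" using g ne v by simp
      then have "?g \<noteq> 0" by (metis zero_fun_apply)
      ultimately have "card (?supp f) \<le> card (?supp ?g)" by (rule least)
      moreover have "?supp ?g \<subset> ?supp f" using g w by auto
      then have "card (?supp ?g) < card (?supp f)" using supp[OF f(1)] by (intro psubset_card_mono)
      ultimately show False by simp
    qed
    have "word_vec w = smul word_rep (inverse (f w)) f"
      using single w by (auto simp: fun_eq_iff word_vec_def)
    then have wU: "word_vec w \<in> U" using f(1) D(1) R.vs.subspace_scale by metis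
    let ?S = "{w \<in> W. word_vec w \<in> U}"
    have "?S = W"
    proof (rule W_connected)
      show "?S \<noteq> {}" using wW wU by auto
      fix v k assume v: "v \<in> ?S" and k: "1 \<le> k" "k < n" "\<not> adjacent e (v ! (k - 1)) (v ! k)"
      let ?c = "diag_coeff (v ! (k - 1)) (v ! k)" and ?d = "off_coeff (v ! (k - 1)) (v ! k)"
      have d: "?d \<noteq> 0" using off_coeff_eq_0_iff[OF neighbours_mod[OF _ k(1,2)]] v k(3) by auto
      have "smul word_rep (inverse ?d) (Tact word_rep k (word_vec v) - smul word_rep ?c (word_vec v)) \<in> U"
        using v D(1) k by (intro R.vs.subspace_diff R.vs.subspace_scale D(2)) auto
      also have "smul word_rep (inverse ?d) (Tact word_rep k (word_vec v) - smul word_rep ?c (word_vec v)) = word_vec (swap_letters k v)"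
        using v k d by (subst Tact_word_vec) (auto simp: fun_eq_iff)
      finally show "swap_letters k v \<in> ?S" using swap_W[OF _ k] v by simp
    qed auto
    then have "word_vec ` W \<subseteq> U" by auto
    then have "vspace word_rep \<subseteq> U" unfolding word_rep_span by (rule R.vs.span_minimal[OF _ D(1)])
    then show ?thesis using U(1) by blast
  qed
  ultimately show ?thesis
    using R.hecke unfolding simple_module_def by blast
qed

definition word_form :: "(int list \<Rightarrow> complex) \<Rightarrow> (int list \<Rightarrow> complex) \<Rightarrow> complex" where
  "word_form f g = (\<Sum>w\<in>W. f w * cnj (g w))"

lemma word_form_pos:
  assumes "f \<in> vspace word_rep" "f \<noteq> 0"
  shows "0 < Re (word_form f f)"
proof -
  obtain w where w: "f w \<noteq> 0" using assms(2) by (auto simp: fun_eq_iff)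
  then have wW: "w \<in> W" using assms(1) by auto
  have "Re (word_form f f) = (\<Sum>w\<in>W. (cmod (f w))\<^sup>2)"
    unfolding word_form_def Re_sum by (simp flip: complex_norm_square of_real_power)
  also have "\<dots> > 0"
    using finite_W wW w by (intro sum_pos2[of _ w]) auto
  finally show ?thesis .
qed

text \<open>The matrix of \<open>T_k\<close> on a word and its image under the exchange is unitary. The mixed terms
  of the form are matched by applying the exchange to the index of summation, which is possible on
  the words with a nonzero off-diagonal entry.\<close>

lemma Tact_word_form:
  assumes k: "1 \<le> k" "k < n" and f: "f \<in> vspace word_rep" and g: "g \<in> vspace word_rep"
  shows "word_form (Tact word_rep k f) (Tact word_rep k g) = word_form f g"
proof -
  let ?c = "\<lambda>w. diag_coeff (w ! (k - 1)) (w ! k)" and ?d = "\<lambda>w. off_coeff (w ! (k - 1)) (w ! k)"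
    and ?s = "swap_letters k"
  define V where "V = {w \<in> W. ?d w \<noteq> 0}"
  have V: "?s w \<in> V" "?d (?s w) = ?d w" "?s (?s w) = w" "length w = n" "w \<in> W" "?c (?s w) = diag_coeff (w ! k) (w ! (k - 1))"
    if "w \<in> V" for w
  proof -
    show w: "w \<in> W" "length w = n" using that length_W unfolding V_def by auto
    then show "?s (?s w) = w" using k by simp
    have nth: "?s w ! (k - 1) = w ! k" "?s w ! k = w ! (k - 1)" using w k by (auto simp: nth_swap_letters)
    then show d: "?d (?s w) = ?d w" using off_coeff_sym by simp
    show "?c (?s w) = diag_coeff (w ! k) (w ! (k - 1))" using nth by simp
    have "\<not> adjacent e (w ! (k - 1)) (w ! k)"
      using off_coeff_eq_0_iff[OF neighbours_mod[OF w(1) k]] that unfolding V_def by simp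
    then show "?s w \<in> V" using swap_W[OF w(1) k] that d unfolding V_def by simp
  qed
  have reindex: "(\<Sum>w\<in>V. h w) = (\<Sum>w\<in>V. h (?s w))" for h :: "int list \<Rightarrow> complex"
    by (rule sum.reindex_bij_witness[where i = ?s and j = ?s]) (auto simp: V)
  have restrict: "(\<Sum>w\<in>W. h w) = (\<Sum>w\<in>V. h w)" if "\<And>w. ?d w = 0 \<Longrightarrow> h w = 0" for h :: "int list \<Rightarrow> complex"
    by (rule sum.mono_neutral_right) (use finite_W that in \<open>auto simp: V_def\<close>)
  have "word_form (Tact word_rep k f) (Tact word_rep k g) =
    (\<Sum>w\<in>W. ?c w * cnj (?c w) * (f w * cnj (g w))) + (\<Sum>w\<in>W. ?d w * cnj (?d w) * (f (?s w) * cnj (g (?s w))))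
    + (\<Sum>w\<in>W. ?c w * cnj (?d w) * (f w * cnj (g (?s w)))) + (\<Sum>w\<in>W. ?d w * cnj (?c w) * (f (?s w) * cnj (g w)))"
    unfolding word_form_def sum.distrib[symmetric]
    by (rule sum.cong) (simp_all add: Tact_word length_W algebra_simps)
  also have "(\<Sum>w\<in>W. ?d w * cnj (?d w) * (f (?s w) * cnj (g (?s w)))) = (\<Sum>w\<in>W. ?d w * cnj (?d w) * (f w * cnj (g w)))"
    by (subst (1 2) restrict, simp, simp, subst reindex) (rule sum.cong[OF refl], simp only: V)
  also have "(\<Sum>w\<in>W. ?d w * cnj (?c w) * (f (?s w) * cnj (g w))) =
      (\<Sum>w\<in>W. ?d w * cnj (diag_coeff (w ! k) (w ! (k - 1))) * (f w * cnj (g (?s w))))"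
    by (subst (1 2) restrict, simp, simp, subst reindex) (rule sum.cong[OF refl], simp only: V)
  also have "(\<Sum>w\<in>W. ?c w * cnj (?c w) * (f w * cnj (g w))) + (\<Sum>w\<in>W. ?d w * cnj (?d w) * (f w * cnj (g w)))
    + (\<Sum>w\<in>W. ?c w * cnj (?d w) * (f w * cnj (g (?s w))))
    + (\<Sum>w\<in>W. ?d w * cnj (diag_coeff (w ! k) (w ! (k - 1))) * (f w * cnj (g (?s w)))) =
    (\<Sum>w\<in>W. (?c w * cnj (?c w) + ?d w * cnj (?d w)) * (f w * cnj (g w))
       + (?c w * cnj (?d w) + ?d w * cnj (diag_coeff (w ! k) (w ! (k - 1)))) * (f w * cnj (g (?s w))))"
    unfolding sum.distrib[symmetric] by (rule sum.cong) (simp_all add: algebra_simps)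
  also have "\<dots> = word_form f g"
    unfolding word_form_def
  proof (rule sum.cong)
    fix w assume w: "w \<in> W"
    note ne = neighbours_mod[OF w k]
    have "?c w * cnj (?c w) + ?d w * cnj (?d w) = of_real ((cmod (?c w))\<^sup>2 + (cmod (?d w))\<^sup>2)"
      by (simp only: complex_norm_square of_real_add)
    also have "\<dots> = 1" unfolding coeff_norm[OF ne] by simp
    finally show "(?c w * cnj (?c w) + ?d w * cnj (?d w)) * (f w * cnj (g w))
       + (?c w * cnj (?d w) + ?d w * cnj (diag_coeff (w ! k) (w ! (k - 1)))) * (f w * cnj (g (?s w))) = f w * cnj (g w)"
      unfolding coeff_orthogonal[OF ne] by simp
  qed simp
  finally show ?thesis .
qed

lemma xact_word_form: "word_form (xact word_rep j f) (xact word_rep j g) = word_form f g"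
proof -
  have "q powi a * cnj (q powi a) = 1" for a
    using complex_norm_square[of "q powi a"] by simp
  then have *: "(q powi a * x) * cnj (q powi a * y) = x * cnj y" for a x y
    by (simp add: algebra_simps)
  show ?thesis unfolding word_form_def word_rep_simps by (simp only: *)
qed

end

section \<open>Particles on a circle\<close>

lemma mod_eq_shift:
  fixes x y c m :: int
  shows "(x + c) mod m = (y + c) mod m \<longleftrightarrow> x mod m = y mod m"
    and "(x - c) mod m = (y - c) mod m \<longleftrightarrow> x mod m = y mod m"
  by (simp_all add: mod_eq_dvd_iff)

lemma mod_eq_close: "x mod m = y mod m \<Longrightarrow> \<bar>x - y\<bar> < m \<Longrightarrow> x = y" for x y m :: int
  using zdvd_not_zless[of "\<bar>x - y\<bar>" m] by (cases "x = y") (auto simp: mod_eq_dvd_iff)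

lemma mod_eq_near:
  fixes x y m :: int
  assumes "x mod m = y mod m" "- m < x - y" "x - y < 2 * m"
  shows "x = y \<or> x = y + m"
proof (cases "x - y < m")
  case True
  then show ?thesis using mod_eq_close[of x m y] assms by auto
next
  case False
  have "x mod m = (y + m) mod m" using assms by simp
  then show ?thesis using mod_eq_close[of x m "y + m"] assms False by auto
qed

text \<open>The particle \<open>p\<close> starts at the integer \<open>p\<close> and has made \<open>a p\<close> steps; the integers modulo \<open>e\<close>
  are the points of the circle. In a valid state the particles have the order in which they
  started, and none is a full turn ahead of another. A walk from the initial state records for
  each step the residue of the point that is left.\<close>

definition site :: "(int \<Rightarrow> nat) \<Rightarrow> int \<Rightarrow> int" where
  "site a p = p + int (a p)"

definition valid :: "nat \<Rightarrow> int set \<Rightarrow> (int \<Rightarrow> nat) \<Rightarrow> bool" where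
  "valid e P a \<longleftrightarrow> (\<forall>p\<in>P. \<forall>p'\<in>P. p < p' \<longrightarrow> site a p < site a p' \<and> site a p' < site a p + int e)"

definition retreat :: "(int \<Rightarrow> nat) \<Rightarrow> int \<Rightarrow> int \<Rightarrow> nat" where
  "retreat a p = a(p := a p - 1)"

lemma retreat_apply [simp]: "retreat a p r = (if r = p then a p - 1 else a r)"
  by (simp add: retreat_def)

lemma site_retreat: "0 < a p \<Longrightarrow> site (retreat a p) r = (if r = p then site a p - 1 else site a r)"
  by (auto simp: site_def of_nat_diff)

inductive walk :: "nat \<Rightarrow> int set \<Rightarrow> int list \<Rightarrow> (int \<Rightarrow> nat) \<Rightarrow> bool" for e P where
  walk_Nil: "walk e P [] (\<lambda>_. 0)"
| walk_step: "walk e P w a \<Longrightarrow> p \<in> P \<Longrightarrow> valid e P (a(p := Suc (a p))) \<Longrightarrow>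
    walk e P (w @ [site a p mod int e]) (a(p := Suc (a p)))"

lemma walk_snocI:
  assumes "walk e P w (retreat a p)" "p \<in> P" "0 < a p" "valid e P a"
  shows "walk e P (w @ [(site a p - 1) mod int e]) a"
proof -
  have a: "(retreat a p)(p := Suc (retreat a p p)) = a" using assms(3) by (auto simp: fun_eq_iff)
  show ?thesis
    using walk_step[OF assms(1,2), unfolded a, OF assms(4)] site_retreat[of a p p] assms(3) by simp
qed

lemma walk_snocE:
  assumes "walk e P (w @ [i]) a"
  obtains p where "p \<in> P" "0 < a p" "i = (site a p - 1) mod int e" "walk e P w (retreat a p)" "valid e P a"
  using assms
proof (cases rule: walk.cases)
  case (walk_step v b p)
  then have "retreat a p = b" "w = v" "i = (site a p - 1) mod int e" by (auto simp: site_def fun_eq_iff)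
  then show ?thesis using walk_step that[of p] by auto
qed simp

lemma walk_prefix: "walk e P (u @ v) a \<Longrightarrow> \<exists>b. walk e P u b"
proof (induction v arbitrary: a rule: rev_induct)
  case (snoc x v)
  have "walk e P ((u @ v) @ [x]) a" using snoc.prems by simp
  then obtain p where "walk e P (u @ v) (retreat a p)" by (rule walk_snocE)
  then show ?case by (rule snoc.IH)
qed auto

text \<open>The starting points lie within one turn of the circle, so that the initial state is valid.\<close>

locale track =
  fixes e :: nat and P :: "int set"
  assumes e_gt1: "e > 1" and finite_P: "finite P"
    and window_P: "p \<in> P \<Longrightarrow> p' \<in> P \<Longrightarrow> \<bar>p - p'\<bar> < int e"
begin

lemma valid_initial: "valid e P (\<lambda>_. 0)"
  using window_P by (fastforce simp: valid_def site_def)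

lemma valid_close:
  "valid e P a \<Longrightarrow> p \<in> P \<Longrightarrow> p' \<in> P \<Longrightarrow> \<bar>site a p - site a p'\<bar> < int e"
  using e_gt1 unfolding valid_def by (cases p p' rule: linorder_cases) fastforce+

lemma valid_distinct:
  assumes "valid e P a" "p \<in> P" "p' \<in> P" "site a p mod int e = site a p' mod int e"
  shows "p = p'"
proof -
  have "site a p = site a p'" using mod_eq_close[OF assms(4) valid_close[OF assms(1-3)]] .
  then show ?thesis using assms(1-3) unfolding valid_def by (metis linorder_neqE less_irrefl)
qed

lemma walk_invariant:
  "walk e P w a \<Longrightarrow> valid e P a \<and> (\<forall>p. p \<notin> P \<longrightarrow> a p = 0) \<and> length w = (\<Sum>p\<in>P. a p) \<and> set w \<subseteq> {0..<int e}"
proof (induction rule: walk.induct)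
  case walk_Nil
  then show ?case using valid_initial by simp
next
  case (walk_step w a p)
  have "(\<Sum>r\<in>P. (a(p := Suc (a p))) r) = Suc (\<Sum>r\<in>P. a r)"
    using walk_step.hyps(2) finite_P by (simp add: sum.remove[of P p])
  moreover have "\<forall>r. r \<notin> P \<longrightarrow> (a(p := Suc (a p))) r = 0" using walk_step by auto
  ultimately show ?case using walk_step e_gt1 by (simp del: fun_upd_apply)
qed

lemma sum_retreat: "p \<in> P \<Longrightarrow> 0 < a p \<Longrightarrow> (\<Sum>r\<in>P. (retreat a p) r) < (\<Sum>r\<in>P. a r)"
  using finite_P by (simp add: sum.remove[of P p])

lemma valid_retreat:
  assumes "valid e P a" "p \<in> P" "0 < a p" "\<And>p'. p' \<in> P \<Longrightarrow> site a p' mod int e \<noteq> (site a p - 1) mod int e"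
  shows "valid e P (retreat a p)"
  unfolding valid_def
proof (intro ballI impI)
  fix r r' assume r: "r \<in> P" "r' \<in> P" "r < r'"
  then have *: "site a r < site a r'" "site a r' < site a r + int e"
    using assms(1) unfolding valid_def by auto
  have 1: "site a r \<noteq> site a p - 1" using assms(4)[OF r(1)] by auto
  have 2: "site a r' \<noteq> site a p - 1 + int e" using assms(4)[OF r(2)] by auto
  show "site (retreat a p) r < site (retreat a p) r' \<and> site (retreat a p) r' < site (retreat a p) r + int e"
    using * 1 2 r(3) by (auto simp: site_retreat[of a p, OF assms(3)])
qed

lemma valid_retreat_free:
  assumes "valid e P (retreat a p)" "p \<in> P" "p' \<in> P" "0 < a p"
  shows "site a p' mod int e \<noteq> (site a p - 1) mod int e"
proof (cases "p' = p")
  case True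
  then show ?thesis using mod_eq_close[of "site a p" "int e" "site a p - 1"] e_gt1 by auto
next
  case False
  then have "site (retreat a p) p' = site a p'" "site (retreat a p) p = site a p - 1"
    using site_retreat[of a p] assms(4) by simp_all
  then show ?thesis using valid_distinct[OF assms(1,3,2)] False by fastforce
qed

text \<open>A particle that has moved cannot be blocked from behind by one that has not: the latter would
  have started from a point not behind the former.\<close>

lemma moved_behind:
  assumes "valid e P a" "p \<in> P" "0 < a p" "p' \<in> P" "site a p' mod int e = (site a p - 1) mod int e"
  shows "0 < a p'"
proof -
  have "p' \<noteq> p"
    using mod_eq_close[of "site a p" "int e" "site a p - 1"] e_gt1 assms(5) by auto
  have "\<bar>site a p' - site a p\<bar> < int e" by (rule valid_close[OF assms(1,4,2)])
  then have *: "site a p' = site a p - 1 \<or> site a p' = site a p - 1 + int e"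
    using mod_eq_near[OF assms(5)] by linarith
  show ?thesis
  proof (cases "p' < p")
    case True
    then have "site a p' < site a p" using assms(1,2,4) unfolding valid_def by auto
    then have "site a p' = site a p - 1" using * e_gt1 by auto
    then show ?thesis using True assms(3) by (simp add: site_def)
  next
    case False
    then have "p < p'" using \<open>p' \<noteq> p\<close> by auto
    then have "site a p < site a p'" using assms(1,2,4) unfolding valid_def by auto
    then have "site a p' = site a p - 1 + int e" using * by auto
    then show ?thesis using window_P[OF assms(4,2)] \<open>p < p'\<close> assms(3) by (simp add: site_def)
  qed
qed

lemma valid_advance:
  assumes "valid e P a" "p \<in> P" "\<And>p'. p' \<in> P \<Longrightarrow> site a p' mod int e \<noteq> (site a p + 1) mod int e"
  shows "valid e P (a(p := Suc (a p)))"
  unfolding valid_def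
proof (intro ballI impI)
  fix r r' assume r: "r \<in> P" "r' \<in> P" "r < r'"
  then have *: "site a r < site a r'" "site a r' < site a r + int e"
    using assms(1) unfolding valid_def by auto
  have 1: "site a r' \<noteq> site a p + 1" using assms(3)[OF r(2)] by auto
  have "(site a r + int e) mod int e = site a r mod int e" by simp
  then have 2: "site a r + int e \<noteq> site a p + 1" using assms(3)[OF r(1)] by metis
  have "site (a(p := Suc (a p))) s = (if s = p then site a p + 1 else site a s)" for s
    by (simp add: site_def)
  then show "site (a(p := Suc (a p))) r < site (a(p := Suc (a p))) r' \<and>
      site (a(p := Suc (a p))) r' < site (a(p := Suc (a p))) r + int e"
    using * 1 2 r(3) by auto
qed

end

text \<open>Without an empty point on the circle no particle could ever move.\<close>

locale particles = track +
  assumes card_P: "card P < e"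
begin

lemma empty_residue:
  obtains h where "0 \<le> h" "h < int e" "\<And>p. p \<in> P \<Longrightarrow> site a p mod int e \<noteq> h"
proof -
  have "card ((\<lambda>p. site a p mod int e) ` P) \<le> card P" by (rule card_image_le[OF finite_P])
  then have "(\<lambda>p. site a p mod int e) ` P \<noteq> {0..<int e}" using card_P by auto
  moreover have "(\<lambda>p. site a p mod int e) ` P \<subseteq> {0..<int e}" using e_gt1 by auto
  ultimately obtain h where "h \<in> {0..<int e}" "h \<notin> (\<lambda>p. site a p mod int e) ` P" by blast
  then show thesis using that[of h] by force
qed

text \<open>Going backwards from \<open>p\<close>, the uninterrupted sequence of particles ends before an empty
  point, since fewer than \<open>e\<close> points are occupied. All particles of the sequence have moved
  because \<open>p\<close> has, so the last of them can move back.\<close>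

lemma block_end:
  assumes a: "valid e P a" and p: "p \<in> P" "0 < a p"
  obtains k p' where "k + 2 \<le> e" "p' \<in> P" "0 < a p'"
    "site a p' mod int e = (site a p - int k) mod int e" "valid e P (retreat a p')"
proof -
  define hole where "hole k \<longleftrightarrow> (\<forall>p'\<in>P. site a p' mod int e \<noteq> (site a p - int k - 1) mod int e)" for k :: nat
  obtain h where h: "0 \<le> h" "h < int e" "\<And>p. p \<in> P \<Longrightarrow> site a p mod int e \<noteq> h"
    using empty_residue by blast
  define k0 where "k0 = nat ((site a p - 1 - h) mod int e)"
  have k0: "int k0 = (site a p - 1 - h) mod int e" unfolding k0_def using e_gt1 by simp
  have "(site a p - int k0 - 1) mod int e = (site a p - (site a p - 1 - h) - 1) mod int e"
    unfolding k0 by (metis mod_diff_right_eq mod_diff_left_eq)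
  then have "hole k0" unfolding hole_def using h by auto
  define k where "k = (LEAST k. hole k)"
  have k: "hole k" unfolding k_def by (rule LeastI[of hole, OF \<open>hole k0\<close>])
  have less: "\<not> hole j" if "j < k" for j using that not_less_Least unfolding k_def by blast
  have "k \<le> k0" unfolding k_def by (rule Least_le[of hole, OF \<open>hole k0\<close>])
  moreover have "int k0 < int e" unfolding k0 using e_gt1 by simp
  moreover have "k \<noteq> e - 1"
  proof
    assume "k = e - 1"
    then have "site a p - int k - 1 = site a p - int e" using e_gt1 by (simp add: of_nat_diff)
    then have "(site a p - int k - 1) mod int e = (site a p - int e) mod int e" by (rule arg_cong)
    also have "\<dots> = site a p mod int e" by simp
    finally have "(site a p - int k - 1) mod int e = site a p mod int e" .
    then show False using k p unfolding hole_def by auto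
  qed
  ultimately have "k + 2 \<le> e" by linarith
  have "\<exists>p'\<in>P. 0 < a p' \<and> site a p' mod int e = (site a p - int j) mod int e" if "j \<le> k" for j
    using that
  proof (induction j)
    case 0
    then show ?case using p by auto
  next
    case (Suc j)
    then obtain p' where p': "p' \<in> P" "0 < a p'" "site a p' mod int e = (site a p - int j) mod int e" by auto
    obtain p'' where p'': "p'' \<in> P" "site a p'' mod int e = (site a p - int j - 1) mod int e"
      using less[of j] Suc.prems unfolding hole_def by auto
    have "site a p'' mod int e = (site a p' - 1) mod int e"
      using p'(3) p''(2) mod_eq_shift(2)[of "site a p'" 1 "int e" "site a p - int j"] by simp
    then have "0 < a p''" by (rule moved_behind[OF a p'(1,2) p''(1)])
    then show ?case using p'' by (intro bexI[of _ p'']) (auto simp: algebra_simps)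
  qed
  then obtain p' where p': "p' \<in> P" "0 < a p'" "site a p' mod int e = (site a p - int k) mod int e" by blast
  have "(site a p' - 1) mod int e = (site a p - int k - 1) mod int e"
    using p'(3) mod_eq_shift(2)[of "site a p'" 1 "int e" "site a p - int k"] by simp
  then have "valid e P (retreat a p')"
    using k unfolding hole_def by (intro valid_retreat[OF a p'(1,2)]) auto
  then show thesis using that[OF \<open>k + 2 \<le> e\<close> p'] by blast
qed

text \<open>As long as some particle has moved, one of them can move back.\<close>

lemma walk_exists:
  "valid e P a \<Longrightarrow> (\<And>p. p \<notin> P \<Longrightarrow> a p = 0) \<Longrightarrow> \<exists>w. walk e P w a"
proof (induction "\<Sum>p\<in>P. a p" arbitrary: a rule: less_induct)
  case less
  show ?case
  proof (cases "\<exists>p\<in>P. 0 < a p")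
    case True
    then obtain p where p: "p \<in> P" "0 < a p" by blast
    then obtain k p' where p': "p' \<in> P" "0 < a p'" "valid e P (retreat a p')"
      using block_end[OF less.prems(1)] by metis
    have "retreat a p' r = 0" if "r \<notin> P" for r using that less.prems(2) p'(1) by auto
    then obtain w where "walk e P w (retreat a p')"
      using less.hyps[OF sum_retreat[of _ a, OF p'(1,2)] p'(3)] by blast
    then show ?thesis using walk_snocI[OF _ p'(1,2) less.prems(1)] by blast
  next
    case False
    then have "a = (\<lambda>_. 0)" using less.prems(2) by force
    then show ?thesis using walk_Nil[of e P] by auto
  qed
qed

text \<open>If the last step of \<open>p\<close> was of residue \<open>i\<close>, the particles that block it from behind can be
  moved back first, beginning with the last one of the block. The residues of these steps are of
  the form \<open>i - k\<close> with \<open>0 < k \<le> e - 2\<close>, hence different from \<open>i\<close> and \<open>i + 1\<close>.\<close>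

lemma walk_block:
  assumes "valid e P a" "\<And>p. p \<notin> P \<Longrightarrow> a p = 0" "p \<in> P" "0 < a p"
  shows "\<exists>t w. walk e P (t @ [(site a p - 1) mod int e] @ w) a \<and>
    (\<forall>x\<in>set w. x mod int e \<noteq> (site a p - 1) mod int e \<and> x mod int e \<noteq> site a p mod int e)"
  using assms
proof (induction "\<Sum>p\<in>P. a p" arbitrary: a rule: less_induct)
  case less
  obtain k p' where k: "k + 2 \<le> e" and p': "p' \<in> P" "0 < a p'"
    "site a p' mod int e = (site a p - int k) mod int e" "valid e P (retreat a p')"
    using block_end[OF less.prems(1,3,4)] by metis
  show ?case
  proof (cases "p' = p")
    case True
    have "retreat a p' r = 0" if "r \<notin> P" for r using that less.prems(2) p'(1) by auto
    then obtain t where "walk e P t (retreat a p)"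
      using walk_exists[OF p'(4)] True by blast
    then have "walk e P (t @ [(site a p - 1) mod int e] @ []) a"
      using walk_snocI less.prems by simp
    then show ?thesis by (intro exI[of _ t] exI[of _ "[]"]) auto
  next
    case False
    then have k0: "0 < k" using valid_distinct[OF less.prems(1) p'(1) less.prems(3)] p'(3) by (cases k) auto
    have eq: "retreat a p' p = a p" "site (retreat a p') p = site a p" using False p' by (auto simp: site_retreat)
    have zero: "retreat a p' r = 0" if "r \<notin> P" for r using that less.prems(2) p'(1) by auto
    have pos: "0 < retreat a p' p" using eq less.prems(4) by simp
    obtain t w where tw: "walk e P (t @ [(site a p - 1) mod int e] @ w) (retreat a p')"
      "\<forall>x\<in>set w. x mod int e \<noteq> (site a p - 1) mod int e \<and> x mod int e \<noteq> site a p mod int e"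
      using less.hyps[of "retreat a p'", OF sum_retreat[of _ a, OF p'(1,2)] p'(4) zero less.prems(3) pos] eq(2) by auto
    let ?x = "(site a p' - 1) mod int e"
    have x: "?x mod int e = (site a p - 1 - int k) mod int e"
      using p'(3) mod_eq_shift(2)[of "site a p'" 1 "int e" "site a p - int k"] by (simp add: algebra_simps)
    have "?x mod int e \<noteq> (site a p - 1) mod int e"
      unfolding x using mod_eq_close[of "site a p - 1 - int k" "int e" "site a p - 1"] k k0 by auto
    moreover have "?x mod int e \<noteq> site a p mod int e"
      unfolding x using mod_eq_close[of "site a p - 1 - int k" "int e" "site a p"] k k0 by auto
    moreover have "walk e P (t @ [(site a p - 1) mod int e] @ (w @ [?x])) a"
      using walk_snocI[OF tw(1) p'(1,2) less.prems(1)] by simp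
    ultimately show ?thesis using tw(2) by (intro exI[of _ t] exI[of _ "w @ [?x]"]) auto
  qed
qed

text \<open>Undo the last step of a particle for which this step has the residue \<open>i + d\<close> with the least
  \<open>d\<close>. A particle that blocks it has made a last step of residue \<open>i + d - 1\<close>, contrary to the
  choice of \<open>d\<close> or, for \<open>d = 0\<close>, to the assumption. Continue until \<open>d = 0\<close>; the residue \<open>i - 1\<close>
  never occurs, as \<open>d \<le> e - 2\<close> by the assumption.\<close>

lemma walk_gap:
  assumes "valid e P a" "\<And>p. p \<notin> P \<Longrightarrow> a p = 0"
    and "\<And>p. p \<in> P \<Longrightarrow> 0 < a p \<Longrightarrow> site a p mod int e \<noteq> i mod int e"
    and "p \<in> P" "j < a p" "(p + int j) mod int e = i mod int e"
  shows "\<exists>t w. walk e P (t @ [i mod int e] @ w) a \<and>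
    (\<forall>x\<in>set w. x mod int e \<noteq> i mod int e \<and> x mod int e \<noteq> (i - 1) mod int e)"
  using assms
proof (induction "\<Sum>p\<in>P. a p" arbitrary: a rule: less_induct)
  case less
  define occupied where "occupied d \<longleftrightarrow> (\<exists>r\<in>P. 0 < a r \<and> (site a r - 1) mod int e = (i + int d) mod int e)" for d :: nat
  have occ_p: "occupied (nat ((site a p - 1 - i) mod int e))"
  proof -
    have "(i + (site a p - 1 - i) mod int e) mod int e = (site a p - 1) mod int e"
      by (simp add: mod_add_right_eq)
    then show ?thesis unfolding occupied_def using less.prems(4,5) e_gt1 by (intro bexI[of _ p]) auto
  qed
  define d where "d = (LEAST d. occupied d)"
  have d: "occupied d" and "d \<le> nat ((site a p - 1 - i) mod int e)"
    unfolding d_def by (rule LeastI[of occupied, OF occ_p], rule Least_le[of occupied, OF occ_p])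
  have less_d: "\<not> occupied c" if "c < d" for c using that not_less_Least unfolding d_def by blast
  obtain r where r: "r \<in> P" "0 < a r" "(site a r - 1) mod int e = (i + int d) mod int e"
    using d unfolding occupied_def by blast
  have de: "d + 1 < e"
  proof -
    have "nat ((site a p - 1 - i) mod int e) < e" using e_gt1 by (simp add: nat_less_iff)
    then have "d < e" using \<open>d \<le> _\<close> by linarith
    moreover have "d \<noteq> e - 1"
    proof
      assume "d = e - 1"
      then have "i + int d = i - 1 + int e" using e_gt1 by (simp add: of_nat_diff)
      then have "(i + int d) mod int e = (i - 1 + int e) mod int e" by (rule arg_cong)
      then have "(site a r - 1) mod int e = (i - 1) mod int e" using r(3) by simp
      then show False using less.prems(3)[OF r(1,2)] mod_eq_shift(2) by blast
    qed
    ultimately show ?thesis by linarith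
  qed
  have valid: "valid e P (retreat a r)"
  proof (rule valid_retreat[OF less.prems(1) r(1,2)])
    fix r' assume r': "r' \<in> P"
    show "site a r' mod int e \<noteq> (site a r - 1) mod int e"
    proof
      assume eq: "site a r' mod int e = (site a r - 1) mod int e"
      have pos: "0 < a r'" by (rule moved_behind[OF less.prems(1) r(1,2) r' eq])
      show False
      proof (cases d)
        case 0
        then show False using less.prems(3)[OF r' pos] eq r(3) by simp
      next
        case (Suc c)
        have "(site a r' - 1) mod int e = (i + int d - 1) mod int e"
          using eq r(3) mod_eq_shift(2) by metis
        then have "occupied c" unfolding occupied_def using r' pos Suc by (intro bexI[of _ r']) (auto simp: algebra_simps)
        then show False using less_d Suc by simp
      qed
    qed
  qed
  have zero: "retreat a r s = 0" if "s \<notin> P" for s using that less.prems(2) r(1) by auto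
  show ?case
  proof (cases "d = 0")
    case True
    obtain t where "walk e P t (retreat a r)" using walk_exists[OF valid] zero by auto
    then have "walk e P (t @ [i mod int e] @ []) a"
      using walk_snocI[OF _ r(1,2) less.prems(1)] r(3) True by simp
    then show ?thesis by (intro exI[of _ t] exI[of _ "[]"]) auto
  next
    case False
    have 1: "(i + int d) mod int e \<noteq> i mod int e"
      using mod_eq_close[of "i + int d" "int e" i] de False by auto
    have 2: "(i + int d) mod int e \<noteq> (i - 1) mod int e"
      using mod_eq_close[of "i + int d" "int e" "i - 1"] de by auto
    have hyp: "site (retreat a r) s mod int e \<noteq> i mod int e" if "s \<in> P" "0 < retreat a r s" for s
    proof (cases "s = r")
      case True
      then show ?thesis using r(2,3) 1 by (simp add: site_retreat)
    next
      case False
      then show ?thesis using less.prems(3)[of s] that r(2) by (simp add: site_retreat)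
    qed
    have j: "j < retreat a r p"
    proof (cases "p = r")
      case True
      have "j \<noteq> a r - 1"
      proof
        assume "j = a r - 1"
        then have "site a r - 1 = p + int j" using True r(2) by (simp add: site_def of_nat_diff)
        then show False using 1 r(3) less.prems(6) by simp
      qed
      then show ?thesis using True less.prems(5) by auto
    qed (use less.prems(5) in auto)
    obtain t w where tw: "walk e P (t @ [i mod int e] @ w) (retreat a r)"
      "\<forall>x\<in>set w. x mod int e \<noteq> i mod int e \<and> x mod int e \<noteq> (i - 1) mod int e"
      using less.hyps[of "retreat a r", OF sum_retreat[of _ a, OF r(1,2)] valid zero hyp less.prems(4) j less.prems(6)] by blast
    have "walk e P (t @ [i mod int e] @ (w @ [(i + int d) mod int e])) a"
      using walk_snocI[OF tw(1) r(1,2) less.prems(1)] r(3) by simp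
    then show ?thesis
      using tw(2) 1 2 by (intro exI[of _ t] exI[of _ "w @ [(i + int d) mod int e]"]) auto
  qed
qed

text \<open>Two consecutive steps are made either by one particle, with successive residues, or by two
  particles, which then arrive at different points.\<close>

lemma walk_neighbours: "walk e P (t @ [i, j]) a \<Longrightarrow> i \<noteq> j"
proof -
  assume "walk e P (t @ [i, j]) a"
  then have "walk e P ((t @ [i]) @ [j]) a" by simp
  then obtain p' where p': "p' \<in> P" "0 < a p'" "j = (site a p' - 1) mod int e" "walk e P (t @ [i]) (retreat a p')" "valid e P a"
    by (rule walk_snocE)
  obtain p where p: "p \<in> P" "0 < retreat a p' p" "i = (site (retreat a p') p - 1) mod int e"
    using p'(4) by (rule walk_snocE)
  show "i \<noteq> j"
  proof (cases "p = p'")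
    case True
    then show ?thesis
      using p p' mod_eq_close[of "site a p' - 1 - 1" "int e" "site a p' - 1"] e_gt1 by (auto simp: site_retreat)
  next
    case False
    then show ?thesis
      using p p' valid_distinct[OF p'(5) p(1) p'(1)] mod_eq_shift(2) by (auto simp: site_retreat)
  qed
qed

text \<open>A particle that makes both steps of residue \<open>i\<close> moves by one or two points from the first to
  the second, so that \<open>e \<le> 2\<close>. Two different particles would collide: at \<open>i\<close> before the first step
  if its particle makes the middle step as well, and at \<open>i + 1\<close> after the last step otherwise.\<close>

lemma walk_second_neighbours:
  assumes "walk e P (t @ [i, j, i]) a"
  shows "e = 2"
proof (rule ccontr)
  assume "e \<noteq> 2"
  have "walk e P ((t @ [i, j]) @ [i]) a" using assms by simp
  then obtain p3 where p3: "p3 \<in> P" "0 < a p3" "i = (site a p3 - 1) mod int e" "walk e P (t @ [i, j]) (retreat a p3)" "valid e P a"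
    by (rule walk_snocE)
  define a2 where "a2 = retreat a p3"
  have "walk e P ((t @ [i]) @ [j]) a2" using p3(4) by (simp add: a2_def)
  then obtain p2 where p2: "p2 \<in> P" "0 < a2 p2" "j = (site a2 p2 - 1) mod int e" "walk e P (t @ [i]) (retreat a2 p2)" "valid e P a2"
    by (rule walk_snocE)
  define a1 where "a1 = retreat a2 p2"
  have "walk e P (t @ [i]) a1" using p2(4) by (simp add: a1_def)
  then obtain p1 where p1: "p1 \<in> P" "0 < a1 p1" "i = (site a1 p1 - 1) mod int e" "walk e P t (retreat a1 p1)" "valid e P a1"
    by (rule walk_snocE)
  have s2: "site a2 r = (if r = p3 then site a p3 - 1 else site a r)" for r
    unfolding a2_def using p3(2) by (simp add: site_retreat)
  have s1: "site a1 r = (if r = p2 then site a2 p2 - 1 else site a2 r)" for r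
    unfolding a1_def using p2(2) by (simp add: site_retreat)
  have e3: "2 < int e" using e_gt1 \<open>e \<noteq> 2\<close> by linarith
  have i: "(site a1 p1 - 1) mod int e = (site a p3 - 1) mod int e" using p1(3) p3(3) by simp
  show False
  proof (cases "p1 = p3")
    case True
    then have "site a1 p1 - 1 = site a p3 - 3 \<or> site a1 p1 - 1 = site a p3 - 2"
      using s1[of p1] s2[of p1] by (auto split: if_splits)
    then show False using mod_eq_close[OF i] e3 by auto
  next
    case False
    show False
    proof (cases "p2 = p1")
      case True
      have "valid e P (retreat a1 p1)" using walk_invariant[OF p1(4)] by blast
      moreover have "site (retreat a1 p1) p1 = site a1 p1 - 1" "site (retreat a1 p1) p3 = site a p3 - 1"
        using p1(2) False True s1[of p3] s2[of p3] by (auto simp: site_retreat)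
      ultimately show False using valid_distinct[OF _ p1(1) p3(1)] i False by metis
    next
      case p21: False
      then have "site a1 p1 = site a p1" using s1[of p1] s2[of p1] False by auto
      then have "site a p1 mod int e = site a p3 mod int e" using i mod_eq_shift(2) by metis
      then show False using valid_distinct[OF p3(5) p1(1) p3(1)] False by blast
    qed
  qed
qed

text \<open>Steps of different residues that are not adjacent belong to particles that are not next to
  each other, and these can move in either order.\<close>

lemma walk_swap_last:
  assumes "walk e P (t @ [i, j]) a" "\<not> adjacent e i j"
  shows "walk e P (t @ [j, i]) a"
proof -
  have "walk e P ((t @ [i]) @ [j]) a" using assms(1) by simp
  then obtain p' where p': "p' \<in> P" "0 < a p'" "j = (site a p' - 1) mod int e" "walk e P (t @ [i]) (retreat a p')" "valid e P a"
    by (rule walk_snocE)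
  obtain p where p: "p \<in> P" "0 < retreat a p' p" "i = (site (retreat a p') p - 1) mod int e"
      "walk e P t (retreat (retreat a p') p)" "valid e P (retreat a p')"
    using p'(4) by (rule walk_snocE)
  have ne: "p \<noteq> p'"
  proof
    assume "p = p'"
    then have "i = (site a p' - 1 - 1) mod int e" using p p'(2) by (simp add: site_retreat)
    then have "j mod int e = (i + 1) mod int e" using p'(3) by (simp add: mod_simps)
    then show False using assms(2) unfolding adjacent_def by blast
  qed
  have ap: "0 < a p" "i = (site a p - 1) mod int e" using p ne p'(2) by (auto simp: site_retreat)
  have "valid e P (retreat a p)"
  proof (rule valid_retreat[OF p'(5) p(1) ap(1)])
    fix r assume r: "r \<in> P"
    show "site a r mod int e \<noteq> (site a p - 1) mod int e"
    proof
      assume eq: "site a r mod int e = (site a p - 1) mod int e"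
      show False
      proof (cases "r = p'")
        case True
        then have "i = site a p' mod int e" using eq ap(2) by simp
        then have "i mod int e = (j + 1) mod int e" using p'(3) by (simp add: mod_simps)
        then show False using assms(2) unfolding adjacent_def by blast
      next
        case False
        have "valid e P (retreat (retreat a p') p)" using walk_invariant[OF p(4)] by blast
        then show False
          using valid_retreat_free[of "retreat a p'" p r, OF _ p(1) r p(2)] eq False ne p'(2) by (auto simp: site_retreat)
      qed
    qed
  qed
  moreover have "retreat (retreat a p') p = retreat (retreat a p) p'" using ne by auto
  ultimately have "walk e P (t @ [(site (retreat a p) p' - 1) mod int e]) (retreat a p)"
    using p(4) p'(1,2) ne by (intro walk_snocI) auto
  then have "walk e P (t @ [j]) (retreat a p)" using p'(3) ne ap(1) by (simp add: site_retreat)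
  then have "walk e P ((t @ [j]) @ [(site a p - 1) mod int e]) a"
    using p(1) ap(1) p'(5) by (intro walk_snocI)
  then show ?thesis using ap(2) by simp
qed

lemma walk_swap:
  "walk e P (t @ [i, j] @ r) a \<Longrightarrow> \<not> adjacent e i j \<Longrightarrow> walk e P (t @ [j, i] @ r) a"
proof (induction r arbitrary: a rule: rev_induct)
  case Nil
  then show ?case using walk_swap_last by simp
next
  case (snoc x r)
  have "walk e P ((t @ [i, j] @ r) @ [x]) a" using snoc.prems(1) by simp
  then obtain p where p: "p \<in> P" "0 < a p" "x = (site a p - 1) mod int e" "walk e P (t @ [i, j] @ r) (retreat a p)" "valid e P a"
    by (rule walk_snocE)
  then show ?case using walk_snocI[OF snoc.IH[OF p(4) snoc.prems(2)] p(1,2,5)] by simp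
qed

end

section \<open>Words with the same final state\<close>

inductive linked :: "nat \<Rightarrow> int list \<Rightarrow> int list \<Rightarrow> bool" for e w where
  linked_refl: "linked e w w"
| linked_swap: "linked e w v \<Longrightarrow> 1 \<le> k \<Longrightarrow> k < length v \<Longrightarrow> \<not> adjacent e (v ! (k - 1)) (v ! k) \<Longrightarrow>
    linked e w (swap_letters k v)"

lemma linked_trans: "linked e v x \<Longrightarrow> linked e w v \<Longrightarrow> linked e w x"
  by (induction rule: linked.induct) (auto intro: linked_swap)

lemma swap_letters_append: "k < length v \<Longrightarrow> swap_letters k (v @ u) = swap_letters k v @ u"
  by (rule nth_equalityI) (auto simp: swap_letters_def nth_append nth_list_update)

lemma linked_append: "linked e w v \<Longrightarrow> linked e (w @ u) (v @ u)"
proof (induction rule: linked.induct)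
  case (linked_swap v k)
  then have "linked e (w @ u) (swap_letters k (v @ u))"
    by (intro linked.linked_swap) (auto simp: nth_append)
  then show ?case using linked_swap by (simp add: swap_letters_append)
qed (rule linked_refl)

lemma swap_letters_middle: "swap_letters (Suc (length t)) (t @ [i, j] @ r) = t @ [j, i] @ r"
  by (simp add: swap_letters_def nth_append list_update_append)

lemma linked_last: "\<not> adjacent e i j \<Longrightarrow> linked e (t @ [i, j]) (t @ [j, i])"
  using linked_swap[OF linked_refl, of "Suc (length t)" "t @ [i, j]" e] swap_letters_middle[of t i j "[]"]
  by (simp add: nth_append)

lemma split_at_swap:
  assumes "1 \<le> k" "k < length w"
  obtains t r where "w = t @ [w ! (k - 1), w ! k] @ r" "swap_letters k w = t @ [w ! k, w ! (k - 1)] @ r"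
proof -
  let ?t = "take (k - 1) w" and ?r = "drop (Suc k) w"
  have "w = take (k - 1) w @ w ! (k - 1) # drop (Suc (k - 1)) w"
    using assms by (intro id_take_nth_drop) auto
  also have "drop (Suc (k - 1)) w = w ! k # drop (Suc k) w"
    using assms by (simp add: Cons_nth_drop_Suc)
  finally have w: "w = ?t @ [w ! (k - 1), w ! k] @ ?r" by simp
  have "Suc (length ?t) = k" using assms by simp
  then have "swap_letters k w = ?t @ [w ! k, w ! (k - 1)] @ ?r"
    using swap_letters_middle[of ?t "w ! (k - 1)" "w ! k" ?r] w by metis
  then show thesis using w that by blast
qed

context particles
begin

text \<open>If the last steps of two walks belong to different particles \<open>p\<close> and \<open>p'\<close>, both can be moved
  back, as neither blocks the other. So the two words are linked through walks that end with the
  steps of \<open>p\<close> and \<open>p'\<close> in either order.\<close>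

lemma walk_linked: "walk e P w a \<Longrightarrow> walk e P v a \<Longrightarrow> linked e w v"
proof (induction "length w" arbitrary: w v a)
  case 0
  then have "length v = 0" using walk_invariant[of w a] walk_invariant[of v a] by auto
  then show ?case using 0 linked_refl by auto
next
  case (Suc n)
  have len: "length v = length w" using walk_invariant Suc.prems by auto
  obtain w' i where w: "w = w' @ [i]" using Suc.hyps(2) by (cases w rule: rev_cases) auto
  obtain v' j where v: "v = v' @ [j]" using Suc.hyps(2) len by (cases v rule: rev_cases) auto
  have n: "n = length w'" "n = length v'" using Suc.hyps(2) w v len by auto
  obtain p where p: "p \<in> P" "0 < a p" "i = (site a p - 1) mod int e" "walk e P w' (retreat a p)" and a: "valid e P a"
    using Suc.prems(1) unfolding w by (rule walk_snocE)
  obtain p' where p': "p' \<in> P" "0 < a p'" "j = (site a p' - 1) mod int e" "walk e P v' (retreat a p')"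
    using Suc.prems(2) unfolding v by (rule walk_snocE)
  show ?case
  proof (cases "p = p'")
    case True
    then show ?thesis
      unfolding w v using Suc.hyps(1)[OF n(1) p(4)] p p' by (auto intro: linked_append)
  next
    case False
    have vp: "valid e P (retreat a p)" and vp': "valid e P (retreat a p')"
      using walk_invariant p(4) p'(4) by blast+
    let ?b = "retreat (retreat a p) p'"
    have b: "?b = retreat (retreat a p') p" using False by auto
    have "valid e P ?b"
      unfolding valid_def
    proof (intro ballI impI)
      fix r r' assume r: "r \<in> P" "r' \<in> P" "r < r'"
      have "site ?b s = (if s = p then site a p - 1 else if s = p' then site a p' - 1 else site a s)" for s
        using p(2) p'(2) False by (auto simp: site_def of_nat_diff)
      moreover have "site (retreat a p) s = (if s = p then site a p - 1 else site a s)"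
        "site (retreat a p') s = (if s = p' then site a p' - 1 else site a s)" for s
        using p(2) p'(2) by (auto simp: site_retreat)
      ultimately show "site ?b r < site ?b r' \<and> site ?b r' < site ?b r + int e"
        using a vp vp' r unfolding valid_def by (smt (verit))
    qed
    moreover have "?b s = 0" if "s \<notin> P" for s
      using that walk_invariant[OF Suc.prems(1)] by auto
    ultimately obtain u where u: "walk e P u ?b" using walk_exists by blast
    have "walk e P (u @ [(site (retreat a p) p' - 1) mod int e]) (retreat a p)"
      using u p' False vp by (intro walk_snocI) auto
    then have uj: "walk e P (u @ [j]) (retreat a p)" using False p p' by (simp add: site_retreat)
    have "walk e P (u @ [(site (retreat a p') p - 1) mod int e]) (retreat a p')"
      using u p False vp' unfolding b by (intro walk_snocI) auto
    then have ui: "walk e P (u @ [i]) (retreat a p')" using False p p' by (simp add: site_retreat)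
    have na: "\<not> adjacent e j i"
    proof
      assume "adjacent e j i"
      then have "j mod int e = (i + 1) mod int e \<or> i mod int e = (j + 1) mod int e"
        unfolding adjacent_def .
      then have "(site a p' - 1) mod int e = site a p mod int e \<or> (site a p - 1) mod int e = site a p' mod int e"
        using p(3) p'(3) by (simp add: mod_simps)
      then show False
        using valid_retreat_free[OF vp p(1) p'(1) p(2)] valid_retreat_free[OF vp' p'(1) p(1) p'(2)] by auto
    qed
    have "linked e (w' @ [i]) (u @ [j] @ [i])"
      using linked_append[OF Suc.hyps(1)[OF n(1) p(4) uj], of "[i]"] by simp
    moreover have "linked e (u @ [j] @ [i]) (u @ [i] @ [j])"
      using linked_last[OF na, of u] by simp
    moreover have "linked e (u @ [i] @ [j]) (v' @ [j])"
    proof -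
      have "length u = length v' - 1" "n = length (u @ [i])"
        using walk_invariant[OF ui] walk_invariant[OF p'(4)] n by auto
      then show ?thesis using linked_append[OF Suc.hyps(1)[OF _ ui p'(4)], of "[j]"] by simp
    qed
    ultimately show ?thesis unfolding w v using linked_trans by blast
  qed
qed

end

lemma word_set_walks:
  assumes "particles e P" "root_of_unity e q" "valid e P a" "\<And>p. p \<notin> P \<Longrightarrow> a p = 0"
  shows "word_set e q (\<Sum>p\<in>P. a p) {w. walk e P w a}"
proof -
  interpret particles e P by fact
  let ?n = "\<Sum>p\<in>P. a p" and ?W = "{w. walk e P w a}"
  have inv: "length w = ?n" "set w \<subseteq> {0..<int e}" if "w \<in> ?W" for w
    using walk_invariant that by auto
  show ?thesis
  proof (intro word_set.intro word_set_axioms.intro assms(2))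
    have "?W \<subseteq> {w. set w \<subseteq> {0..<int e} \<and> length w = ?n}" using inv by auto
    then show "finite ?W" by (rule finite_subset) (rule finite_lists_length_eq, simp)
    show "?W \<noteq> {}" using walk_exists[OF assms(3,4)] by auto
    fix w k assume w: "w \<in> ?W" and k: "1 \<le> k" "k < ?n"
    then obtain t r where t: "w = t @ [w ! (k - 1), w ! k] @ r" "swap_letters k w = t @ [w ! k, w ! (k - 1)] @ r"
      using split_at_swap[of k w] inv by metis
    have "walk e P ((t @ [w ! (k - 1), w ! k]) @ r) a" using w t(1) by simp
    then show "w ! (k - 1) \<noteq> w ! k" using walk_prefix walk_neighbours by blast
    show "swap_letters k w \<in> ?W" if "\<not> adjacent e (w ! (k - 1)) (w ! k)"
    proof -
      have "walk e P (t @ [w ! (k - 1), w ! k] @ r) a" using w t(1) by simp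
      then have "walk e P (t @ [w ! k, w ! (k - 1)] @ r) a" using that by (rule walk_swap)
      then show ?thesis using t(2) by simp
    qed
  next
    fix w k assume w: "w \<in> ?W" and e2: "e \<noteq> 2" and k: "1 \<le> k" "Suc k < ?n"
    have len: "length w = ?n" using inv w by simp
    have "w = take (k - 1) w @ w ! (k - 1) # drop (Suc (k - 1)) w"
      using k len by (intro id_take_nth_drop) auto
    also have "drop (Suc (k - 1)) w = w ! k # w ! Suc k # drop (Suc (Suc k)) w"
      using k len by (simp add: Cons_nth_drop_Suc)
    finally have "walk e P ((take (k - 1) w @ [w ! (k - 1), w ! k, w ! Suc k]) @ drop (Suc (Suc k)) w) a"
      using w by simp
    then have "\<exists>b. walk e P (take (k - 1) w @ [w ! (k - 1), w ! k, w ! Suc k]) b" by (rule walk_prefix)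
    then show "w ! (k - 1) \<noteq> w ! Suc k" using walk_second_neighbours e2 by metis
  next
    fix S assume S: "S \<subseteq> ?W" "S \<noteq> {}"
      and closed: "\<And>w k. w \<in> S \<Longrightarrow> 1 \<le> k \<Longrightarrow> k < ?n \<Longrightarrow> \<not> adjacent e (w ! (k - 1)) (w ! k) \<Longrightarrow> swap_letters k w \<in> S"
    obtain w where w: "w \<in> S" using S by blast
    have "v \<in> S" if "linked e w v" for v
      using that
    proof (induction rule: linked.induct)
      case (linked_swap v k)
      then show ?case using closed[of v k] inv(1)[of v] S(1) by auto
    qed (rule w)
    moreover have "linked e w v" if "v \<in> ?W" for v
      using walk_linked w S(1) that by blast
    ultimately show "S = ?W" using S(1) by blast
  qed (use inv in auto)
qed

section \<open>The signature rule\<close>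

lemma set_reduce: "set (reduce P bs) \<subseteq> set bs"
  by (induction bs) (auto split: list.splits if_splits)

lemma reduce_cong: "(\<And>b. b \<in> set bs \<Longrightarrow> P b = P' b) \<Longrightarrow> reduce P bs = reduce P' bs"
proof (induction bs)
  case (Cons b bs)
  have "set (reduce P bs) \<subseteq> set bs" by (rule set_reduce)
  then show ?case using Cons by (auto split: list.splits)
qed simp

lemma reduce_all_plus: "(\<And>b. b \<in> set bs \<Longrightarrow> P b) \<Longrightarrow> reduce P bs = bs"
  by (induction bs) (auto split: list.splits)

lemma reduce_append_minus:
  assumes "\<And>b. b \<in> set (reduce P zs) \<Longrightarrow> \<not> P b"
  shows "reduce P (xs @ zs) = reduce P xs @ reduce P zs"
  using assms by (induction xs) (auto split: list.splits)

text \<open>Entries \<open>-\<close> of \<open>xs\<close> can only cancel entries at the beginning of the reduced list of \<open>zs\<close>.\<close>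

lemma reduce_append: "\<exists>us k. reduce P (xs @ zs) = us @ drop k (reduce P zs) \<and> set us \<subseteq> set xs"
proof (induction xs)
  case Nil
  show ?case by (rule exI[of _ "[]"], rule exI[of _ 0]) simp
next
  case (Cons x xs)
  then obtain us k where us: "reduce P (xs @ zs) = us @ drop k (reduce P zs)" "set us \<subseteq> set xs" by blast
  consider "us @ drop k (reduce P zs) = []" | y ys where "us @ drop k (reduce P zs) = y # ys" by (cases "us @ drop k (reduce P zs)") auto
  then show ?case
  proof cases
    case 1
    then show ?thesis using us by (intro exI[of _ "[x]"] exI[of _ k]) auto
  next
    case 2
    show ?thesis
    proof (cases "\<not> P x \<and> P y")
      case False
      then show ?thesis using us 2 by (intro exI[of _ "x # us"] exI[of _ k]) auto
    next
      case True
      show ?thesis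
      proof (cases us)
        case Nil
        then have "ys = drop (Suc k) (reduce P zs)" using 2 by (metis append_Nil drop_Suc list.sel(3) tl_drop)
        then show ?thesis using us 2 True Nil by (intro exI[of _ "[]"] exI[of _ "Suc k"]) auto
      next
        case (Cons u us')
        then show ?thesis using us 2 True by (intro exI[of _ us'] exI[of _ k]) auto
      qed
    qed
  qed
qed

text \<open>The entry \<open>+\<close> at the front of the reduced list of \<open>zs\<close> cancels the last \<open>-\<close> that survives in
  \<open>xs\<close>, if there is one.\<close>

lemma reduce_append_plus:
  assumes zs: "reduce P zs = b # ms" "P b" "\<And>x. x \<in> set ms \<Longrightarrow> \<not> P x"
  shows "reduce P (xs @ zs) = (if \<forall>x\<in>set (reduce P xs). P x then reduce P xs @ b # ms else butlast (reduce P xs) @ ms)"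
proof (induction xs)
  case Nil
  then show ?case using zs by simp
next
  case (Cons x xs)
  show ?case
  proof (cases "reduce P xs")
    case Nil
    then have "reduce P (xs @ zs) = b # ms" using Cons by simp
    then show ?thesis using Nil assms(2) by (cases "P x") simp_all
  next
    case R: (Cons r R)
    show ?thesis
    proof (cases "R = []")
      case True
      then have "reduce P (xs @ zs) = (if P r then r # b # ms else ms)" using Cons R by simp
      then show ?thesis using R True assms(3) by (cases "P x"; cases "P r"; cases ms) simp_all
    next
      case False
      define T where "T = (if \<forall>x\<in>set (r # R). P x then R @ b # ms else butlast R @ ms)"
      have "reduce P (xs @ zs) = r # T" using Cons R False by (simp add: T_def)
      then show ?thesis using R False by (cases "P x"; cases "P r") (simp_all add: T_def)
    qed
  qed
qed

text \<open>An entry \<open>-\<close> surviving in \<open>xs\<close> would cancel the entry \<open>b\<close>, and a \<open>+\<close> surviving in \<open>ys\<close> would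
  come after \<open>b\<close>.\<close>

lemma last_plus_surrounding:
  assumes "distinct (xs @ b # ys)" "P b"
    and ne: "filter P (reduce P (xs @ b # ys)) \<noteq> []" and last: "last (filter P (reduce P (xs @ b # ys))) = b"
  shows "\<And>x. x \<in> set (reduce P xs) \<Longrightarrow> P x" and "\<And>y. y \<in> set (reduce P ys) \<Longrightarrow> \<not> P y"
proof -
  let ?R = "reduce P (xs @ b # ys)"
  have "b \<in> set (filter P ?R)" using last_in_set[OF ne] last by simp
  then have b: "b \<in> set ?R" by simp
  have nb: "b \<notin> set xs" "b \<notin> set ys" using assms(1) by auto
  have bys: "reduce P (b # ys) = b # reduce P ys" using assms(2) by (auto split: list.splits)
  show ys: "\<not> P y" if "y \<in> set (reduce P ys)" for y
  proof
    assume "P y"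
    obtain us k where us: "?R = us @ drop k (b # reduce P ys)" "set us \<subseteq> set xs"
      using reduce_append[of P xs "b # ys"] bys by auto
    have "k = 0"
    proof (rule ccontr)
      assume "k \<noteq> 0"
      then have "set (drop k (b # reduce P ys)) \<subseteq> set ys"
        using set_drop_subset[of "k - 1" "reduce P ys"] set_reduce[of P ys] by (cases k) auto
      then show False using b us nb by auto
    qed
    then have "filter P ?R = filter P us @ b # filter P (reduce P ys)" using us assms(2) by simp
    moreover have "filter P (reduce P ys) \<noteq> []" using that \<open>P y\<close> by (auto simp: filter_empty_conv)
    ultimately have "last (filter P ?R) = last (filter P (reduce P ys))" by simp
    also have "\<dots> \<in> set (filter P (reduce P ys))" using \<open>filter P (reduce P ys) \<noteq> []\<close> by (rule last_in_set)
    finally show False using last set_reduce[of P ys] nb by auto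
  qed
  show "P x" if "x \<in> set (reduce P xs)" for x
  proof (rule ccontr)
    assume "\<not> P x"
    then have "?R = butlast (reduce P xs) @ reduce P ys"
      using reduce_append_plus[OF bys assms(2) ys] that by auto
    then have "b \<in> set (reduce P xs) \<union> set (reduce P ys)" using b by (auto dest: in_set_butlastD)
    then show False using set_reduce[of P xs] set_reduce[of P ys] nb by auto
  qed
qed

text \<open>The reduced list has the form \<open>(+)\<^sup>a b (-)\<^sup>c\<close>, and remains reduced when \<open>b\<close> is turned into a
  \<open>-\<close>, which then is the first one.\<close>

lemma flip_last_plus:
  assumes "distinct bs" "b \<in> set bs" "P b"
    and ne: "filter P (reduce P bs) \<noteq> []" and last: "last (filter P (reduce P bs)) = b"
    and P': "\<And>x. P' x \<longleftrightarrow> P x \<and> x \<noteq> b"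
  shows "filter (\<lambda>x. \<not> P' x) (reduce P' bs) \<noteq> []" "hd (filter (\<lambda>x. \<not> P' x) (reduce P' bs)) = b"
proof -
  obtain xs ys where bs: "bs = xs @ b # ys" using split_list[OF assms(2)] by blast
  have nb: "b \<notin> set xs" "b \<notin> set ys" using assms(1) bs by auto
  note s = last_plus_surrounding[OF assms(1)[unfolded bs] assms(3) ne[unfolded bs] last[unfolded bs]]
  have eq: "reduce P' xs = reduce P xs" "reduce P' ys = reduce P ys"
    using nb by (auto intro!: reduce_cong simp: P')
  have "reduce P' (b # ys) = b # reduce P ys"
    using s(2) eq by (auto split: list.splits simp: P')
  moreover have "\<not> P' x" if "x \<in> set (b # reduce P ys)" for x using that s(2) P' by auto
  ultimately have R: "reduce P' bs = reduce P xs @ b # reduce P ys"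
    using reduce_append_minus[of P' "b # ys" xs] eq bs by simp
  have "b \<notin> set (reduce P xs)" using set_reduce[of P xs] nb by auto
  then have "filter (\<lambda>x. \<not> P' x) (reduce P xs) = []" using s(1) by (auto simp: filter_empty_conv P')
  then show "filter (\<lambda>x. \<not> P' x) (reduce P' bs) \<noteq> []" "hd (filter (\<lambda>x. \<not> P' x) (reduce P' bs)) = b"
    unfolding R by (auto simp: P')
qed

text \<open>An entry \<open>+\<close> next to \<open>b\<close> would cancel it.\<close>

lemma single_minus_last:
  assumes "distinct (xs @ b # ys)" "\<not> P b" "b \<in> set (reduce P (xs @ b # ys))" "\<And>y. y \<in> set ys \<Longrightarrow> P y"
  shows "ys = []"
proof (cases ys)
  case (Cons y ys')
  have "reduce P ys = ys" using assms(4) by (rule reduce_all_plus)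
  then have "reduce P (b # ys) = ys'" using Cons assms(2,4) by simp
  then obtain us k where "reduce P (xs @ b # ys) = us @ drop k ys'" "set us \<subseteq> set xs"
    using reduce_append[of P xs "b # ys"] by auto
  then show ?thesis using assms(1,3) set_drop_subset[of k ys'] Cons by auto
qed

section \<open>Addable and removable boxes\<close>

definition shape :: "nat \<Rightarrow> mpart \<Rightarrow> bool" where
  "shape l \<Lambda> \<longleftrightarrow>
     (\<forall>m k. m \<notin> {1..l} \<or> k = 0 \<longrightarrow> \<Lambda> m k = 0) \<and> (\<forall>m k. 1 \<le> k \<longrightarrow> \<Lambda> m (Suc k) \<le> \<Lambda> m k) \<and> finite (boxes \<Lambda>)"

lemma multipartition_shape: "multipartition l n \<Lambda> \<longleftrightarrow> shape l \<Lambda> \<and> card (boxes \<Lambda>) = n"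
  unfolding multipartition_def shape_def by auto

lemma shape_outside: "shape l \<Lambda> \<Longrightarrow> 0 < \<Lambda> m r \<Longrightarrow> 1 \<le> m \<and> m \<le> l \<and> 1 \<le> r"
  unfolding shape_def by (metis atLeastAtMost_iff less_numeral_extra(3) not_less_eq_eq One_nat_def not0_implies_Suc Suc_le_eq zero_less_Suc)

lemma shape_decreasing:
  assumes "shape l \<Lambda>" "1 \<le> r" "r \<le> r'"
  shows "\<Lambda> m r' \<le> \<Lambda> m r"
  using assms(3)
proof (induction r' rule: dec_induct)
  case (step k)
  then have "\<Lambda> m (Suc k) \<le> \<Lambda> m k" using assms unfolding shape_def by auto
  then show ?case using step by simp
qed simp

lemma finite_nonzero_rows: "shape l \<Lambda> \<Longrightarrow> finite {(r, m). 0 < \<Lambda> m r}"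
proof -
  assume sh: "shape l \<Lambda>"
  have "{(r, m). 0 < \<Lambda> m r} \<subseteq> (\<lambda>(r, c, m). (r, m)) ` boxes \<Lambda>"
  proof
    fix x assume "x \<in> {(r, m). 0 < \<Lambda> m r}"
    then obtain r m where x: "x = (r, m)" "0 < \<Lambda> m r" by auto
    then have "(r, 1, m) \<in> boxes \<Lambda>" using shape_outside[OF sh] unfolding boxes_def by auto
    then show "x \<in> (\<lambda>(r, c, m). (r, m)) ` boxes \<Lambda>" using x by force
  qed
  then show ?thesis using sh finite_subset unfolding shape_def by blast
qed

lemma finite_corners: "shape l \<Lambda> \<Longrightarrow> finite {b. addable l \<Lambda> b \<or> removable l \<Lambda> b}"
proof -
  assume sh: "shape l \<Lambda>"
  let ?nz = "{(r, m). 0 < \<Lambda> m r}"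
  let ?A = "{1} \<times> {1..l} \<union> (\<lambda>(r, m). (Suc r, m)) ` ?nz"
  have "{b. addable l \<Lambda> b \<or> removable l \<Lambda> b} \<subseteq>
    (\<lambda>(r, m). (r, Suc (\<Lambda> m r), m)) ` ?A \<union> (\<lambda>(r, m). (r, \<Lambda> m r, m)) ` ?nz"
  proof
    fix b assume b: "b \<in> {b. addable l \<Lambda> b \<or> removable l \<Lambda> b}"
    obtain r c m where bb: "b = (r, c, m)" by (cases b)
    show "b \<in> (\<lambda>(r, m). (r, Suc (\<Lambda> m r), m)) ` ?A \<union> (\<lambda>(r, m). (r, \<Lambda> m r, m)) ` ?nz"
    proof (cases "addable l \<Lambda> b")
      case True
      then have r: "m \<in> {1..l}" "1 \<le> r" "c = Suc (\<Lambda> m r)" "r = 1 \<or> \<Lambda> m r < \<Lambda> m (r - 1)"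
        unfolding bb addable_def by auto
      have "(r, m) \<in> ?A"
      proof (cases "r = 1")
        case False
        then have "(r, m) = (\<lambda>(r, m). (Suc r, m)) (r - 1, m)" "(r - 1, m) \<in> ?nz" using r by auto
        then show ?thesis by blast
      qed (use r in auto)
      show ?thesis unfolding bb r(3)
        by (rule UnI1, rule image_eqI[of _ _ "(r, m)"]) (simp, rule \<open>(r, m) \<in> ?A\<close>)
    next
      case False
      then have "(r, m) \<in> ?nz" "c = \<Lambda> m r" using b unfolding bb removable_def by auto
      then show ?thesis unfolding bb by (intro UnI2 image_eqI[of _ _ "(r, m)"]) auto
    qed
  qed
  moreover have "finite ?nz" by (rule finite_nonzero_rows[OF sh])
  ultimately show ?thesis by (meson finite_UnI finite_imageI finite_SigmaI finite.intros finite_atLeastAtMost finite_subset)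
qed

lemma box_less_irrefl: "\<not> box_less s b b"
  and box_less_trans: "box_less s a b \<Longrightarrow> box_less s b c \<Longrightarrow> box_less s a c"
  unfolding box_less_def by auto

text \<open>The corners of one component lie on different diagonals. So corners with equal contents
  belong to different components, and \<open>box_less\<close> is total on the corners.\<close>

lemma corner_same_diagonal:
  assumes sh: "shape l \<Lambda>" and b: "addable l \<Lambda> (r, c, m) \<or> removable l \<Lambda> (r, c, m)"
    and b': "addable l \<Lambda> (r', c', m) \<or> removable l \<Lambda> (r', c', m)" and less: "r < r'"
  shows "int c - int r \<noteq> int c' - int r'"
proof
  assume "int c - int r = int c' - int r'"
  then have "c < c'" using less by linarith
  have r: "1 \<le> r" "c' \<le> Suc (\<Lambda> m r')" using b b' unfolding addable_def removable_def by auto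
  then have le: "c \<le> \<Lambda> m r'" using \<open>c < c'\<close> by linarith
  show False
  proof (cases "addable l \<Lambda> (r, c, m)")
    case True
    then have "\<Lambda> m r < c" unfolding addable_def by auto
    then show False using shape_decreasing[OF sh r(1), of r' m] less le by simp
  next
    case False
    then have "\<Lambda> m (Suc r) < c" using b unfolding removable_def by auto
    then show False using shape_decreasing[OF sh, of "Suc r" r' m] less le by simp
  qed
qed

lemma box_less_total:
  assumes sh: "shape l \<Lambda>" and b: "addable l \<Lambda> b \<or> removable l \<Lambda> b" "addable l \<Lambda> b' \<or> removable l \<Lambda> b'" "b \<noteq> b'"
  shows "box_less s b b' \<or> box_less s b' b"
proof (rule ccontr)
  assume *: "\<not> (box_less s b b' \<or> box_less s b' b)"
  obtain r c m r' c' m' where bb: "b = (r, c, m)" "b' = (r', c', m')" by (cases b, cases b')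
  have eq: "charged_content s b = charged_content s b'" "m = m'" using * unfolding box_less_def bb by auto
  then have d: "int c - int r = int c' - int r'" unfolding bb charged_content_def by simp
  have "r \<noteq> r'" using d eq b(3) bb by auto
  then show False
    using corner_same_diagonal[OF sh, of r c m r' c'] corner_same_diagonal[OF sh, of r' c' m r c] d b eq bb
    by (cases "r < r'") auto
qed

lemma sorted_list_exists:
  assumes "finite A" "\<And>x y. x \<in> A \<Longrightarrow> y \<in> A \<Longrightarrow> x \<noteq> y \<Longrightarrow> R x y \<or> R y x"
    and trans: "\<And>x y z. R x y \<Longrightarrow> R y z \<Longrightarrow> R x z"
  shows "\<exists>xs. set xs = A \<and> sorted_wrt R xs"
  using assms(1,2)
proof (induction A rule: finite_induct)
  case empty
  show ?case by (rule exI[of _ "[]"]) simp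
next
  case (insert a A)
  then obtain xs where xs: "set xs = A" "sorted_wrt R xs" by auto
  let ?ys = "filter (\<lambda>x. R x a) xs @ a # filter (\<lambda>x. \<not> R x a) xs"
  have "set ?ys = insert a A" using xs by auto
  moreover have "R a x" if "x \<in> A" "\<not> R x a" for x
    using insert.prems[of a x] that insert.hyps(2) by auto
  then have "sorted_wrt R ?ys"
    using xs trans by (auto simp: sorted_wrt_append sorted_wrt_filter)
  ultimately show ?case by blast
qed

lemma sorted_list_unique:
  assumes irrefl: "\<And>x. \<not> R x x" and trans: "\<And>x y z. R x y \<Longrightarrow> R y z \<Longrightarrow> R x z"
  shows "set xs = set ys \<Longrightarrow> sorted_wrt R xs \<Longrightarrow> sorted_wrt R ys \<Longrightarrow> xs = ys"
proof (induction xs arbitrary: ys)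
  case (Cons x xs)
  then obtain y ys' where ys: "ys = y # ys'" by (cases ys) auto
  have "x = y"
  proof (rule ccontr)
    assume "x \<noteq> y"
    then have "x \<in> set ys'" "y \<in> set xs" using Cons.prems(1) ys by auto
    then have "R y x" "R x y" using Cons.prems ys by auto
    then show False using irrefl trans by blast
  qed
  moreover have "x \<notin> set xs" "y \<notin> set ys'" using Cons.prems ys irrefl by auto
  ultimately have "set xs = set ys'" using Cons.prems(1) ys by auto
  then show ?case using Cons.IH[of ys'] Cons.prems ys \<open>x = y\<close> by simp
qed simp

definition corners :: "nat \<Rightarrow> nat \<Rightarrow> (nat \<Rightarrow> int) \<Rightarrow> int \<Rightarrow> mpart \<Rightarrow> box set" where
  "corners e l s i \<Lambda> =
     {b. (addable l \<Lambda> b \<or> removable l \<Lambda> b) \<and> charged_content s b mod int e = i mod int e}"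

lemma signature_corners:
  assumes "shape l \<Lambda>"
  shows "set (signature e l s i \<Lambda>) = corners e l s i \<Lambda>" "sorted_wrt (box_less s) (signature e l s i \<Lambda>)"
    "distinct (signature e l s i \<Lambda>)"
proof -
  let ?Q = "\<lambda>bs. set bs = corners e l s i \<Lambda> \<and> sorted_wrt (box_less s) bs"
  have "finite (corners e l s i \<Lambda>)"
    by (rule finite_subset[OF _ finite_corners[OF assms]]) (auto simp: corners_def)
  then have "\<exists>bs. ?Q bs"
    using box_less_trans box_less_total[OF assms] by (intro sorted_list_exists) (auto simp: corners_def)
  then obtain bs where bs: "?Q bs" by blast
  have sig: "signature e l s i \<Lambda> = bs"
    unfolding signature_def corners_def[symmetric]
  proof (rule the_equality)
    show "?Q bs" by (rule bs)
    fix bs' assume bs': "?Q bs'"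
    show "bs' = bs"
      by (rule sorted_list_unique[of "box_less s"]) (use bs bs' box_less_irrefl box_less_trans in auto)
  qed
  show "set (signature e l s i \<Lambda>) = corners e l s i \<Lambda>" "sorted_wrt (box_less s) (signature e l s i \<Lambda>)"
    unfolding sig using bs by auto
  have "distinct bs" if "sorted_wrt (box_less s) bs" for bs
    using that by (induction bs) (use box_less_irrefl in auto)
  then show "distinct (signature e l s i \<Lambda>)" unfolding sig using bs by blast
qed

lemma addable_not_removable: "addable l \<Lambda> b \<Longrightarrow> \<not> removable l \<Lambda> b"
  unfolding addable_def removable_def by (auto split: prod.splits)

lemma add_box_apply: "add_box (r, c, m) \<Lambda> m' r' = (if m' = m \<and> r' = r then c else \<Lambda> m' r')"
  unfolding add_box_def by simp

lemma remove_add_box: "addable l \<mu> b \<Longrightarrow> remove_box b (add_box b \<mu>) = \<mu>"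
  unfolding addable_def add_box_def remove_box_def by (auto simp: fun_eq_iff)

lemma boxes_add_box:
  assumes "addable l \<mu> b"
  shows "boxes (add_box b \<mu>) = insert b (boxes \<mu>)"
proof -
  obtain r c m where b: "b = (r, c, m)" by (cases b)
  then have a: "1 \<le> r" "c = Suc (\<mu> m r)" using assms unfolding addable_def by auto
  have "x \<in> boxes (add_box b \<mu>) \<longleftrightarrow> x \<in> insert b (boxes \<mu>)" for x
  proof -
    obtain r' c' m' where x: "x = (r', c', m')" by (cases x)
    show ?thesis using a unfolding x b by (auto simp: boxes_def add_box_apply)
  qed
  then show ?thesis by blast
qed

lemma shape_add_box:
  assumes "shape l \<mu>" "addable l \<mu> b"
  shows "shape l (add_box b \<mu>)" "card (boxes (add_box b \<mu>)) = Suc (card (boxes \<mu>))"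
proof -
  obtain r c m where b: "b = (r, c, m)" by (cases b)
  have a: "m \<in> {1..l}" "1 \<le> r" "c = Suc (\<mu> m r)" "r = 1 \<or> \<mu> m r < \<mu> m (r - 1)"
    using assms(2) unfolding b addable_def by auto
  have "\<mu> m (Suc r) \<le> \<mu> m r" using assms(1) a(2) unfolding shape_def by blast
  then have "\<mu> m (Suc r) \<le> Suc (\<mu> m r)" by (rule le_SucI)
  then show "shape l (add_box b \<mu>)"
    using assms(1) a boxes_add_box[OF assms(2)] unfolding shape_def b
    by (auto simp: add_box_apply)
  have "b \<notin> boxes \<mu>" using a unfolding b boxes_def by auto
  moreover have "finite (boxes \<mu>)" using assms(1) unfolding shape_def by blast
  ultimately show "card (boxes (add_box b \<mu>)) = Suc (card (boxes \<mu>))"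
    unfolding boxes_add_box[OF assms(2)] by simp
qed

lemma mod_eq_plus1:
  assumes "1 < e"
  shows "(x + 1) mod int e \<noteq> x mod int e" "(x - 1) mod int e \<noteq> x mod int e"
  using mod_eq_close[of "x + 1" "int e" x] mod_eq_close[of "x - 1" "int e" x] assms by auto

text \<open>Adding a box changes which boxes are addable or removable only on the neighbouring diagonals,
  apart from the box itself, which turns from addable to removable.\<close>

lemma corners_add_box:
  assumes e: "1 < e" and sh: "shape l \<mu>" and b: "addable l \<mu> b" "charged_content s b mod int e = i mod int e"
    and b': "charged_content s b' mod int e = i mod int e"
  shows "addable l (add_box b \<mu>) b' \<longleftrightarrow> addable l \<mu> b' \<and> b' \<noteq> b"
    and "removable l (add_box b \<mu>) b' \<longleftrightarrow> removable l \<mu> b' \<or> b' = b"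
proof -
  obtain r c m where bb: "b = (r, c, m)" by (cases b)
  obtain r' c' m' where bb': "b' = (r', c', m')" by (cases b')
  have a: "m \<in> {1..l}" "1 \<le> r" "c = Suc (\<mu> m r)" "r = 1 \<or> \<mu> m r < \<mu> m (r - 1)"
    using b(1) unfolding bb addable_def by auto
  have dec: "\<mu> m (Suc r) \<le> \<mu> m r" using sh a(2) unfolding shape_def by blast
  have no1: "int c' - int r' \<noteq> int c - int r + 1" "int c' - int r' \<noteq> int c - int r - 1" if "m' = m"
  proof -
    have "charged_content s b' = charged_content s b + (int c' - int r' - (int c - int r))"
      unfolding bb bb' charged_content_def using that by simp
    moreover have "charged_content s b' mod int e = charged_content s b mod int e" using b(2) b' by simp
    ultimately show "int c' - int r' \<noteq> int c - int r + 1" "int c' - int r' \<noteq> int c - int r - 1"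
      using mod_eq_plus1[OF e, of "charged_content s b"] by auto
  qed
  show "addable l (add_box b \<mu>) b' \<longleftrightarrow> addable l \<mu> b' \<and> b' \<noteq> b"
  proof (cases "m' = m")
    case True
    consider "r' = r" | "r' = Suc r" | "r' \<noteq> r" "r' \<noteq> Suc r" by blast
    then show ?thesis
    proof cases
      case 1
      then show ?thesis using True no1 a unfolding addable_def bb bb' by (auto simp: add_box_apply)
    next
      case 2
      then show ?thesis using True no1 a dec unfolding addable_def bb bb' by (auto simp: add_box_apply)
    next
      case 3
      then have "r' - 1 \<noteq> r \<or> r' = 0" by linarith
      then show ?thesis using 3 a unfolding addable_def bb bb' by (auto simp: add_box_apply)
    qed
  next
    case False
    then show ?thesis unfolding addable_def bb bb' by (auto simp: add_box_apply)
  qed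
  show "removable l (add_box b \<mu>) b' \<longleftrightarrow> removable l \<mu> b' \<or> b' = b"
  proof (cases "m' = m")
    case True
    consider "r' = r" | "Suc r' = r" | "r' \<noteq> r" "Suc r' \<noteq> r" by blast
    then show ?thesis
    proof cases
      case 1
      then show ?thesis using True no1 a dec unfolding removable_def bb bb' by (auto simp: add_box_apply)
    next
      case 2
      then show ?thesis using True no1 a dec unfolding removable_def bb bb' by (auto simp: add_box_apply)
    next
      case 3
      then show ?thesis unfolding removable_def bb bb' by (auto simp: add_box_apply)
    qed
  next
    case False
    then show ?thesis unfolding removable_def bb bb' by (auto simp: add_box_apply)
  qed
qed

lemma f_tilde_add_box:
  assumes sh: "shape l \<mu>" and f: "f_tilde e l s i \<mu> = Some \<Lambda>"
  obtains b where "\<Lambda> = add_box b \<mu>" "addable l \<mu> b" "b \<in> corners e l s i \<mu>"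
    "filter (addable l \<mu>) (reduce (addable l \<mu>) (signature e l s i \<mu>)) \<noteq> []"
    "last (filter (addable l \<mu>) (reduce (addable l \<mu>) (signature e l s i \<mu>))) = b"
proof -
  let ?bs = "filter (addable l \<mu>) (reduce (addable l \<mu>) (signature e l s i \<mu>))"
  have ne: "?bs \<noteq> []" and \<Lambda>: "\<Lambda> = add_box (last ?bs) \<mu>"
    using f unfolding f_tilde_def by (auto simp: Let_def split: if_splits)
  have "last ?bs \<in> set ?bs" by (rule last_in_set[OF ne])
  then have "addable l \<mu> (last ?bs)" "last ?bs \<in> corners e l s i \<mu>"
    using set_reduce[of "addable l \<mu>" "signature e l s i \<mu>"] signature_corners(1)[OF sh, of e s i] by auto
  then show thesis using that \<Lambda> ne by blast
qed

text \<open>When \<open>b\<close> is added, the list of corners of its residue stays the same and only the sign of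
  \<open>b\<close> changes. Having been the last surviving \<open>+\<close>, the box \<open>b\<close> becomes the first surviving \<open>-\<close>.\<close>

lemma e_tilde_f_tilde:
  assumes e: "1 < e" and sh: "shape l \<mu>" and f: "f_tilde e l s i \<mu> = Some \<Lambda>"
  shows "e_tilde e l s i \<Lambda> = Some \<mu>"
proof -
  let ?P = "addable l \<mu>" and ?P' = "\<lambda>b'. addable l \<mu> b' \<and> b' \<noteq> last (filter (addable l \<mu>) (reduce (addable l \<mu>) (signature e l s i \<mu>)))"
  obtain b where \<Lambda>: "\<Lambda> = add_box b \<mu>" and b: "addable l \<mu> b" "b \<in> corners e l s i \<mu>"
    and ne: "filter ?P (reduce ?P (signature e l s i \<mu>)) \<noteq> []" and last: "last (filter ?P (reduce ?P (signature e l s i \<mu>))) = b"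
    by (rule f_tilde_add_box[OF sh f])
  have sh': "shape l \<Lambda>" unfolding \<Lambda> by (rule shape_add_box(1)[OF sh b(1)])
  have res: "charged_content s b mod int e = i mod int e" using b(2) unfolding corners_def by simp
  note ca = corners_add_box[OF e sh b(1) res, folded \<Lambda>]
  have "corners e l s i \<Lambda> = corners e l s i \<mu>"
    unfolding corners_def using ca b(1) res by blast
  then have "set (signature e l s i \<Lambda>) = set (signature e l s i \<mu>)"
    using signature_corners(1)[OF sh, of e s i] signature_corners(1)[OF sh', of e s i] by simp
  then have "signature e l s i \<Lambda> = signature e l s i \<mu>"
    by (intro sorted_list_unique[of "box_less s"])
      (rule box_less_irrefl, erule box_less_trans, assumption, assumption,
        rule signature_corners(2)[OF sh'], rule signature_corners(2)[OF sh])
  then have sig: "set (signature e l s i \<Lambda>) = corners e l s i \<mu>" "signature e l s i \<Lambda> = signature e l s i \<mu>"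
    using signature_corners(1)[OF sh, of e s i] by auto
  have in_c: "charged_content s x mod int e = i mod int e" "addable l \<mu> x \<or> removable l \<mu> x"
    if "x \<in> set (signature e l s i \<Lambda>)" for x
    using that unfolding sig(1) corners_def by auto
  define Q where "Q x \<longleftrightarrow> ?P x \<and> x \<noteq> b" for x
  have red: "reduce (addable l \<Lambda>) (signature e l s i \<Lambda>) = reduce Q (signature e l s i \<mu>)"
    unfolding sig(2) by (rule reduce_cong) (use ca(1) in_c sig(2) in \<open>auto simp: Q_def\<close>)
  have "filter (removable l \<Lambda>) (reduce (addable l \<Lambda>) (signature e l s i \<Lambda>))
      = filter (\<lambda>x. \<not> Q x) (reduce Q (signature e l s i \<mu>))"
    unfolding red
  proof (rule filter_cong[OF refl])
    fix x assume "x \<in> set (reduce Q (signature e l s i \<mu>))"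
    then have x: "x \<in> set (signature e l s i \<Lambda>)" using set_reduce sig(2) by fastforce
    show "removable l \<Lambda> x \<longleftrightarrow> \<not> Q x"
      using ca(2)[OF in_c(1)[OF x]] in_c(2)[OF x] addable_not_removable[of l \<mu> x] unfolding Q_def by auto
  qed
  moreover have "filter (\<lambda>x. \<not> Q x) (reduce Q (signature e l s i \<mu>)) \<noteq> []"
    "hd (filter (\<lambda>x. \<not> Q x) (reduce Q (signature e l s i \<mu>))) = b"
    by (rule flip_last_plus[of _ b ?P]; use signature_corners[OF sh] b ne last in \<open>simp add: Q_def\<close>)+
  ultimately show ?thesis
    unfolding e_tilde_def using remove_add_box[OF b(1)] \<Lambda> by (simp add: Let_def)
qed

text \<open>Without entries \<open>-\<close> nothing is cancelled, and the last \<open>+\<close> is the largest corner.\<close>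

lemma f_tilde_largest:
  assumes sh: "shape l \<mu>" and f: "f_tilde e l s i \<mu> = Some \<Lambda>"
    and no_minus: "\<And>b. b \<in> corners e l s i \<mu> \<Longrightarrow> \<not> removable l \<mu> b"
  obtains b where "\<Lambda> = add_box b \<mu>" "addable l \<mu> b" "b \<in> corners e l s i \<mu>"
    "\<And>b'. b' \<in> corners e l s i \<mu> \<Longrightarrow> b' \<noteq> b \<Longrightarrow> box_less s b' b"
proof -
  let ?P = "addable l \<mu>" and ?sig = "signature e l s i \<mu>"
  obtain b where b: "\<Lambda> = add_box b \<mu>" "addable l \<mu> b" "b \<in> corners e l s i \<mu>"
    and last: "last (filter ?P (reduce ?P ?sig)) = b"
    by (rule f_tilde_add_box[OF sh f])
  have "?P x" if "x \<in> set ?sig" for x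
  proof -
    have "x \<in> corners e l s i \<mu>" using that signature_corners(1)[OF sh, of e s i] by simp
    then show ?thesis using no_minus[of x] unfolding corners_def by blast
  qed
  then have "reduce ?P ?sig = ?sig" "filter ?P ?sig = ?sig"
    by (auto intro: reduce_all_plus simp: filter_id_conv)
  then have last: "last ?sig = b" using last by simp
  have "?sig \<noteq> []" using b(3) signature_corners(1)[OF sh, of e s i] by auto
  then have sig: "?sig = butlast ?sig @ [b]" using last append_butlast_last_id by metis
  have "box_less s b' b" if "b' \<in> corners e l s i \<mu>" "b' \<noteq> b" for b'
  proof -
    have "b' \<in> set (butlast ?sig)"
    proof -
      have "b' \<in> set (butlast ?sig @ [b])" using that(1) signature_corners(1)[OF sh, of e s i] sig by simp
      then show ?thesis using that(2) by simp
    qed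
    moreover have "sorted_wrt (box_less s) (butlast ?sig @ [b])"
      using signature_corners(2)[OF sh, of s e i] sig by simp
    ultimately show ?thesis by (simp add: sorted_wrt_append)
  qed
  then show thesis using that b by blast
qed

text \<open>All corners larger than the only removable one have the sign \<open>+\<close>, and the first of them
  would cancel it.\<close>

lemma e_tilde_unique_minus:
  assumes sh: "shape l \<Lambda>" and f: "e_tilde e l s i \<Lambda> = Some \<mu>"
    and unique: "\<And>b b'. b \<in> corners e l s i \<Lambda> \<Longrightarrow> b' \<in> corners e l s i \<Lambda> \<Longrightarrow> removable l \<Lambda> b \<Longrightarrow> removable l \<Lambda> b' \<Longrightarrow> b = b'"
  obtains b where "\<mu> = remove_box b \<Lambda>" "removable l \<Lambda> b" "b \<in> corners e l s i \<Lambda>"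
    "\<And>b'. b' \<in> corners e l s i \<Lambda> \<Longrightarrow> \<not> box_less s b b'"
proof -
  let ?P = "addable l \<Lambda>" and ?sig = "signature e l s i \<Lambda>"
  let ?bs = "filter (removable l \<Lambda>) (reduce ?P ?sig)"
  have ne: "?bs \<noteq> []" and \<mu>: "\<mu> = remove_box (hd ?bs) \<Lambda>"
    using f unfolding e_tilde_def by (auto simp: Let_def split: if_splits)
  define b where "b = hd ?bs"
  have b: "removable l \<Lambda> b" "b \<in> set (reduce ?P ?sig)" using hd_in_set[OF ne] unfolding b_def by auto
  then have b_sig: "b \<in> set ?sig" using set_reduce by fastforce
  then have bc: "b \<in> corners e l s i \<Lambda>" using signature_corners(1)[OF sh, of e s i] by simp
  obtain xs ys where sig: "?sig = xs @ b # ys" using split_list[OF b_sig] by blast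
  have d: "distinct (xs @ b # ys)" using signature_corners(3)[OF sh, of e s i] unfolding sig .
  have plus: "?P y" if "y \<in> set ys" for y
  proof -
    have y: "y \<in> corners e l s i \<Lambda>" using that sig signature_corners(1)[OF sh, of e s i] by auto
    have "y \<noteq> b" using d that by auto
    then have "\<not> removable l \<Lambda> y" using unique[OF bc y b(1)] by blast
    then show ?thesis using y unfolding corners_def by blast
  qed
  have "ys = []"
    by (rule single_minus_last[OF d, of ?P]) (use b addable_not_removable[of l \<Lambda> b] sig plus in auto)
  have sorted: "sorted_wrt (box_less s) (xs @ [b])" and set: "corners e l s i \<Lambda> = set (xs @ [b])"
    using signature_corners(2)[OF sh, of s e i] signature_corners(1)[OF sh, of e s i] \<open>ys = []\<close> unfolding sig by simp_all
  have "\<not> box_less s b b'" if "b' \<in> corners e l s i \<Lambda>" for b'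
  proof (cases "b' = b")
    case False
    then have "box_less s b' b" using that sorted unfolding set by (auto simp: sorted_wrt_append)
    then show ?thesis using box_less_irrefl[of s b] box_less_trans[of s b b' b] by blast
  qed (simp add: box_less_irrefl)
  then show thesis using that[of b] \<mu> b bc b_def by blast
qed

lemma crystal_label_multipartition:
  assumes "crystal_label e l s n \<Lambda>"
  shows "multipartition l n \<Lambda>"
  using assms
proof (induction rule: crystal_label.induct)
  case 1
  have "boxes empty_mpart = {}" unfolding boxes_def empty_mpart_def by auto
  then show ?case unfolding multipartition_def by (auto simp: empty_mpart_def)
next
  case (2 n \<mu> i \<Lambda>)
  then have sh: "shape l \<mu>" "card (boxes \<mu>) = n" unfolding multipartition_shape by auto
  obtain b where "\<Lambda> = add_box b \<mu>" "addable l \<mu> b" by (rule f_tilde_add_box[OF sh(1) 2(2)])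
  then show ?case unfolding multipartition_shape using shape_add_box[OF sh(1)] sh(2) by simp
qed

lemma crystal_label_SucE:
  assumes "1 < e" "crystal_label e l s (Suc n) \<Lambda>"
  obtains i \<mu> where "crystal_label e l s n \<mu>" "shape l \<mu>" "f_tilde e l s i \<mu> = Some \<Lambda>" "e_tilde e l s i \<Lambda> = Some \<mu>"
  using assms(2)
proof (cases rule: crystal_label.cases)
  case (2 \<mu> i)
  then have "shape l \<mu>" using crystal_label_multipartition multipartition_shape by blast
  then show ?thesis using 2 that e_tilde_f_tilde[OF assms(1)] by blast
qed

section \<open>Multipartitions as states of the particle system\<close>

lemma walk_subset:
  "walk e Q u a \<Longrightarrow> P \<subseteq> Q \<Longrightarrow> (\<And>q. q \<in> Q - P \<Longrightarrow> a q = 0) \<Longrightarrow> walk e P u a"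
proof (induction rule: walk.induct)
  case (walk_step w a p)
  have p: "p \<in> P" using walk_step.prems(2)[of p] walk_step.hyps(2) by auto
  have "a q = 0" if "q \<in> Q - P" for q using walk_step.prems(2)[OF that] by (auto split: if_splits)
  then have "walk e P w a" by (rule walk_step.IH[OF walk_step.prems(1)])
  moreover have "valid e P (a(p := Suc (a p)))"
    using walk_step.hyps(3) walk_step.prems(1) unfolding valid_def by blast
  ultimately show ?case using p walk.walk_step by blast
qed (rule walk_Nil)

text \<open>A particle that never moves does not restrict the others if it is not in their way at the
  end, as they only move forward.\<close>

lemma walk_insert:
  assumes "particles e P" "walk e P u a" "valid e (insert p P) a" "a p = 0" "p \<notin> P"
    and "\<And>r. r \<in> P \<Longrightarrow> \<bar>p - r\<bar> < int e"
  shows "walk e (insert p P) u a"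
  using assms(2-4)
proof (induction rule: walk.induct)
  case (walk_step w a p')
  interpret particles e P by fact
  let ?a = "a(p' := Suc (a p'))"
  have ne: "p' \<noteq> p" using walk_step.hyps(2) assms(5) by auto
  have ap: "a p = 0" using walk_step.prems(2) ne by simp
  have "valid e (insert p P) a"
    unfolding valid_def
  proof (intro ballI impI)
    fix r r' assume r: "r \<in> insert p P" "r' \<in> insert p P" "r < r'"
    have va: "valid e P a" using walk_invariant[OF walk_step.hyps(1)] by blast
    have v: "site ?a r < site ?a r'" "site ?a r' < site ?a r + int e"
      using walk_step.prems(1) r unfolding valid_def by auto
    have le: "x \<le> site a x" "site a x \<le> site ?a x" for x by (simp_all add: site_def)
    have sp: "site a p = p" "site ?a p = p" using ap ne by (simp_all add: site_def)
    show "site a r < site a r' \<and> site a r' < site a r + int e"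
    proof (cases "r = p \<or> r' = p")
      case True
      then show ?thesis
      proof
        assume "r = p"
        then show ?thesis using v le[of r'] sp r by auto
      next
        assume "r' = p"
        then show ?thesis using v le[of r] sp r assms(6)[of r] by auto
      qed
    next
      case False
      then show ?thesis using va r unfolding valid_def by auto
    qed
  qed
  then have "walk e (insert p P) w a" by (rule walk_step.IH[OF _ ap])
  then show ?case
    by (rule walk.walk_step) (use walk_step.hyps(2) walk_step.prems(1) in \<open>simp_all del: fun_upd_apply\<close>)
qed (rule walk_Nil)

locale charge =
  fixes e l :: nat and s :: "nat \<Rightarrow> int"
  assumes e_gt1: "e > 1" and l_ge1: "1 \<le> l"
    and s_step: "1 \<le> j \<Longrightarrow> j < l \<Longrightarrow> s j \<le> s (Suc j)" and s_last: "s l < s 1 + int e"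
begin

lemma s_mono: "1 \<le> j \<Longrightarrow> j \<le> k \<Longrightarrow> k \<le> l \<Longrightarrow> s j \<le> s k"
proof (induction k)
  case (Suc k)
  then show ?case using s_step[of k] by (cases "j = Suc k") auto
qed simp

text \<open>In the fundamental alcoves only the first \<open>gap m\<close> rows of the component \<open>m\<close> can be nonzero.
  The contents of the first boxes of these rows, for all components, run exactly once through the
  interval \<open>s_l - e < p \<le> s_l\<close>; row \<open>r\<close> of component \<open>m\<close> becomes the particle that starts from the
  content \<open>pos m r\<close>.\<close>

definition gap :: "nat \<Rightarrow> int" where
  "gap m = (if m = 1 then int e + s 1 - s l else s m - s (m - 1))"

definition pos :: "nat \<Rightarrow> nat \<Rightarrow> int" where
  "pos m r = s m - int r + 1"

definition window :: "int set" where
  "window = {s l - int e<..s l}"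

definition comp :: "int \<Rightarrow> nat" where
  "comp p = (LEAST m. 1 \<le> m \<and> p \<le> s m)"

definition row :: "int \<Rightarrow> nat" where
  "row p = nat (s (comp p) - p + 1)"

lemma gap_nonneg: "1 \<le> m \<Longrightarrow> m \<le> l \<Longrightarrow> 0 \<le> gap m"
  using s_mono[of "m - 1" m] s_last by (auto simp: gap_def)

lemma gap_1: "1 \<le> gap 1"
  using s_last by (simp add: gap_def)

lemma pos_inverse:
  assumes m: "1 \<le> m" "m \<le> l" and r: "1 \<le> r" "int r \<le> gap m"
  shows "pos m r \<in> window" "comp (pos m r) = m" "row (pos m r) = r"
proof -
  have "s l - int e < pos m r"
  proof (cases "m = 1")
    case False
    then have "s 1 \<le> s (m - 1)" using m by (intro s_mono) auto
    then show ?thesis using r False s_last unfolding gap_def pos_def by auto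
  qed (use r in \<open>auto simp: gap_def pos_def\<close>)
  moreover have "pos m r \<le> s l" using s_mono[OF m order_refl] r unfolding pos_def by auto
  ultimately show "pos m r \<in> window" unfolding window_def by auto
  show c: "comp (pos m r) = m"
    unfolding comp_def
  proof (rule Least_equality)
    show "1 \<le> m \<and> pos m r \<le> s m" using m r unfolding pos_def by auto
    fix k assume k: "1 \<le> k \<and> pos m r \<le> s k"
    show "m \<le> k"
    proof (rule ccontr)
      assume "\<not> m \<le> k"
      then have "s k \<le> s (m - 1)" "m \<noteq> 1" using k m by (auto intro: s_mono)
      then show False using k r unfolding gap_def pos_def by auto
    qed
  qed
  show "row (pos m r) = r" unfolding row_def c by (simp add: pos_def)
qed

lemma comp_row:
  assumes "p \<in> window"
  shows "1 \<le> comp p" "comp p \<le> l" "1 \<le> row p" "int (row p) \<le> gap (comp p)" "pos (comp p) (row p) = p" "p \<le> s (comp p)"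
proof -
  have p: "p \<le> s l" "s l - int e < p" using assms unfolding window_def by auto
  have L: "1 \<le> comp p \<and> p \<le> s (comp p)" unfolding comp_def by (rule LeastI[of _ l]) (use l_ge1 p in auto)
  then show "1 \<le> comp p" "p \<le> s (comp p)" by auto
  show "comp p \<le> l" unfolding comp_def by (rule Least_le) (use l_ge1 p in auto)
  show "1 \<le> row p" "pos (comp p) (row p) = p" using L unfolding row_def pos_def by auto
  show "int (row p) \<le> gap (comp p)"
  proof (cases "comp p = 1")
    case True
    then show ?thesis using L p unfolding row_def gap_def by auto
  next
    case False
    have "\<not> (1 \<le> comp p - 1 \<and> p \<le> s (comp p - 1))"
      using not_less_Least[of "comp p - 1" "\<lambda>m. 1 \<le> m \<and> p \<le> s m"] L unfolding comp_def[symmetric] by auto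
    then show ?thesis using L False unfolding row_def gap_def by auto
  qed
qed

lemma comp_mono: "p \<in> window \<Longrightarrow> p' \<in> window \<Longrightarrow> p \<le> p' \<Longrightarrow> comp p \<le> comp p'"
  unfolding comp_def[of p] by (rule Least_le) (use comp_row[of p'] in auto)

lemma window_close: "p \<in> window \<Longrightarrow> p' \<in> window \<Longrightarrow> \<bar>p - p'\<bar> < int e"
  unfolding window_def by auto

definition len :: "mpart \<Rightarrow> int \<Rightarrow> nat" where
  "len \<Lambda> p = (if p \<in> window then \<Lambda> (comp p) (row p) else 0)"

definition occ :: "mpart \<Rightarrow> int set" where
  "occ \<Lambda> = {p. 0 < len \<Lambda> p}"

text \<open>These are the inequalities of the fundamental alcove for the positions of the particles.
  Together with \<open>card (occ \<Lambda>) < e\<close> they amount to the alcove condition.\<close>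

definition alcove_like :: "mpart \<Rightarrow> bool" where
  "alcove_like \<Lambda> \<longleftrightarrow> shape l \<Lambda> \<and> (\<forall>m r. 0 < \<Lambda> m r \<longrightarrow> int r \<le> gap m) \<and> valid e (occ \<Lambda>) (len \<Lambda>)"

lemma alcove_likeD:
  assumes "alcove_like \<Lambda>"
  shows "shape l \<Lambda>" "0 < \<Lambda> m r \<Longrightarrow> int r \<le> gap m" "valid e (occ \<Lambda>) (len \<Lambda>)"
  using assms unfolding alcove_like_def by auto

lemma occ_window: "p \<in> occ \<Lambda> \<Longrightarrow> p \<in> window"
  unfolding occ_def len_def by (auto split: if_splits)

lemma len_outside: "p \<notin> occ \<Lambda> \<Longrightarrow> len \<Lambda> p = 0"
  unfolding occ_def by auto

lemma len_pos: "1 \<le> m \<Longrightarrow> m \<le> l \<Longrightarrow> 1 \<le> r \<Longrightarrow> int r \<le> gap m \<Longrightarrow> len \<Lambda> (pos m r) = \<Lambda> m r"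
  unfolding len_def using pos_inverse[of m r] by auto

lemma alcove_like_row:
  assumes "alcove_like \<Lambda>" "0 < \<Lambda> m r"
  shows "1 \<le> m" "m \<le> l" "1 \<le> r" "int r \<le> gap m" "pos m r \<in> occ \<Lambda>" "len \<Lambda> (pos m r) = \<Lambda> m r"
    "comp (pos m r) = m" "row (pos m r) = r"
proof -
  show m: "1 \<le> m" "m \<le> l" "1 \<le> r" using shape_outside[OF alcove_likeD(1)[OF assms(1)] assms(2)] by auto
  show g: "int r \<le> gap m" by (rule alcove_likeD(2)[OF assms])
  show "len \<Lambda> (pos m r) = \<Lambda> m r" by (rule len_pos[OF m g])
  then show "pos m r \<in> occ \<Lambda>" using assms(2) unfolding occ_def by simp
  show "comp (pos m r) = m" "row (pos m r) = r" by (rule pos_inverse[OF m g])+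
qed

lemma track_occ: "track e (occ \<Lambda>)"
proof
  have "occ \<Lambda> \<subseteq> window" using occ_window by auto
  then show "finite (occ \<Lambda>)" by (rule finite_subset) (simp add: window_def)
qed (use e_gt1 window_close occ_window in auto)

lemma particles_occ: "card (occ \<Lambda>) < e \<Longrightarrow> particles e (occ \<Lambda>)"
  using track_occ by (intro particles.intro particles_axioms.intro)

lemma content_window: "p \<in> window \<Longrightarrow> charged_content s (row p, c, comp p) = p + int c - 1"
  using comp_row(5)[of p] unfolding charged_content_def pos_def by auto

lemma removable_particle:
  assumes "alcove_like \<Lambda>" "removable l \<Lambda> b"
  obtains p where "p \<in> occ \<Lambda>" "b = (row p, len \<Lambda> p, comp p)" "charged_content s b = site (len \<Lambda>) p - 1"
proof -
  obtain r c m where b: "b = (r, c, m)" by (cases b)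
  then have c: "c = \<Lambda> m r" "0 < \<Lambda> m r" using assms(2) unfolding removable_def by auto
  note g = alcove_like_row[OF assms(1) c(2)]
  have "b = (row (pos m r), len \<Lambda> (pos m r), comp (pos m r))" using g c b by simp
  then show thesis
    using that[OF g(5)] content_window[OF occ_window[OF g(5)]] by (simp add: site_def)
qed

text \<open>A particle whose next box is not addable is held up by the previous row of the same
  component, which has the same length.\<close>

lemma not_addable_next:
  assumes "alcove_like \<Lambda>" "q \<in> occ \<Lambda>" "\<not> addable l \<Lambda> (row q, Suc (len \<Lambda> q), comp q)"
  shows "q + 1 \<in> occ \<Lambda>" "comp (q + 1) = comp q" "row q = Suc (row (q + 1))" "len \<Lambda> (q + 1) = len \<Lambda> q"
proof -
  note w = comp_row[OF occ_window[OF assms(2)]]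
  have len: "len \<Lambda> q = \<Lambda> (comp q) (row q)" using occ_window[OF assms(2)] unfolding len_def by simp
  let ?r = "row q - 1"
  have r: "row q \<noteq> 1" "\<Lambda> (comp q) ?r \<le> \<Lambda> (comp q) (row q)"
    using assms(3) w len unfolding addable_def by auto
  then have r1: "1 \<le> ?r" "?r \<le> row q" using w(3) by auto
  then have eq: "\<Lambda> (comp q) ?r = len \<Lambda> q"
    using shape_decreasing[OF alcove_likeD(1)[OF assms(1)] r1, of "comp q"] r len by simp
  then have "0 < \<Lambda> (comp q) ?r" using assms(2) unfolding occ_def by simp
  note g = alcove_like_row[OF assms(1) this]
  have "pos (comp q) ?r = q + 1" using w(5) r1 unfolding pos_def by auto
  then show "q + 1 \<in> occ \<Lambda>" "comp (q + 1) = comp q" "row q = Suc (row (q + 1))" "len \<Lambda> (q + 1) = len \<Lambda> q"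
    using g eq r1 by auto
qed

lemma len_add_box:
  assumes "p \<in> window"
  shows "len (add_box (row p, c, comp p) \<Lambda>) = (len \<Lambda>)(p := c)"
    and "len (remove_box (row p, c, comp p) \<Lambda>) = (len \<Lambda>)(p := c - 1)"
proof -
  have "p' = p" if "p' \<in> window" "comp p' = comp p" "row p' = row p" for p'
    using comp_row(5)[OF assms] comp_row(5)[OF that(1)] that by simp
  then show "len (add_box (row p, c, comp p) \<Lambda>) = (len \<Lambda>)(p := c)"
    "len (remove_box (row p, c, comp p) \<Lambda>) = (len \<Lambda>)(p := c - 1)"
    using assms by (auto simp: fun_eq_iff len_def add_box_def remove_box_def)
qed

text \<open>If some particle has made a last step of residue \<open>i\<close>, then \<open>walk_block\<close> applies. Otherwise
  there is no removable \<open>i\<close>-box, and the new box is the largest addable one. In an existing row it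
  keeps the order of the particles, as the next point is empty. In a new row it can violate the
  order only if an older row has a box at the same place, or one turn ahead of it. In that case no
  particle stands at residue \<open>i\<close>, as its next box would be a larger addable \<open>i\<close>-box; then
  \<open>walk_gap\<close> applies.\<close>

lemma f_tilde_alcove_like:
  assumes alcove_like: "alcove_like \<mu>" and card: "card (occ \<mu>) < e" and f: "f_tilde e l s i \<mu> = Some \<Lambda>"
  shows "alcove_like \<Lambda> \<or> (\<exists>t w. walk e (occ \<mu>) (t @ [i mod int e] @ w) (len \<mu>) \<and>
    ((\<forall>x\<in>set w. x mod int e \<noteq> i mod int e \<and> x mod int e \<noteq> (i + 1) mod int e) \<or>
     (\<forall>x\<in>set w. x mod int e \<noteq> i mod int e \<and> x mod int e \<noteq> (i - 1) mod int e)))"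
proof -
  interpret particles e "occ \<mu>" by (rule particles_occ[OF card])
  let ?a = "len \<mu>" and ?P = "occ \<mu>"
  note sh = alcove_likeD(1)[OF alcove_like] and outer = alcove_likeD(2)[OF alcove_like] and va = alcove_likeD(3)[OF alcove_like]
  show ?thesis
  proof (cases "\<exists>p\<in>?P. (site ?a p - 1) mod int e = i mod int e")
    case True
    then obtain p where p: "p \<in> ?P" "(site ?a p - 1) mod int e = i mod int e" by blast
    have "site ?a p mod int e = (i + 1) mod int e"
      using mod_eq_shift(1)[of "site ?a p - 1" 1 "int e" i] p(2) by simp
    moreover have "0 < ?a p" using p(1) unfolding occ_def by simp
    ultimately show ?thesis
      using walk_block[OF va len_outside p(1)] p(2) by auto
  next
    case no_particle: False
    have "\<not> removable l \<mu> b" if bc: "b \<in> corners e l s i \<mu>" for b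
    proof
      assume "removable l \<mu> b"
      then obtain p where "p \<in> ?P" "charged_content s b = site ?a p - 1"
        using removable_particle[OF alcove_like, of b] by blast
      then show False using bc no_particle unfolding corners_def by auto
    qed
    then obtain b where \<Lambda>: "\<Lambda> = add_box b \<mu>" and b: "addable l \<mu> b" "b \<in> corners e l s i \<mu>"
      and largest: "\<And>b'. b' \<in> corners e l s i \<mu> \<Longrightarrow> b' \<noteq> b \<Longrightarrow> box_less s b' b"
      using f_tilde_largest[OF sh f] by metis
    obtain r c m where brcm: "b = (r, c, m)" by (cases b)
    have bb: "1 \<le> m" "m \<le> l" "1 \<le> r" "c = Suc (\<mu> m r)" "r = 1 \<or> \<mu> m r < \<mu> m (r - 1)"
      using b(1) unfolding brcm addable_def by auto
    define C where "C = pos m r"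
    have content: "charged_content s b = C + int c - 1" unfolding brcm charged_content_def C_def pos_def by simp
    then have Ci: "(C + int c - 1) mod int e = i mod int e" using b(2) unfolding corners_def by simp
    have shL: "shape l \<Lambda>" unfolding \<Lambda> by (rule shape_add_box(1)[OF sh b(1)])
    show ?thesis
    proof (cases "0 < \<mu> m r")
      case True
      note g = alcove_like_row[OF alcove_like True]
      have bC: "b = (row C, Suc (?a C), comp C)" unfolding brcm C_def using g bb(4) by simp
      have P: "C \<in> ?P" using g(5) unfolding C_def .
      have lenL: "len \<Lambda> = ?a(C := Suc (?a C))" unfolding \<Lambda> bC by (rule len_add_box(1)[OF occ_window[OF P]])
      have "c = Suc (?a C)" using bC brcm by simp
      then have "site ?a C mod int e = i mod int e" using Ci by (simp add: site_def)
      then have siteC: "(site ?a C + 1) mod int e = (i + 1) mod int e" using mod_eq_shift(1) by blast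
      have "valid e ?P (?a(C := Suc (?a C)))"
      proof (rule valid_advance[OF va P])
        fix p' assume p': "p' \<in> ?P"
        show "site ?a p' mod int e \<noteq> (site ?a C + 1) mod int e"
          using no_particle p' mod_eq_shift(2)[of "site ?a p'" 1 "int e" "i + 1"] siteC by auto
      qed
      moreover have "occ \<Lambda> = ?P" unfolding occ_def lenL using P by (auto simp: occ_def)
      moreover have "int r' \<le> gap m'" if "0 < \<Lambda> m' r'" for m' r'
        using that outer[of m' r'] outer[OF True] unfolding \<Lambda> brcm by (auto simp: add_box_apply split: if_splits)
      ultimately have "alcove_like \<Lambda>" unfolding alcove_like_def using shL lenL by simp
      then show ?thesis by blast
    next
      case False
      then have c1: "c = 1" using bb(4) by simp
      \<comment> \<open>The clause on components decides between boxes of equal contents in \<open>box_less\<close>.\<close>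
      have old_box: "\<exists>p'\<in>?P. \<exists>j. j < ?a p' \<and> (p' + int j = C \<and> (\<forall>q\<in>?P. q < p' \<longrightarrow> comp q \<le> m) \<or> p' + int j = C + int e)"
        if "\<not> alcove_like \<Lambda>"
      proof (cases "int r \<le> gap m")
        case False
        \<comment> \<open>A row that is too deep starts with the content of the first box of the cyclically
          preceding component, up to a turn. If absent, that box would be a larger addable one.\<close>
        define m' where "m' = (if m = 1 then l else m - 1)"
        have "int r - 1 \<le> gap m"
        proof (cases "r = 1")
          case True
          then show ?thesis using gap_nonneg[OF bb(1,2)] by simp
        next
          case False
          then show ?thesis using bb(3,5) outer[of m "r - 1"] by auto
        qed
        then have r: "int r = gap m + 1" using False by linarith
        have m': "1 \<le> m'" "m' \<le> l" unfolding m'_def using bb l_ge1 by auto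
        have C: "C = (if m = 1 then s m' - int e else s m')" unfolding C_def pos_def r gap_def m'_def by simp
        have "0 < \<mu> m' 1"
        proof (rule ccontr)
          assume "\<not> 0 < \<mu> m' 1"
          then have add: "addable l \<mu> (1, 1, m')" unfolding addable_def using m' by auto
          have ct: "charged_content s (1, 1, m') = s m'" unfolding charged_content_def by simp
          have "s m' mod int e = C mod int e" unfolding C by simp
          then have "(1, 1, m') \<in> corners e l s i \<mu>"
            unfolding corners_def using add ct Ci c1 by simp
          moreover have "(1, 1, m') \<noteq> b"
            using r gap_1 bb(1) unfolding brcm m'_def by auto
          ultimately have "box_less s (1, 1, m') b" by (rule largest)
          then show False
            using C bb(1) e_gt1 unfolding box_less_def ct content c1 by (auto simp: brcm m'_def split: if_splits)
        qed
        note g = alcove_like_row[OF alcove_like this]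
        have p': "pos m' 1 = s m'" unfolding pos_def by simp
        show ?thesis
        proof (intro bexI exI conjI)
          show "s m' \<in> ?P" using g(5) p' by simp
          show "0 < ?a (s m')" using g(5) p' unfolding occ_def by simp
          show "s m' + int 0 = C \<and> (\<forall>q\<in>?P. q < s m' \<longrightarrow> comp q \<le> m) \<or> s m' + int 0 = C + int e"
          proof (cases "m = 1")
            case False
            have "comp q \<le> m" if "q \<in> ?P" "q < s m'" for q
            proof -
              have "comp q \<le> comp (s m')"
                using comp_mono[OF occ_window[OF that(1)] occ_window] g(5) p' that(2) by auto
              then show ?thesis using g(7) p' unfolding m'_def using False by simp
            qed
            then show ?thesis using C False by simp
          qed (use C in simp)
        qed
      next
        case True
        note w = pos_inverse[OF bb(1-3) True, folded C_def]
        have bC: "b = (row C, 1, comp C)" unfolding brcm c1 w ..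
        have lenL: "len \<Lambda> = ?a(C := 1)" unfolding \<Lambda> bC by (rule len_add_box(1)[OF w(1)])
        have a0: "?a C = 0" unfolding C_def using len_pos[OF bb(1-3) True] False by simp
        have occL: "occ \<Lambda> = insert C ?P" unfolding occ_def lenL by auto
        show ?thesis
        proof (rule ccontr)
          assume none: "\<not> ?thesis"
          have no: "\<not> (j < ?a p' \<and> (p' + int j = C \<or> p' + int j = C + int e))" if p': "p' \<in> ?P" for p' j
          proof
            assume j: "j < ?a p' \<and> (p' + int j = C \<or> p' + int j = C + int e)"
            have "comp q \<le> m" if "q \<in> ?P" "q < p'" "p' + int j = C" for q
              using comp_mono[OF occ_window[OF that(1)] w(1)] that w(2) by auto
            then show False using none p' j by blast
          qed
          have "valid e (insert C ?P) (?a(C := 1))"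
          proof -
            have sites: "site (?a(C := 1)) x = (if x = C then C + 1 else site ?a x)" for x by (simp add: site_def)
            have pair: "(p < C \<longrightarrow> site ?a p < C + 1 \<and> C + 1 < site ?a p + int e) \<and>
                (C < p \<longrightarrow> C + 1 < site ?a p \<and> site ?a p < C + 1 + int e)" if p: "p \<in> ?P" for p
            proof -
              have pos: "0 < ?a p" using p unfolding occ_def by simp
              have close: "\<bar>p - C\<bar> < int e" by (rule window_close[OF occ_window[OF p] w(1)])
              have "site ?a p < C + 1" if "p < C"
              proof (rule ccontr)
                assume "\<not> site ?a p < C + 1"
                then have "nat (C - p) < ?a p" "p + int (nat (C - p)) = C" using that by (auto simp: site_def)
                then show False using no[OF p] by blast
              qed
              moreover have "site ?a p < C + 1 + int e" if "C < p"
              proof (rule ccontr)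
                assume "\<not> site ?a p < C + 1 + int e"
                then have "nat (C + int e - p) < ?a p" "p + int (nat (C + int e - p)) = C + int e"
                  using that close by (auto simp: site_def)
                then show False using no[OF p] by blast
              qed
              ultimately show ?thesis using pos close by (auto simp: site_def)
            qed
            show ?thesis
              unfolding valid_def
            proof (intro ballI impI)
              fix p p' assume pp: "p \<in> insert C ?P" "p' \<in> insert C ?P" "p < p'"
              show "site (?a(C := 1)) p < site (?a(C := 1)) p' \<and> site (?a(C := 1)) p' < site (?a(C := 1)) p + int e"
              proof (cases "p = C \<or> p' = C")
                case True
                then show ?thesis using pp pair[of p] pair[of p'] unfolding sites by auto
              next
                case False
                then show ?thesis using pp va unfolding sites valid_def by auto
              qed
            qed
          qed
          moreover have "int r' \<le> gap m''" if "0 < \<Lambda> m'' r'" for m'' r'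
            using that outer[of m'' r'] True unfolding \<Lambda> brcm by (auto simp: add_box_apply split: if_splits)
          ultimately have "alcove_like \<Lambda>" unfolding alcove_like_def occL lenL using shL by simp
          then show False using that by blast
        qed
      qed
      show ?thesis
      proof (cases "alcove_like \<Lambda>")
        case not_alcove_like: False
        obtain p' j where p': "p' \<in> ?P" "j < ?a p'"
          and j: "p' + int j = C \<and> (\<forall>q\<in>?P. q < p' \<longrightarrow> comp q \<le> m) \<or> p' + int j = C + int e"
          using old_box[OF not_alcove_like] by blast
        have Ci': "C mod int e = i mod int e" using Ci c1 by simp
        have res: "(p' + int j) mod int e = i mod int e" using j Ci' by auto
        have none: "site ?a q mod int e \<noteq> i mod int e" if q: "q \<in> ?P" "0 < ?a q" for q
        proof
          assume qi: "site ?a q mod int e = i mod int e"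
          let ?\<beta> = "(row q, Suc (?a q), comp q)"
          have add: "addable l \<mu> ?\<beta>"
          proof (rule ccontr)
            assume "\<not> addable l \<mu> ?\<beta>"
            note n = not_addable_next[OF alcove_like q(1) this]
            have "site ?a (q + 1) - 1 = site ?a q" using n(4) by (simp add: site_def)
            then show False using no_particle n(1) qi by metis
          qed
          have ct: "charged_content s ?\<beta> = site ?a q"
            using content_window[OF occ_window[OF q(1)]] by (simp add: site_def)
          have "?\<beta> \<in> corners e l s i \<mu>" unfolding corners_def using add ct qi by simp
          moreover have "?\<beta> \<noteq> b" unfolding brcm c1 using q(2) by auto
          ultimately have "box_less s ?\<beta> b" by (rule largest)
          then have less: "site ?a q < C \<or> site ?a q = C \<and> m < comp q"
            unfolding box_less_def ct content c1 by (auto simp: brcm)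
          have close: "\<bar>site ?a p' - site ?a q\<bar> < int e" by (rule valid_close[OF va p'(1) q(1)])
          from j show False
          proof
            assume j: "p' + int j = C \<and> (\<forall>q\<in>?P. q < p' \<longrightarrow> comp q \<le> m)"
            then have big: "C + 1 \<le> site ?a p'" using p'(2) by (simp add: site_def)
            have "site ?a q = C"
              using mod_eq_close[of "site ?a q" "int e" C] qi Ci' close big less by auto
            moreover have "q < p'"
            proof (rule ccontr)
              assume "\<not> q < p'"
              then have "p' = q \<or> p' < q" by linarith
              then have "site ?a p' \<le> site ?a q"
                using va p'(1) q(1) unfolding valid_def by (auto intro: less_imp_le)
              then show False using big less by auto
            qed
            ultimately show False using less j q(1) by auto
          next
            assume "p' + int j = C + int e"
            then have "C + int e + 1 \<le> site ?a p'" using p'(2) by (simp add: site_def)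
            then show False using close less by auto
          qed
        qed
        show ?thesis using walk_gap[OF va len_outside none p' res] by blast
      qed blast
    qed
  qed
qed

text \<open>The particles stand at different points, so there is only one removable \<open>i\<close>-box, and it is
  larger than all addable \<open>i\<close>-boxes. The next box of a particle at residue \<open>i\<close> would be addable
  and larger. So the point \<open>i\<close> is empty: the particle of the removed box can move back, and there
  are fewer than \<open>e\<close> particles. After that no particle stands at \<open>i + 1\<close>, where a last step of
  residue \<open>i\<close> would have led it.\<close>

lemma e_tilde_alcove_like:
  assumes alcove_like: "alcove_like \<Lambda>" and e: "e_tilde e l s i \<Lambda> = Some \<mu>" and sh\<mu>: "shape l \<mu>"
  shows "alcove_like \<mu>" "card (occ \<Lambda>) < e" "card (occ \<mu>) < e"
    "\<And>p. p \<in> occ \<mu> \<Longrightarrow> (site (len \<mu>) p - 1) mod int e \<noteq> i mod int e"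
    "\<And>u. walk e (occ \<Lambda>) (u @ [i mod int e]) (len \<Lambda>) \<longleftrightarrow> walk e (occ \<mu>) u (len \<mu>)"
proof -
  interpret track e "occ \<Lambda>" by (rule track_occ)
  let ?a = "len \<Lambda>" and ?P = "occ \<Lambda>"
  note sh = alcove_likeD(1)[OF alcove_like] and outer = alcove_likeD(2)[OF alcove_like] and va = alcove_likeD(3)[OF alcove_like]
  have "b = b'" if bc: "b \<in> corners e l s i \<Lambda>" "b' \<in> corners e l s i \<Lambda>" "removable l \<Lambda> b" "removable l \<Lambda> b'" for b b'
  proof -
    obtain p where p: "p \<in> ?P" "b = (row p, ?a p, comp p)" "charged_content s b = site ?a p - 1"
      by (rule removable_particle[OF alcove_like bc(3)])
    obtain p' where p': "p' \<in> ?P" "b' = (row p', ?a p', comp p')" "charged_content s b' = site ?a p' - 1"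
      by (rule removable_particle[OF alcove_like bc(4)])
    have "(site ?a p - 1) mod int e = (site ?a p' - 1) mod int e"
      using bc(1,2) p(3) p'(3) unfolding corners_def by simp
    then have "p = p'" using valid_distinct[OF va p(1) p'(1)] mod_eq_shift(2) by blast
    then show ?thesis using p p' by simp
  qed
  then obtain b where \<mu>: "\<mu> = remove_box b \<Lambda>" and b: "removable l \<Lambda> b" "b \<in> corners e l s i \<Lambda>"
    and largest: "\<And>b'. b' \<in> corners e l s i \<Lambda> \<Longrightarrow> \<not> box_less s b b'"
    using e_tilde_unique_minus[OF sh e] by metis
  obtain p where p: "p \<in> ?P" and bp: "b = (row p, ?a p, comp p)" and ct: "charged_content s b = site ?a p - 1"
    by (rule removable_particle[OF alcove_like b(1)])
  have pi: "(site ?a p - 1) mod int e = i mod int e" using b(2) ct unfolding corners_def by simp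
  have ap: "0 < ?a p" using p unfolding occ_def by simp
  have a\<Lambda>: "?a q = \<Lambda> (comp q) (row q)" if "q \<in> ?P" for q using occ_window[OF that] unfolding len_def by simp
  have free: "site ?a q mod int e \<noteq> i mod int e" if q: "q \<in> ?P" for q
  proof
    assume qi: "site ?a q mod int e = i mod int e"
    have removable: "\<Lambda> (comp p) (Suc (row p)) < \<Lambda> (comp p) (row p)"
      using b(1) unfolding bp removable_def by auto
    let ?\<beta> = "(row q, Suc (?a q), comp q)"
    have add: "addable l \<Lambda> ?\<beta>"
    proof (rule ccontr)
      assume "\<not> addable l \<Lambda> ?\<beta>"
      note n = not_addable_next[OF alcove_like q this]
      have "site ?a (q + 1) - 1 = site ?a q" using n(4) by (simp add: site_def)
      then have "(site ?a (q + 1) - 1) mod int e = (site ?a p - 1) mod int e" using qi pi by simp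
      then have "q + 1 = p" using valid_distinct[OF va n(1) p] mod_eq_shift(2) by blast
      then show False using removable n a\<Lambda>[OF q] a\<Lambda>[OF p] by auto
    qed
    have ctq: "charged_content s ?\<beta> = site ?a q"
      using content_window[OF occ_window[OF q]] by (simp add: site_def)
    have "?\<beta> \<in> corners e l s i \<Lambda>" unfolding corners_def using add ctq qi by simp
    then have nl: "\<not> (site ?a p - 1 < site ?a q)" "\<not> (site ?a p - 1 = site ?a q \<and> comp q < comp p)"
      using largest[of ?\<beta>] unfolding box_less_def ctq ct by (auto simp: bp)
    have close: "\<bar>site ?a q - site ?a p\<bar> < int e" by (rule valid_close[OF va q p])
    have "site ?a q mod int e = (site ?a p - 1) mod int e" using qi pi by simp
    then have eq: "site ?a q = site ?a p - 1"
      using mod_eq_near[of "site ?a q" "int e" "site ?a p - 1"] close nl(1) e_gt1 by auto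
    have "q < p"
    proof (rule ccontr)
      assume "\<not> q < p"
      then have "p = q \<or> p < q" by linarith
      then have "site ?a p \<le> site ?a q" using va p q unfolding valid_def by (auto intro: less_imp_le)
      then show False using eq by simp
    qed
    then have "comp q \<le> comp p" using comp_mono occ_window p q by auto
    then have cc: "comp q = comp p" using nl(2) eq by auto
    have rows: "int (row q) = int (row p) + (p - q)"
      using comp_row(5)[OF occ_window[OF p]] comp_row(5)[OF occ_window[OF q]] cc unfolding pos_def by auto
    then have "Suc (row p) \<le> row q" using \<open>q < p\<close> by linarith
    then have "\<Lambda> (comp p) (row q) \<le> \<Lambda> (comp p) (Suc (row p))" by (intro shape_decreasing[OF sh]) auto
    then have "?a q < ?a p" using removable a\<Lambda>[OF q] a\<Lambda>[OF p] cc by simp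
    then show False using eq \<open>q < p\<close> by (simp add: site_def)
  qed
  show card: "card ?P < e"
  proof -
    have "inj_on (\<lambda>q. site ?a q mod int e) ?P" using valid_distinct[OF va] by (auto simp: inj_on_def)
    then have "card ?P = card ((\<lambda>q. site ?a q mod int e) ` ?P)" by (simp add: card_image)
    also have "\<dots> < card {0..<int e}"
    proof (rule psubset_card_mono)
      have "i mod int e \<in> {0..<int e}" using e_gt1 by auto
      moreover have "i mod int e \<notin> (\<lambda>q. site ?a q mod int e) ` ?P" 
      proof
        assume "i mod int e \<in> (\<lambda>q. site ?a q mod int e) ` ?P"
        then obtain q where "i mod int e = site ?a q mod int e" "q \<in> ?P" by (rule imageE)
        then show False using free[of q] by simp
      qed
      moreover have "(\<lambda>q. site ?a q mod int e) ` ?P \<subseteq> {0..<int e}" using e_gt1 by auto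
      ultimately show "(\<lambda>q. site ?a q mod int e) ` ?P \<subset> {0..<int e}" by blast
    qed simp
    finally show ?thesis by simp
  qed
  have vr: "valid e ?P (retreat ?a p)"
    by (rule valid_retreat[OF va p ap]) (use free pi in auto)
  have len\<mu>: "len \<mu> = retreat ?a p" unfolding \<mu> bp len_add_box(2)[OF occ_window[OF p]] by (simp add: retreat_def)
  have occ\<mu>: "occ \<mu> \<subseteq> ?P" "?P - {p} \<subseteq> occ \<mu>" unfolding occ_def len\<mu> by (auto split: if_splits)
  have v\<mu>: "valid e (occ \<mu>) (len \<mu>)" using vr occ\<mu>(1) unfolding len\<mu> valid_def by blast
  have outer\<mu>: "int r \<le> gap m" if "0 < \<mu> m r" for m r
    using that outer[of m r] unfolding \<mu> bp remove_box_def a\<Lambda>[OF p] by (auto split: if_splits)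
  then show "alcove_like \<mu>" unfolding alcove_like_def using sh\<mu> v\<mu> by simp
  show card\<mu>: "card (occ \<mu>) < e" using card_mono[OF finite_P occ\<mu>(1)] card by simp
  show "(site (len \<mu>) q - 1) mod int e \<noteq> i mod int e" if "q \<in> occ \<mu>" for q
  proof (cases "q = p")
    case True
    then show ?thesis
      unfolding len\<mu> using ap pi mod_eq_close[of "site ?a p - 1 - 1" "int e" "site ?a p - 1"] e_gt1
      by (auto simp: site_retreat)
  next
    case False
    have "q \<in> ?P" using that occ\<mu> by blast
    then show ?thesis
      unfolding len\<mu> using False ap pi valid_distinct[OF va _ p] mod_eq_shift(2) by (simp add: site_retreat) metis
  qed
  fix u
  have "walk e ?P (u @ [i mod int e]) ?a \<longleftrightarrow> walk e ?P u (retreat ?a p)"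
  proof
    assume "walk e ?P (u @ [i mod int e]) ?a"
    then obtain q where q: "q \<in> ?P" "i mod int e = (site ?a q - 1) mod int e" "walk e ?P u (retreat ?a q)"
      by (rule walk_snocE)
    have "(site ?a q - 1) mod int e = (site ?a p - 1) mod int e" using q(2) pi by simp
    then have "q = p" using valid_distinct[OF va q(1) p] mod_eq_shift(2) by blast
    then show "walk e ?P u (retreat ?a p)" using q by simp
  next
    assume "walk e ?P u (retreat ?a p)"
    then show "walk e ?P (u @ [i mod int e]) ?a" using walk_snocI[OF _ p ap va] pi by simp
  qed
  also have "\<dots> \<longleftrightarrow> walk e (occ \<mu>) u (len \<mu>)"
    unfolding len\<mu>
  proof
    assume "walk e ?P u (retreat ?a p)"
    then show "walk e (occ \<mu>) u (retreat ?a p)"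
      by (rule walk_subset[OF _ occ\<mu>(1)]) (use len_outside[of _ \<mu>] len\<mu> in auto)
  next
    assume w: "walk e (occ \<mu>) u (retreat ?a p)"
    show "walk e ?P u (retreat ?a p)"
    proof (cases "p \<in> occ \<mu>")
      case True
      then have "occ \<mu> = ?P" using occ\<mu> p by blast
      then show ?thesis using w by simp
    next
      case False
      then have P: "?P = insert p (occ \<mu>)" using occ\<mu> p by blast
      show ?thesis
        unfolding P
      proof (rule walk_insert[OF particles_occ[OF card\<mu>] w])
        show "valid e (insert p (occ \<mu>)) (retreat ?a p)" using vr P by simp
        show "retreat ?a p p = 0" using len_outside[OF False] len\<mu> by simp
        show "p \<notin> occ \<mu>" by (rule False)
        show "\<bar>p - r\<bar> < int e" if "r \<in> occ \<mu>" for r using window_close occ_window p that by blast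
      qed
    qed
  qed
  finally show "walk e ?P (u @ [i mod int e]) ?a \<longleftrightarrow> walk e (occ \<mu>) u (len \<mu>)" .
qed

lemma alcove_like_empty: "alcove_like empty_mpart" "occ empty_mpart = {}" "len empty_mpart = (\<lambda>_. 0)"
proof -
  show len: "len empty_mpart = (\<lambda>_. 0)" unfolding len_def empty_mpart_def by auto
  then show "occ empty_mpart = {}" unfolding occ_def by simp
  moreover have "boxes empty_mpart = {}" by (auto simp: boxes_def empty_mpart_def)
  ultimately show "alcove_like empty_mpart"
    unfolding alcove_like_def valid_def shape_def by (auto simp: empty_mpart_def)
qed

lemma sum_len:
  assumes "alcove_like \<Lambda>"
  shows "(\<Sum>p\<in>occ \<Lambda>. len \<Lambda> p) = card (boxes \<Lambda>)"
proof -
  have b: "boxes \<Lambda> = (\<lambda>(p, c). (row p, c, comp p)) ` (SIGMA p:occ \<Lambda>. {1..len \<Lambda> p})"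
  proof (intro equalityI subsetI)
    fix x assume x: "x \<in> boxes \<Lambda>"
    obtain r c m where rcm: "x = (r, c, m)" by (cases x)
    then have c: "1 \<le> c" "c \<le> \<Lambda> m r" "0 < \<Lambda> m r" using x unfolding boxes_def by auto
    note g = alcove_like_row[OF assms c(3)]
    show "x \<in> (\<lambda>(p, c). (row p, c, comp p)) ` (SIGMA p:occ \<Lambda>. {1..len \<Lambda> p})"
      by (rule image_eqI[of _ _ "(pos m r, c)"]) (use g c rcm in auto)
  next
    fix x assume "x \<in> (\<lambda>(p, c). (row p, c, comp p)) ` (SIGMA p:occ \<Lambda>. {1..len \<Lambda> p})"
    then obtain p c where x: "p \<in> occ \<Lambda>" "1 \<le> c" "c \<le> len \<Lambda> p" "x = (row p, c, comp p)" by auto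
    then show "x \<in> boxes \<Lambda>" using comp_row(3)[OF occ_window[OF x(1)]] occ_window[OF x(1)] unfolding boxes_def len_def by auto
  qed
  have inj: "inj_on (\<lambda>(p, c). (row p, c, comp p)) (SIGMA p:occ \<Lambda>. {1..len \<Lambda> p})"
  proof (rule inj_onI, clarify)
    fix p c p' c' assume pp: "p \<in> occ \<Lambda>" "p' \<in> occ \<Lambda>" and eq: "row p = row p'" "comp p = comp p'"
    have "p = pos (comp p) (row p)" by (rule comp_row(5)[OF occ_window[OF pp(1)], symmetric])
    also have "\<dots> = pos (comp p') (row p')" by (simp only: eq)
    also have "\<dots> = p'" by (rule comp_row(5)[OF occ_window[OF pp(2)]])
    finally show "p = p' \<and> c = c" by simp
  qed
  have "finite (occ \<Lambda>)" using track.finite_P[OF track_occ] .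
  then show ?thesis unfolding b card_image[OF inj] by (simp add: card_SigmaI)
qed

end

section \<open>The fundamental alcove\<close>

lemma dot_root_vec:
  assumes "i < N" "j < N"
  shows "dot N y (root_vec i j) = y i - y j"
proof -
  have "dot N y (root_vec i j) = (\<Sum>t<N. (if t = i then y t else 0) - (if t = j then y t else 0))"
    unfolding dot_def root_vec_def basis_vec_def by (rule sum.cong) auto
  then show ?thesis using assms by (simp add: sum_subtractf)
qed

lemma regular_points_iff:
  "x \<in> regular_points e N \<rho> \<longleftrightarrow> x \<in> topspace (Euclidean_space N) \<and>
     (\<forall>i<N. \<forall>j<N. i \<noteq> j \<longrightarrow> (\<forall>r::int. (x i + \<rho> i) - (x j + \<rho> j) \<noteq> of_int (r * int e)))"
proof -
  have "x \<in> hyperplane e N \<rho> (root_vec i j) r \<longleftrightarrow> (x i + \<rho> i) - (x j + \<rho> j) = of_int (r * int e)"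
    if "x \<in> topspace (Euclidean_space N)" "i < N" "j < N" for i j r
    using that(1) unfolding hyperplane_def mem_Collect_eq dot_root_vec[OF that(2,3)] by simp
  moreover have "x \<in> regular_points e N \<rho> \<longleftrightarrow> x \<in> topspace (Euclidean_space N) \<and>
      (\<forall>i<N. \<forall>j<N. i \<noteq> j \<longrightarrow> (\<forall>r. x \<notin> hyperplane e N \<rho> (root_vec i j) r))"
    unfolding regular_points_def by blast
  ultimately show ?thesis by blast
qed

lemma between_multiples: "0 < d \<Longrightarrow> d < real e \<Longrightarrow> d \<noteq> of_int (r * int e)"
proof
  assume d: "0 < d" "d < real e" "d = of_int (r * int e)"
  then have "0 < real_of_int (r * int e)" "real_of_int (r * int e) < real_of_int (int e)" by simp_all
  then have "0 < r * int e" "r * int e < 1 * int e" by (simp_all only: of_int_0_less_iff of_int_less_iff mult_1)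
  then show False by (auto simp: zero_less_mult_iff)
qed

text \<open>The points of the alcove are those whose coordinates, shifted by \<open>\<rho>\<close>, are decreasing and lie in
  an open interval of length \<open>e\<close>: this set is convex, and the differences of two coordinates cannot
  leave the interval between \<open>0\<close> and \<open>e\<close> without meeting a hyperplane.\<close>

lemma alcove_iff:
  fixes \<rho> :: "nat \<Rightarrow> real"
  assumes \<rho>: "\<And>i j. i < j \<Longrightarrow> j < N \<Longrightarrow> 0 < \<rho> i - \<rho> j \<and> \<rho> i - \<rho> j < real e"
    and x: "\<And>t. N \<le> t \<Longrightarrow> x t = 0"
  shows "connected_component_of (subtopology (Euclidean_space N) (regular_points e N \<rho>)) (\<lambda>t. 0) x \<longleftrightarrow>
    (\<forall>i j. i < j \<and> j < N \<longrightarrow> 0 < (x i + \<rho> i) - (x j + \<rho> j) \<and> (x i + \<rho> i) - (x j + \<rho> j) < real e)"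
    (is "connected_component_of ?X ?o x \<longleftrightarrow> ?R")
proof
  assume "connected_component_of ?X ?o x"
  then obtain T where T: "connectedin ?X T" "?o \<in> T" "x \<in> T"
    unfolding connected_component_of_def by auto
  show ?R
  proof (intro allI impI)
    fix i j assume ij: "i < j \<and> j < N"
    define f where "f y = (y i + \<rho> i) - (y j + \<rho> j)" for y :: "nat \<Rightarrow> real"
    have proj: "continuous_map ?X euclideanreal (\<lambda>y. y k)" for k
      unfolding Euclidean_space_def
      by (intro continuous_map_from_subtopology) (rule continuous_map_product_projection, simp)
    have "continuous_map ?X euclideanreal f"
      unfolding f_def by (intro continuous_map_diff continuous_map_add proj) auto
    then have "connectedin euclideanreal (f ` T)"
      using T(1) connectedin_continuous_map_image by blast
    then have conn: "connected (f ` T)" by simp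
    have "T \<subseteq> regular_points e N \<rho>" using connectedin_subset_topspace[OF T(1)] by auto
    then have no: "f y \<noteq> of_int (r * int e)" if "y \<in> T" for y r
    proof -
      have "y \<in> regular_points e N \<rho>" using that \<open>T \<subseteq> _\<close> by blast
      moreover have "i < N" "j < N" "i \<noteq> j" using ij by auto
      ultimately show ?thesis unfolding f_def regular_points_iff by blast
    qed
    have fo: "0 < f ?o" "f ?o < real e" using \<rho> ij unfolding f_def by auto
    have sub: "{min (f ?o) (f x)..max (f ?o) (f x)} \<subseteq> f ` T"
      using connected_contains_Icc[OF conn] T(2,3) by (auto simp: min_def max_def)
    have "0 < f x"
    proof (rule ccontr)
      assume "\<not> 0 < f x"
      then have "0 \<in> f ` T" using sub fo by auto
      then show False using no[of _ 0] by auto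
    qed
    moreover have "f x < real e"
    proof (rule ccontr)
      assume "\<not> f x < real e"
      then have "real e \<in> f ` T" using sub fo by auto
      then obtain y where "real e = f y" "y \<in> T" by (rule imageE)
      then show False using no[of y 1] by simp
    qed
    ultimately show "0 < (x i + \<rho> i) - (x j + \<rho> j) \<and> (x i + \<rho> i) - (x j + \<rho> j) < real e"
      unfolding f_def by simp
  qed
next
  assume R: ?R
  define g where "g u = (\<lambda>t. u * x t)" for u :: real
  have reg: "g u \<in> regular_points e N \<rho>" if u: "0 \<le> u" "u \<le> 1" for u
  proof -
    have pos: "0 < (g u i + \<rho> i) - (g u j + \<rho> j) \<and> (g u i + \<rho> i) - (g u j + \<rho> j) < real e" if ij: "i < j" "j < N" for i j
    proof -
      let ?d = "(x i + \<rho> i) - (x j + \<rho> j)"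
      have d: "0 < ?d" "?d < real e" "0 < \<rho> i - \<rho> j" "\<rho> i - \<rho> j < real e" using R \<rho>[OF ij] ij by auto
      have eq: "(g u i + \<rho> i) - (g u j + \<rho> j) = u *\<^sub>R ?d + (1 - u) *\<^sub>R (\<rho> i - \<rho> j)"
        unfolding g_def by (simp add: algebra_simps)
      have "convex {0<..<real e}" by (rule convex_real_interval)
      then have "u *\<^sub>R ?d + (1 - u) *\<^sub>R (\<rho> i - \<rho> j) \<in> {0<..<real e}"
        using d u by (intro convexD) auto
      then show ?thesis unfolding eq by simp
    qed
    have "(g u i + \<rho> i) - (g u j + \<rho> j) \<noteq> of_int (r * int e)" if ij: "i < N" "j < N" "i \<noteq> j" for i j r
    proof (cases "i < j")
      case True
      then show ?thesis using between_multiples pos ij by blast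
    next
      case False
      then have "(g u j + \<rho> j) - (g u i + \<rho> i) \<noteq> of_int ((- r) * int e)"
        using between_multiples pos[of j i] ij by (intro between_multiples) auto
      then show ?thesis by auto
    qed
    moreover have "g u \<in> topspace (Euclidean_space N)" using x unfolding g_def topspace_Euclidean_space by auto
    ultimately show ?thesis unfolding regular_points_iff by blast
  qed
  have "continuous_map (top_of_set {0..1}) ?X g"
    unfolding Euclidean_space_def continuous_map_in_subtopology
  proof (intro conjI)
    show "continuous_map (top_of_set {0..1}) (powertop_real UNIV) g"
      unfolding continuous_map_componentwise_UNIV g_def
      by (auto simp: continuous_map_iff_continuous intro!: continuous_intros)
    show "g \<in> topspace (top_of_set {0..1}) \<rightarrow> {x. \<forall>i\<ge>N. x i = 0}" using x unfolding g_def by auto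
    show "g \<in> topspace (top_of_set {0..1}) \<rightarrow> regular_points e N \<rho>" using reg by auto
  qed
  then have "connectedin ?X (g ` {0..1})"
    by (rule connectedin_continuous_map_image) (simp add: connectedin_subtopology)
  moreover have "?o \<in> g ` {0..1}" by (rule image_eqI[of _ _ 0]) (auto simp: g_def)
  moreover have "x \<in> g ` {0..1}" by (rule image_eqI[of _ _ 1]) (auto simp: g_def)
  ultimately show "connected_component_of ?X ?o x"
    unfolding connected_component_of_def by auto
qed

section \<open>The index set of the coordinates\<close>

text \<open>The coordinates list the components in descending order, so that the starting points
  \<open>pos m r\<close> decrease along the list. In this order \<open>idx l h m i\<close> is the number of the coordinate
  of row \<open>i\<close> of component \<open>m\<close>, counted from \<open>0\<close>.\<close>

definition above :: "nat \<Rightarrow> (nat \<Rightarrow> nat) \<Rightarrow> nat \<Rightarrow> nat" where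
  "above l h m = (\<Sum>k\<in>{Suc m..l}. h k)"

definition idx :: "nat \<Rightarrow> (nat \<Rightarrow> nat) \<Rightarrow> nat \<Rightarrow> nat \<Rightarrow> nat" where
  "idx l h m i = above l h m + i - 1"

lemma above_step: "1 \<le> m \<Longrightarrow> m \<le> l \<Longrightarrow> above l h (m - 1) = h m + above l h m"
  unfolding above_def by (simp add: sum.atLeast_Suc_atMost)

lemma above_mono: "m' < m \<Longrightarrow> m \<le> l \<Longrightarrow> above l h m + h m \<le> above l h m'"
proof -
  assume m: "m' < m" "m \<le> l"
  have "(\<Sum>k\<in>{m..l}. h k) \<le> (\<Sum>k\<in>{Suc m'..l}. h k)" using m by (intro sum_mono2) auto
  then show ?thesis using above_step[of m l h] m unfolding above_def by simp
qed

lemma idx_less: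
  assumes "m \<le> l" "1 \<le> i" "i \<le> h m" "1 \<le> i'" "m' < m \<or> m' = m \<and> i < i'"
  shows "idx l h m i < idx l h m' i'"
proof (cases "m' = m")
  case False
  then show ?thesis using above_mono[of m' m l h] assms unfolding idx_def by auto
qed (use assms in \<open>auto simp: idx_def\<close>)

lemma idx_bound: "1 \<le> m \<Longrightarrow> m \<le> l \<Longrightarrow> 1 \<le> i \<Longrightarrow> i \<le> h m \<Longrightarrow> idx l h m i < height_sum l h"
  using above_mono[of 0 m l h] unfolding idx_def height_sum_def above_def by auto

lemma idx_cases:
  assumes "t < height_sum l h"
  obtains m i where "1 \<le> m" "m \<le> l" "1 \<le> i" "i \<le> h m" "t = idx l h m i"
proof -
  have "\<exists>m i. 1 \<le> m \<and> m \<le> l \<and> 1 \<le> i \<and> i \<le> h m \<and> t = idx l h m i"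
    if "t < above l h m0" "m0 \<le> l" for m0
    using that(2,1)
  proof (induction m0 rule: inc_induct)
    case base
    then show ?case by (simp add: above_def)
  next
    case (step m0)
    show ?case
    proof (cases "t < above l h (Suc m0)")
      case True
      then show ?thesis by (rule step.IH)
    next
      case False
      then have "t = idx l h (Suc m0) (t - above l h (Suc m0) + 1)" unfolding idx_def by simp
      moreover have "t - above l h (Suc m0) + 1 \<le> h (Suc m0)"
        using above_step[of "Suc m0" l h] step False by simp
      ultimately show ?thesis using step by (intro exI[of _ "Suc m0"] exI[of _ "t - above l h (Suc m0) + 1"]) auto
    qed
  qed
  from this[of 0] show thesis using that assms unfolding above_def height_sum_def by auto
qed

lemma idx_inj:
  assumes "m \<le> l" "1 \<le> i" "i \<le> h m" "m' \<le> l" "1 \<le> i'" "i' \<le> h m'" "idx l h m i = idx l h m' i'"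
  shows "m = m' \<and> i = i'"
  using idx_less[of m l i h i' m'] idx_less[of m' l i' h i m] assms by (metis linorder_neqE_nat less_irrefl)

lemma eps_idx: "eps l h m i t = (if t = idx l h m i then 1 else 0)"
  unfolding eps_def basis_vec_def idx_def above_def by simp

lemma sum_eps_idx:
  assumes m: "1 \<le> m" "m \<le> l" "1 \<le> i" "i \<le> h m"
  shows "(\<Sum>m'\<in>{1..l}. \<Sum>i'\<in>{1..h m'}. c m' i' * eps l h m' i' (idx l h m i)) = (c m i :: real)"
proof -
  have "(\<Sum>i'\<in>{1..h m'}. c m' i' * eps l h m' i' (idx l h m i)) = (if m' = m then c m i else 0)"
    if "m' \<in> {1..l}" for m'
  proof -
    have "(\<Sum>i'\<in>{1..h m'}. c m' i' * eps l h m' i' (idx l h m i)) = (\<Sum>i'\<in>{1..h m'}. if i' = i \<and> m' = m then c m i else 0)"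
      by (rule sum.cong) (use idx_inj[of m l i h m'] m that in \<open>auto simp: eps_idx\<close>)
    also have "\<dots> = (if m' = m then c m i else 0)" using m by (cases "m' = m") auto
    finally show ?thesis .
  qed
  then show ?thesis using m by simp
qed

lemma mpart_point_idx:
  "1 \<le> m \<Longrightarrow> m \<le> l \<Longrightarrow> 1 \<le> i \<Longrightarrow> i \<le> h m \<Longrightarrow> mpart_point l h \<Lambda> (idx l h m i) = real (\<Lambda> m i)"
  unfolding mpart_point_def by (rule sum_eps_idx)

lemma rho_idx:
  "1 \<le> m \<Longrightarrow> m \<le> l \<Longrightarrow> 1 \<le> i \<Longrightarrow> i \<le> h m \<Longrightarrow> rho l s h (idx l h m i) = of_int (s m - int i + 1)"
  unfolding rho_def by (rule sum_eps_idx)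

lemma mpart_point_outside: "height_sum l h \<le> t \<Longrightarrow> mpart_point l h \<Lambda> t = 0"
  unfolding mpart_point_def eps_idx
  by (intro sum.neutral ballI) (use idx_bound[of _ l _ h] in force)

section \<open>The two combinatorial conditions\<close>

lemma down_closed_interval:
  assumes "finite S" "0 \<notin> S" "\<And>r. Suc r \<in> S \<Longrightarrow> 1 \<le> r \<Longrightarrow> r \<in> S"
  shows "S = {1..card S}"
proof (cases "S = {}")
  case False
  have down: "r \<in> S" if "r' \<in> S" "1 \<le> r" "r \<le> r'" for r r'
    using that(3,1,2)
  proof (induction r rule: inc_induct)
    case (step k)
    then show ?case using assms(3)[of k] by auto
  qed
  have S: "S = {1..Max S}"
  proof
    show "S \<subseteq> {1..Max S}" using assms(1,2) by (auto simp: Suc_le_eq intro: gr0I)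
    show "{1..Max S} \<subseteq> S" using down[OF Max_in[OF assms(1) False]] by auto
  qed
  have "card {1..Max S} = Max S" by simp
  then have "card S = Max S" unfolding S[symmetric] .
  then show ?thesis using S by (simp only:)
qed simp

lemma nonzero_rows_heights:
  assumes "shape l \<Lambda>"
  shows "nonzero_rows \<Lambda> m = {1..heights \<Lambda> m}"
  unfolding heights_def
proof (rule down_closed_interval)
  have "nonzero_rows \<Lambda> m \<subseteq> fst ` {(r, m). 0 < \<Lambda> m r}" unfolding nonzero_rows_def by force
  then show "finite (nonzero_rows \<Lambda> m)"
    using finite_nonzero_rows[OF assms] finite_subset by blast
  show "r \<in> nonzero_rows \<Lambda> m" if "Suc r \<in> nonzero_rows \<Lambda> m" "1 \<le> r" for r
    using that shape_decreasing[OF assms that(2), of "Suc r" m] unfolding nonzero_rows_def by auto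
qed (simp add: nonzero_rows_def)

lemma positive_iff_heights:
  assumes "shape l \<Lambda>"
  shows "0 < \<Lambda> m r \<longleftrightarrow> 1 \<le> r \<and> r \<le> heights \<Lambda> m"
proof -
  have "0 < \<Lambda> m r \<longleftrightarrow> r \<in> nonzero_rows \<Lambda> m"
    using shape_outside[OF assms, of m r] unfolding nonzero_rows_def by auto
  then show ?thesis unfolding nonzero_rows_heights[OF assms] by auto
qed

lemma sorted_wrt_concat:
  "sorted_wrt R (concat xss) \<longleftrightarrow>
    (\<forall>xs\<in>set xss. sorted_wrt R xs) \<and> sorted_wrt (\<lambda>xs ys. \<forall>x\<in>set xs. \<forall>y\<in>set ys. R x y) xss"
  by (induction xss) (auto simp: sorted_wrt_append)

lemma sorted_wrt_upt: "sorted_wrt Q [1..<Suc l] \<longleftrightarrow> (\<forall>m m'. 1 \<le> m \<and> m < m' \<and> m' \<le> l \<longrightarrow> Q m m')"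
proof -
  have "sorted_wrt Q [1..<Suc l] \<longleftrightarrow> (\<forall>i j. i < j \<longrightarrow> j < l \<longrightarrow> Q (Suc i) (Suc j))"
    unfolding sorted_wrt_iff_nth_less by (auto simp del: upt_Suc)
  also have "\<dots> \<longleftrightarrow> (\<forall>m m'. 1 \<le> m \<and> m < m' \<and> m' \<le> l \<longrightarrow> Q m m')"
  proof (intro iffI allI impI)
    fix m m' assume "\<forall>i j. i < j \<longrightarrow> j < l \<longrightarrow> Q (Suc i) (Suc j)" and m: "1 \<le> m \<and> m < m' \<and> m' \<le> l"
    then have "m - 1 < m' - 1 \<longrightarrow> m' - 1 < l \<longrightarrow> Q (Suc (m - 1)) (Suc (m' - 1))" by blast
    then show "Q m m'" using m by auto
  qed auto
  finally show ?thesis .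
qed

abbreviation border_content :: "(nat \<Rightarrow> int) \<Rightarrow> mpart \<Rightarrow> nat \<Rightarrow> nat \<Rightarrow> int" where
  "border_content s \<Lambda> m r \<equiv> charged_content s (r, \<Lambda> m r, m)"

lemma component_border_set:
  assumes "shape l \<Lambda>"
  shows "component_border s \<Lambda> m = mset_set (border_content s \<Lambda> m ` nonzero_rows \<Lambda> m)"
proof -
  have "inj_on (border_content s \<Lambda> m) (nonzero_rows \<Lambda> m)"
  proof (rule linorder_inj_onI')
    fix r r' assume r: "r \<in> nonzero_rows \<Lambda> m" "r < r'"
    then have "\<Lambda> m r' \<le> \<Lambda> m r" by (intro shape_decreasing[OF assms]) (auto simp: nonzero_rows_def)
    then show "border_content s \<Lambda> m r \<noteq> border_content s \<Lambda> m r'" using r unfolding charged_content_def by auto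
  qed
  then show ?thesis unfolding component_border_def by (simp add: image_mset_mset_set)
qed

lemma reading_word_increasing_iff:
  assumes "shape l \<Lambda>"
  shows "sorted_wrt (<) (reading_word l s \<Lambda>) \<longleftrightarrow>
    (\<forall>m m' r r'. 1 \<le> m \<and> m < m' \<and> m' \<le> l \<and> 0 < \<Lambda> m r \<and> 0 < \<Lambda> m' r' \<longrightarrow>
       border_content s \<Lambda> m r < border_content s \<Lambda> m' r')"
proof -
  have fin: "finite (nonzero_rows \<Lambda> m)" for m unfolding nonzero_rows_heights[OF assms] by simp
  have sl: "sorted_list_of_multiset (component_border s \<Lambda> m) = sorted_list_of_set (border_content s \<Lambda> m ` nonzero_rows \<Lambda> m)" for m
    unfolding component_border_set[OF assms] by simp
  have rows: "r \<in> nonzero_rows \<Lambda> m \<longleftrightarrow> 0 < \<Lambda> m r" for m r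
    using shape_outside[OF assms, of m r] unfolding nonzero_rows_def by auto
  have "sorted_wrt (<) (reading_word l s \<Lambda>) \<longleftrightarrow>
    (\<forall>m m'. 1 \<le> m \<and> m < m' \<and> m' \<le> l \<longrightarrow> (\<forall>x\<in>border_content s \<Lambda> m ` nonzero_rows \<Lambda> m.
      \<forall>y\<in>border_content s \<Lambda> m' ` nonzero_rows \<Lambda> m'. x < y))"
    unfolding reading_word_def sorted_wrt_concat sorted_wrt_map sorted_wrt_upt sl
    using fin by simp
  then show ?thesis using rows by auto
qed

lemma period_iff:
  assumes "shape l \<Lambda>"
  shows "period_at_most e (right_border l s \<Lambda>) \<longleftrightarrow>
    (\<forall>m m' r r'. 0 < \<Lambda> m r \<and> 0 < \<Lambda> m' r' \<longrightarrow> border_content s \<Lambda> m r < border_content s \<Lambda> m' r' + int e)"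
    (is "_ \<longleftrightarrow> ?R")
proof -
  define B where "B = {border_content s \<Lambda> m r |m r. 0 < \<Lambda> m r}"
  have fin: "finite (nonzero_rows \<Lambda> m)" for m unfolding nonzero_rows_heights[OF assms] by simp
  have "set_mset (right_border l s \<Lambda>) = (\<Union>m\<in>{1..l}. border_content s \<Lambda> m ` nonzero_rows \<Lambda> m)"
    unfolding right_border_def component_border_set[OF assms] using fin by (simp add: set_mset_sum)
  also have "\<dots> = B" unfolding B_def nonzero_rows_def using shape_outside[OF assms] by fastforce
  finally have set: "set_mset (right_border l s \<Lambda>) = B" .
  then have "finite B" by (metis finite_set_mset)
  show ?thesis
  proof
    assume "period_at_most e (right_border l s \<Lambda>)"
    then obtain z where "B \<subseteq> {z..z + int e - 1}" unfolding period_at_most_def set by blast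
    then have z: "z \<le> x \<and> x \<le> z + int e - 1" if "x \<in> B" for x using that by auto
    show ?R
    proof (intro allI impI)
      fix m m' r r' assume "0 < \<Lambda> m r \<and> 0 < \<Lambda> m' r'"
      then have "border_content s \<Lambda> m r \<in> B" "border_content s \<Lambda> m' r' \<in> B" unfolding B_def by auto
      from z[OF this(1)] z[OF this(2)] show "border_content s \<Lambda> m r < border_content s \<Lambda> m' r' + int e" by linarith
    qed
  next
    assume R: ?R
    have pair: "x < y + int e" if "x \<in> B" "y \<in> B" for x y using that R unfolding B_def by auto
    have "B \<subseteq> {Min B..Min B + int e - 1}"
    proof
      fix x assume x: "x \<in> B"
      then have "Min B \<in> B" "Min B \<le> x" using \<open>finite B\<close> by (auto intro: Min_in)
      then show "x \<in> {Min B..Min B + int e - 1}" using pair[OF x, of "Min B"] by auto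
    qed
    then show "period_at_most e (right_border l s \<Lambda>)" unfolding period_at_most_def set by blast
  qed
qed

context charge
begin

lemma border_content_pos:
  assumes "1 \<le> m" "m \<le> l" "1 \<le> r" "int r \<le> gap m"
  shows "border_content s \<Lambda> m r = site (len \<Lambda>) (pos m r) - 1"
  using len_pos[OF assms] unfolding charged_content_def site_def pos_def by simp

lemma pos_less:
  assumes "1 \<le> m" "m < m'" "m' \<le> l" "1 \<le> r" "int r' \<le> gap m'"
  shows "pos m r < pos m' r'"
proof -
  have "s m \<le> s (m' - 1)" by (rule s_mono) (use assms in auto)
  then show ?thesis using assms unfolding pos_def gap_def by auto
qed

text \<open>The last box of the row of a particle \<open>p\<close> has the content \<open>site p - 1\<close>, so that the
  conditions on the reading word and the period express the order of the particles in different
  components and their distances. By cylindricity a row that is too deep is at most as long as a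
  row of the cyclically preceding component. The contents of their last boxes would then violate
  the reading word condition or, for the first component, the bound on the period.\<close>

lemma border_condition_iff_alcove_like:
  assumes sh: "shape l \<Lambda>"
  shows "border_condition e l s \<Lambda> \<longleftrightarrow> alcove_like \<Lambda>"
proof
  assume "alcove_like \<Lambda>"
  note outer = alcove_likeD(2)[OF this] and va = alcove_likeD(3)[OF this] and row = alcove_like_row[OF this]
  interpret track e "occ \<Lambda>" by (rule track_occ)
  have bc: "border_content s \<Lambda> m r = site (len \<Lambda>) (pos m r) - 1" if "0 < \<Lambda> m r" for m r
    by (rule border_content_pos[OF row(1-4)[OF that]])
  have "cylindric e l s \<Lambda>"
    unfolding cylindric_def
  proof (intro conjI allI impI)
    fix j k :: nat assume j: "1 \<le> j \<and> j < l \<and> 1 \<le> k"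
    have "s j \<le> s (Suc j)" using s_step j by auto
    then have "\<not> int (nat (int k + s (Suc j) - s j)) \<le> gap (Suc j)" using j unfolding gap_def by auto
    then have "\<Lambda> (Suc j) (nat (int k + s (Suc j) - s j)) = 0" using outer by fastforce
    then show "\<Lambda> (Suc j) (nat (int k + s (Suc j) - s j)) \<le> \<Lambda> j k" by simp
  next
    fix k :: nat assume k: "1 \<le> k"
    have "\<not> int (nat (int k + int e + s 1 - s l)) \<le> gap 1" using k s_last unfolding gap_def by auto
    then have "\<Lambda> 1 (nat (int k + int e + s 1 - s l)) = 0" using outer by fastforce
    then show "\<Lambda> 1 (nat (int k + int e + s 1 - s l)) \<le> \<Lambda> l k" by simp
  qed
  moreover have "period_at_most e (right_border l s \<Lambda>)"
    unfolding period_iff[OF sh]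
  proof (intro allI impI)
    fix m m' r r' assume "0 < \<Lambda> m r \<and> 0 < \<Lambda> m' r'"
    then have p: "0 < \<Lambda> m r" "0 < \<Lambda> m' r'" by auto
    show "border_content s \<Lambda> m r < border_content s \<Lambda> m' r' + int e"
      using valid_close[OF va row(5)[OF p(1)] row(5)[OF p(2)]] bc[OF p(1)] bc[OF p(2)] by linarith
  qed
  moreover have "sorted_wrt (<) (reading_word l s \<Lambda>)"
    unfolding reading_word_increasing_iff[OF sh]
  proof (intro allI impI)
    fix m m' r r' assume m: "1 \<le> m \<and> m < m' \<and> m' \<le> l \<and> 0 < \<Lambda> m r \<and> 0 < \<Lambda> m' r'"
    then have p: "0 < \<Lambda> m r" "0 < \<Lambda> m' r'" by auto
    have "pos m r < pos m' r'" by (rule pos_less) (use m row(3)[OF p(1)] row(4)[OF p(2)] in auto)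
    then have "site (len \<Lambda>) (pos m r) < site (len \<Lambda>) (pos m' r')"
      using va row(5)[OF p(1)] row(5)[OF p(2)] unfolding valid_def by blast
    then show "border_content s \<Lambda> m r < border_content s \<Lambda> m' r'" using bc[OF p(1)] bc[OF p(2)] by linarith
  qed
  ultimately show "border_condition e l s \<Lambda>" unfolding border_condition_def by blast
next
  assume "border_condition e l s \<Lambda>"
  then have cyl: "cylindric e l s \<Lambda>" and per: "period_at_most e (right_border l s \<Lambda>)"
    and word: "sorted_wrt (<) (reading_word l s \<Lambda>)" unfolding border_condition_def by auto
  have word: "border_content s \<Lambda> m r < border_content s \<Lambda> m' r'"
    if "1 \<le> m" "m < m'" "m' \<le> l" "0 < \<Lambda> m r" "0 < \<Lambda> m' r'" for m m' r r'
    using word that unfolding reading_word_increasing_iff[OF sh] by blast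
  have per: "border_content s \<Lambda> m r < border_content s \<Lambda> m' r' + int e"
    if "0 < \<Lambda> m r" "0 < \<Lambda> m' r'" for m m' r r'
    using per that unfolding period_iff[OF sh] by blast
  have outer: "int r \<le> gap m" if pos: "0 < \<Lambda> m r" for m r
  proof (rule ccontr)
    assume "\<not> int r \<le> gap m"
    have m: "1 \<le> m" "m \<le> l" using shape_outside[OF sh pos] by auto
    define k where "k = nat (int r - gap m)"
    have k: "1 \<le> k" "int r = int k + gap m" unfolding k_def using \<open>\<not> int r \<le> gap m\<close> by auto
    show False
    proof (cases "m = 1")
      case True
      have "nat (int k + int e + s 1 - s l) = r" using k True unfolding gap_def by simp
      then have le: "\<Lambda> 1 r \<le> \<Lambda> l k" using cyl k(1) unfolding cylindric_def by metis
      then have "border_content s \<Lambda> l k < border_content s \<Lambda> 1 r + int e"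
        using pos True by (intro per) auto
      then show False using le k True unfolding charged_content_def gap_def by auto
    next
      case False
      then have j: "1 \<le> m - 1" "m - 1 < l" "Suc (m - 1) = m" using m by auto
      have "nat (int k + s m - s (m - 1)) = r" using k False unfolding gap_def by simp
      moreover have "\<Lambda> (Suc (m - 1)) (nat (int k + s (Suc (m - 1)) - s (m - 1))) \<le> \<Lambda> (m - 1) k"
        using cyl k(1) j(1,2) unfolding cylindric_def by blast
      ultimately have le: "\<Lambda> m r \<le> \<Lambda> (m - 1) k" using j(3) by simp
      then have "border_content s \<Lambda> (m - 1) k < border_content s \<Lambda> m r"
        using pos j m by (intro word) auto
      then show False using le k False unfolding charged_content_def gap_def by auto
    qed
  qed
  have content: "site (len \<Lambda>) p = border_content s \<Lambda> (comp p) (row p) + 1" "0 < \<Lambda> (comp p) (row p)" if "p \<in> occ \<Lambda>" for p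
  proof -
    note w = comp_row[OF occ_window[OF that]]
    show "site (len \<Lambda>) p = border_content s \<Lambda> (comp p) (row p) + 1"
      using border_content_pos[OF w(1-4), of \<Lambda>] w(5) by simp
    show "0 < \<Lambda> (comp p) (row p)" using that occ_window[OF that] unfolding occ_def len_def by simp
  qed
  have "valid e (occ \<Lambda>) (len \<Lambda>)"
    unfolding valid_def
  proof (intro ballI impI)
    fix p p' assume p: "p \<in> occ \<Lambda>" "p' \<in> occ \<Lambda>" "p < p'"
    note w = comp_row[OF occ_window[OF p(1)]] and w' = comp_row[OF occ_window[OF p(2)]]
    have "comp p \<le> comp p'" using comp_mono occ_window p by auto
    have "site (len \<Lambda>) p < site (len \<Lambda>) p'"
    proof (cases "comp p = comp p'")
      case True
      then have "row p' \<le> row p" using w(5) w'(5) p(3) unfolding pos_def by simp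
      then have "\<Lambda> (comp p) (row p) \<le> \<Lambda> (comp p) (row p')" by (intro shape_decreasing[OF sh w'(3)])
      then show ?thesis using p(3) occ_window[OF p(1)] occ_window[OF p(2)] True unfolding site_def len_def by simp
    next
      case False
      then have "border_content s \<Lambda> (comp p) (row p) < border_content s \<Lambda> (comp p') (row p')"
        using \<open>comp p \<le> comp p'\<close> w w' content p by (intro word) auto
      then show ?thesis using content(1)[OF p(1)] content(1)[OF p(2)] by simp
    qed
    moreover have "site (len \<Lambda>) p' < site (len \<Lambda>) p + int e"
      using per[OF content(2)[OF p(2)] content(2)[OF p(1)]] content(1)[OF p(1)] content(1)[OF p(2)] by simp
    ultimately show "site (len \<Lambda>) p < site (len \<Lambda>) p' \<and> site (len \<Lambda>) p' < site (len \<Lambda>) p + int e" ..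
  qed
  then show "alcove_like \<Lambda>" unfolding alcove_like_def using sh outer by blast
qed

lemma gap_ge2: "m \<in> {2..l} \<Longrightarrow> gap m = s m - s (m - 1)"
  unfolding gap_def by auto

lemma admissible_iff:
  "admissible e l s h \<longleftrightarrow> (\<forall>m\<in>{1..l}. int (h m) \<le> gap m) \<and> (\<exists>m\<in>{1..l}. int (h m) < gap m)"
proof -
  have "{1..l} = insert 1 {2..l}" using l_ge1 by auto
  then show ?thesis unfolding admissible_def using gap_ge2 by (auto simp: gap_def)
qed

lemma sum_gap: "(\<Sum>m\<in>{1..l}. gap m) = int e"
proof -
  have "(\<Sum>m\<in>{1..k}. gap m) = int e + s k - s l" if "1 \<le> k" "k \<le> l" for k
    using that
  proof (induction k rule: nat_induct_at_least)
    case base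
    then show ?case by (simp add: gap_def)
  next
    case (Suc k)
    then show ?case by (simp add: gap_def)
  qed
  then show ?thesis using l_ge1 by simp
qed

text \<open>The coordinates, shifted by \<open>\<rho>\<close>, are the positions of the particles. The number of particles
  is the sum of the heights, and the gaps add up to \<open>e\<close>; so once no height exceeds its gap, one
  inequality of admissibility is strict if and only if there are fewer than \<open>e\<close> particles.\<close>

lemma alcove_condition_iff_alcove_like:
  assumes sh: "shape l \<Lambda>"
  shows "alcove_condition e l s \<Lambda> \<longleftrightarrow> alcove_like \<Lambda> \<and> card (occ \<Lambda>) < e"
proof -
  let ?h = "heights \<Lambda>"
  let ?N = "height_sum l ?h"
  let ?y = "\<lambda>t. mpart_point l ?h \<Lambda> t + rho l s ?h t"
  note pos_iff = positive_iff_heights[OF sh]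
  have outer_iff: "(\<forall>m\<in>{1..l}. int (?h m) \<le> gap m) \<longleftrightarrow> (\<forall>m r. 0 < \<Lambda> m r \<longrightarrow> int r \<le> gap m)"
  proof
    assume h: "\<forall>m\<in>{1..l}. int (?h m) \<le> gap m"
    show "\<forall>m r. 0 < \<Lambda> m r \<longrightarrow> int r \<le> gap m"
    proof (intro allI impI)
      fix m r assume "0 < \<Lambda> m r"
      then have "m \<in> {1..l}" "r \<le> ?h m" using shape_outside[OF sh, of m r] pos_iff by auto
      then have "int (?h m) \<le> gap m" "int r \<le> int (?h m)" using h by auto
      then show "int r \<le> gap m" by linarith
    qed
  next
    assume o: "\<forall>m r. 0 < \<Lambda> m r \<longrightarrow> int r \<le> gap m"
    show "\<forall>m\<in>{1..l}. int (?h m) \<le> gap m"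
    proof
      fix m assume m: "m \<in> {1..l}"
      show "int (?h m) \<le> gap m"
      proof (cases "?h m = 0")
        case True
        then show ?thesis using gap_nonneg[of m] m by simp
      next
        case False
        then have "0 < \<Lambda> m (?h m)" unfolding pos_iff by simp
        then show ?thesis using o by blast
      qed
    qed
  qed
  show ?thesis
  proof (cases "\<forall>m\<in>{1..l}. int (?h m) \<le> gap m")
    case False
    then have "\<not> admissible e l s ?h" "\<not> alcove_like \<Lambda>" unfolding admissible_iff alcove_like_def outer_iff by auto
    then show ?thesis unfolding alcove_condition_def Let_def by simp
  next
    case True
    have outer: "int r \<le> gap m" if "0 < \<Lambda> m r" for m r using True that unfolding outer_iff by blast
    have in_gap: "int i \<le> gap m" "len \<Lambda> (pos m i) = \<Lambda> m i" "pos m i \<in> occ \<Lambda>" "comp (pos m i) = m" "row (pos m i) = i"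
      if "1 \<le> m" "m \<le> l" "1 \<le> i" "i \<le> ?h m" for m i
    proof -
      have p: "0 < \<Lambda> m i" using that pos_iff by simp
      then show g: "int i \<le> gap m" using outer by blast
      show "len \<Lambda> (pos m i) = \<Lambda> m i" by (rule len_pos[OF that(1-3) g])
      then show "pos m i \<in> occ \<Lambda>" using p unfolding occ_def by simp
      show "comp (pos m i) = m" "row (pos m i) = i" by (rule pos_inverse[OF that(1-3) g])+
    qed
    have occ_rows: "1 \<le> comp p" "comp p \<le> l" "1 \<le> row p" "row p \<le> ?h (comp p)" "pos (comp p) (row p) = p" if "p \<in> occ \<Lambda>" for p
    proof -
      note w = comp_row[OF occ_window[OF that]]
      show "1 \<le> comp p" "comp p \<le> l" "1 \<le> row p" "pos (comp p) (row p) = p" using w by auto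
      have "0 < \<Lambda> (comp p) (row p)" using that occ_window[OF that] unfolding occ_def len_def by simp
      then show "row p \<le> ?h (comp p)" unfolding pos_iff by simp
    qed
    have order: "pos m' i' < pos m i"
      if "1 \<le> m" "m \<le> l" "1 \<le> i" "i \<le> ?h m" "1 \<le> m'" "m' \<le> l" "1 \<le> i'" "i' \<le> ?h m'" "idx l ?h m i < idx l ?h m' i'" for m i m' i'
    proof -
      have "m' < m \<or> m' = m \<and> i < i'"
      proof (rule ccontr)
        assume "\<not> (m' < m \<or> m' = m \<and> i < i')"
        then have "m < m' \<or> m = m' \<and> i' \<le> i" by auto
        then have "idx l ?h m' i' \<le> idx l ?h m i"
          using idx_less[of m' l i' ?h i m] that by (cases "m = m' \<and> i = i'") auto
        then show False using that by simp
      qed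
      then show ?thesis
      proof
        assume "m' < m"
        then show ?thesis using pos_less[of m' m i' i] that in_gap(1) by auto
      qed (auto simp: pos_def)
    qed
    have card: "int (card (occ \<Lambda>)) = (\<Sum>m\<in>{1..l}. int (?h m))"
    proof -
      have b: "bij_betw (\<lambda>(m, i). pos m i) (SIGMA m:{1..l}. {1..?h m}) (occ \<Lambda>)"
        by (rule bij_betw_byWitness[where f' = "\<lambda>p. (comp p, row p)"]) (use in_gap occ_rows in auto)
      have "card (occ \<Lambda>) = card (SIGMA m:{1..l}. {1..?h m})" using bij_betw_same_card[OF b] by simp
      then show ?thesis by (simp add: card_SigmaI)
    qed
    have adm: "admissible e l s ?h \<longleftrightarrow> card (occ \<Lambda>) < e"
    proof -
      have "(\<exists>m\<in>{1..l}. int (?h m) < gap m) \<longleftrightarrow> (\<Sum>m\<in>{1..l}. int (?h m)) < (\<Sum>m\<in>{1..l}. gap m)"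
      proof
        assume "\<exists>m\<in>{1..l}. int (?h m) < gap m"
        then show "(\<Sum>m\<in>{1..l}. int (?h m)) < (\<Sum>m\<in>{1..l}. gap m)"
          using True by (intro sum_strict_mono_ex1) auto
      next
        assume less: "(\<Sum>m\<in>{1..l}. int (?h m)) < (\<Sum>m\<in>{1..l}. gap m)"
        show "\<exists>m\<in>{1..l}. int (?h m) < gap m"
        proof (rule ccontr)
          assume "\<not> ?thesis"
          then have "(\<Sum>m\<in>{1..l}. gap m) \<le> (\<Sum>m\<in>{1..l}. int (?h m))" by (intro sum_mono) (auto simp: not_less)
          then show False using less by simp
        qed
      qed
      then show ?thesis unfolding admissible_iff sum_gap card[symmetric] using True by simp
    qed
    have y: "?y (idx l ?h m i) = of_int (site (len \<Lambda>) (pos m i))" "rho l s ?h (idx l ?h m i) = of_int (pos m i)"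
      if "1 \<le> m" "m \<le> l" "1 \<le> i" "i \<le> ?h m" for m i
      using mpart_point_idx[of m l i ?h \<Lambda>, OF that] rho_idx[of m l i ?h s, OF that] in_gap(2)[OF that] unfolding site_def pos_def by auto
    have \<rho>: "0 < rho l s ?h t - rho l s ?h t' \<and> rho l s ?h t - rho l s ?h t' < real e" if t: "t < t'" "t' < ?N" for t t'
    proof -
      obtain m i where m: "1 \<le> m" "m \<le> l" "1 \<le> i" "i \<le> ?h m" and tm: "t = idx l ?h m i" using idx_cases[of t l ?h] t by auto
      obtain m' i' where m': "1 \<le> m'" "m' \<le> l" "1 \<le> i'" "i' \<le> ?h m'" and tm': "t' = idx l ?h m' i'" using idx_cases[of t' l ?h] t by auto
      have "pos m' i' < pos m i" using order m m' t(1) unfolding tm tm' by blast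
      moreover have "\<bar>pos m i - pos m' i'\<bar> < int e"
        using window_close occ_window in_gap(3)[OF m] in_gap(3)[OF m'] by blast
      ultimately show ?thesis unfolding tm tm' y(2)[OF m] y(2)[OF m'] by linarith
    qed
    have "mpart_point l ?h \<Lambda> \<in> fundamental_alcove e l s ?h \<longleftrightarrow>
      (\<forall>t t'. t < t' \<and> t' < ?N \<longrightarrow> 0 < ?y t - ?y t' \<and> ?y t - ?y t' < real e)"
      unfolding fundamental_alcove_def Let_def mem_Collect_eq
      using alcove_iff[of ?N "rho l s ?h" e "mpart_point l ?h \<Lambda>", OF \<rho> mpart_point_outside] by simp
    also have "\<dots> \<longleftrightarrow> valid e (occ \<Lambda>) (len \<Lambda>)"
    proof
      assume *: "\<forall>t t'. t < t' \<and> t' < ?N \<longrightarrow> 0 < ?y t - ?y t' \<and> ?y t - ?y t' < real e"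
      show "valid e (occ \<Lambda>) (len \<Lambda>)"
        unfolding valid_def
      proof (intro ballI impI)
        fix p p' assume p: "p \<in> occ \<Lambda>" "p' \<in> occ \<Lambda>" "p < p'"
        note r = occ_rows(1-4)[OF p(1)] and r' = occ_rows(1-4)[OF p(2)]
        let ?t = "idx l ?h (comp p') (row p')" and ?t' = "idx l ?h (comp p) (row p)"
        have "?t < ?t'"
        proof (rule ccontr)
          assume "\<not> ?t < ?t'"
          moreover have "?t \<noteq> ?t'"
            using idx_inj[of "comp p'" l "row p'" ?h "comp p" "row p", OF r'(2-4) r(2-4)] occ_rows(5)[OF p(1)] occ_rows(5)[OF p(2)] p(3) by force
          ultimately have "pos (comp p') (row p') < pos (comp p) (row p)" using order[OF r r'] by simp
          then show False using occ_rows(5) p by simp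
        qed
        moreover have "?t' < ?N" by (rule idx_bound[of "comp p" l "row p" ?h, OF r])
        ultimately have "0 < ?y ?t - ?y ?t' \<and> ?y ?t - ?y ?t' < real e" using * by blast
        then show "site (len \<Lambda>) p < site (len \<Lambda>) p' \<and> site (len \<Lambda>) p' < site (len \<Lambda>) p + int e"
          unfolding y(1)[OF r] y(1)[OF r'] occ_rows(5)[OF p(1)] occ_rows(5)[OF p(2)] by linarith
      qed
    next
      assume v: "valid e (occ \<Lambda>) (len \<Lambda>)"
      show "\<forall>t t'. t < t' \<and> t' < ?N \<longrightarrow> 0 < ?y t - ?y t' \<and> ?y t - ?y t' < real e"
      proof (intro allI impI)
        fix t t' assume t: "t < t' \<and> t' < ?N"
        obtain m i where m: "1 \<le> m" "m \<le> l" "1 \<le> i" "i \<le> ?h m" and tm: "t = idx l ?h m i" using idx_cases[of t l ?h] t by auto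
        obtain m' i' where m': "1 \<le> m'" "m' \<le> l" "1 \<le> i'" "i' \<le> ?h m'" and tm': "t' = idx l ?h m' i'" using idx_cases[of t' l ?h] t by auto
        have "pos m' i' < pos m i" using order m m' t unfolding tm tm' by blast
        then have "site (len \<Lambda>) (pos m' i') < site (len \<Lambda>) (pos m i) \<and>
            site (len \<Lambda>) (pos m i) < site (len \<Lambda>) (pos m' i') + int e"
          using v in_gap(3)[OF m] in_gap(3)[OF m'] unfolding valid_def by blast
        then show "0 < ?y t - ?y t' \<and> ?y t - ?y t' < real e" unfolding tm tm' y(1)[OF m] y(1)[OF m'] by linarith
      qed
    qed
    finally show ?thesis
      unfolding alcove_condition_def Let_def adm alcove_like_def using sh outer by blast
  qed
qed

end

section \<open>Weights of modules with semisimple \<open>X_j\<close>\<close>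

text \<open>This form of semisimplicity passes to every subspace.\<close>

definition semisimple_X :: "complex \<Rightarrow> nat \<Rightarrow> ('v::ab_group_add) brep \<Rightarrow> bool" where
  "semisimple_X q n M \<longleftrightarrow> (\<forall>j\<in>{1..n}. \<forall>a. \<forall>v\<in>vspace M.
     X_minus q M j a (X_minus q M j a v) = 0 \<longrightarrow> X_minus q M j a v = 0)"

lemma lin_map_sum:
  assumes "vspace_rep A" "vspace_rep B" "lin_map A B f" "finite T" "T \<subseteq> vspace A"
  shows "f (\<Sum>b\<in>T. smul A (r b) b) = (\<Sum>b\<in>T. smul B (r b) (f b))"
proof -
  interpret A: vspace_rep A by fact
  interpret B: vspace_rep B by fact
  show ?thesis
    using assms(4,5)
  proof (induction T rule: finite_induct)
    case empty
    then show ?case using lin_map_minus(2)[OF assms(1-3) A.in_vspace(1) A.in_vspace(1)] by simp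
  next
    case (insert b T)
    have "(\<Sum>b\<in>T. smul A (r b) b) \<in> vspace A"
      using insert.prems by (intro A.vs.subspace_sum[OF A.subspace_vspace] A.in_vspace) auto
    then show ?case
      using insert lin_mapD[OF assms(3)] A.in_vspace(4) by simp
  qed
qed

lemma calibrated_semisimple_X:
  assumes "hecke_rep M q n" "calibrated q n M"
  shows "semisimple_X q n M"
  unfolding semisimple_X_def
proof (intro ballI allI impI)
  interpret hecke_rep M q n by fact
  obtain B where indep: "\<not> vs.dependent B" and span: "vs.span B = vspace M"
    and eig: "\<forall>b\<in>B. \<forall>j\<in>{1..n}. \<exists>c. Xact q M j b = smul M c b"
    using assms(2) unfolding calibrated_def by blast
  fix j a v assume j: "j \<in> {1..n}" and v: "v \<in> vspace M"
    and 0: "X_minus q M j a (X_minus q M j a v) = 0"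
  have "\<forall>b\<in>B. \<exists>c. Xact q M j b = smul M c b" using eig j by blast
  then obtain c where c: "\<And>b. b \<in> B \<Longrightarrow> Xact q M j b = smul M (c b) b"
    using bchoice[of B "\<lambda>b c. Xact q M j b = smul M c b"] by blast
  have "v \<in> vs.span B" using v span by simp
  then obtain T r where T: "finite T" "T \<subseteq> B" "v = (\<Sum>b\<in>T. smul M (r b) b)"
    unfolding vs.span_explicit by auto
  have B: "B \<subseteq> vspace M" using span vs.span_superset by blast
  have TV: "T \<subseteq> vspace M" using T(2) B by blast
  have lin: "lin_map M M (X_minus q M j a)" by (rule X_minus_lin) (use j in auto)
  have X: "X_minus q M j a (\<Sum>b\<in>T. smul M (f b) b) = (\<Sum>b\<in>T. smul M (f b * (c b - a)) b)" for f
  proof -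
    have "X_minus q M j a (\<Sum>b\<in>T. smul M (f b) b) = (\<Sum>b\<in>T. smul M (f b) (X_minus q M j a b))"
      by (rule lin_map_sum[OF vspace_rep_axioms vspace_rep_axioms lin T(1) TV])
    also have "\<dots> = (\<Sum>b\<in>T. smul M (f b * (c b - a)) b)"
      by (rule sum.cong) (use T(2) in \<open>auto simp: X_minus_def c vs.scale_left_diff_distrib right_diff_distrib vs.scale_right_diff_distrib\<close>)
    finally show ?thesis .
  qed
  have "(\<Sum>b\<in>T. smul M (r b * (c b - a) * (c b - a)) b) = 0" using 0 unfolding T(3) X .
  then have "r b * (c b - a) * (c b - a) = 0" if "b \<in> T" for b
    using vs.independentD[OF indep T(1,2), of "\<lambda>b. r b * (c b - a) * (c b - a)" b] that by simp
  then have "(\<Sum>b\<in>T. smul M (r b * (c b - a)) b) = 0" by (intro sum.neutral) auto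
  then show "X_minus q M j a v = 0" unfolding T(3) X .
qed

text \<open>If \<open>w = (X_j - a) v\<close> is a nonzero eigenvector for \<open>a\<close>, then \<open>\<bar>a\<bar> = 1\<close> because \<open>X_j\<close>
  preserves the form; hence the image of \<open>X_j - a\<close> is orthogonal to \<open>w\<close>, which contains \<open>w\<close>
  itself.\<close>

lemma unitary_semisimple_X:
  assumes "hecke_rep M q n" "cmod q = 1" "unitary n M"
  shows "semisimple_X q n M"
  unfolding semisimple_X_def
proof (intro ballI allI impI)
  interpret hecke_rep M q n by fact
  obtain \<Phi> where herm: "pos_def_hermitian M \<Phi>"
    and inv: "\<forall>g\<in>braid_action n M. \<forall>u\<in>vspace M. \<forall>v\<in>vspace M. \<Phi> (g u) (g v) = \<Phi> u v"
    using assms(3) unfolding unitary_def by blast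
  have add: "\<Phi> (u + v) w = \<Phi> u w + \<Phi> v w" and scale: "\<Phi> (smul M c u) v = c * \<Phi> u v"
    and sym: "\<Phi> v u = cnj (\<Phi> u v)" and pos: "v \<noteq> 0 \<Longrightarrow> 0 < Re (\<Phi> v v)"
    if uvw: "u \<in> vspace M" "v \<in> vspace M" "w \<in> vspace M" for u v w c
  proof -
    note h = herm[unfolded pos_def_hermitian_def]
    show "\<Phi> (u + v) w = \<Phi> u w + \<Phi> v w" using h[THEN conjunct1] uvw by simp
    show "\<Phi> (smul M c u) v = c * \<Phi> u v" using h[THEN conjunct2, THEN conjunct1] uvw by simp
    show "\<Phi> v u = cnj (\<Phi> u v)"
      using h[THEN conjunct2, THEN conjunct2, THEN conjunct1, rule_format, OF uvw(1,2)] .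
    show "v \<noteq> 0 \<Longrightarrow> 0 < Re (\<Phi> v v)"
      using h[THEN conjunct2, THEN conjunct2, THEN conjunct2] uvw by simp
  qed
  have scale1: "\<Phi> (smul M c u) v = c * \<Phi> u v" if "u \<in> vspace M" "v \<in> vspace M" for u v c
    by (rule scale[OF that that(1)])
  have scale2: "\<Phi> u (smul M c v) = cnj c * \<Phi> u v" if "u \<in> vspace M" "v \<in> vspace M" for u v c
    using that sym[of "smul M c v" u u] scale1[of v u c] sym[of v u u] in_vspace(4) by simp
  fix j a v assume j: "j \<in> {1..n}" and v: "v \<in> vspace M"
    and 0: "X_minus q M j a (X_minus q M j a v) = 0"
  have j: "1 \<le> j" "j \<le> n" using j by auto
  let ?X = "Xact q M j"
  have X: "\<Phi> (?X u) (?X w) = \<Phi> u w" if uw: "u \<in> vspace M" "w \<in> vspace M" for u w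
  proof -
    have "xact M j \<circ> id \<in> braid_action n M" by (intro braid_action.intros j)
    then have "\<Phi> (xact M j u) (xact M j w) = \<Phi> u w" using inv uw by force
    moreover have "cmod (q powi (1 - int j)) = 1" using assms(2) by (simp add: norm_power_int)
    then have "q powi (1 - int j) * cnj (q powi (1 - int j)) = 1"
      using complex_norm_square[of "q powi (1 - int j)"] by simp
    moreover from this have "cnj (q powi (1 - int j)) * q powi (1 - int j) = 1" by (simp only: mult.commute)
    ultimately show ?thesis
      unfolding Xact_def using xact_in[OF j] uw by (simp add: scale1 scale2 in_vspace flip: mult.assoc)
  qed
  define w where "w = X_minus q M j a v"
  have w: "w \<in> vspace M" unfolding w_def by (rule X_minus_in[OF j v])
  have Xw: "?X w = smul M a w" using 0 unfolding w_def[symmetric] by (simp add: X_minus_def)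
  show "X_minus q M j a v = 0"
  proof (rule ccontr)
    assume "X_minus q M j a v \<noteq> 0"
    then have p: "0 < Re (\<Phi> w w)" using pos[OF w w w] unfolding w_def by blast
    have "\<Phi> w w = \<Phi> (smul M a w) (smul M a w)" using X[OF w w] unfolding Xw by simp
    also have "\<dots> = a * (cnj a * \<Phi> w w)" using scale1[OF w in_vspace(4)[OF w]] scale2[OF w w] by simp
    finally have "\<Phi> w w = a * (cnj a * \<Phi> w w)" .
    then have "(a * cnj a - 1) * \<Phi> w w = 0" by (simp add: algebra_simps)
    then have aa: "a * cnj a = 1" using p by auto
    have Xv: "?X v \<in> vspace M" by (rule Xact_in[OF j v])
    have "\<Phi> (?X v) w = a * (cnj a * \<Phi> (?X v) w)" using aa by (simp flip: mult.assoc)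
    also have "\<dots> = a * \<Phi> (?X v) (?X w)" unfolding Xw using scale2[OF Xv w] by simp
    also have "\<dots> = a * \<Phi> v w" using X[OF v w] by simp
    finally have "\<Phi> (?X v - smul M a v) w = 0"
      using add[of "?X v - smul M a v" "smul M a v" w] scale[of v w w a] Xv v w by (simp add: in_vspace)
    then have "\<Phi> w w = 0" unfolding w_def X_minus_def by simp
    then show False using p by simp
  qed
qed

definition weight :: "complex \<Rightarrow> nat \<Rightarrow> ('v::ab_group_add) brep \<Rightarrow> int list \<Rightarrow> bool" where
  "weight q n M w \<longleftrightarrow> length w = n \<and>
     (\<exists>v\<in>vspace M. v \<noteq> 0 \<and> (\<forall>j\<in>{1..n}. Xact q M j v = smul M (q powi (w ! (j - 1))) v))"

lemma weightI:
  assumes "length w = n" "v \<in> vspace M" "v \<noteq> 0"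
    "\<And>j. j \<in> {1..n} \<Longrightarrow> Xact q M j v = smul M (q powi (w ! (j - 1))) v"
  shows "weight q n M w"
  using assms unfolding weight_def by blast

locale semisimple_rep = hecke_rep M q n + root_of_unity e q
  for M :: "('v::ab_group_add) brep" and q n e +
  assumes semisimple: "semisimple_X q n M"
begin

lemma eigen_square:
  assumes "1 \<le> j" "j \<le> n" "v \<in> vspace M" "X_minus q M j a (X_minus q M j a v) = 0"
  shows "X_minus q M j a v = 0"
  using semisimple assms unfolding semisimple_X_def by auto

lemma q_neq_1: "q \<noteq> 1"
  using q_powi_eq_iff[of 1 0] e_gt1 by simp

lemma Xact_Tact2:
  assumes "1 \<le> i" "i < n" "v \<in> vspace M"
  shows "Xact q M i (Tact M i v) = Tact M i (Xact q M (Suc i) v) - smul M (q - 1) (Xact q M (Suc i) v)"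
proof -
  note T = Tact_linear[OF assms(1,2)] and inT = Tact_in[OF assms(1,2)]
  have ij: "1 \<le> i" "i \<le> n" using assms by auto
  have xi: "xact M i (Tact M i v) \<in> vspace M" "xact M (Suc i) v \<in> vspace M"
    using assms inT xact_in by auto
  have "Tact M i (xact M (Suc i) v) = Tact M i (Tact M i (xact M i (Tact M i v)))"
    using Tact_xact_Tact[OF assms(3,1,2)] by simp
  also have "\<dots> = smul M (q - 1) (xact M (Suc i) v) + smul M q (xact M i (Tact M i v))"
    using Tact_quadratic[OF assms(1,2) xi(1)] Tact_xact_Tact[OF assms(3,1,2)] by simp
  finally have *: "smul M q (xact M i (Tact M i v)) = Tact M i (xact M (Suc i) v) - smul M (q - 1) (xact M (Suc i) v)"
    by simp
  have "q powi (1 - int (Suc i)) * q = q powi (1 - int i)"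
    using q_nonzero by (simp flip: power_int_add_1)
  then have "Xact q M i (Tact M i v) = smul M (q powi (1 - int (Suc i))) (smul M q (xact M i (Tact M i v)))"
    unfolding Xact_def by simp
  also have "\<dots> = Tact M i (Xact q M (Suc i) v) - smul M (q - 1) (Xact q M (Suc i) v)"
    unfolding * Xact_def using xi(2) by (simp add: T vs.scale_right_diff_distrib mult.commute)
  finally show ?thesis .
qed

text \<open>On a common eigenvector \<open>v\<close> of \<open>X_k\<close> and \<open>X_(k+1)\<close> with the same eigenvalue, the Bernstein
  relation would make \<open>v\<close> and \<open>T_k v\<close> a Jordan block of \<open>X_(k+1)\<close>.\<close>

lemma weight_neighbours:
  assumes w: "weight q n M w" and k: "1 \<le> k" "k < n"
  shows "w ! (k - 1) mod int e \<noteq> w ! k mod int e"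
proof
  assume eq: "w ! (k - 1) mod int e = w ! k mod int e"
  obtain v where v: "v \<in> vspace M" "v \<noteq> 0"
    and X: "\<And>j. j \<in> {1..n} \<Longrightarrow> Xact q M j v = smul M (q powi (w ! (j - 1))) v"
    using w unfolding weight_def by blast
  let ?a = "q powi (w ! k)"
  have Xk: "Xact q M k v = smul M ?a v" "Xact q M (Suc k) v = smul M ?a v"
    using X[of k] X[of "Suc k"] k eq q_powi_eq_iff by auto
  have Tv: "Tact M k v \<in> vspace M" by (rule Tact_in[OF k v(1)])
  have 1: "X_minus q M (Suc k) ?a (Tact M k v) = smul M ((q - 1) * ?a) v"
    unfolding X_minus_def Xact_Tact[OF k v(1)] Xk using v(1) by (simp add: Tact_linear(2)[OF k])
  have "X_minus q M (Suc k) ?a (smul M ((q - 1) * ?a) v) = 0"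
    unfolding X_minus_def using Xk(2) k v(1) by (simp add: Xact_linear(2) mult.commute)
  then have "X_minus q M (Suc k) ?a (X_minus q M (Suc k) ?a (Tact M k v)) = 0" unfolding 1 .
  moreover have "1 \<le> Suc k" "Suc k \<le> n" using k by auto
  ultimately have "X_minus q M (Suc k) ?a (Tact M k v) = 0" using eigen_square Tv by blast
  then have "smul M ((q - 1) * ?a) v = 0" using 1 by simp
  then show False using v(2) q_neq_1 q_nz by simp
qed

text \<open>The intertwiner \<open>T_k - c\<close>, with \<open>c\<close> the diagonal coefficient, exchanges two letters of a weight
  unless it vanishes on the weight vector.\<close>

lemma intertwiner:
  assumes len: "length w = n" and v: "v \<in> vspace M"
    and X: "\<And>j. j \<in> {1..n} \<Longrightarrow> Xact q M j v = smul M (q powi (w ! (j - 1))) v"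
    and k: "1 \<le> k" "k < n" and ne: "w ! (k - 1) mod int e \<noteq> w ! k mod int e"
  defines "u \<equiv> Tact M k v - smul M (diag_coeff (w ! (k - 1)) (w ! k)) v"
  shows "u \<in> vspace M" "\<And>j. j \<in> {1..n} \<Longrightarrow> Xact q M j u = smul M (q powi (swap_letters k w ! (j - 1))) u"
proof -
  let ?a = "w ! (k - 1)" and ?b = "w ! k"
  let ?c = "diag_coeff ?a ?b"
  have Tv: "Tact M k v \<in> vspace M" by (rule Tact_in[OF k v])
  show u: "u \<in> vspace M" unfolding u_def using v Tv by (intro in_vspace)
  have c: "(q - 1) * q powi ?b = ?c * (q powi ?b - q powi ?a)"
    unfolding diag_coeff_def using q_powi_eq_iff ne by auto
  have Xk: "Xact q M k v = smul M (q powi ?a) v" "Xact q M (Suc k) v = smul M (q powi ?b) v"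
    using X[of k] X[of "Suc k"] k by auto
  fix j assume j: "j \<in> {1..n}"
  have Xu: "Xact q M j u = Xact q M j (Tact M k v) - smul M ?c (Xact q M j v)"
    unfolding u_def using j v Tv Xact_linear(2)[of j] Xact_minus(1)[of j] in_vspace(4) by simp
  consider "j = k" | "j = Suc k" | "j \<noteq> k" "j \<noteq> Suc k" by blast
  then show "Xact q M j u = smul M (q powi (swap_letters k w ! (j - 1))) u"
  proof cases
    case 1
    have "swap_letters k w ! (j - 1) = ?b" using 1 k len by (simp add: nth_swap_letters)
    moreover have "Xact q M j u = smul M (q powi ?b) (Tact M k v) - smul M ((q - 1) * q powi ?b + ?c * q powi ?a) v"
      unfolding Xu unfolding 1 Xact_Tact2[OF k v] Xk using v by (simp add: Tact_linear(2)[OF k] vs.scale_left_distrib)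
    moreover have "(q - 1) * q powi ?b + ?c * q powi ?a = q powi ?b * ?c" using c by (simp add: algebra_simps)
    ultimately show ?thesis unfolding u_def by (simp add: vs.scale_right_diff_distrib)
  next
    case 2
    have "swap_letters k w ! (j - 1) = ?a" using 2 k len by (simp add: nth_swap_letters)
    moreover have "Xact q M j u = smul M (q powi ?a) (Tact M k v) + smul M ((q - 1) * q powi ?b - ?c * q powi ?b) v"
      unfolding Xu unfolding 2 Xact_Tact[OF k v] Xk using v by (simp add: Tact_linear(2)[OF k] vs.scale_left_diff_distrib)
    moreover have "(q - 1) * q powi ?b - ?c * q powi ?b = - (q powi ?a * ?c)" using c by (simp add: algebra_simps)
    ultimately show ?thesis unfolding u_def by (simp add: vs.scale_right_diff_distrib)
  next
    case 3
    have "swap_letters k w ! (j - 1) = w ! (j - 1)"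
      using 3 k j len by (subst nth_swap_letters) auto
    moreover have "Xact q M j (Tact M k v) = Tact M k (Xact q M j v)"
      using Tact_Xact_far[OF k _ _ _ _ v] 3 j by auto
    ultimately show ?thesis
      unfolding Xu unfolding u_def using X[OF j] v
      by (simp add: Tact_linear(2)[OF k] vs.scale_right_diff_distrib mult.commute)
  qed
qed

lemma eigenvector_coeff:
  assumes "v \<in> vspace M" "v \<noteq> 0" "1 \<le> k" "k < n" "Tact M k v = smul M c v"
  shows "c * c = (q - 1) * c + q"
proof -
  have "smul M (c * c) v = Tact M k (Tact M k v)"
    using assms by (simp add: Tact_linear(2)[OF assms(3,4)])
  also have "\<dots> = smul M ((q - 1) * c + q) v"
    unfolding Tact_quadratic[OF assms(3,4,1)] using assms(5) by (simp add: vs.scale_left_distrib)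
  finally show ?thesis using vs.scale_cancel_right[of "c * c" v "(q - 1) * c + q"] assms(2) by simp
qed

text \<open>If the intertwiner vanished, the diagonal coefficient would be an eigenvalue of \<open>T_k\<close>, hence
  a root of its quadratic equation. Then the off-diagonal coefficient would be zero, and the
  letters would be adjacent.\<close>

lemma weight_swap:
  assumes w: "weight q n M w" and k: "1 \<le> k" "k < n" and na: "\<not> adjacent e (w ! (k - 1)) (w ! k)"
  shows "weight q n M (swap_letters k w)"
proof -
  obtain v where v: "v \<in> vspace M" "v \<noteq> 0"
    and X: "\<And>j. j \<in> {1..n} \<Longrightarrow> Xact q M j v = smul M (q powi (w ! (j - 1))) v"
    and len: "length w = n"
    using w unfolding weight_def by blast
  let ?a = "w ! (k - 1)" and ?b = "w ! k"
  let ?c = "diag_coeff ?a ?b"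
  note ne = weight_neighbours[OF w k]
  let ?u = "Tact M k v - smul M ?c v"
  have "?u \<noteq> 0"
  proof
    assume "?u = 0"
    then have "?c * ?c = (q - 1) * ?c + q" by (intro eigenvector_coeff[OF v k]) simp
    then have "q + ?c * (q - 1 - ?c) = 0" by (simp add: algebra_simps)
    moreover have "diag_coeff ?b ?a = q - 1 - ?c" using diag_coeff_add[OF ne] by (simp add: algebra_simps)
    ultimately have "off_coeff ?a ?b * off_coeff ?a ?b = 0"
      unfolding off_coeff_square[OF ne] by simp
    then show False using off_coeff_eq_0_iff[OF ne] na by simp
  qed
  then show ?thesis
    by (intro weightI[OF _ intertwiner(1)[OF len v(1) X k ne] _ intertwiner(2)[OF len v(1) X k ne]])
      (simp_all add: len)
qed

text \<open>Otherwise \<open>T_k\<close> and \<open>T_(k+1)\<close> act on the weight vector by scalars \<open>c\<close> and \<open>c'\<close>. These have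
  the sum \<open>q - 1\<close> and, by the quadratic relation, the product \<open>-q\<close>; the braid relation makes them
  equal. Hence \<open>q = -1\<close>, which means \<open>e = 2\<close>.\<close>

lemma weight_second_neighbours:
  assumes w: "weight q n M w" and k: "1 \<le> k" "Suc k < n" and e2: "e \<noteq> 2"
  shows "w ! (k - 1) mod int e \<noteq> w ! Suc k mod int e"
proof
  assume eq: "w ! (k - 1) mod int e = w ! Suc k mod int e"
  obtain v where v: "v \<in> vspace M" "v \<noteq> 0"
    and X: "\<And>j. j \<in> {1..n} \<Longrightarrow> Xact q M j v = smul M (q powi (w ! (j - 1))) v"
    and len: "length w = n"
    using w unfolding weight_def by blast
  have k': "1 \<le> k" "k < n" "1 \<le> Suc k" "Suc k < n" using k by auto
  have nk: "k \<noteq> k - 1" "Suc k \<noteq> k - 1" "k - 1 \<noteq> k" "k - 1 \<noteq> Suc k" using k by auto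
  let ?a = "w ! (k - 1)" and ?b = "w ! k" and ?a' = "w ! Suc k"
  note ne = weight_neighbours[OF w k'(1,2)]
  have ne': "?b mod int e \<noteq> ?a' mod int e" using weight_neighbours[OF w k'(3,4)] by simp
  let ?c = "diag_coeff ?a ?b" and ?c' = "diag_coeff ?b ?a'"
  have qa: "q powi ?a = q powi ?a'" using eq q_powi_eq_iff by blast
  have c': "?c' = diag_coeff ?b ?a" unfolding diag_coeff_def qa by simp
  \<comment> \<open>A nonzero image under an intertwiner would have the same letter twice in a row.\<close>
  have Tk: "Tact M k v = smul M ?c v"
  proof (rule ccontr)
    assume "\<not> ?thesis"
    then have "Tact M k v - smul M ?c v \<noteq> 0" by simp
    then have "weight q n M (swap_letters k w)"
      by (intro weightI[OF _ intertwiner(1)[OF len v(1) X k'(1,2) ne] _ intertwiner(2)[OF len v(1) X k'(1,2) ne]])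
        (simp_all add: len)
    from weight_neighbours[OF this k'(3,4)] show False
      using eq k len nk by (simp add: nth_swap_letters)
  qed
  have Tk': "Tact M (Suc k) v = smul M ?c' v"
  proof (rule ccontr)
    assume "\<not> ?thesis"
    then have "Tact M (Suc k) v - smul M (diag_coeff (w ! (Suc k - 1)) (w ! Suc k)) v \<noteq> 0" by simp
    moreover have ne'': "w ! (Suc k - 1) mod int e \<noteq> w ! Suc k mod int e" using ne' by simp
    ultimately have "weight q n M (swap_letters (Suc k) w)"
      by (intro weightI[OF _ intertwiner(1)[OF len v(1) X k'(3,4) ne''] _ intertwiner(2)[OF len v(1) X k'(3,4) ne'']])
        (simp_all add: len)
    from weight_neighbours[OF this k'(1,2)] show False
      using eq k len nk by (simp add: nth_swap_letters)
  qed
  have "smul M (?c * ?c' * ?c) v = smul M (?c' * ?c * ?c') v"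
    using Tact_braid[OF v(1) k] Tk Tk' v(1)
    by (simp add: Tact_linear(2)[OF k'(1,2)] Tact_linear(2)[OF k'(3,4)] mult_ac)
  then have br: "?c * ?c' * ?c = ?c' * ?c * ?c'" using v(2) vs.scale_cancel_right by blast
  have quad: "?c * ?c = (q - 1) * ?c + q" by (rule eigenvector_coeff[OF v k'(1,2) Tk])
  have sum: "?c + ?c' = q - 1" using diag_coeff_add[OF ne] unfolding c' .
  have prod: "?c * ?c' = - q"
  proof -
    have "?c' = q - 1 - ?c" using sum by (simp add: algebra_simps)
    then have "?c * ?c' = ?c * (q - 1 - ?c)" by (rule arg_cong)
    also have "\<dots> = - q" using quad by (simp add: algebra_simps)
    finally show ?thesis .
  qed
  then have "?c \<noteq> 0" "?c' \<noteq> 0" using q_nz by auto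
  then have cc: "?c = ?c'" using br by simp
  have "(q - 1) * (q - 1) = 4 * (?c * ?c')" using sum unfolding cc by (simp add: sum[symmetric] algebra_simps)
  moreover have "(q + 1) * (q + 1) = (q - 1) * (q - 1) + 4 * q" by (simp add: algebra_simps)
  ultimately have "(q + 1) * (q + 1) = 0" unfolding prod by simp
  then have "q = -1" by (simp add: add_eq_0_iff2)
  then have "q powi 2 = q powi 0" by simp
  then have "2 mod int e = 0 mod int e" using q_powi_eq_iff by blast
  then show False using mod_eq_close[of 2 "int e" 0] e2 e_gt1 by simp
qed

lemma not_adjacent_iff:
  assumes "d = 1 \<or> d = -1" "x mod int e \<noteq> (i + d) mod int e" "x mod int e \<noteq> (i - d) mod int e"
  shows "\<not> adjacent e i x" "\<not> adjacent e x i"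
proof -
  have "x mod int e \<noteq> (i + 1) mod int e" "x mod int e \<noteq> (i - 1) mod int e" using assms by auto
  then have "\<not> adjacent e i x"
    unfolding adjacent_def using mod_eq_shift(2)[of "x + 1" 1 "int e" i] by auto
  then show "\<not> adjacent e i x" "\<not> adjacent e x i" using adjacent_sym by auto
qed

text \<open>Between two letters \<open>i\<close> both neighbours \<open>i + 1\<close> and \<open>i - 1\<close> must occur. In a shortest
  violation that avoids \<open>i + d\<close>, letters not adjacent to \<open>i\<close> can be moved outside, and two letters
  \<open>i - d\<close> enclose a shorter violation. What remains is \<open>i, i\<close> or \<open>i, i - d, i\<close>, and neither occurs
  in a weight.\<close>

lemma weight_between:
  assumes d: "d = 1 \<or> d = -1"
  shows "\<lbrakk>weight q n M (t @ [i] @ w @ [j] @ r); i mod int e = j mod int e;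
    \<forall>x\<in>set w. x mod int e \<noteq> i mod int e \<and> x mod int e \<noteq> (i + d) mod int e\<rbrakk> \<Longrightarrow> False"
proof (induction "length w" arbitrary: t i w j r rule: less_induct)
  case less
  note wt = less.prems(1)
  have len: "length (t @ [i] @ w @ [j] @ r) = n" using wt unfolding weight_def by simp
  show ?case
  proof (cases w)
    case Nil
    then show ?thesis
      using weight_neighbours[OF wt, of "Suc (length t)"] len less.prems(2) by (simp add: nth_append)
  next
    case (Cons x w')
    have x: "x mod int e \<noteq> i mod int e" "x mod int e \<noteq> (i + d) mod int e" using less.prems(3) Cons by auto
    show ?thesis
    proof (cases "x mod int e = (i - d) mod int e")
      case False
      have "weight q n M (swap_letters (Suc (length t)) (t @ [i, x] @ (w' @ [j] @ r)))"
        using wt Cons len not_adjacent_iff(1)[OF d x(2) False]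
        by (intro weight_swap) (auto simp: nth_append)
      then have "weight q n M ((t @ [x]) @ [i] @ w' @ [j] @ r)"
        unfolding swap_letters_middle by simp
      then show False
        using less.hyps[of w' "t @ [x]" i j r] Cons less.prems(2,3) by simp
    next
      case x_eq: True
      show ?thesis
      proof (cases "\<exists>y\<in>set w'. y mod int e = (i - d) mod int e")
        case True
        then obtain w1 y w2 where w': "w' = w1 @ y # w2" "y mod int e = (i - d) mod int e"
          "\<forall>z\<in>set w1. z mod int e \<noteq> (i - d) mod int e"
          using split_list_first_prop[of w' "\<lambda>y. y mod int e = (i - d) mod int e"] by blast
        have "weight q n M ((t @ [i]) @ [x] @ w1 @ [y] @ (w2 @ [j] @ r))"
          using wt Cons w'(1) by simp
        moreover have "x mod int e = y mod int e" using x_eq w'(2) by simp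
        moreover have "z mod int e \<noteq> x mod int e \<and> z mod int e \<noteq> (x + d) mod int e" if "z \<in> set w1" for z
        proof -
          have "(x + d) mod int e = i mod int e"
            using x_eq mod_eq_shift(1)[of x d "int e" "i - d"] by simp
          then show ?thesis using w'(3) that x_eq less.prems(3) Cons w'(1) by auto
        qed
        ultimately show False using less.hyps[of w1 "t @ [i]" x y "w2 @ [j] @ r"] Cons w'(1) by simp
      next
        case none: False
        show ?thesis
        proof (cases w' rule: rev_cases)
          case Nil
          have "e \<noteq> 2"
          proof
            assume "e = 2"
            then have "(i + d) mod int e = (i - d) mod int e" using d by (auto simp: mod_eq_dvd_iff)
            then show False using x(2) x_eq by simp
          qed
          then show False
            using weight_second_neighbours[OF wt, of "Suc (length t)"] Cons Nil len less.prems(2)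
            by (simp add: nth_append)
        next
          case (snoc w1 y)
          have y: "y mod int e \<noteq> (j + d) mod int e" "y mod int e \<noteq> (j - d) mod int e"
          proof -
            have "(j + d) mod int e = (i + d) mod int e" "(j - d) mod int e = (i - d) mod int e"
              using less.prems(2) mod_eq_shift by metis+
            then show "y mod int e \<noteq> (j + d) mod int e" "y mod int e \<noteq> (j - d) mod int e"
              using none less.prems(3) Cons snoc by auto
          qed
          let ?t = "t @ [i] @ x # w1"
          have "weight q n M (swap_letters (Suc (length ?t)) (?t @ [y, j] @ r))"
          proof (rule weight_swap)
            show "weight q n M (?t @ [y, j] @ r)" using wt Cons snoc by simp
            have "(?t @ [y, j] @ r) ! (Suc (length ?t) - 1) = y" "(?t @ [y, j] @ r) ! Suc (length ?t) = j"
              by (simp_all add: nth_append)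
            then show "\<not> adjacent e ((?t @ [y, j] @ r) ! (Suc (length ?t) - 1)) ((?t @ [y, j] @ r) ! Suc (length ?t))"
              using not_adjacent_iff(2)[OF d y] by (simp only: not_False_eq_True)
          qed (use len Cons snoc in auto)
          then have "weight q n M (?t @ [j, y] @ r)" unfolding swap_letters_middle .
          then have "weight q n M (t @ [i] @ (x # w1) @ [j] @ (y # r))" by simp
          then show False
            using less.hyps[of "x # w1" t i j "y # r"] Cons snoc less.prems(2,3) by simp
        qed
      qed
    qed
  qed
qed

end

section \<open>Transport along isomorphisms\<close>

lemma braid_action_invariant:
  assumes "hecke_rep M q n"
    and T: "\<And>i u v. 1 \<le> i \<Longrightarrow> i < n \<Longrightarrow> u \<in> vspace M \<Longrightarrow> v \<in> vspace M \<Longrightarrow> \<Phi> (Tact M i u) (Tact M i v) = \<Phi> u v"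
    and x: "\<And>j u v. 1 \<le> j \<Longrightarrow> j \<le> n \<Longrightarrow> u \<in> vspace M \<Longrightarrow> v \<in> vspace M \<Longrightarrow> \<Phi> (xact M j u) (xact M j v) = \<Phi> u v"
    and "g \<in> braid_action n M"
  shows "(\<forall>u\<in>vspace M. g u \<in> vspace M) \<and> (\<forall>u\<in>vspace M. \<forall>v\<in>vspace M. \<Phi> (g u) (g v) = \<Phi> u v)"
proof -
  interpret hecke_rep M q n by fact
  have inv: "inv_into (vspace M) f u \<in> vspace M" "f (inv_into (vspace M) f u) = u"
    if "bij_betw f (vspace M) (vspace M)" "u \<in> vspace M" for f u
    using that by (auto simp: bij_betw_def inv_into_into f_inv_into_f)
  show ?thesis
    using assms(4)
  proof (induction rule: braid_action.induct)
    case 1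
    then show ?case by simp
  next
    case (2 i g)
    then show ?case using T[OF 2(1,2)] Tact_in[OF 2(1,2)] by simp
  next
    case (3 i g)
    note b = inv[OF Tact_bij[OF 3(1,2)]]
    show ?case
    proof (intro conjI ballI)
      fix u assume "u \<in> vspace M"
      then show "(inv_into (vspace M) (Tact M i) \<circ> g) u \<in> vspace M" using b(1) 3(4) by simp
    next
      fix u v assume "u \<in> vspace M" "v \<in> vspace M"
      then have g: "g u \<in> vspace M" "g v \<in> vspace M" "\<Phi> (g u) (g v) = \<Phi> u v" using 3(4) by auto
      show "\<Phi> ((inv_into (vspace M) (Tact M i) \<circ> g) u) ((inv_into (vspace M) (Tact M i) \<circ> g) v) = \<Phi> u v"
        using T[OF 3(1,2) b(1)[OF g(1)] b(1)[OF g(2)]] unfolding b(2)[OF g(1)] b(2)[OF g(2)] g(3) by simp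
    qed
  next
    case (4 j g)
    then show ?case using x[OF 4(1,2)] xact_in[OF 4(1,2)] by simp
  next
    case (5 j g)
    note b = inv[OF xact_bij[OF 5(1,2)]]
    show ?case
    proof (intro conjI ballI)
      fix u assume "u \<in> vspace M"
      then show "(inv_into (vspace M) (xact M j) \<circ> g) u \<in> vspace M" using b(1) 5(4) by simp
    next
      fix u v assume "u \<in> vspace M" "v \<in> vspace M"
      then have g: "g u \<in> vspace M" "g v \<in> vspace M" "\<Phi> (g u) (g v) = \<Phi> u v" using 5(4) by auto
      show "\<Phi> ((inv_into (vspace M) (xact M j) \<circ> g) u) ((inv_into (vspace M) (xact M j) \<circ> g) v) = \<Phi> u v"
        using x[OF 5(1,2) b(1)[OF g(1)] b(1)[OF g(2)]] unfolding b(2)[OF g(1)] b(2)[OF g(2)] g(3) by simp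
    qed
  qed
qed

context word_set
begin

lemma iso_span:
  assumes "hecke_rep M q n" "hecke_iso n word_rep M \<phi>"
  shows "vspace M = module.span (smul M) (\<phi> ` word_vec ` W)"
proof -
  interpret M: hecke_rep M q n by fact
  interpret L: hecke_rep word_rep q n by (rule hecke_rep_word)
  have bij: "bij_betw \<phi> (vspace word_rep) (vspace M)" and lin: "lin_map word_rep M \<phi>"
    using assms(2) hecke_homD(1) unfolding hecke_iso_def by blast+
  have gen: "word_vec ` W \<subseteq> vspace word_rep" using word_vec_in by blast
  show ?thesis
  proof
    show "vspace M \<subseteq> M.vs.span (\<phi> ` word_vec ` W)"
    proof
      fix v assume "v \<in> vspace M"
      then obtain f where f: "f \<in> vspace word_rep" "v = \<phi> f" using bij unfolding bij_betw_def by blast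
      show "v \<in> M.vs.span (\<phi> ` word_vec ` W)"
        unfolding f(2)
        by (rule lin_map_span_subset[OF L.vspace_rep_axioms M.vspace_rep_axioms lin gen M.vs.subspace_span
              _ f(1)[unfolded word_rep_span]]) (rule M.vs.span_base, rule imageI)
    qed
    have "\<phi> ` word_vec ` W \<subseteq> vspace M" using lin_mapD(1)[OF lin] gen by blast
    then show "M.vs.span (\<phi> ` word_vec ` W) \<subseteq> vspace M" by (rule M.vs.span_minimal[OF _ M.subspace_vspace])
  qed
qed

lemma iso_finite_dim:
  assumes "hecke_rep M q n" "hecke_iso n word_rep M \<phi>"
  shows "finite_dim M"
  unfolding finite_dim_def using iso_span[OF assms] finite_W by (intro exI[of _ "\<phi> ` word_vec ` W"]) auto

lemma iso_calibrated:
  assumes "hecke_rep M q n" "hecke_iso n word_rep M \<phi>"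
  shows "calibrated q n M"
proof -
  interpret M: hecke_rep M q n by fact
  have hom: "hecke_hom n word_rep M \<phi>" using assms(2) unfolding hecke_iso_def by blast
  obtain B where B: "B \<subseteq> \<phi> ` word_vec ` W" "M.vs.independent B" "\<phi> ` word_vec ` W \<subseteq> M.vs.span B"
    using M.vs.maximal_independent_subset by blast
  have "M.vs.span B = vspace M"
  proof
    show "M.vs.span B \<subseteq> vspace M" unfolding iso_span[OF assms] using B(1) by (rule M.vs.span_mono)
    show "vspace M \<subseteq> M.vs.span B" unfolding iso_span[OF assms] using B(3) by (rule M.vs.span_minimal) simp
  qed
  moreover have "\<exists>c. Xact q M j b = smul M c b" if b: "b \<in> B" and j: "j \<in> {1..n}" for b j
  proof -
    obtain w where w: "w \<in> W" "b = \<phi> (word_vec w)" using B(1) b by blast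
    have "Xact q M j b = \<phi> (Xact q word_rep j (word_vec w))"
      unfolding w(2) using hecke_hom_Xact[OF hecke_rep_word hom _ _ word_vec_in[OF w(1)]] j by simp
    also have "\<dots> = smul M (q powi (w ! (j - 1))) b"
      unfolding Xact_word_vec w(2) by (rule lin_mapD(3)[OF hecke_homD(1)[OF hom] word_vec_in[OF w(1)]])
    finally show ?thesis by blast
  qed
  ultimately show ?thesis
    unfolding calibrated_def using iso_finite_dim[OF assms] B(2) by blast
qed

lemma iso_unitary:
  assumes "hecke_rep M q n" "hecke_iso n word_rep M \<phi>"
  shows "unitary n M"
proof -
  interpret M: hecke_rep M q n by fact
  let ?\<psi> = "inv_into (vspace word_rep) \<phi>"
  have "hecke_iso n M word_rep ?\<psi>" by (rule hecke_iso_inv[OF hecke_rep_word assms(2)])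
  then have bij: "bij_betw ?\<psi> (vspace M) (vspace word_rep)" and hom: "hecke_hom n M word_rep ?\<psi>"
    unfolding hecke_iso_def by auto
  note lin = lin_mapD[OF hecke_homD(1)[OF hom]]
  define \<Phi> where "\<Phi> u v = word_form (?\<psi> u) (?\<psi> v)" for u v
  interpret L: hecke_rep word_rep q n by (rule hecke_rep_word)
  have \<psi>0: "?\<psi> 0 = 0"
    using lin_map_minus(2)[OF M.vspace_rep_axioms L.vspace_rep_axioms hecke_homD(1)[OF hom]] M.in_vspace(1) by blast
  have nz: "?\<psi> v \<noteq> 0" if "v \<in> vspace M" "v \<noteq> 0" for v
    using bij \<psi>0 that M.in_vspace(1) unfolding bij_betw_def inj_on_def by metis
  have "pos_def_hermitian M \<Phi>"
    unfolding pos_def_hermitian_def \<Phi>_def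
  proof (intro conjI ballI allI impI)
    fix u v w c assume u: "u \<in> vspace M" "v \<in> vspace M"
    show "word_form (?\<psi> (smul M c u)) (?\<psi> v) = c * word_form (?\<psi> u) (?\<psi> v)" for c
      unfolding lin(3)[OF u(1)] by (simp add: word_form_def sum_distrib_left mult.assoc)
    show "word_form (?\<psi> v) (?\<psi> u) = cnj (word_form (?\<psi> u) (?\<psi> v))"
      by (simp add: word_form_def mult.commute)
    show "word_form (?\<psi> (u + v)) (?\<psi> w) = word_form (?\<psi> u) (?\<psi> w) + word_form (?\<psi> v) (?\<psi> w)"
      if "w \<in> vspace M" for w
      unfolding lin(2)[OF u] by (simp add: word_form_def sum.distrib distrib_right)
  next
    fix v assume v: "v \<in> vspace M" "v \<noteq> 0"
    show "0 < Re (word_form (?\<psi> v) (?\<psi> v))"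
      by (rule word_form_pos[OF lin(1)[OF v(1)] nz[OF v]])
  qed
  moreover have "\<Phi> (g u) (g v) = \<Phi> u v" if "g \<in> braid_action n M" "u \<in> vspace M" "v \<in> vspace M" for g u v
  proof -
    have "(\<forall>u\<in>vspace M. g u \<in> vspace M) \<and> (\<forall>u\<in>vspace M. \<forall>v\<in>vspace M. \<Phi> (g u) (g v) = \<Phi> u v)"
    proof (rule braid_action_invariant[OF assms(1) _ _ that(1)])
      show "\<Phi> (Tact M i u) (Tact M i v) = \<Phi> u v" if "1 \<le> i" "i < n" "u \<in> vspace M" "v \<in> vspace M" for i u v
        unfolding \<Phi>_def hecke_homD(2)[OF hom that(1,2,3)] hecke_homD(2)[OF hom that(1,2,4)]
        by (rule Tact_word_form[OF that(1,2) lin(1)[OF that(3)] lin(1)[OF that(4)]])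
      show "\<Phi> (xact M j u) (xact M j v) = \<Phi> u v" if "1 \<le> j" "j \<le> n" "u \<in> vspace M" "v \<in> vspace M" for j u v
        unfolding \<Phi>_def hecke_homD(3)[OF hom that(1,2,3)] hecke_homD(3)[OF hom that(1,2,4)]
        by (rule xact_word_form)
    qed
    then show ?thesis using that by blast
  qed
  ultimately show ?thesis unfolding unitary_def using iso_finite_dim[OF assms] by blast
qed

end

section \<open>Generalised eigenspaces\<close>

context hecke_rep
begin

text \<open>The operator \<open>X_n\<close> commutes with the algebra of rank \<open>n - 1\<close>.\<close>

lemma X_minus_hom: "1 \<le> n \<Longrightarrow> hecke_hom (n - 1) M M (X_minus q M n a)"
proof -
  assume n: "1 \<le> n"
  have 1: "X_minus q M n a (Tact M i v) = Tact M i (X_minus q M n a v)" if "1 \<le> i" "i < n - 1" "v \<in> vspace M" for i v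
  proof -
    have i: "1 \<le> i" "i < n" using that by auto
    have "Xact q M n (Tact M i v) = Tact M i (Xact q M n v)"
      using Tact_Xact_far[of i n v] that n by simp
    then show ?thesis
      unfolding X_minus_def using Tact_minus(1)[OF i Xact_in[OF n order_refl that(3)] in_vspace(4)[OF that(3)]]
        Tact_linear(2)[OF i that(3)] by simp
  qed
  have 2: "X_minus q M n a (xact M j v) = xact M j (X_minus q M n a v)" if "1 \<le> j" "j \<le> n - 1" "v \<in> vspace M" for j v
  proof -
    have j: "1 \<le> j" "j \<le> n" using that by auto
    have "Xact q M n (xact M j v) = xact M j (Xact q M n v)"
      unfolding Xact_def using xact_commute[OF that(3) n order_refl j] xact_linear(2)[OF j xact_in[OF n order_refl that(3)]] by simp
    then show ?thesis
      unfolding X_minus_def using xact_minus(1)[OF j Xact_in[OF n order_refl that(3)] in_vspace(4)[OF that(3)]]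
        xact_linear(2)[OF j that(3)] by simp
  qed
  show ?thesis unfolding hecke_hom_def using X_minus_lin[OF n order_refl] 1 2 by auto
qed

lemma X_minus_power_hom: "1 \<le> n \<Longrightarrow> hecke_hom (n - 1) M M (X_minus q M n a ^^ k)"
proof (induction k)
  case 0
  then show ?case by (simp add: hecke_hom_def lin_map_def)
next
  case (Suc k)
  then show ?case using hecke_hom_comp[OF _ X_minus_hom, of M "X_minus q M n a ^^ k" a] by (simp add: comp_def)
qed

lemma gen_eigenspace_socle:
  assumes n: "1 \<le> n" and S: "S = socle q k (gen_eigenspace q n a M)"
  shows "smul S = smul M" "Tact S = Tact M" "xact S = xact M" "vspace S \<subseteq> vspace M"
    "\<And>v. v \<in> vspace S \<Longrightarrow> \<exists>k. (X_minus q M n a ^^ k) v = 0" "S = restrict_rep M (vspace S)"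
proof -
  let ?E = "{v \<in> vspace M. \<exists>k. (X_minus q M n a ^^ k) v = 0}"
  have E: "gen_eigenspace q n a M = restrict_rep M ?E" unfolding gen_eigenspace_def by simp
  show s: "smul S = smul M" "Tact S = Tact M" "xact S = xact M" "S = restrict_rep M (vspace S)"
    unfolding S socle_def E by (simp_all add: restrict_rep_def)
  have lin: "lin_map M M (X_minus q M n a ^^ k)" for k by (rule hecke_homD(1)[OF X_minus_power_hom[OF n]])
  have zero: "(X_minus q M n a ^^ k) 0 = 0" for k
    using lin_map_minus(2)[OF vspace_rep_axioms vspace_rep_axioms lin in_vspace(1) in_vspace(1)] .
  have more: "(X_minus q M n a ^^ (k' + k)) v = 0" if "(X_minus q M n a ^^ k) v = 0" for k k' v
    using that zero by (simp add: funpow_add)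
  have sub: "vs.subspace ?E"
  proof (rule vs.subspaceI)
    show "0 \<in> ?E" using in_vspace(1) zero by blast
    show "u + v \<in> ?E" if uv: "u \<in> ?E" "v \<in> ?E" for u v
    proof -
      obtain k k' where k: "(X_minus q M n a ^^ k) u = 0" "(X_minus q M n a ^^ k') v = 0" using uv by blast
      have "(X_minus q M n a ^^ (k' + k)) (u + v) = 0"
        using lin_mapD(2)[OF lin, of u v "k' + k"] uv more[OF k(1), of k'] more[OF k(2), of k] by (simp add: add.commute)
      then show ?thesis using uv in_vspace(2) by blast
    qed
    show "smul M c v \<in> ?E" if v: "v \<in> ?E" for c v
    proof -
      obtain k where "(X_minus q M n a ^^ k) v = 0" using v by blast
      then have "(X_minus q M n a ^^ k) (smul M c v) = 0" using lin_mapD(3)[OF lin, of v k c] v by simp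
      then show ?thesis using v in_vspace(4) by blast
    qed
  qed
  have "vspace S = vs.span (\<Union> {W. W \<subseteq> ?E \<and> simple_module q k (restrict_rep (restrict_rep M ?E) W)})"
    unfolding S socle_def E by (simp add: restrict_rep_def)
  also have "\<dots> \<subseteq> ?E" by (rule vs.span_minimal[OF _ sub]) blast
  finally have "vspace S \<subseteq> ?E" .
  then show "vspace S \<subseteq> vspace M" "\<And>v. v \<in> vspace S \<Longrightarrow> \<exists>k. (X_minus q M n a ^^ k) v = 0" by blast+
qed

end

section \<open>The simple modules labelled by multipartitions in the alcove\<close>

text \<open>Kernels of homomorphisms from a simple module are trivial, so some power of \<open>X_(n+1) - a\<close>
  annihilates the whole image of \<open>f\<close>. Multiplying \<open>f\<close> by the largest power that does not
  annihilate it turns the generalised eigenvectors into eigenvectors.\<close>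

lemma simple_killed_by_power:
  assumes "hecke_rep M q (Suc n)" "hecke_rep A q n" "simple_module q n A" "hecke_hom n A M f"
    and nil: "\<And>v. v \<in> vspace A \<Longrightarrow> \<exists>k. (X_minus q M (Suc n) a ^^ k) (f v) = 0"
    and nz: "v0 \<in> vspace A" "f v0 \<noteq> 0"
  shows "\<exists>g v. hecke_hom n A M g \<and> v \<in> vspace A \<and> g v \<noteq> 0 \<and>
    (\<forall>v\<in>vspace A. Xact q M (Suc n) (g v) = smul M a (g v))"
proof -
  interpret M: hecke_rep M q "Suc n" by fact
  interpret A: hecke_rep A q n by fact
  have Mn: "hecke_rep M q n" using hecke_rep_rank_le[OF assms(1), of n] by simp
  let ?p = "\<lambda>k v. (X_minus q M (Suc n) a ^^ k) (f v)"
  have hom: "hecke_hom n A M (?p k)" for k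
    using hecke_hom_comp[OF assms(4)] M.X_minus_power_hom[where a = a and k = k] by simp
  obtain v where v: "v \<in> vspace A" "f v \<noteq> 0" using nz by blast
  obtain K where K: "?p K v = 0" using nil[OF v(1)] by blast
  have "{v \<in> vspace A. ?p K v = 0} = {0} \<or> {v \<in> vspace A. ?p K v = 0} = vspace A"
    using assms(3) hecke_hom_kernel[OF assms(2) Mn hom, of K] unfolding simple_module_def by auto
  moreover have "{v \<in> vspace A. ?p K v = 0} \<noteq> {0}"
  proof
    assume "{v \<in> vspace A. ?p K v = 0} = {0}"
    moreover have "v \<in> {v \<in> vspace A. ?p K v = 0}" using v K by simp
    ultimately have "v = 0" by (simp only: singleton_iff)
    moreover have "f 0 = 0"
      using lin_map_minus(2)[OF A.vspace_rep_axioms M.vspace_rep_axioms hecke_homD(1)[OF assms(4)] v(1) v(1)] .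
    ultimately show False using v(2) by simp
  qed
  ultimately have "{v \<in> vspace A. ?p K v = 0} = vspace A" by blast
  then have all: "\<forall>v\<in>vspace A. ?p K v = 0" by blast
  define k where "k = (LEAST k. \<forall>v\<in>vspace A. ?p k v = 0)"
  have k: "\<forall>v\<in>vspace A. ?p k v = 0" unfolding k_def by (rule LeastI[of _ K]) (rule all)
  have "k \<noteq> 0"
  proof
    assume "k = 0"
    then have "f v = 0" using k v(1) by simp
    then show False using v(2) by simp
  qed
  then obtain k' where k': "k = Suc k'" by (cases k) auto
  have "\<not> (\<forall>v\<in>vspace A. ?p k' v = 0)" using not_less_Least[of k' "\<lambda>k. \<forall>v\<in>vspace A. ?p k v = 0"] k' unfolding k_def by simp
  then obtain v1 where v1: "v1 \<in> vspace A" "?p k' v1 \<noteq> 0" by blast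
  have "Xact q M (Suc n) (?p k' v) = smul M a (?p k' v)" if "v \<in> vspace A" for v
  proof -
    have "X_minus q M (Suc n) a (?p k' v) = 0" using k that unfolding k' by simp
    then show ?thesis unfolding X_minus_def by simp
  qed
  then show ?thesis using hom v1 by blast
qed

context charge
begin

definition words :: "mpart \<Rightarrow> int list set" where
  "words \<Lambda> = {w. walk e (occ \<Lambda>) w (len \<Lambda>)}"

lemma word_set_words:
  assumes "root_of_unity e q" "alcove_like \<Lambda>" "card (occ \<Lambda>) < e" "multipartition l n \<Lambda>"
  shows "word_set e q n (words \<Lambda>)"
  using word_set_walks[OF particles_occ[OF assms(3)] assms(1) alcove_likeD(3)[OF assms(2)] len_outside]
    sum_len[OF assms(2)] assms(4)
  unfolding words_def multipartition_shape by simp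

text \<open>A label of positive size has a box that the crystal operator removes, and this requires an
  empty point on the circle.\<close>

lemma alcove_like_label_card:
  assumes "crystal_label e l s n \<Lambda>" "alcove_like \<Lambda>"
  shows "card (occ \<Lambda>) < e"
  using assms(1)
proof (cases rule: crystal_label.cases)
  case 1
  then show ?thesis using alcove_like_empty(2) e_gt1 by simp
next
  case (2 n' \<mu> i)
  obtain i \<mu> where "e_tilde e l s i \<Lambda> = Some \<mu>" "shape l \<mu>"
    using crystal_label_SucE[OF e_gt1] assms(1) 2(1) by metis
  then show ?thesis using e_tilde_alcove_like(2)[OF assms(2)] by blast
qed

lemma last_letter:
  assumes "w \<in> words \<mu>" "w \<noteq> []"
  obtains p where "p \<in> occ \<mu>" "last w = (site (len \<mu>) p - 1) mod int e"
proof -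
  have "walk e (occ \<mu>) (butlast w @ [last w]) (len \<mu>)" using assms unfolding words_def by simp
  then show thesis using that by (rule walk_snocE)
qed

text \<open>The words of \<open>V\<close> followed by \<open>x\<close> are the words of \<open>W\<close> that end in \<open>x\<close>, and \<open>T_k\<close> with
  \<open>k < n\<close> does not touch this last letter.\<close>

lemma word_embedding:
  assumes "word_set e q n V" "word_set e q (Suc n) W" and VW: "\<And>u. u @ [x] \<in> W \<longleftrightarrow> u \<in> V"
  defines "f \<equiv> \<lambda>h w. if w \<noteq> [] \<and> last w = x then h (butlast w) else (0::complex)"
  shows "hecke_hom n (word_set.word_rep e q n V) (word_set.word_rep e q (Suc n) W) f"
    and "\<And>h. h \<in> vspace (word_set.word_rep e q n V) \<Longrightarrow>
      Xact q (word_set.word_rep e q (Suc n) W) (Suc n) (f h) = smul (word_set.word_rep e q (Suc n) W) (q powi x) (f h)"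
    and "\<And>h. f h = 0 \<Longrightarrow> h = 0"
proof -
  interpret V: word_set e q n V by fact
  interpret W: word_set e q "Suc n" W by fact
  have f_in: "f h \<in> vspace W.word_rep" if "h \<in> vspace V.word_rep" for h
  proof -
    have "f h w = 0" if "w \<notin> W" for w
    proof (cases "w \<noteq> [] \<and> last w = x")
      case True
      then have "butlast w @ [x] = w" by auto
      then have "butlast w \<notin> V" using VW[of "butlast w"] \<open>w \<notin> W\<close> by simp
      then show ?thesis using \<open>h \<in> vspace V.word_rep\<close> by (simp add: f_def)
    qed (auto simp: f_def)
    then show ?thesis by simp
  qed
  have f_app: "f h (u @ [y]) = (if y = x then h u else 0)" for h u y by (simp add: f_def)
  have lenW: "\<exists>u y. w = u @ [y] \<and> length u = n" if "w \<in> W" for w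
    using W.length_W[OF that] by (cases w rule: rev_cases) auto
  show "hecke_hom n V.word_rep W.word_rep f"
    unfolding hecke_hom_def lin_map_def
  proof (intro conjI ballI allI)
    fix h h' c assume h: "h \<in> vspace V.word_rep" "h' \<in> vspace V.word_rep"
    show "f (h + h') = f h + f h'" by (auto simp: f_def fun_eq_iff)
  next
    fix h c assume h: "h \<in> vspace V.word_rep"
    show "f h \<in> vspace W.word_rep" by (rule f_in[OF h])
    show "f (smul V.word_rep c h) = smul W.word_rep c (f h)" for c by (auto simp: f_def fun_eq_iff)
  next
    fix i h assume i: "i \<in> {1..<n}" and h: "h \<in> vspace V.word_rep"
    have i: "1 \<le> i" "i < n" using i by auto
    show "f (Tact V.word_rep i h) = Tact W.word_rep i (f h)"
    proof (rule W.word_rep_eqI)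
      show "f (Tact V.word_rep i h) \<in> vspace W.word_rep" by (rule f_in[OF V.Tact_word_in[OF i h]])
      show "Tact W.word_rep i (f h) \<in> vspace W.word_rep" by (rule W.Tact_word_in[OF _ _ f_in[OF h]]) (use i in auto)
      fix w assume "w \<in> W"
      then obtain u y where w: "w = u @ [y]" "length u = n" using lenW by blast
      have nth: "w ! (i - 1) = u ! (i - 1)" "w ! i = u ! i" using w i by (auto simp: nth_append)
      have sw: "swap_letters i w = swap_letters i u @ [y]" using w i by (simp add: swap_letters_append)
      have lw: "length w = Suc n" using w by simp
      show "f (Tact V.word_rep i h) w = Tact W.word_rep i (f h) w"
        unfolding W.Tact_word[OF lw] nth sw unfolding w(1) f_app V.Tact_word[OF w(2)] by simp
    qed
  next
    fix j h assume j: "j \<in> {1..n}" and h: "h \<in> vspace V.word_rep"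
    have xin: "xact V.word_rep j h \<in> vspace V.word_rep" using h by simp
    show "f (xact V.word_rep j h) = xact W.word_rep j (f h)"
    proof (rule W.word_rep_eqI)
      show "f (xact V.word_rep j h) \<in> vspace W.word_rep" by (rule f_in[OF xin])
      show "xact W.word_rep j (f h) \<in> vspace W.word_rep" using f_in[OF h] by simp
      fix w assume "w \<in> W"
      then obtain u y where w: "w = u @ [y]" "length u = n" using lenW by blast
      have "j - 1 < length u" using w j by auto
      then show "f (xact V.word_rep j h) w = xact W.word_rep j (f h) w"
        unfolding w(1) f_app by (simp add: nth_append f_app)
    qed
  qed
  show "Xact q W.word_rep (Suc n) (f h) = smul W.word_rep (q powi x) (f h)" if h: "h \<in> vspace V.word_rep" for h
  proof
    fix w
    show "Xact q W.word_rep (Suc n) (f h) w = smul W.word_rep (q powi x) (f h) w"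
    proof (cases "w \<in> W")
      case True
      then obtain u y where w: "w = u @ [y]" "length u = n" using lenW by blast
      then show ?thesis unfolding W.Xact_word by (simp add: f_app nth_append)
    next
      case False
      then have "f h w = 0" using f_in[OF h] by simp
      then show ?thesis unfolding W.Xact_word by simp
    qed
  qed
  show "h = 0" if "f h = 0" for h
  proof
    fix u
    have "f h (u @ [x]) = 0" using that by simp
    then show "h u = 0 u" by (simp add: f_app)
  qed
qed

text \<open>By induction, the socle that belongs to a box removed by the crystal operator is the
  seminormal module of the smaller multipartition \<open>\<mu>\<close>. This module also embeds into the seminormal
  module of \<open>\<Lambda>\<close>, and \<open>simple_modules_isomorphic\<close> applies because no word of \<open>\<mu>\<close> ends with the
  residue of the removed box.\<close>

lemma is_D_seminormal:
  assumes R: "root_of_unity e q"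
  shows "is_D q e l s n \<Lambda> M \<Longrightarrow> alcove_like \<Lambda> \<Longrightarrow>
    \<exists>\<phi>. hecke_iso n (word_set.word_rep e q n (words \<Lambda>)) (M :: ('v::ab_group_add) brep) \<phi>"
proof (induction n arbitrary: \<Lambda> M)
  case 0
  interpret root_of_unity e q by (rule R)
  have \<Lambda>: "\<Lambda> = empty_mpart" and H: "aff_hecke_module q 0 M" and dim: "vector_space.dim (smul M) (vspace M) = 1"
    using 0 unfolding is_D.simps cyclotomic_module_def by auto
  interpret M: hecke_rep M q 0 by (rule hecke_repI[OF H q_nz])
  have W: "words \<Lambda> = {[]}"
  proof -
    have "w = []" if "walk e {} w (\<lambda>_. 0)" for w using that by (cases rule: walk.cases) auto
    then show ?thesis unfolding words_def \<Lambda> alcove_like_empty(2,3) using walk_Nil[of e "{}"] by auto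
  qed
  have "word_set e q 0 (words \<Lambda>)"
  proof (rule word_set_words[OF R 0(2)])
    show "card (occ \<Lambda>) < e" unfolding \<Lambda> alcove_like_empty(2) using e_gt1 by simp
    show "multipartition l 0 \<Lambda>"
      unfolding \<Lambda> by (rule crystal_label_multipartition) (rule crystal_label.intros)
  qed
  then interpret L: word_set e q 0 "{[]}" unfolding W .
  obtain B where B: "B \<subseteq> vspace M" "M.vs.independent B" "vspace M \<subseteq> M.vs.span B" "card B = 1"
    using M.vs.basis_exists[of "vspace M"] dim by metis
  then obtain v where v: "B = {v}" using card_1_singletonE by blast
  have v0: "v \<noteq> 0" "v \<in> vspace M" using B v M.vs.dependent_zero[of B] by auto
  have V: "\<exists>c. u = smul M c v" if "u \<in> vspace M" for u
    using that B(3) unfolding v M.vs.span_singleton by blast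
  let ?\<phi> = "\<lambda>f :: int list \<Rightarrow> complex. smul M (f []) v"
  have "hecke_hom 0 L.word_rep M ?\<phi>"
    unfolding hecke_hom_def lin_map_def using v0(2)
    by (auto simp: M.in_vspace M.vs.scale_left_distrib)
  moreover have "bij_betw ?\<phi> (vspace L.word_rep) (vspace M)"
    unfolding bij_betw_def
  proof
    show "inj_on ?\<phi> (vspace L.word_rep)"
    proof (rule inj_onI)
      fix f g assume fg: "f \<in> vspace L.word_rep" "g \<in> vspace L.word_rep" "smul M (f []) v = smul M (g []) v"
      then have "f [] = g []" using v0(1) by simp
      then show "f = g" using L.word_rep_eqI[OF fg(1,2)] by auto
    qed
    show "?\<phi> ` vspace L.word_rep = vspace M"
    proof
      show "?\<phi> ` vspace L.word_rep \<subseteq> vspace M" using v0(2) M.in_vspace(4) by auto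
      show "vspace M \<subseteq> ?\<phi> ` vspace L.word_rep"
      proof
        fix u assume "u \<in> vspace M"
        then obtain c where "u = smul M c v" using V by blast
        then show "u \<in> ?\<phi> ` vspace L.word_rep"
          by (intro image_eqI[of _ _ "\<lambda>w. if w = [] then c else 0"]) auto
      qed
    qed
  qed
  ultimately show ?case unfolding W hecke_iso_def by blast
next
  case (Suc n)
  interpret root_of_unity e q by (rule R)
  have label: "crystal_label e l s (Suc n) \<Lambda>" and simple: "simple_module q (Suc n) M"
    and soc: "\<And>i \<mu>. e_tilde e l s i \<Lambda> = Some \<mu> \<Longrightarrow>
      is_D q e l s n \<mu> (socle q n (gen_eigenspace q (Suc n) (q powi i) M))"
    using Suc.prems(1) unfolding is_D.simps by blast+
  obtain i \<mu> where label\<mu>: "crystal_label e l s n \<mu>" and sh\<mu>: "shape l \<mu>" and e\<mu>: "e_tilde e l s i \<Lambda> = Some \<mu>"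
    by (rule crystal_label_SucE[OF e_gt1 label])
  note eg = e_tilde_alcove_like[OF Suc.prems(2) e\<mu> sh\<mu>]
  define S where "S = socle q n (gen_eigenspace q (Suc n) (q powi i) M)"
  have H: "aff_hecke_module q (Suc n) M" using simple unfolding simple_module_def by blast
  interpret M: hecke_rep M q "Suc n" by (rule hecke_repI[OF H q_nz])
  note S = M.gen_eigenspace_socle[OF _ S_def, simplified]
  obtain \<phi> where \<phi>: "hecke_iso n (word_set.word_rep e q n (words \<mu>)) S \<phi>"
    using Suc.IH[OF soc[OF e\<mu>] eg(1)] unfolding S_def by blast
  have V: "word_set e q n (words \<mu>)"
    by (rule word_set_words[OF R eg(1,3) crystal_label_multipartition[OF label\<mu>]])
  have W: "word_set e q (Suc n) (words \<Lambda>)"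
    by (rule word_set_words[OF R Suc.prems(2) eg(2) crystal_label_multipartition[OF label]])
  interpret V: word_set e q n "words \<mu>" by (rule V)
  interpret W: word_set e q "Suc n" "words \<Lambda>" by (rule W)
  have \<phi>hom: "hecke_hom n V.word_rep M \<phi>"
    using \<phi> S(4) unfolding hecke_iso_def hecke_hom_def lin_map_def S(1-3) by blast
  have \<phi>S: "\<phi> v \<in> vspace S" if "v \<in> vspace V.word_rep" for v
    using \<phi> that unfolding hecke_iso_def bij_betw_def by blast
  obtain w0 where w0: "w0 \<in> words \<mu>" using V.W_nonempty by blast
  interpret A: hecke_rep V.word_rep q n by (rule V.hecke_rep_word)
  have nz: "\<phi> (V.word_vec w0) \<noteq> 0"
  proof
    assume "\<phi> (V.word_vec w0) = 0"
    moreover have "\<phi> 0 = 0"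
      using lin_map_minus(2)[OF A.vspace_rep_axioms M.vspace_rep_axioms hecke_homD(1)[OF \<phi>hom]] A.in_vspace(1) by blast
    ultimately have "V.word_vec w0 = 0"
      using \<phi> V.word_vec_in[OF w0] A.in_vspace(1) unfolding hecke_iso_def bij_betw_def inj_on_def by metis
    then have "V.word_vec w0 w0 = 0" by simp
    then show False by (simp add: V.word_vec_def)
  qed
  have nil: "\<exists>k. (X_minus q M (Suc n) (q powi i) ^^ k) (\<phi> v) = 0" if "v \<in> vspace V.word_rep" for v
    by (rule S(5)[OF \<phi>S[OF that]])
  have "\<exists>g v. hecke_hom n V.word_rep M g \<and> v \<in> vspace V.word_rep \<and> g v \<noteq> 0 \<and>
      (\<forall>v\<in>vspace V.word_rep. Xact q M (Suc n) (g v) = smul M (q powi i) (g v))"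
    by (rule simple_killed_by_power[OF M.hecke_rep_axioms A.hecke_rep_axioms V.simple_word_rep \<phi>hom])
      (rule nil, assumption, rule V.word_vec_in[OF w0], rule nz)
  then obtain g v0 where g: "hecke_hom n V.word_rep M g" and v0: "v0 \<in> vspace V.word_rep" "g v0 \<noteq> 0"
    and gX: "\<And>v. v \<in> vspace V.word_rep \<Longrightarrow> Xact q M (Suc n) (g v) = smul M (q powi i) (g v)"
    by blast
  have VW: "u @ [i mod int e] \<in> words \<Lambda> \<longleftrightarrow> u \<in> words \<mu>" for u
    unfolding words_def using eg(5) by simp
  define f where "f = (\<lambda>h w. if w \<noteq> [] \<and> last w = i mod int e then h (butlast w) else (0::complex))"
  note emb = word_embedding[OF V W VW]
  \<comment> \<open>These are all \<open>e\<close>-th roots of unity but one; the eigenvalues of \<open>X_n\<close> on the module of \<open>\<mu>\<close>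
    are among them.\<close>
  let ?as = "map (\<lambda>j. q powi j) (filter (\<lambda>j. j \<noteq> i mod int e) [0..int e - 1])"
  have "\<exists>\<phi>. hecke_iso (Suc n) W.word_rep M \<phi>"
  proof (rule simple_modules_isomorphic[where A = V.word_rep and f = f and g = g and a = "q powi i" and as = ?as])
    show "hecke_rep V.word_rep q n" by (rule V.hecke_rep_word)
    show "simple_module q (Suc n) M" by (rule simple)
    show "simple_module q (Suc n) W.word_rep" by (rule W.simple_word_rep)
    show "hecke_hom n V.word_rep W.word_rep f" using emb(1) unfolding f_def .
    show "Xact q W.word_rep (Suc n) (f v) = smul W.word_rep (q powi i) (f v)" if "v \<in> vspace V.word_rep" for v
      using emb(2)[OF that] unfolding f_def by (simp add: q_powi_mod)
    show "hecke_hom n V.word_rep M g" by (rule g)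
    show "Xact q M (Suc n) (g v) = smul M (q powi i) (g v)" if "v \<in> vspace V.word_rep" for v
      by (rule gX[OF that])
    show "h = 0" if "f h = 0" for h by (rule emb(3)) (use that in \<open>simp add: f_def\<close>)
    show "v0 \<in> vspace V.word_rep" "g v0 \<noteq> 0" by (rule v0)+
    show "q \<noteq> 0" by (rule q_nz)
    show "q powi i \<noteq> 0" using q_nz by simp
    show "q powi i \<notin> set ?as" using q_powi_eq_iff e_gt1 by auto
    show "foldr (X_minus q V.word_rep n) ?as h = 0" if n: "1 \<le> n" and h: "h \<in> vspace V.word_rep" for h
    proof
      fix w
      show "foldr (X_minus q V.word_rep n) ?as h w = 0 w"
      proof (cases "w \<in> words \<mu>")
        case True
        have len: "length w = n" by (rule V.length_W[OF True])
        have "w \<noteq> []" using len n by auto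
        then have ne: "w \<noteq> []" "last w = w ! (n - 1)" using len by (auto simp: last_conv_nth)
        obtain p where p: "p \<in> occ \<mu>" "last w = (site (len \<mu>) p - 1) mod int e" by (rule last_letter[OF True ne(1)])
        have "w ! (n - 1) \<noteq> i mod int e" using eg(4)[OF p(1)] p(2) ne(2) by simp
        moreover have "w ! (n - 1) \<in> {0..<int e}" using V.letters_W[OF True] ne last_in_set by fastforce
        ultimately have "q powi (w ! (n - 1)) \<in> set ?as" by auto
        then have "prod_list (map (\<lambda>a. q powi (w ! (n - 1)) - a) ?as) = 0"
          unfolding prod_list_zero_iff by force
        then show ?thesis unfolding V.foldr_X_minus_word by simp
      next
        case False
        then have "h w = 0" using h by simp
        then show ?thesis unfolding V.foldr_X_minus_word by simp
      qed
    qed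
  qed
  then show ?case .
qed

text \<open>Every word of \<open>\<mu>\<close> followed by \<open>i\<close> is a weight. If the box of residue \<open>i\<close> led out of the
  alcove, one of these weights would have two letters \<open>i\<close> that are not separated by both
  neighbours.\<close>

lemma semisimple_alcove_like:
  assumes R: "root_of_unity e q"
  shows "is_D q e l s n \<Lambda> M \<Longrightarrow> semisimple_X q n (M :: ('v::ab_group_add) brep) \<Longrightarrow> alcove_like \<Lambda>"
proof (induction n arbitrary: \<Lambda> M)
  case 0
  then show ?case using alcove_like_empty(1) by simp
next
  case (Suc n)
  interpret root_of_unity e q by (rule R)
  have label: "crystal_label e l s (Suc n) \<Lambda>" and H: "aff_hecke_module q (Suc n) M"
    and soc: "\<And>i \<mu>. e_tilde e l s i \<Lambda> = Some \<mu> \<Longrightarrow>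
      is_D q e l s n \<mu> (socle q n (gen_eigenspace q (Suc n) (q powi i) M))"
    using Suc.prems(1) unfolding is_D.simps simple_module_def by blast+
  obtain i \<mu> where label\<mu>: "crystal_label e l s n \<mu>" and f\<mu>: "f_tilde e l s i \<mu> = Some \<Lambda>" and e\<mu>: "e_tilde e l s i \<Lambda> = Some \<mu>"
    by (rule crystal_label_SucE[OF e_gt1 label])
  define S where "S = socle q n (gen_eigenspace q (Suc n) (q powi i) M)"
  have hecke: "hecke_rep M q (Suc n)" by (rule hecke_repI[OF H q_nz])
  interpret semisimple_rep M q "Suc n" e
    by (intro semisimple_rep.intro semisimple_rep_axioms.intro hecke R Suc.prems(2))
  note S = gen_eigenspace_socle[OF _ S_def, simplified]
  have DS: "is_D q e l s n \<mu> S" unfolding S_def by (rule soc[OF e\<mu>])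
  have X: "X_minus q S j a v = X_minus q M j a v" for j a v
    unfolding X_minus_def Xact_def S(1,3) ..
  have "semisimple_X q n S"
    unfolding semisimple_X_def X using S(4) eigen_square by auto
  then have alcove_like\<mu>: "alcove_like \<mu>" by (rule Suc.IH[OF DS])
  have card\<mu>: "card (occ \<mu>) < e" by (rule alcove_like_label_card[OF label\<mu> alcove_like\<mu>])
  obtain \<phi> where \<phi>: "hecke_iso n (word_set.word_rep e q n (words \<mu>)) S \<phi>"
    using is_D_seminormal[OF R DS alcove_like\<mu>] by blast
  interpret V: word_set e q n "words \<mu>"
    by (rule word_set_words[OF R alcove_like\<mu> card\<mu> crystal_label_multipartition[OF label\<mu>]])
  have weight: "weight q (Suc n) M (u @ [i])" if u: "u \<in> words \<mu>" for u
  proof -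
    let ?v = "\<phi> (V.word_vec u)"
    have uin: "V.word_vec u \<in> vspace V.word_rep" by (rule V.word_vec_in[OF u])
    have hom: "hecke_hom n V.word_rep S \<phi>" and bij: "bij_betw \<phi> (vspace V.word_rep) (vspace S)"
      using \<phi> unfolding hecke_iso_def by auto
    have vS: "?v \<in> vspace S" using bij uin unfolding bij_betw_def by blast
    then have vM: "?v \<in> vspace M" using S(4) by blast
    interpret A: hecke_rep V.word_rep q n by (rule V.hecke_rep_word)
    have vsS: "module.subspace (smul S) (vspace S)" "vector_space (smul S)"
    proof -
      have "aff_hecke_module q n S" using DS by (cases n) (auto simp: cyclotomic_module_def)
      then show "module.subspace (smul S) (vspace S)" "vector_space (smul S)"
        unfolding aff_hecke_module_def braid_rep_def by auto
    qed
    then have repS: "vspace_rep S" by (intro vspace_rep.intro)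
    have "\<phi> 0 = 0"
      using lin_map_minus(2)[OF A.vspace_rep_axioms repS hecke_homD(1)[OF hom]] A.in_vspace(1) by blast
    moreover have "V.word_vec u \<noteq> 0"
    proof
      assume "V.word_vec u = 0"
      then have "V.word_vec u u = 0" by simp
      then show False by (simp add: V.word_vec_def)
    qed
    ultimately have nz: "?v \<noteq> 0"
      using bij uin A.in_vspace(1) unfolding bij_betw_def inj_on_def by metis
    have len: "length u = n" by (rule V.length_W[OF u])
    have "Xact q M j ?v = smul M (q powi (u ! (j - 1))) ?v" if "1 \<le> j" "j \<le> n" for j
    proof -
      have "Xact q M j ?v = Xact q S j ?v" unfolding Xact_def S(1,3) ..
      also have "\<dots> = \<phi> (Xact q V.word_rep j (V.word_vec u))"
        using hecke_hom_Xact[OF V.hecke_rep_word hom that uin] by simp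
      also have "\<dots> = smul M (q powi (u ! (j - 1))) ?v"
        unfolding V.Xact_word_vec using lin_mapD(3)[OF hecke_homD(1)[OF hom] uin] S(1) by simp
      finally show ?thesis .
    qed
    moreover have "Xact q M (Suc n) ?v = smul M (q powi i) ?v"
    proof -
      obtain k where k: "(X_minus q M (Suc n) (q powi i) ^^ k) ?v = 0" using S(5)[OF vS] by blast
      \<comment> \<open>Semisimplicity turns generalised eigenvectors into eigenvectors.\<close>
      have "X_minus q M (Suc n) (q powi i) ?v = 0"
        using k
      proof (induction k)
        case 0
        then show ?case using nz by simp
      next
        case (Suc k)
        show ?case
        proof (cases k)
          case 0
          then show ?thesis using Suc.prems by simp
        next
          case (Suc k')
          let ?y = "(X_minus q M (Suc n) (q powi i) ^^ k') ?v"
          have "?y \<in> vspace M"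
            using lin_mapD(1)[OF hecke_homD(1)[OF X_minus_power_hom[where a = "q powi i" and k = k']] vM] by simp
          moreover have "X_minus q M (Suc n) (q powi i) (X_minus q M (Suc n) (q powi i) ?y) = 0"
            using Suc.prems Suc by simp
          moreover have "1 \<le> Suc n" "Suc n \<le> Suc n" by auto
          ultimately have "X_minus q M (Suc n) (q powi i) ?y = 0" using eigen_square by blast
          then show ?thesis using Suc.IH Suc by simp
        qed
      qed
      then show ?thesis unfolding X_minus_def by simp
    qed
    ultimately have "\<forall>j\<in>{1..Suc n}. Xact q M j ?v = smul M (q powi ((u @ [i]) ! (j - 1))) ?v"
      using len by (auto simp: nth_append le_Suc_eq)
    then show ?thesis unfolding weight_def using vM nz len by auto
  qed
  show ?case
  proof (rule ccontr)
    assume "\<not> alcove_like \<Lambda>"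
    then obtain t w where walk: "walk e (occ \<mu>) (t @ [i mod int e] @ w) (len \<mu>)"
      and w: "(\<forall>x\<in>set w. x mod int e \<noteq> i mod int e \<and> x mod int e \<noteq> (i + 1) mod int e) \<or>
        (\<forall>x\<in>set w. x mod int e \<noteq> i mod int e \<and> x mod int e \<noteq> (i - 1) mod int e)"
      using f_tilde_alcove_like[OF alcove_like\<mu> card\<mu> f\<mu>] by blast
    have "weight q (Suc n) M ((t @ [i mod int e] @ w) @ [i])"
      by (rule weight) (use walk in \<open>simp add: words_def\<close>)
    then have wt: "weight q (Suc n) M (t @ [i mod int e] @ w @ [i] @ [])" by simp
    from w show False
    proof
      assume "\<forall>x\<in>set w. x mod int e \<noteq> i mod int e \<and> x mod int e \<noteq> (i + 1) mod int e"
      then show False using weight_between[of 1, OF _ wt] by (simp add: mod_add_left_eq)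
    next
      assume "\<forall>x\<in>set w. x mod int e \<noteq> i mod int e \<and> x mod int e \<noteq> (i - 1) mod int e"
      then show False using weight_between[of "-1", OF _ wt] by (simp add: mod_diff_left_eq)
    qed
  qed
qed

end

section \<open>Unitarity, calibration and the alcove\<close>

theorem theoremB:
  fixes e n l :: nat and q :: complex and s :: "nat \<Rightarrow> int" and \<Lambda> :: mpart
    and D :: "('v::ab_group_add) brep"
  assumes "e > 1" and "n \<ge> 1" and "l \<ge> 1"
    and "q = exp (2 * of_real pi * \<i> / of_nat e)"
    and "\<And>j. 1 \<le> j \<Longrightarrow> j < l \<Longrightarrow> s j \<le> s (Suc j)"
    and "s l < s 1 + int e"
    and "multipartition l n \<Lambda>"
    and "is_D q e l s n \<Lambda> D"
  shows "(border_condition e l s \<Lambda> \<longleftrightarrow> alcove_condition e l s \<Lambda>) \<and>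
         (alcove_condition e l s \<Lambda> \<longleftrightarrow> calibrated q n D) \<and>
         (unitary n D \<longleftrightarrow> border_condition e l s \<Lambda>)"
proof -
  interpret charge e l s by standard (use assms in auto)
  have R: "root_of_unity e q" using assms(1,4) by unfold_locales
  interpret root_of_unity e q by (rule R)
  have sh: "shape l \<Lambda>" using assms(7) multipartition_shape by blast
  obtain n' where n: "n = Suc n'" using assms(2) by (cases n) auto
  have label: "crystal_label e l s n \<Lambda>" and H: "aff_hecke_module q n D"
    using assms(8) unfolding n is_D.simps simple_module_def by blast+
  have hecke: "hecke_rep D q n" by (rule hecke_repI[OF H q_nz])
  have border: "border_condition e l s \<Lambda> \<longleftrightarrow> alcove_like \<Lambda>" by (rule border_condition_iff_alcove_like[OF sh])
  have alcove: "alcove_condition e l s \<Lambda> \<longleftrightarrow> alcove_like \<Lambda>"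
    using alcove_condition_iff_alcove_like[OF sh] alcove_like_label_card[OF label] by blast
  have "calibrated q n D" "unitary n D" if alcove_like: "alcove_like \<Lambda>"
  proof -
    interpret W: word_set e q n "words \<Lambda>"
      by (rule word_set_words[OF R alcove_like alcove_like_label_card[OF label alcove_like] assms(7)])
    obtain \<phi> where "hecke_iso n W.word_rep D \<phi>" using is_D_seminormal[OF R assms(8) alcove_like] by blast
    then show "calibrated q n D" "unitary n D"
      using W.iso_calibrated[OF hecke] W.iso_unitary[OF hecke] by blast+
  qed
  moreover have "alcove_like \<Lambda>" if "calibrated q n D"
    by (rule semisimple_alcove_like[OF R assms(8) calibrated_semisimple_X[OF hecke that]])
  moreover have "alcove_like \<Lambda>" if "unitary n D"
    by (rule semisimple_alcove_like[OF R assms(8) unitary_semisimple_X[OF hecke _ that]])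
      (use norm_q_powi[of 1] in simp)
  ultimately show ?thesis using border alcove by blast
qed

end
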